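(* Let $K\in\mathbb{N}=\{1,2,\dots\}$ be fixed and let $\lambda\in\mathbb{R}$. Let $X_n$ be the number of key comparisons used by optimal $K$-pivot QuickSort and $Y_n:=(X_n-\mathbb{E}[X_n])/n$. Then, as $n\to\infty$, $$Y_n\stackrel{d}{\longrightarrow}Z_K,\qquad \mathbb{E}[\exp(\lambda Y_n)]\longrightarrow\mathbb{E}[\exp(\lambda Z_K)]<\infty,$$ where the distribution of $Z_K$ is determined as the unique centered, square integrable probability measure on $\mathbb{R}$ such that $$Z_K\stackrel{d}{=}\sum_{i=0}^K\left(D_iZ_K^{(i)}+\alpha_KD_i\ln(D_i)\right)+l_{\mathrm{opt}}(D),$$ where $D,Z_K^{(0)},\dots,Z_K^{(K)}$ are independent and $Z_K^{(i)}$ has the same distribution as $Z_K$ for all $i=0,\dots,K$. Moreover, all moments of $Y_n$ converge to the corresponding moments of $Z_K$.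
   Context: Notation: $H_n=\sum_{i=1}^n \frac1i$; $\stackrel{d}{\longrightarrow}$ denotes convergence in distribution. Probabilistic model. Fix $K\in\mathbb{N}$. Let $V_1,\dots,V_K,a_1,a_2,\dots$ be independent random variables, uniformly distributed on $[0,1]$. For $n>K$ the list to be sorted is $a_1,\dots,a_{n-K},V_1,\dots,V_K$; the last $K$ items are the pivots, and $p_1<\dots<p_K$ denote the sorted pivots. The spacings are $D_0=p_1$, $D_i=p_{i+1}-p_i$ for $1\le i\le K-1$, $D_K=1-p_K$, and $D=(D_0,\dots,D_K)$. The sublists $S_0,\dots,S_K$ consist of the non-pivot elements of the list lying in $(0,p_1),(p_1,p_2),\dots,(p_K,1)$, respectively, and $I_i^{(n)}=|S_i|$. Classification trees. $\mathcal{T}$ is the (finite) set of all binary search trees with internal nodes $p_1,\dots,p_K$ and external nodes (leaves) $S_0,\dots,S_K$ from left to right. For $t\in\mathcal{T}$, $h_t(i)$ is the depth of the leaf $S_i$ in $t$ (the number of comparisons needed to classify an element into $S_i$ using $t$), and $l_t(x_0,\dots,x_K)=\sum_{i=0}^K x_i h_t(i)$. Put $l_{\mathrm{opt}}(D)=\min_{t\in\mathcal{T}} l_t(D)$, $\gamma_K=\mathbb{E}[l_{\mathrm{opt}}(D)]$ and $\alpha_K=\gamma_K/(H_{K+1}-1)$. Optimal partition strategy. The elements $a_1,\dots,a_{n-K}$ are classified one after another. Let $C^{(k)}_i$ be the number of elements among $a_1,\dots,a_{k-1}$ classified into $S_i$. The element $a_k$ is classified using the tree $t\in\mathcal{T}$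 minimizing $l_t(C^{(k)}_0+1,\dots,C^{(k)}_K+1)$; ties are resolved by choosing the smallest minimizing tree with respect to an arbitrary but fixed total order on $\mathcal{T}$. With $G_{t,k}$ the event that $a_k$ is classified using $t$, the number of comparisons in the partitioning stage is $$P_n=\sum_{k=1}^{n-K}\sum_{t\in\mathcal{T}}\sum_{i=0}^K \mathbf{1}_{G_{t,k}}\mathbf{1}_{\{a_k\in S_i\}}h_t(i)+R_K,$$ where $R_K\le K^2$ is the number of comparisons used to sort the $K$ pivots by a fixed elementary sorting algorithm. Number of key comparisons. For $0\le n\le K$, $X_n$ is the number of comparisons a fixed elementary sorting algorithm uses on $n$ elements in uniformly random order (at most $K^2$). For $n>K$ the distribution of $X_n$ is given recursively by $$X_n\stackrel{d}{=}\sum_{i=0}^K X^{(i)}_{I_i^{(n)}}+P_n,$$ where the $X^{(i)}_m$ are distributed as $X_m$, and the sequences $(X^{(i)}_m)_{m\ge0}$, $i=0,\dots,K$, are independent of each other and of $(I_0^{(n)},\dots,I_K^{(n)},P_n)$. *)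

theory Defs
  imports "HOL-Probability.Probability" "HOL-Library.Tree"
begin

subsection \<open>Elementary sorting algorithms\<close>

text \<open>A deterministic comparison sort of \<open>n\<close> items \<open>x 1, \<dots>, x n\<close> is a decision tree: inner nodes
  compare two items by their indices, leaves announce the indices in sorted order. Ties have
  probability zero throughout, so correctness is only demanded for pairwise distinct items.\<close>

datatype cmp_tree = Output "nat list" | Compare nat nat cmp_tree cmp_tree

primrec cmp_indices :: "cmp_tree \<Rightarrow> nat set" where
  "cmp_indices (Output ys) = {}"
| "cmp_indices (Compare i j s t) = {i, j} \<union> cmp_indices s \<union> cmp_indices t"

primrec cmp_result :: "cmp_tree \<Rightarrow> (nat \<Rightarrow> real) \<Rightarrow> nat list" where
  "cmp_result (Output ys) x = ys"
| "cmp_result (Compare i j s t) x = (if x i < x j then cmp_result s x else cmp_result t x)"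

primrec cmp_count :: "cmp_tree \<Rightarrow> (nat \<Rightarrow> real) \<Rightarrow> nat" where
  "cmp_count (Output ys) x = 0"
| "cmp_count (Compare i j s t) x = Suc (if x i < x j then cmp_count s x else cmp_count t x)"

definition sorting_algorithm :: "nat \<Rightarrow> cmp_tree \<Rightarrow> bool" where
  "sorting_algorithm n t \<longleftrightarrow> cmp_indices t \<subseteq> {1..n} \<and>
     (\<forall>x. inj_on x {1..n} \<longrightarrow>
        distinct (cmp_result t x) \<and> set (cmp_result t x) = {1..n} \<and>
        sorted (map x (cmp_result t x)))"


subsection \<open>Classification trees\<close>

definition search_trees :: "nat \<Rightarrow> nat tree set" where
  "search_trees K = {t. bst t \<and> set_tree t = {1..K}}"

text \<open>Depths of the leaves from left to right.\<close>

fun leaf_depths :: "'a tree \<Rightarrow> nat list" where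
  "leaf_depths Leaf = [0]"
| "leaf_depths (Node l a r) = map Suc (leaf_depths l @ leaf_depths r)"

definition leaf_depth :: "nat tree \<Rightarrow> nat \<Rightarrow> nat" where
  "leaf_depth t i = leaf_depths t ! i"

definition tree_cost :: "nat \<Rightarrow> nat tree \<Rightarrow> (nat \<Rightarrow> real) \<Rightarrow> real" where
  "tree_cost K t x = (\<Sum>i=0..K. x i * real (leaf_depth t i))"

definition opt_cost :: "nat \<Rightarrow> (nat \<Rightarrow> real) \<Rightarrow> real" where
  "opt_cost K x = Min ((\<lambda>t. tree_cost K t x) ` search_trees K)"

definition opt_trees :: "nat \<Rightarrow> (nat \<Rightarrow> real) \<Rightarrow> nat tree set" where
  "opt_trees K x = {t \<in> search_trees K. \<forall>s\<in>search_trees K. tree_cost K t x \<le> tree_cost K s x}"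

definition opt_tree :: "nat \<Rightarrow> nat tree rel \<Rightarrow> (nat \<Rightarrow> real) \<Rightarrow> nat tree" where
  "opt_tree K ord x = (THE t. t \<in> opt_trees K x \<and> (\<forall>s\<in>opt_trees K x. (t, s) \<in> ord))"


subsection \<open>Pivots, spacings and sublists\<close>

definition unif :: "real measure" where
  "unif = uniform_measure lborel {0..1}"

definition pivot_space :: "nat \<Rightarrow> (nat \<Rightarrow> real) measure" where
  "pivot_space K = PiM {1..K} (\<lambda>_. unif)"

text \<open>The canonical space of \<open>(V, a)\<close> with \<open>V 1, \<dots>, V K, a 1, a 2, \<dots>\<close> independent and uniform.\<close>

definition input_space :: "nat \<Rightarrow> ((nat \<Rightarrow> real) \<times> (nat \<Rightarrow> real)) measure" where
  "input_space K = pivot_space K \<Otimes>\<^sub>M PiM {1..} (\<lambda>_. unif)"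

text \<open>The sorted pivots \<open>p 1, \<dots>, p K\<close>, extended by \<open>p 0 = 0\<close> and \<open>p (K + 1) = 1\<close>.\<close>

definition pivot :: "nat \<Rightarrow> (nat \<Rightarrow> real) \<Rightarrow> nat \<Rightarrow> real" where
  "pivot K v i =
     (if i = 0 then 0 else if i \<le> K then sort (map v [1..<Suc K]) ! (i - 1) else 1)"

definition spacing :: "nat \<Rightarrow> (nat \<Rightarrow> real) \<Rightarrow> nat \<Rightarrow> real" where
  "spacing K v i = pivot K v (i + 1) - pivot K v i"

definition sublist_interval :: "nat \<Rightarrow> (nat \<Rightarrow> real) \<Rightarrow> nat \<Rightarrow> real set" where
  "sublist_interval K v i = {pivot K v i <..< pivot K v (i + 1)}"

text \<open>The number of elements among \<open>a 1, \<dots>, a m\<close> that belong to the \<open>i\<close>-th sublist; this gives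
  both the sublist sizes (\<open>m = n - K\<close>) and the counters seen when \<open>a k\<close> is classified
  (\<open>m = k - 1\<close>).\<close>

definition sublist_count ::
    "nat \<Rightarrow> (nat \<Rightarrow> real) \<times> (nat \<Rightarrow> real) \<Rightarrow> nat \<Rightarrow> nat \<Rightarrow> nat" where
  "sublist_count K = (\<lambda>(v, a) m i. card {j \<in> {1..m}. a j \<in> sublist_interval K v i})"


subsection \<open>The partitioning stage\<close>

definition chosen_tree ::
    "nat \<Rightarrow> nat tree rel \<Rightarrow> (nat \<Rightarrow> real) \<times> (nat \<Rightarrow> real) \<Rightarrow> nat \<Rightarrow> nat tree" where
  "chosen_tree K ord \<omega> k = opt_tree K ord (\<lambda>i. real (sublist_count K \<omega> (k - 1) i + 1))"

definition partition_cost ::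
    "nat \<Rightarrow> nat tree rel \<Rightarrow> cmp_tree \<Rightarrow> nat \<Rightarrow> (nat \<Rightarrow> real) \<times> (nat \<Rightarrow> real) \<Rightarrow> real" where
  "partition_cost K ord piv n = (\<lambda>(v, a).
     (\<Sum>k=1..n-K. \<Sum>t\<in>search_trees K. \<Sum>i=0..K.
        of_bool (chosen_tree K ord (v, a) k = t) * of_bool (a k \<in> sublist_interval K v i) *
        real (leaf_depth t i))
     + real (cmp_count piv v))"


subsection \<open>The law of the number of key comparisons\<close>

text \<open>In the recursive case \<open>x i m\<close> plays the role of the copy of \<open>X m\<close> belonging to the \<open>i\<close>-th
  sublist. Since every sublist has at most \<open>n - K\<close> elements, indices \<open>m < n\<close> suffice. For fixed
  \<open>i\<close> only the single entry at the size of that sublist is used, so the joint law of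
  \<open>x i 0, x i 1, \<dots>\<close> is immaterial; it is taken to be the product law. The clause \<open>n \<le> K\<close>
  sorts a uniformly random permutation.\<close>

context
  notes PiM_cong[fundef_cong]
begin

function quicksort_law ::
    "nat \<Rightarrow> nat tree rel \<Rightarrow> cmp_tree \<Rightarrow> (nat \<Rightarrow> cmp_tree) \<Rightarrow> nat \<Rightarrow> real measure" where
  "quicksort_law K ord piv alg n =
     (if n \<le> K then
        distr (measure_pmf (pmf_of_set {\<pi>. \<pi> permutes {1..n}})) borel
          (\<lambda>\<pi>. real (cmp_count (alg n) (\<lambda>i. real (\<pi> i))))
      else
        distr (input_space K \<Otimes>\<^sub>M
               PiM {0..K} (\<lambda>i. PiM {..<n} (\<lambda>m. quicksort_law K ord piv alg m))) borel
          (\<lambda>(\<omega>, x). (\<Sum>i=0..K. x i (sublist_count K \<omega> (n - K) i)) + partition_cost K ord piv n \<omega>))"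
  by pat_completeness auto

termination
  by (relation "Wellfounded.measure (\<lambda>(K, ord, piv, alg, n). n)") auto

end

declare quicksort_law.simps [simp del]

text \<open>The law of \<open>(X n - E (X n)) / n\<close>.\<close>

definition normalized_law ::
    "nat \<Rightarrow> nat tree rel \<Rightarrow> cmp_tree \<Rightarrow> (nat \<Rightarrow> cmp_tree) \<Rightarrow> nat \<Rightarrow> real measure" where
  "normalized_law K ord piv alg n =
     distr (quicksort_law K ord piv alg n) borel
       (\<lambda>x. (x - (\<integral>y. y \<partial>quicksort_law K ord piv alg n)) / real n)"


subsection \<open>The limit equation\<close>

definition gamma_const :: "nat \<Rightarrow> real" where
  "gamma_const K = (\<integral>v. opt_cost K (spacing K v) \<partial>pivot_space K)"

definition alpha_const :: "nat \<Rightarrow> real" where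
  "alpha_const K = gamma_const K / (harm (K + 1) - 1)"

definition limit_map :: "nat \<Rightarrow> real measure \<Rightarrow> real measure" where
  "limit_map K Z =
     distr (pivot_space K \<Otimes>\<^sub>M PiM {0..K} (\<lambda>_. Z)) borel
       (\<lambda>(v, z). (\<Sum>i=0..K. spacing K v i * z i
                          + alpha_const K * spacing K v i * ln (spacing K v i))
                + opt_cost K (spacing K v))"

definition limit_law :: "nat \<Rightarrow> real measure \<Rightarrow> bool" where
  "limit_law K Z \<longleftrightarrow>
     real_distribution Z \<and> integrable Z (\<lambda>z. z\<^sup>2) \<and> (\<integral>z. z \<partial>Z) = 0 \<and> Z = limit_map K Z"

end

theory Submission
  imports Defs
begin

text \<open>
  Let \<open>D\<close> be the spacings of the pivots. Given the pivots, the sublist sizes \<open>I i\<close> are binomial and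
  the trees chosen are eventually nearly optimal for \<open>D\<close>, so \<open>P n / n\<close> is within \<open>O(n powr (- 1 / 2))\<close>
  of \<open>opt_cost K D\<close> in \<open>L\<^sup>1\<close>. Since \<open>\<alpha> * E (\<Sum>i. D i * ln (D i)) = - gamma_const K\<close>, writing the mean as
  \<open>\<alpha> * n * ln n + (n + 1) * r n\<close> turns its recursion into a perturbed harmonic one for \<open>r\<close>, driven by the
  size-biased sublist kernel; that kernel forgets its starting point, so \<open>r\<close> converges. Hence the
  centered, rescaled toll converges in \<open>L\<^sup>1\<close> to \<open>b = opt_cost K D + \<alpha> * (\<Sum>i. D i * ln (D i))\<close>.

  Induction along the recursion gives \<open>E (exp (s * Y n)) \<le> exp (c * s\<^sup>2)\<close> uniformly in \<open>n\<close>, for \<open>s\<close>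
  in a bounded set. In the metric \<open>sup t. \<bar>\<phi> t - \<psi> t\<bar> / t\<^sup>2\<close> on characteristic functions of centered laws,
  the recursion contracts by the factor \<open>E (\<Sum>i. (D i)\<^sup>2) < 1\<close> up to vanishing errors. So the
  characteristic functions of the \<open>Y n\<close> are Cauchy, tightness supplies a limit law, the same estimate shows that it
  solves the fixed-point equation and that the solution is unique, and the exponential bounds give
  uniform integrability of powers and exponentials.
\<close>

text \<open>The laws are given only through a recursion; what two indices share is the input
  \<open>\<omega>\<close> of the first partitioning step. All comparisons integrate over that one
  space, on which the spacings and the sublist sizes and tolls of every \<open>n\<close> live
  together. The obstacle is the mean: the toll contains \<open>\<mu> n\<close> minus the means of
  the sublists, and a leading-order expansion leaves an error of the same order as the toll itself,
  so the second-order term must be shown to converge. It is normalized by \<open>n + 1\<close>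
  because the sublist sizes plus one sum to exactly \<open>n + 1\<close>; this makes the size-biased
  weights a probability kernel and constants harmonic. The rate \<open>n powr (- 1 / 4)\<close>
  stems from using Hoelder continuity of order 1/2 of \<open>x * ln x\<close> on deviations of order
  \<open>n powr (- 1 / 2)\<close>. One elementary fact drives both the exponential bounds and the
  contraction: a sublist with more than \<open>(1 - \<epsilon>) * n\<close> elements occurs with
  probability at most \<open>K * (K + 1) * \<epsilon>\<close>, uniformly in
  \<open>n\<close>.\<close>

section \<open>Contraction and renewal recursions\<close>

text \<open>The infimum of the admissible bounds must be 0: from an admissible bound just above a
  positive infimum, one step would lead below it. This closes three arguments: convergence of the
  renewal sequence, the Cauchy property of the characteristic functions, and uniqueness of the limit
  law.\<close>

lemma contraction_arbitrarily_small:
  fixes P :: "real \<Rightarrow> bool"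
  assumes "P d0" "d0 \<ge> 0" "0 < \<kappa>" "\<kappa> \<le> 1"
    and step: "\<And>d \<eta>. 0 \<le> d \<Longrightarrow> P d \<Longrightarrow> 0 < \<eta> \<Longrightarrow> P ((1 - \<kappa>) * d + \<eta>)"
    and mono: "\<And>d e. P d \<Longrightarrow> d \<le> e \<Longrightarrow> P e"
    and "\<eta> > 0"
  shows "P \<eta>"
proof -
  define S where "S = {d. d \<ge> 0 \<and> P d}"
  define i where "i = Inf S"
  have S: "S \<noteq> {}" "bdd_below S" using assms(1,2) by (auto simp: S_def intro!: bdd_belowI[of _ 0])
  have i0: "i \<ge> 0" unfolding i_def using S by (intro cInf_greatest) (auto simp: S_def)
  have "i \<le> 0"
  proof (rule ccontr)
    assume "\<not> i \<le> 0"
    \<comment> \<open>The contraction gains \<open>\<kappa> * i = 4 * e\<close>, while the two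
      errors of size \<open>e\<close> cost less than that.\<close>
    define e where "e = \<kappa> * i / 4"
    have e: "e > 0" using \<open>\<not> i \<le> 0\<close> \<open>0 < \<kappa>\<close> by (simp add: e_def)
    have "Inf S < i + e" using e by (simp add: i_def)
    then obtain d where d: "d \<in> S" "d < i + e" using cInf_lessD[OF S(1)] by blast
    have "(1 - \<kappa>) * d + e \<in> S"
      using d e step[of d e] assms(4) by (auto simp: S_def intro!: add_nonneg_nonneg mult_nonneg_nonneg)
    then have "i \<le> (1 - \<kappa>) * d + e" unfolding i_def using S(2) by (rule cInf_lower)
    also have "\<dots> \<le> (1 - \<kappa>) * (i + e) + e" using d assms(4) by (intro add_right_mono mult_left_mono) auto
    also have "\<dots> = i - 4 * e + (1 - \<kappa>) * e + e" by (simp add: e_def algebra_simps)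
    also have "\<dots> \<le> i - 4 * e + 1 * e + e" using assms(3) e by (intro add_mono mult_right_mono) auto
    also have "\<dots> < i" using e by simp
    finally show False by simp
  qed
  then have "Inf S < \<eta>" using \<open>\<eta> > 0\<close> by (simp add: i_def)
  then obtain d where "d \<in> S" "d < \<eta>" using cInf_lessD[OF S(1)] by blast
  then show ?thesis using mono[of d \<eta>] by (simp add: S_def)
qed

text \<open>Abstract form of the size-biased sublist kernel, whose mass at \<open>j\<close> is of
  order \<open>j / n\<^sup>2\<close>. The upper bound makes a jump into a fixed initial block
  unlikely; the lower bound guarantees a fixed chance of a substantial descent.\<close>

locale renewal_kernel =
  fixes q :: "nat \<Rightarrow> nat \<Rightarrow> real" and n0 K :: nat and c C :: real
  assumes q_nonneg: "\<And>n j. K < n \<Longrightarrow> 0 \<le> q n j"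
    and q_sum: "\<And>n. K < n \<Longrightarrow> (\<Sum>j<n. q n j) = 1"
    and q_upper: "\<And>n j. K < n \<Longrightarrow> q n j \<le> C * (real j + 1) / (real n + 1)\<^sup>2"
    and q_lower: "\<And>n j. n0 \<le> n \<Longrightarrow> 2 * j \<le> n \<Longrightarrow> c * (real j + 1) / (real n + 1)\<^sup>2 \<le> q n j"
    and n0: "K < n0" "15 \<le> n0" and c_pos: "0 < c"
begin

lemma c_le_C: "c \<le> C"
proof -
  have "c / (real n0 + 1)\<^sup>2 \<le> C / (real n0 + 1)\<^sup>2"
    using q_lower[of n0 0] q_upper[of n0 0] n0 by simp
  then show ?thesis using divide_le_cancel by (smt (verit) zero_less_power of_nat_0_le_iff)
qed

text \<open>The scale of the errors in the mean recursion. It also serves as a potential: its kernel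
  average exceeds its present value by a fixed factor, and this gain is what absorbs the
  errors.\<close>

definition \<phi> :: "nat \<Rightarrow> real" where "\<phi> n = (real n + 1) powr (- 1 / 4)"

lemma \<phi>_pos: "\<phi> n > 0"
  by (simp add: \<phi>_def)

lemma \<phi>_antimono: "m \<le> n \<Longrightarrow> \<phi> n \<le> \<phi> m"
  unfolding \<phi>_def by (rule powr_mono2') auto

text \<open>\<open>16 powr (1 / 4) = 2\<close>, so dividing the argument by 16 doubles the
  potential.\<close>

lemma \<phi>_double: assumes "16 * (j + 1) \<le> n + 1" shows "2 * \<phi> n \<le> \<phi> j"
proof -
  have e: "real n + 1 = 16 * ((real n + 1) / 16)" by simp
  have "2 * \<phi> n = 2 * (16 * ((real n + 1) / 16)) powr (- 1 / 4)"
    unfolding \<phi>_def by (rule arg_cong[OF e])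
  also have "\<dots> = 2 * 16 powr (- 1 / 4) * ((real n + 1) / 16) powr (- 1 / 4)"
    by (subst powr_mult) auto
  also have "(16::real) powr (- 1 / 4) = 1 / 2"
  proof -
    have "(16::real) = 2 powr 4" by simp
    then show ?thesis by (simp only: powr_powr) (simp add: powr_minus_divide)
  qed
  also have "2 * (1 / 2) * ((real n + 1) / 16) powr (- 1 / 4) = ((real n + 1) / 16) powr (- 1 / 4)" by simp
  also have "\<dots> \<le> \<phi> j" unfolding \<phi>_def using assms by (intro powr_mono2') auto
  finally show ?thesis .
qed

text \<open>Sites below \<open>(n + 1) div 16\<close> carry mass at least \<open>c / 1024\<close>,
  and there the potential is at least doubled; elsewhere nothing is lost. The general
  \<open>\<psi>\<close> accommodates the tail bound, where the potential is frozen on an initial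
  block.\<close>

lemma potential_gain:
  assumes n: "n0 \<le> n" and 1: "\<And>j. j < n \<Longrightarrow> \<phi> n \<le> \<psi> j"
    and 2: "\<And>j. j < (n + 1) div 16 \<Longrightarrow> 2 * \<phi> n \<le> \<psi> j"
  shows "(1 + c / 1024) * \<phi> n \<le> (\<Sum>j<n. q n j * \<psi> j)"
proof -
  have Kn: "K < n" and n15: "15 \<le> n" using n n0 by auto
  define m where "m = (n + 1) div 16"
  have m: "m \<ge> 1" "m < n" using n15 by (auto simp: m_def)
  have "c * (\<Sum>j<m. real j + 1) / (real n + 1)\<^sup>2 = (\<Sum>j<m. c * (real j + 1) / (real n + 1)\<^sup>2)"
    by (simp add: sum_distrib_left sum_divide_distrib)
  also have "\<dots> \<le> (\<Sum>j<m. q n j)"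
    by (intro sum_mono q_lower n) (use m in \<open>auto simp: m_def\<close>)
  finally have A: "c * (\<Sum>j<m. real j + 1) / (real n + 1)\<^sup>2 \<le> (\<Sum>j<m. q n j)" .
  have S: "(\<Sum>j<k. real j + 1) = real k * (real k + 1) / 2" for k
    by (induction k) (auto simp: field_simps)
  have "(real n + 1) / 16 \<le> real m + 1"
  proof -
    have "n + 1 \<le> 16 * (m + 1)" by (simp add: m_def)
    then have "real (n + 1) \<le> real (16 * (m + 1))" by (rule of_nat_mono)
    then show ?thesis by simp
  qed
  then have "((real n + 1) / 16)\<^sup>2 \<le> (real m + 1)\<^sup>2" by (intro power_mono) auto
  also have "\<dots> \<le> 4 * (real m * (real m + 1) / 2)" using m by (simp add: power2_eq_square mult_right_mono)
  finally have "(real n + 1)\<^sup>2 / 1024 \<le> (\<Sum>j<m. real j + 1)"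
    by (simp add: S power_divide)
  then have "c * ((real n + 1)\<^sup>2 / 1024) / (real n + 1)\<^sup>2 \<le> c * (\<Sum>j<m. real j + 1) / (real n + 1)\<^sup>2"
    using c_pos by (intro divide_right_mono mult_left_mono) auto
  also have "c * ((real n + 1)\<^sup>2 / 1024) / (real n + 1)\<^sup>2 = c / 1024"
  proof -
    have "(real n + 1)\<^sup>2 \<noteq> 0" by (smt (verit) of_nat_0_le_iff zero_less_power)
    then show ?thesis by simp
  qed
  finally have D: "c / 1024 \<le> (\<Sum>j<m. q n j)" using A by linarith
  have split: "{..<n} = {..<m} \<union> {m..<n}" using m by auto
  have "(1 + c / 1024) * \<phi> n \<le> (1 + (\<Sum>j<m. q n j)) * \<phi> n"
    using D \<phi>_pos[of n] by (intro mult_right_mono) auto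
  also have "\<dots> = (\<Sum>j<n. q n j * \<phi> n) + (\<Sum>j<m. q n j * \<phi> n)"
    using q_sum[OF Kn] by (simp add: sum_distrib_right[symmetric] distrib_right)
  also have "\<dots> = (\<Sum>j<m. q n j * (2 * \<phi> n)) + (\<Sum>j\<in>{m..<n}. q n j * \<phi> n)"
    unfolding split by (subst sum.union_disjoint) (auto simp: sum.distrib[symmetric] algebra_simps sum_distrib_left)
  also have "\<dots> \<le> (\<Sum>j<m. q n j * \<psi> j) + (\<Sum>j\<in>{m..<n}. q n j * \<psi> j)"
    using 1 2 q_nonneg[OF Kn] by (intro add_mono sum_mono mult_left_mono) (auto simp: m_def)
  also have "\<dots> = (\<Sum>j<n. q n j * \<psi> j)"
    unfolding split by (subst sum.union_disjoint) auto
  finally show ?thesis .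
qed

section \<open>Boundedness and convergence of perturbed harmonic sequences\<close>

definition perturbed_harmonic :: "real \<Rightarrow> (nat \<Rightarrow> real) \<Rightarrow> bool" where
  "perturbed_harmonic E r \<longleftrightarrow> (\<forall>n>K. \<bar>r n - (\<Sum>j<n. q n j * r j)\<bar> \<le> E * \<phi> n)"

lemma perturbed_harmonic_uminus:
  "perturbed_harmonic E r \<Longrightarrow> perturbed_harmonic E (\<lambda>n. - r n)"
  unfolding perturbed_harmonic_def by (simp add: sum_negf) (smt (verit))

text \<open>Comparison with the supersolution \<open>B - D * \<phi>\<close>: for
  \<open>D = E * 1024 / c\<close> one kernel step gains
  \<open>D * (c / 1024) * \<phi> n = E * \<phi> n\<close>, exactly the permitted error, so the bound
  propagates by strong induction.\<close>

lemma perturbed_harmonic_bounded_above: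
  assumes r: "perturbed_harmonic E r" and E: "E \<ge> 0"
  shows "\<exists>B. \<forall>n. r n \<le> B"
proof -
  define D where "D = E * 1024 / c"
  have D: "D \<ge> 0" "D * (c / 1024) = E" using E c_pos by (auto simp: D_def)
  define B where "B = Max ((\<lambda>n. r n + D * \<phi> n) ` {..n0})"
  have "r n \<le> B - D * \<phi> n" for n
  proof (induction n rule: less_induct)
    case (less n)
    show ?case
    proof (cases "n \<le> n0")
      case True
      then have "r n + D * \<phi> n \<le> B" unfolding B_def by (intro Max_ge) auto
      then show ?thesis by simp
    next
      case False
      then have n: "n0 \<le> n" "K < n" using n0 by auto
      have "r n \<le> (\<Sum>j<n. q n j * r j) + E * \<phi> n"
        using r n unfolding perturbed_harmonic_def by fastforce
      also have "(\<Sum>j<n. q n j * r j) \<le> (\<Sum>j<n. q n j * (B - D * \<phi> j))"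
        using less q_nonneg n by (intro sum_mono mult_left_mono) auto
      also have "\<dots> = B * (\<Sum>j<n. q n j) - D * (\<Sum>j<n. q n j * \<phi> j)"
        by (simp add: sum_subtractf sum_distrib_left algebra_simps)
      finally have "r n \<le> B * (\<Sum>j<n. q n j) - D * (\<Sum>j<n. q n j * \<phi> j) + E * \<phi> n" by simp
      also have "B * (\<Sum>j<n. q n j) - D * (\<Sum>j<n. q n j * \<phi> j) \<le> B - D * ((1 + c / 1024) * \<phi> n)"
        using q_sum[OF n(2)] D(1)
        by (simp, intro mult_left_mono potential_gain n \<phi>_antimono \<phi>_double) auto
      finally have "r n \<le> B - D * ((1 + c / 1024) * \<phi> n) + E * \<phi> n" by simp
      moreover have "D * ((1 + c / 1024) * \<phi> n) = D * \<phi> n + (D * (c / 1024)) * \<phi> n"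
        by (simp add: algebra_simps)
      ultimately show ?thesis unfolding D(2) by linarith
    qed
  qed
  then have "r n \<le> B" for n using D \<phi>_pos[of n] by (smt (verit) mult_nonneg_nonneg)
  then show ?thesis by blast
qed

text \<open>A chain moving according to \<open>q\<close> enters \<open>{..<N}\<close> from any starting point with a law that
  dominates \<open>\<kappa>\<close> times the uniform law on \<open>{N div 4..<N div 2}\<close>; this forgets the starting point.\<close>

definition \<kappa> :: real where "\<kappa> = c / (32 * C)"

definition mid :: "nat \<Rightarrow> (nat \<Rightarrow> real) \<Rightarrow> real" where
  "mid N r = (\<Sum>j\<in>{N div 4..<N div 2}. r j) / card {N div 4..<N div 2}"

lemma \<kappa>: "0 < \<kappa>" "\<kappa> \<le> 1"
  using c_pos c_le_C by (auto simp: \<kappa>_def field_simps)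

text \<open>The entering mass splits into \<open>w\<close>, the uniform share on the middle block,
  and the rest. On the rest \<open>r\<close> is at most \<open>M\<close> except below
  \<open>N0\<close>, where it can exceed \<open>M\<close> by \<open>2 * B\<close>; those sites carry
  only a share of order \<open>(N0 / N)\<^sup>2\<close> of the entering mass, which vanishes for
  \<open>N\<close> large against \<open>N0\<close>.\<close>

lemma entrance_bound:
  assumes N: "n0 \<le> N" "N0 \<le> N" "N \<le> n"
    and B: "\<And>j. \<bar>r j\<bar> \<le> B" and M: "\<And>j. N0 \<le> j \<Longrightarrow> r j \<le> M"
  shows "(\<Sum>j<N. q n j * r j) \<le> (\<Sum>j<N. q n j) *
     (\<kappa> * mid N r + (1 - \<kappa>) * M + 2 * B * (32 * C / c) * (real N0 / real N)\<^sup>2)"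
proof -
  define T where "T = {N div 4..<N div 2}"
  define Q where "Q = (\<Sum>j<N. q n j)"
  define w where "w j = (if j \<in> T then \<kappa> * Q / card T else 0)" for j
  have Kn: "K < n" and N15: "15 \<le> N" and nn0: "n0 \<le> n" using N n0 by auto
  have C: "C > 0" using c_pos c_le_C by simp
  have TN: "T \<subseteq> {..<N}" "finite T" by (auto simp: T_def)
  have cT: "real N \<le> 8 * real (card T)"
  proof -
    have "2 * (N div 4) \<le> N div 2" "N < 4 * (N div 4) + 4" "3 \<le> N div 4"
      using N15 by linarith+
    then have "N \<le> 8 * card T" by (simp add: T_def)
    then have "real N \<le> real (8 * card T)" by (rule of_nat_mono)
    then show ?thesis by simp
  qed
  have cT0: "real (card T) > 0" using cT N15 by simp
  have n2: "(real n + 1)\<^sup>2 > 0" by (smt (verit) of_nat_0_le_iff zero_less_power)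
  have QM: "(\<Sum>j<k. q n j) \<le> C * (real k)\<^sup>2 / (real n + 1)\<^sup>2" for k
  proof -
    have "(\<Sum>j<k. q n j) \<le> (\<Sum>j<k. C * real k / (real n + 1)\<^sup>2)"
      using C by (intro sum_mono order_trans[OF q_upper[OF Kn]] divide_right_mono mult_left_mono) auto
    then show ?thesis by (simp add: power2_eq_square mult_ac)
  qed
  have Tlo: "c * (real N / 4) / (real n + 1)\<^sup>2 \<le> q n j" if "j \<in> T" for j
  proof -
    have "N \<le> 4 * (j + 1)" using that by (auto simp: T_def)
    then have "real N \<le> real (4 * (j + 1))" by (rule of_nat_mono)
    then have "real N / 4 \<le> real j + 1" by simp
    then have "c * (real N / 4) / (real n + 1)\<^sup>2 \<le> c * (real j + 1) / (real n + 1)\<^sup>2"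
      using c_pos by (intro divide_right_mono mult_left_mono) auto
    also have "\<dots> \<le> q n j" using that N by (intro q_lower nn0) (auto simp: T_def)
    finally show ?thesis .
  qed
  have wq: "w j \<le> q n j" for j
  proof (cases "j \<in> T")
    case True
    have "\<kappa> * Q / card T \<le> \<kappa> * (C * (real N)\<^sup>2 / (real n + 1)\<^sup>2) / card T"
      using QM[of N] \<kappa> by (intro divide_right_mono mult_left_mono) (auto simp: Q_def)
    also have "\<dots> \<le> \<kappa> * (C * (real N)\<^sup>2 / (real n + 1)\<^sup>2) / (real N / 8)"
      using cT \<kappa> C N15 cT0 by (intro divide_left_mono) auto
    \<comment> \<open>Origin of the 32 in \<open>\<kappa>\<close>: a factor 8 from
      \<open>card T \<ge> N / 8\<close> and a factor 4 from \<open>j + 1 \<ge> N / 4\<close> on the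
      middle block.\<close>
    also have "\<dots> = c * (real N / 4) / (real n + 1)\<^sup>2"
      using C N15 by (simp add: \<kappa>_def power2_eq_square)
    finally show ?thesis using Tlo[OF True] True by (simp add: w_def)
  qed (simp add: w_def q_nonneg[OF Kn])
  \<comment> \<open>A lower bound for the entering mass \<open>Q\<close> is needed to convert the
    absolute mass below \<open>N0\<close> into a share of \<open>Q\<close>.\<close>
  have "c * (real N)\<^sup>2 / 32 / (real n + 1)\<^sup>2 = (real N / 8) * (c * (real N / 4) / (real n + 1)\<^sup>2)"
    by (simp add: power2_eq_square)
  also have "\<dots> \<le> real (card T) * (c * (real N / 4) / (real n + 1)\<^sup>2)"
    using cT c_pos by (intro mult_right_mono) auto
  also have "\<dots> = (\<Sum>j\<in>T. c * (real N / 4) / (real n + 1)\<^sup>2)" by simp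
  also have "\<dots> \<le> (\<Sum>j\<in>T. q n j)" by (intro sum_mono Tlo)
  also have "\<dots> \<le> Q" unfolding Q_def using TN q_nonneg[OF Kn] by (intro sum_mono2) auto
  finally have Qlo: "c * (real N)\<^sup>2 / 32 / (real n + 1)\<^sup>2 \<le> Q" .
  have "(\<Sum>j<N0. q n j) \<le> C * (real N0)\<^sup>2 / (real n + 1)\<^sup>2" by (rule QM)
  also have "\<dots> = (32 * C / c) * (real N0 / real N)\<^sup>2 * (c * (real N)\<^sup>2 / 32 / (real n + 1)\<^sup>2)"
    using c_pos N15 by (simp add: power_divide)
  also have "\<dots> \<le> (32 * C / c) * (real N0 / real N)\<^sup>2 * Q"
    using c_pos C by (intro mult_left_mono Qlo) auto
  finally have small: "(\<Sum>j<N0. q n j) \<le> (32 * C / c) * (real N0 / real N)\<^sup>2 * Q" .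
  have B0: "B \<ge> 0" using B[of 0] by linarith
  have MB: "- B \<le> M" using B[of N0] M[of N0] by linarith
  have sw: "(\<Sum>j<N. w j) = \<kappa> * Q"
  proof -
    have "(\<Sum>j<N. w j) = (\<Sum>j\<in>T. \<kappa> * Q / card T)"
      unfolding w_def using TN by (simp add: sum.If_cases Int_absorb1)
    then show ?thesis using cT0 by simp
  qed
  have swr: "(\<Sum>j<N. w j * r j) = \<kappa> * Q * mid N r"
  proof -
    have "(\<Sum>j<N. w j * r j) = (\<Sum>j<N. if j \<in> T then \<kappa> * Q / card T * r j else 0)"
      by (intro sum.cong) (auto simp: w_def)
    also have "\<dots> = (\<Sum>j\<in>T. \<kappa> * Q / card T * r j)"
      using TN by (simp add: sum.If_cases Int_absorb1)
    also have "\<dots> = \<kappa> * Q * mid N r"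
      by (simp add: mid_def T_def sum_distrib_left sum_divide_distrib mult_ac)
    finally show ?thesis .
  qed
  have "(\<Sum>j<N. q n j * r j) = (\<Sum>j<N. w j * r j) + (\<Sum>j<N. (q n j - w j) * r j)"
    by (simp add: sum.distrib[symmetric] algebra_simps)
  also have "(\<Sum>j<N. (q n j - w j) * r j) \<le> (\<Sum>j<N. (q n j - w j) * M + (if j < N0 then q n j * (2 * B) else 0))"
  proof (rule sum_mono)
    fix j
    show "(q n j - w j) * r j \<le> (q n j - w j) * M + (if j < N0 then q n j * (2 * B) else 0)"
    proof (cases "j < N0")
      case True
      have "(q n j - w j) * r j \<le> (q n j - w j) * (M + 2 * B)"
        using wq[of j] MB B[of j] by (intro mult_left_mono) auto
      also have "\<dots> = (q n j - w j) * M + (q n j - w j) * (2 * B)" by (simp add: algebra_simps)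
      also have "(q n j - w j) * (2 * B) \<le> q n j * (2 * B)"
        using B0 \<kappa> Q_def q_nonneg[OF Kn] by (intro mult_right_mono) (auto simp: w_def sum_nonneg)
      finally show ?thesis using True by simp
    next
      case False
      then show ?thesis using wq[of j] M[of j] by (auto intro!: mult_left_mono)
    qed
  qed
  also have "\<dots> = (Q - \<kappa> * Q) * M + (\<Sum>j<N0. q n j) * (2 * B)"
  proof -
    have "{..<N} \<inter> {j. j < N0} = {..<N0}" using N by auto
    then show ?thesis
      by (simp add: sum.distrib sum_distrib_right[symmetric] sum_subtractf sw Q_def sum.If_cases)
  qed
  also have "(\<Sum>j<N0. q n j) * (2 * B) \<le> ((32 * C / c) * (real N0 / real N)\<^sup>2 * Q) * (2 * B)"
    using small B0 by (intro mult_right_mono) auto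
  finally show ?thesis unfolding swr Q_def[symmetric] by (simp add: algebra_simps)
qed

text \<open>The supersolution argument restarted at \<open>N\<close>. A jump below \<open>N\<close>
  is charged to \<open>entrance_bound\<close>, and the potential is frozen there at
  \<open>2 * \<phi> N\<close>, so that \<open>potential_gain\<close> still applies and the
  comparison value on the block is the bare constant \<open>b\<close>.\<close>

lemma tail_upper_bound:
  assumes r: "perturbed_harmonic E r" and E: "E \<ge> 0"
    and N: "n0 \<le> N" "N0 \<le> N"
    and B: "\<And>j. \<bar>r j\<bar> \<le> B" and M: "\<And>j. N0 \<le> j \<Longrightarrow> r j \<le> M"
    and n: "N \<le> n"
  shows "r n \<le> \<kappa> * mid N r + (1 - \<kappa>) * M + 2 * B * (32 * C / c) * (real N0 / real N)\<^sup>2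
           + 2 * (E * 1024 / c) * \<phi> N"
proof -
  define D where "D = E * 1024 / c"
  have D: "D \<ge> 0" "D * (c / 1024) = E" using E c_pos by (auto simp: D_def)
  define b where "b = \<kappa> * mid N r + (1 - \<kappa>) * M + 2 * B * (32 * C / c) * (real N0 / real N)\<^sup>2"
  have "r n \<le> b + D * (2 * \<phi> N - \<phi> n)"
    using n
  proof (induction n rule: less_induct)
    case (less n)
    then have n: "n0 \<le> n" "K < n" "N \<le> n" using n0 N by auto
    define \<psi> where "\<psi> j = (if j < N then 2 * \<phi> N else \<phi> j)" for j
    have split: "{..<n} = {..<N} \<union> {N..<n}" using n by auto
    have "r n \<le> (\<Sum>j<n. q n j * r j) + E * \<phi> n"
      using r n unfolding perturbed_harmonic_def by fastforce
    also have "(\<Sum>j<n. q n j * r j) = (\<Sum>j<N. q n j * r j) + (\<Sum>j\<in>{N..<n}. q n j * r j)"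
      unfolding split by (subst sum.union_disjoint) auto
    also have "(\<Sum>j<N. q n j * r j) \<le> (\<Sum>j<N. q n j) * b"
      unfolding b_def by (intro entrance_bound N n B M)
    also have "\<dots> = (\<Sum>j<N. q n j * (b + D * (2 * \<phi> N - \<psi> j)))"
      by (simp add: \<psi>_def sum_distrib_right)
    also have "(\<Sum>j\<in>{N..<n}. q n j * r j) \<le> (\<Sum>j\<in>{N..<n}. q n j * (b + D * (2 * \<phi> N - \<psi> j)))"
      using less q_nonneg n by (intro sum_mono mult_left_mono) (auto simp: \<psi>_def)
    also have "(\<Sum>j<N. q n j * (b + D * (2 * \<phi> N - \<psi> j))) + \<dots>
         = (\<Sum>j<n. q n j * (b + D * (2 * \<phi> N - \<psi> j)))"
      unfolding split by (subst sum.union_disjoint) auto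
    also have "\<dots> = (b + 2 * D * \<phi> N) * (\<Sum>j<n. q n j) - D * (\<Sum>j<n. q n j * \<psi> j)"
      by (simp add: sum_distrib_left sum_subtractf sum.distrib algebra_simps)
    also have "\<dots> \<le> b + 2 * D * \<phi> N - D * ((1 + c / 1024) * \<phi> n)"
    proof -
      have "(1 + c / 1024) * \<phi> n \<le> (\<Sum>j<n. q n j * \<psi> j)"
      proof (rule potential_gain[OF n(1)])
        show "\<phi> n \<le> \<psi> j" if "j < n" for j
          using that \<phi>_antimono[of j n] \<phi>_antimono[of N n] \<phi>_pos[of N] n by (auto simp: \<psi>_def)
        show "2 * \<phi> n \<le> \<psi> j" if "j < (n + 1) div 16" for j
          using \<phi>_double[of j n] that \<phi>_antimono[of N n] n by (auto simp: \<psi>_def)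
      qed
      then show ?thesis using q_sum[OF n(2)] D(1) by (simp add: mult_left_mono)
    qed
    finally have "r n \<le> b + 2 * D * \<phi> N - D * ((1 + c / 1024) * \<phi> n) + E * \<phi> n" by simp
    moreover have "D * ((1 + c / 1024) * \<phi> n) = D * \<phi> n + (D * (c / 1024)) * \<phi> n"
      by (simp add: algebra_simps)
    moreover have "D * (2 * \<phi> N - \<phi> n) = 2 * D * \<phi> N - D * \<phi> n" by (simp add: algebra_simps)
    ultimately show ?case unfolding D(2) by linarith
  qed
  also have "\<dots> \<le> b + D * (2 * \<phi> N)"
    using D \<phi>_pos[of n] by (intro add_left_mono mult_left_mono) auto
  finally show ?thesis by (simp add: b_def D_def)
qed

lemma \<phi>_tendsto: "\<phi> \<longlonglongrightarrow> 0"
proof -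
  have "filterlim (\<lambda>n. real n + 1) at_top sequentially"
    by (subst add.commute) (rule filterlim_tendsto_add_at_top[OF tendsto_const filterlim_real_sequentially])
  then show ?thesis unfolding \<phi>_def by (intro tendsto_neg_powr) auto
qed

text \<open>Apply the tail bound to \<open>r\<close> and to \<open>- r\<close>. The terms
  \<open>mid N r\<close> are the same for all starting points and cancel, so the oscillation beyond
  \<open>N\<close> is at most \<open>1 - \<kappa>\<close> times the oscillation beyond
  \<open>N0\<close>, plus errors that vanish as \<open>N\<close> grows.\<close>

theorem perturbed_harmonic_convergent:
  assumes r: "perturbed_harmonic E r" and E: "E \<ge> 0"
  shows "convergent r"
proof -
  obtain B1 B2 where B12: "\<And>n. r n \<le> B1" "\<And>n. - r n \<le> B2"
    using perturbed_harmonic_bounded_above[OF r E]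
      perturbed_harmonic_bounded_above[OF perturbed_harmonic_uminus[OF r] E] by metis
  define B where "B = max B1 B2"
  have B: "\<bar>r n\<bar> \<le> B" for n using B12[of n] by (auto simp: B_def)
  define P where "P d \<longleftrightarrow> (\<exists>N. \<forall>m\<ge>N. \<forall>n\<ge>N. r n - r m \<le> d)" for d
  have small: "P \<eta>" if "\<eta> > 0" for \<eta>
  proof (rule contraction_arbitrarily_small[where P=P and \<kappa>=\<kappa> and ?d0.0="2 * B"])
    have "r n - r m \<le> 2 * B" for n m using B[of n] B[of m] by linarith
    then show "P (2 * B)" by (auto simp: P_def)
    show "0 \<le> 2 * B" using B[of 0] by linarith
    show "P d \<Longrightarrow> d \<le> e \<Longrightarrow> P e" for d e unfolding P_def by (meson order_trans)
    fix d \<eta> :: real assume d: "0 \<le> d" "P d" "0 < \<eta>"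
    then obtain N0 where N0: "\<And>m n. m \<ge> N0 \<Longrightarrow> n \<ge> N0 \<Longrightarrow> r n - r m \<le> d" by (auto simp: P_def)
    define M where "M = Sup (r ` {N0..})"
    define L where "L = Inf (r ` {N0..})"
    have bdd: "bdd_above (r ` {N0..})" "bdd_below (r ` {N0..})"
    proof -
      have "r j \<le> B" "- B \<le> r j" for j using B[of j] by linarith+
      then show "bdd_above (r ` {N0..})" "bdd_below (r ` {N0..})"
        by (auto intro!: bdd_aboveI2 bdd_belowI2)
    qed
    have M: "N0 \<le> j \<Longrightarrow> r j \<le> M" for j unfolding M_def using bdd by (intro cSup_upper) auto
    have L: "N0 \<le> j \<Longrightarrow> - r j \<le> - L" for j unfolding L_def using bdd by (simp add: cInf_lower)
    have "M \<le> L + d"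
      unfolding M_def
    proof (rule cSup_least)
      fix x assume "x \<in> r ` {N0..}"
      then obtain n where n: "x = r n" "n \<ge> N0" by auto
      have "r n - d \<le> L" unfolding L_def
        by (rule cInf_greatest) (use N0[of _ n] n in \<open>force+\<close>)
      then show "x \<le> L + d" using n by simp
    qed auto
    have "(\<lambda>N. 4 * B * (32 * C / c) * (real N0 / real N)\<^sup>2 + 4 * (E * 1024 / c) * \<phi> N) \<longlonglongrightarrow>
        4 * B * (32 * C / c) * 0\<^sup>2 + 4 * (E * 1024 / c) * 0"
      by (intro tendsto_intros \<phi>_tendsto lim_const_over_n)
    then have "\<forall>\<^sub>F N in sequentially. 4 * B * (32 * C / c) * (real N0 / real N)\<^sup>2 + 4 * (E * 1024 / c) * \<phi> N < \<eta>"
      using d by (intro order_tendstoD(2)) auto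
    then have "\<forall>\<^sub>F N in sequentially. 4 * B * (32 * C / c) * (real N0 / real N)\<^sup>2 + 4 * (E * 1024 / c) * \<phi> N < \<eta>
        \<and> n0 \<le> N \<and> N0 \<le> N"
      using eventually_ge_at_top[of n0] eventually_ge_at_top[of N0] by eventually_elim auto
    then obtain N where N: "4 * B * (32 * C / c) * (real N0 / real N)\<^sup>2 + 4 * (E * 1024 / c) * \<phi> N < \<eta>"
        "n0 \<le> N" "N0 \<le> N"
      using eventually_happens'[OF sequentially_bot] by blast
    have "r n - r m \<le> (1 - \<kappa>) * d + \<eta>" if "N \<le> m" "N \<le> n" for n m
    proof -
      have "r n \<le> \<kappa> * mid N r + (1 - \<kappa>) * M + 2 * B * (32 * C / c) * (real N0 / real N)\<^sup>2
           + 2 * (E * 1024 / c) * \<phi> N"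
        by (rule tail_upper_bound[OF r E N(2,3) B M that(2)]) auto
      moreover have "- r m \<le> \<kappa> * mid N (\<lambda>n. - r n) + (1 - \<kappa>) * (- L) + 2 * B * (32 * C / c) * (real N0 / real N)\<^sup>2
           + 2 * (E * 1024 / c) * \<phi> N"
        by (rule tail_upper_bound[OF perturbed_harmonic_uminus[OF r] E N(2,3) _ L that(1)]) (use B in auto)
      moreover have "\<kappa> * mid N (\<lambda>n. - r n) = - (\<kappa> * mid N r)" by (simp add: mid_def sum_negf)
      moreover have "(1 - \<kappa>) * (M - L) \<le> (1 - \<kappa>) * d" using \<open>M \<le> L + d\<close> \<kappa> by (intro mult_left_mono) auto
      moreover have "(1 - \<kappa>) * (M - L) = (1 - \<kappa>) * M + (1 - \<kappa>) * (- L)" by (simp add: algebra_simps)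
      ultimately show ?thesis using N(1) by linarith
    qed
    then show "P ((1 - \<kappa>) * d + \<eta>)" by (auto simp: P_def)
  qed (use \<kappa> that in auto)
  have "Cauchy r"
  proof (rule metric_CauchyI)
    fix e :: real assume "0 < e"
    then obtain N where N: "\<And>m n. m \<ge> N \<Longrightarrow> n \<ge> N \<Longrightarrow> r n - r m \<le> e / 2"
      using small[of "e / 2"] by (auto simp: P_def)
    show "\<exists>M. \<forall>m\<ge>M. \<forall>n\<ge>M. dist (r m) (r n) < e"
      using N \<open>0 < e\<close> by (intro exI[of _ N]) (auto simp: dist_real_def abs_less_iff intro!: le_less_trans[OF N])
  qed
  then show ?thesis by (simp add: Cauchy_convergent)
qed

end

section \<open>Estimates for \<open>x ln x\<close> and for characters\<close>

text \<open>This is \<open>ln x \<le> x - 1\<close> at \<open>x = 1 / sqrt d\<close>; taking the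
  root first trades the logarithm for the power one half at the cost of the factor 2.\<close>

lemma neg_xlnx_le_sqrt:
  fixes d :: real assumes "0 \<le> d" shows "- (d * ln d) \<le> 2 * sqrt d"
proof (cases "d = 0")
  case False
  then have d: "d > 0" using assms by simp
  have "ln (1 / sqrt d) \<le> 1 / sqrt d - 1" using d by (intro ln_le_minus_one) auto
  then have "- (ln d / 2) \<le> 1 / sqrt d" using d by (simp add: ln_div ln_sqrt)
  then have "d * (- (ln d / 2)) \<le> d * (1 / sqrt d)" using d by (intro mult_left_mono) auto
  also have "d * (1 / sqrt d) = sqrt d" using d by (simp add: real_div_sqrt)
  finally show ?thesis by simp
qed simp

text \<open>Upwards, the tangent bound for the logarithm gives a difference of at most
  \<open>d \<le> sqrt d\<close>, where \<open>d = y - x\<close>. Downwards, superadditivity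
  \<open>x * ln x + d * ln d \<le> y * ln y\<close> reduces the claim to the bound at 0.\<close>

lemma xlnx_holder_aux:
  fixes x y :: real
  assumes "0 \<le> x" "x \<le> y" "y \<le> 1"
  shows "\<bar>x * ln x - y * ln y\<bar> \<le> 2 * sqrt (y - x)"
proof (cases "x = 0 \<or> x = y")
  case True
  then show ?thesis
  proof
    assume "x = 0"
    moreover have "y * ln y \<le> 0" using assms by (cases "y = 0") (auto intro!: mult_nonneg_nonpos)
    ultimately show ?thesis using neg_xlnx_le_sqrt[of y] assms by simp
  qed simp
next
  case False
  define d where "d = y - x"
  have x: "x > 0" and y: "y > 0" and d: "d > 0" "d \<le> y" "d \<le> 1" using False assms by (auto simp: d_def)
  have "x * ln (y / x) \<le> x * (y / x - 1)" using x y by (intro mult_left_mono ln_le_minus_one) auto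
  also have "\<dots> = d" using x by (simp add: d_def field_simps)
  finally have "x * ln y - x * ln x \<le> d" using x y by (simp add: ln_div algebra_simps)
  moreover have "(y - x) * ln y \<le> 0" using y assms by (intro mult_nonneg_nonpos) auto
  ultimately have "y * ln y - x * ln x \<le> d" by (simp add: algebra_simps)
  also have "d \<le> sqrt d"
  proof -
    have "d * d \<le> d * 1" using d by (intro mult_left_mono) auto
    then show ?thesis using d by (intro real_le_rsqrt) (simp add: power2_eq_square)
  qed
  finally have 1: "y * ln y - x * ln x \<le> 2 * sqrt d" using d by (smt (verit) real_sqrt_gt_zero)
  have "x * ln x + d * ln d \<le> x * ln y + d * ln y"
    using x y d assms by (intro add_mono mult_left_mono) auto
  also have "\<dots> = y * ln y" by (simp add: d_def algebra_simps)
  finally have "x * ln x - y * ln y \<le> 2 * sqrt d" using neg_xlnx_le_sqrt[of d] d by linarith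
  then show ?thesis using 1 by (simp add: d_def abs_le_iff)
qed

lemma xlnx_holder:
  fixes x y :: real
  assumes "0 \<le> x" "x \<le> 1" "0 \<le> y" "y \<le> 1"
  shows "\<bar>x * ln x - y * ln y\<bar> \<le> 2 * sqrt \<bar>x - y\<bar>"
  using xlnx_holder_aux[of x y] xlnx_holder_aux[of y x] assms by (cases "x \<le> y") auto

lemma abs_xlnx_le:
  fixes x :: real
  assumes "0 \<le> x" "x \<le> 1"
  shows "\<bar>x * ln x\<bar> \<le> 2"
proof -
  have "sqrt x \<le> 1" using assms by simp
  moreover have "\<bar>x * ln x\<bar> \<le> 2 * sqrt x" using xlnx_holder[of x 0] assms by simp
  ultimately show ?thesis by linarith
qed

lemma continuous_on_xlnx: "continuous_on {0..1::real} (\<lambda>x. x * ln x)"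
proof (subst continuous_on_def, intro ballI)
  fix x :: real assume x: "x \<in> {0..1}"
  have "((\<lambda>y. y * ln y - x * ln x) \<longlongrightarrow> 0) (at x within {0..1})"
  proof (rule Lim_null_comparison)
    show "\<forall>\<^sub>F y in at x within {0..1}. norm (y * ln y - x * ln x) \<le> 2 * sqrt \<bar>y - x\<bar>"
      using x by (auto simp: eventually_at_filter intro!: always_eventually xlnx_holder)
    have "((\<lambda>y. 2 * sqrt \<bar>y - x\<bar>) \<longlongrightarrow> 2 * sqrt \<bar>x - x\<bar>) (at x within {0..1})"
      by (intro tendsto_intros)
    then show "((\<lambda>y. 2 * sqrt \<bar>y - x\<bar>) \<longlongrightarrow> 0) (at x within {0..1})" by simp
  qed
  then show "((\<lambda>y. y * ln y) \<longlongrightarrow> x * ln x) (at x within {0..1})"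
    by (rule Lim_null[THEN iffD2])
qed

text \<open>Integration by parts: \<open>x ^ Suc j * (1 - x) ^ Suc k\<close> vanishes at both ends,
  so the integral of its derivative trades one power of \<open>1 - x\<close> for one power of
  \<open>x\<close>.\<close>

lemma beta_integral_nat:
  "((\<lambda>x::real. x ^ j * (1 - x) ^ k) has_integral fact j * fact k / fact (j + k + 1)) {0..1}"
proof (induction k arbitrary: j)
  case 0
  have "((\<lambda>x::real. x ^ j) has_integral (1 ^ Suc j / real (Suc j) - 0 ^ Suc j / real (Suc j))) {0..1}"
    by (intro fundamental_theorem_of_calculus)
       (auto intro!: derivative_eq_intros simp: has_real_derivative_iff_has_vector_derivative[symmetric] simp del: power_Suc of_nat_Suc)
  moreover have "fact j * fact 0 / fact (j + 0 + 1) = (1 / (1 + real j) :: real)"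
    by (simp add: divide_simps)
  ultimately show ?case by simp
next
  case (Suc k)
  have "((\<lambda>x::real. real (Suc j) * x ^ j * (1 - x) ^ Suc k - real (Suc k) * (x ^ Suc j * (1 - x) ^ k)) has_integral
     (1 ^ Suc j * (1 - 1) ^ Suc k - 0 ^ Suc j * (1 - 0) ^ Suc k)) {0..1}"
    by (intro fundamental_theorem_of_calculus)
       (auto intro!: derivative_eq_intros simp: has_real_derivative_iff_has_vector_derivative[symmetric] simp del: power_Suc of_nat_Suc)
  then have "((\<lambda>x::real. real (Suc j) * x ^ j * (1 - x) ^ Suc k - real (Suc k) * (x ^ Suc j * (1 - x) ^ k)) has_integral 0) {0..1}"
    by simp
  from has_integral_add[OF this has_integral_mult_right[OF Suc.IH[of "Suc j"], of "real (Suc k)"]]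
  have "((\<lambda>x::real. real (Suc j) * x ^ j * (1 - x) ^ Suc k) has_integral
     real (Suc k) * (fact (Suc j) * fact k / fact (Suc j + k + 1))) {0..1}" by simp
  from has_integral_mult_right[OF this, of "1 / real (Suc j)"]
  have *: "((\<lambda>x::real. 1 / real (Suc j) * (real (Suc j) * x ^ j * (1 - x) ^ Suc k)) has_integral
     1 / real (Suc j) * (real (Suc k) * (fact (Suc j) * fact k / fact (Suc j + k + 1)))) {0..1}" .
  have "1 / real (Suc j) * (real (Suc k) * (fact (Suc j) * fact k / fact (Suc j + k + 1)))
      = (fact j * fact (Suc k) / fact (j + Suc k + 1) :: real)"
    by (simp add: fact_Suc[of j] fact_Suc[of k] del: fact_Suc of_nat_Suc)
  moreover have "1 / real (Suc j) * (real (Suc j) * x ^ j * (1 - x) ^ Suc k) = x ^ j * (1 - x) ^ Suc k" for x :: real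
    by (simp del: power_Suc of_nat_Suc)
  ultimately show ?case using * by (simp only:)
qed

lemma has_integral_cancel:
  fixes g :: "real \<Rightarrow> real"
  shows "((\<lambda>x. c * g x) has_integral I) S \<Longrightarrow> c \<noteq> 0 \<Longrightarrow> (g has_integral 1 / c * I) S"
  using has_integral_mult_right[of "\<lambda>x. c * g x" I S "1 / c"] by simp

text \<open>The derivative of \<open>x\<^sup>2 * ln x * (1 - x) ^ Suc k\<close> integrates to 0 and
  links the cases \<open>k\<close> and \<open>Suc k\<close>; the plain beta integral that it
  produces supplies the next harmonic summand. These values give the mean entropy of the
  spacings.\<close>

lemma xlnx_beta_integral:
  "((\<lambda>x::real. x * ln x * (1 - x) ^ k) has_integral - (harm (k + 2) - 1) / (real (k + 1) * real (k + 2))) {0..1}"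
proof (induction k)
  case 0
  have "((\<lambda>x::real. x * ln x) has_integral ((1 * (1 * ln 1) / 2 - 1\<^sup>2 / 4) - (0 * (0 * ln 0) / 2 - 0\<^sup>2 / 4))) {0..1}"
  \<comment> \<open>Grouping the antiderivative around \<open>x * ln x\<close> keeps it continuous
    at 0, where it is not treated as differentiable.\<close>
  proof (rule fundamental_theorem_of_calculus_interior[where f="\<lambda>x::real. x * (x * ln x) / 2 - x\<^sup>2 / 4"])
    show "continuous_on {0..1::real} (\<lambda>x. x * (x * ln x) / 2 - x\<^sup>2 / 4)"
      by (intro continuous_intros continuous_on_xlnx) auto
    fix x :: real assume "x \<in> {0<..<1}"
    then have x: "x > 0" by simp
    have "((\<lambda>x. x * (x * ln x) / 2 - x\<^sup>2 / 4) has_real_derivative x * ln x) (at x)"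
      using x by (auto intro!: derivative_eq_intros simp: field_simps)
    then show "((\<lambda>x. x * (x * ln x) / 2 - x\<^sup>2 / 4) has_vector_derivative x * ln x) (at x)"
      by (simp add: has_real_derivative_iff_has_vector_derivative)
  qed simp
  moreover have "harm (0 + 2) = (3 / 2 :: real)" by (simp add: harm_def numeral_2_eq_2)
  ultimately show ?case by (simp only:) simp
next
  case (Suc k)
  let ?f = "\<lambda>x::real. 2 * (x * ln x * (1 - x) ^ Suc k) + x ^ 1 * (1 - x) ^ Suc k
        - real (Suc k) * (x * ln x * (1 - x) ^ k - x * ln x * (1 - x) ^ Suc k)"
  have "(?f has_integral (1 * (1 * ln 1) * (1 - 1) ^ Suc k - 0 * (0 * ln 0) * (1 - 0) ^ Suc k)) {0..1}"
  proof (rule fundamental_theorem_of_calculus_interior[where f="\<lambda>x::real. x * (x * ln x) * (1 - x) ^ Suc k"])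
    have "continuous_on {0..1::real} (\<lambda>x. x * (x * ln x))"
      by (rule continuous_on_mult[OF continuous_on_id continuous_on_xlnx])
    moreover have "continuous_on {0..1::real} (\<lambda>x. (1 - x) ^ Suc k)"
      by (intro continuous_intros)
    ultimately show "continuous_on {0..1::real} (\<lambda>x. x * (x * ln x) * (1 - x) ^ Suc k)"
      by (rule continuous_on_mult)
    fix x :: real assume "x \<in> {0<..<1}"
    then have x: "x > 0" by simp
    have "((\<lambda>x. x * (x * ln x)) has_real_derivative 2 * (x * ln x) + x) (at x)"
      using x by (auto intro!: derivative_eq_intros simp: field_simps)
    moreover have "((\<lambda>x. (1 - x) ^ Suc k) has_real_derivative - (real (Suc k) * (1 - x) ^ k)) (at x)"
      by (auto intro!: derivative_eq_intros simp del: power_Suc of_nat_Suc)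
    ultimately have "((\<lambda>x. x * (x * ln x) * (1 - x) ^ Suc k) has_real_derivative
        (2 * (x * ln x) + x) * (1 - x) ^ Suc k + - (real (Suc k) * (1 - x) ^ k) * (x * (x * ln x))) (at x)"
      by (rule DERIV_mult)
    also have "(2 * (x * ln x) + x) * (1 - x) ^ Suc k + - (real (Suc k) * (1 - x) ^ k) * (x * (x * ln x)) = ?f x"
    proof -
      have *: "x * ln x * (1 - x) ^ k - x * ln x * (1 - x) ^ Suc k = (1 - x) ^ k * (x * (x * ln x))"
        by (simp add: algebra_simps)
      have gen: "(2 * L + y) * s + - (m * p) * w = 2 * (L * s) + y ^ 1 * s - m * z"
        if "z = p * w" for L y s m p w z :: real
        using that by (simp add: algebra_simps)
      show ?thesis
        by (rule gen[where L="x * ln x" and y=x and s="(1 - x) ^ Suc k" and m="real (Suc k)", OF *])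
    qed
    finally show "((\<lambda>x. x * (x * ln x) * (1 - x) ^ Suc k) has_vector_derivative ?f x) (at x)"
      by (simp add: has_real_derivative_iff_has_vector_derivative)
  qed simp
  then have F: "(?f has_integral 0) {0..1}" by simp
  let ?A = "- (harm (k + 2) - 1) / (real (k + 1) * real (k + 2)) :: real"
  let ?I = "fact 1 * fact (Suc k) / fact (1 + Suc k + 1) :: real"
  have "((\<lambda>x. ?f x - x ^ 1 * (1 - x) ^ Suc k + real (Suc k) * (x * ln x * (1 - x) ^ k)) has_integral
      (0 - ?I + real (Suc k) * ?A)) {0..1}"
    by (intro has_integral_add has_integral_diff has_integral_mult_right F Suc.IH beta_integral_nat)
  also have "(\<lambda>x. ?f x - x ^ 1 * (1 - x) ^ Suc k + real (Suc k) * (x * ln x * (1 - x) ^ k))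
    = (\<lambda>x. real (k + 3) * (x * ln x * (1 - x) ^ Suc k))"
  proof
    fix x :: real
    have *: "2 * a + d - m * (b - a) - d + m * b = (m + 2) * a" for a b d m :: real by (simp add: algebra_simps)
    have **: "real (k + 3) = real (Suc k) + 2" by simp
    show "?f x - x ^ 1 * (1 - x) ^ Suc k + real (Suc k) * (x * ln x * (1 - x) ^ k)
       = real (k + 3) * (x * ln x * (1 - x) ^ Suc k)" unfolding ** by (rule *)
  qed
  finally have "((\<lambda>x. real (k + 3) * (x * ln x * (1 - x) ^ Suc k)) has_integral
      (0 - ?I + real (Suc k) * ?A)) {0..1}" .
  then have "((\<lambda>x. (x * ln x * (1 - x) ^ Suc k)) has_integral
      1 / real (k + 3) * (0 - ?I + real (Suc k) * ?A)) {0..1}"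
    by (rule has_integral_cancel) simp
  also have "1 / real (k + 3) * (0 - ?I + real (Suc k) * ?A) =
     - (harm (Suc k + 2) - 1) / (real (Suc k + 1) * real (Suc k + 2))"
  proof -
    have "(fact (Suc (Suc (Suc k))) :: real) = real (Suc (Suc (Suc k))) * (real (Suc (Suc k)) * fact (Suc k))"
      by (simp only: fact_Suc)
    then have I: "?I = 1 / ((real k + 2) * (real k + 3))"
      by (simp del: fact_Suc) (simp add: field_simps)
    have h: "harm (Suc k + 2) = (harm (k + 2) :: real) + 1 / (real k + 3)"
      by (simp add: harm_Suc inverse_eq_divide add.commute)
    have *: "1 / (y + 3) * (0 - 1 / ((y + 2) * (y + 3)) + (y + 1) * (- (H - 1) / ((y + 1) * (y + 2)))) =
       - (H + 1 / (y + 3) - 1) / ((y + 2) * (y + 3))" if "y \<ge> 0" for y H :: real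
      using that by (simp add: divide_simps) (simp add: algebra_simps)
    have r: "real (k + 3) = real k + 3" "real (Suc k) = real k + 1" "real (k + 1) = real k + 1"
      "real (k + 2) = real k + 2" "real (Suc k + 1) = real k + 2" "real (Suc k + 2) = real k + 3" by simp_all
    show ?thesis unfolding I h r by (rule *) simp
  qed
  finally show ?case .
qed

section \<open>Taylor bounds for characters\<close>

lemma iexp_diff_bound: "cmod (iexp x - iexp y) \<le> \<bar>x - y\<bar>"
proof -
  have "iexp x - iexp y = iexp y * (iexp (x - y) - 1)" by (simp add: algebra_simps exp_add[symmetric])
  then have "cmod (iexp x - iexp y) = cmod (iexp (x - y) - 1)" by (simp add: norm_mult)
  then show ?thesis using iexp_approx1[of "x - y" 0] by simp
qed

text \<open>For \<open>x\<close> and \<open>y\<close> proportional to \<open>t\<close> the bound is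
  of order \<open>t\<^sup>2\<close> and at the same time proportional to the difference
  \<open>x - y\<close>. Both features are needed to compare tolls in a metric with weight
  \<open>1 / t\<^sup>2\<close>.\<close>

lemma iexp_diff_linear_bound:
  "cmod (iexp x - iexp y - \<i> * complex_of_real (x - y)) \<le> \<bar>x - y\<bar> * (\<bar>x - y\<bar> / 2 + \<bar>y\<bar>)"
proof -
  define d where "d = x - y"
  have x: "x = y + d" by (simp add: d_def)
  have "iexp x - iexp y - \<i> * complex_of_real d = iexp y * (iexp d - (1 + \<i> * d)) + \<i> * d * (iexp y - 1)"
    unfolding x by (simp add: algebra_simps exp_add[symmetric])
  also have "cmod \<dots> \<le> cmod (iexp y * (iexp d - (1 + \<i> * d))) + cmod (\<i> * d * (iexp y - 1))"
    by (rule norm_triangle_ineq)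
  also have "cmod (iexp y * (iexp d - (1 + \<i> * d))) = cmod (iexp d - (1 + \<i> * d))"
    by (simp add: norm_mult)
  also have "\<dots> \<le> \<bar>d\<bar> * \<bar>d\<bar> / 2"
    using iexp_approx1[of d 1] by (simp add: numeral_2_eq_2)
  also have "cmod (\<i> * d * (iexp y - 1)) \<le> \<bar>d\<bar> * \<bar>y\<bar>"
    using iexp_diff_bound[of y 0] by (simp add: norm_mult mult_left_mono)
  finally show ?thesis by (simp add: d_def algebra_simps)
qed

section \<open>Weak convergence and characteristic functions\<close>

text \<open>Uniform integrability: truncating \<open>f\<close> at level \<open>R\<close> changes the
  integral by at most \<open>B / R\<close>, uniformly in \<open>n\<close>, and weak convergence
  handles the bounded continuous truncation. The second-moment bound passes to \<open>M\<close> by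
  monotone convergence along truncated squares.\<close>

lemma weak_conv_imp_integral_conv:
  fixes f :: "real \<Rightarrow> real"
  assumes \<mu>: "\<And>n. real_distribution (\<mu> n)" and M: "real_distribution M" and conv: "weak_conv_m \<mu> M"
    and cont: "\<And>x. isCont f x"
    and int: "\<And>n. integrable (\<mu> n) (\<lambda>x. (f x)\<^sup>2)" and B: "\<And>n. (\<integral>x. (f x)\<^sup>2 \<partial>\<mu> n) \<le> B"
  shows "integrable M f" "(\<lambda>n. \<integral>x. f x \<partial>\<mu> n) \<longlonglongrightarrow> (\<integral>x. f x \<partial>M)"
proof -
  interpret \<mu>: real_distribution "\<mu> n" for n by fact
  interpret M: real_distribution M by fact
  have [measurable]: "f \<in> borel_measurable borel"
    using cont by (intro borel_measurable_continuous_onI continuous_at_imp_continuous_on) auto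
  have B0: "B \<ge> 0" using B[of 0] by (smt (verit) integral_nonneg_AE AE_I2 zero_le_power2)
  define h where "h R x = min ((f x)\<^sup>2) R" for R x
  have ih: "integrable N (h R)" if R: "R \<ge> 0" and N: "real_distribution N" for R N
  proof -
    interpret N: real_distribution N by fact
    show ?thesis unfolding h_def by (rule N.integrable_const_bound[where B=R]) (use R in auto)
  qed
  have h: "integrable M (h R)" "(\<integral>x. h R x \<partial>M) \<le> B" if R: "R \<ge> 0" for R
  proof -
    show "integrable M (h R)" by (rule ih[OF R M])
    have "(\<lambda>n. \<integral>x. h R x \<partial>\<mu> n) \<longlonglongrightarrow> (\<integral>x. h R x \<partial>M)"
    proof (rule weak_conv_imp_integral_bdd_continuous_conv[OF \<mu> M conv])
      show "isCont (h R) x" for x unfolding h_def using cont by (intro continuous_intros) auto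
      show "norm (h R x) \<le> R" for x using R by (auto simp: h_def)
    qed
    moreover have "(\<integral>x. h R x \<partial>\<mu> n) \<le> B" for n
    proof -
      have "(\<integral>x. h R x \<partial>\<mu> n) \<le> (\<integral>x. (f x)\<^sup>2 \<partial>\<mu> n)"
        by (intro integral_mono ih R \<mu> int) (simp add: h_def)
      then show ?thesis using B[of n] by simp
    qed
    ultimately show "(\<integral>x. h R x \<partial>M) \<le> B" by (intro LIMSEQ_le_const2) auto
  qed
  have int2: "integrable M (\<lambda>x. (f x)\<^sup>2)" and IM: "(\<integral>x. (f x)\<^sup>2 \<partial>M) \<le> B"
  proof -
    have ev: "\<forall>\<^sub>F k in sequentially. h (real k) x = (f x)\<^sup>2" for x
      using eventually_ge_at_top[of "nat \<lceil>(f x)\<^sup>2\<rceil>"] by eventually_elim (auto simp: h_def min_def nat_le_iff ceiling_le_iff)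
    have lim: "(\<lambda>k. h (real k) x) \<longlonglongrightarrow> (f x)\<^sup>2" for x
      using ev[of x] by (rule tendsto_eventually)
    have inc: "incseq (\<lambda>k. \<integral>x. h (real k) x \<partial>M)"
      by (intro incseq_SucI integral_mono h) (auto simp: h_def)
    have bd: "Bseq (\<lambda>k. \<integral>x. h (real k) x \<partial>M)"
    proof (rule BseqI'[where K=B])
      fix k have "0 \<le> (\<integral>x. h (real k) x \<partial>M)" by (intro Bochner_Integration.integral_nonneg) (auto simp: h_def)
      then show "norm (\<integral>x. h (real k) x \<partial>M) \<le> B" using h(2)[of "real k"] by simp
    qed
    obtain l where l: "(\<lambda>k. \<integral>x. h (real k) x \<partial>M) \<longlonglongrightarrow> l"
      using Bseq_monoseq_convergent[OF bd incseq_imp_monoseq[OF inc]] by (auto simp: convergent_def)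
    have *: "has_bochner_integral M (\<lambda>x. (f x)\<^sup>2) l"
    proof (rule has_bochner_integral_monotone_convergence)
      show "AE x in M. mono (\<lambda>k. h (real k) x)" by (auto simp: mono_def h_def)
    qed (use h l lim in auto)
    show "integrable M (\<lambda>x. (f x)\<^sup>2)" using * by (rule integrable.intros)
    have "l \<le> B" using l h(2) by (intro LIMSEQ_le_const2[OF l]) auto
    then show "(\<integral>x. (f x)\<^sup>2 \<partial>M) \<le> B" using has_bochner_integral_integral_eq[OF *] by simp
  qed
  have intf: "integrable N f" if "real_distribution N" "integrable N (\<lambda>x. (f x)\<^sup>2)" for N
  proof -
    interpret N: real_distribution N by fact
    show ?thesis by (rule N.square_integrable_imp_integrable) (use that in auto)
  qed
  show "integrable M f" by (rule intf[OF M int2])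
  define g where "g R x = max (- R) (min R (f x))" for R x
  have fg: "\<bar>f x - g R x\<bar> \<le> (f x)\<^sup>2 / R" if "R > 0" for R x
  proof (cases "\<bar>f x\<bar> \<le> R")
    case True then show ?thesis using that by (auto simp: g_def)
  next
    case False
    then have "\<bar>f x - g R x\<bar> \<le> \<bar>f x\<bar>" using that by (auto simp: g_def)
    also have "\<dots> \<le> \<bar>f x\<bar> * (\<bar>f x\<bar> / R)"
    proof -
      have "1 \<le> \<bar>f x\<bar> / R" using False that by simp
      then have "\<bar>f x\<bar> * 1 \<le> \<bar>f x\<bar> * (\<bar>f x\<bar> / R)" by (intro mult_left_mono) auto
      then show ?thesis by simp
    qed
    finally show ?thesis by (simp add: power2_eq_square)
  qed
  have close: "\<bar>(\<integral>x. f x \<partial>N) - (\<integral>x. g R x \<partial>N)\<bar> \<le> B / R"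
    if "real_distribution N" "integrable N (\<lambda>x. (f x)\<^sup>2)" "(\<integral>x. (f x)\<^sup>2 \<partial>N) \<le> B" "R > 0" for N R
  proof -
    interpret N: real_distribution N by fact
    have ig: "integrable N (g R)" unfolding g_def
      by (rule N.integrable_const_bound[where B=R]) (use \<open>R > 0\<close> in auto)
    have "\<bar>(\<integral>x. f x \<partial>N) - (\<integral>x. g R x \<partial>N)\<bar> = \<bar>\<integral>x. f x - g R x \<partial>N\<bar>"
      using ig intf[OF that(1,2)] by simp
    also have "\<dots> \<le> (\<integral>x. \<bar>f x - g R x\<bar> \<partial>N)" by (rule integral_abs_bound)
    also have "\<dots> \<le> (\<integral>x. (f x)\<^sup>2 / R \<partial>N)"
      using ig intf[OF that(1,2)] that fg by (intro integral_mono) auto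
    also have "\<dots> \<le> B / R" using that by (simp add: divide_right_mono)
    finally show ?thesis .
  qed
  show "(\<lambda>n. \<integral>x. f x \<partial>\<mu> n) \<longlonglongrightarrow> (\<integral>x. f x \<partial>M)"
  proof (rule LIMSEQ_I)
    fix e :: real assume e: "0 < e"
    define R where "R = 4 * (B + 1) / e"
    have R: "R > 0" "B / R < e / 3" using e B0 mult_nonneg_nonneg[OF B0 less_imp_le[OF e]]
      by (auto simp: R_def field_simps intro!: add_nonneg_pos)
    have "(\<lambda>n. \<integral>x. g R x \<partial>\<mu> n) \<longlonglongrightarrow> (\<integral>x. g R x \<partial>M)"
    proof (rule weak_conv_imp_integral_bdd_continuous_conv[OF \<mu> M conv])
      show "isCont (g R) x" for x unfolding g_def using cont by (intro continuous_intros) auto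
      show "norm (g R x) \<le> R" for x using R by (auto simp: g_def)
    qed
    from LIMSEQ_D[OF this, of "e / 3"] e obtain no where
      no: "\<And>n. n \<ge> no \<Longrightarrow> \<bar>(\<integral>x. g R x \<partial>\<mu> n) - (\<integral>x. g R x \<partial>M)\<bar> < e / 3" by auto
    have "\<bar>(\<integral>x. f x \<partial>\<mu> n) - (\<integral>x. f x \<partial>M)\<bar> < e" if "n \<ge> no" for n
      using no[OF that] close[OF \<mu>[of n] int B R(1)] close[OF M int2 IM R(1)] R(2) by linarith
    then show "\<exists>no. \<forall>n\<ge>no. norm ((\<integral>x. f x \<partial>\<mu> n) - (\<integral>x. f x \<partial>M)) < e" by auto
  qed
qed

text \<open>The regularity shared by the characteristic functions of all centered laws whose second
  moment is bounded in terms of \<open>C\<close>.\<close>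

definition cf_regular :: "real \<Rightarrow> (real \<Rightarrow> complex) \<Rightarrow> bool" where
  "cf_regular C \<psi> \<longleftrightarrow> (\<forall>s. cmod (\<psi> s) \<le> 1) \<and> (\<forall>s. cmod (\<psi> s - 1) \<le> C * \<bar>s\<bar>) \<and>
     (\<forall>s s'. cmod (\<psi> s - \<psi> s') \<le> C * \<bar>s - s'\<bar> * (\<bar>s\<bar> + \<bar>s'\<bar>))"

text \<open>Centering allows the linear term to be subtracted under the integral, which leaves a
  bound by the second moment. The bound linear in \<open>s\<close> uses
  \<open>\<bar>x\<bar> \<le> 1 + x\<^sup>2\<close>.\<close>

lemma cf_regular_char:
  assumes M: "real_distribution M" and sq: "integrable M (\<lambda>x. x\<^sup>2)" and mean: "(\<integral>x. x \<partial>M) = 0"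
    and C: "2 * (1 + (\<integral>x. x\<^sup>2 \<partial>M)) \<le> C"
  shows "cf_regular C (char M)"
proof -
  interpret real_distribution M by fact
  have int1: "integrable M (\<lambda>x. x)" by (rule square_integrable_imp_integrable) (use sq in auto)
  have sq0: "(\<integral>x. x\<^sup>2 \<partial>M) \<ge> 0" by simp
  have it: "integrable M (\<lambda>x. iexp (s * x))" for s by (rule integrable_iexp) auto
  have 2: "cmod (char M s - char M s') \<le> C * \<bar>s - s'\<bar> * (\<bar>s\<bar> + \<bar>s'\<bar>)" for s s'
  proof -
    let ?d = "\<lambda>x. iexp (s * x) - iexp (s' * x) - \<i> * complex_of_real (s * x - s' * x)"
    have "(\<integral>x. \<i> * complex_of_real (s * x - s' * x) \<partial>M) = \<i> * complex_of_real (\<integral>x. s * x - s' * x \<partial>M)"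
      by (simp only: integral_mult_right_zero integral_complex_of_real)
    also have "(\<integral>x. s * x - s' * x \<partial>M) = 0" using int1 mean by simp
    finally have "char M s - char M s' = (\<integral>x. ?d x \<partial>M)"
      using it int1 by (simp add: char_def)
    also have "cmod \<dots> \<le> (\<integral>x. cmod (?d x) \<partial>M)" by (rule integral_norm_bound)
    also have "\<dots> \<le> (\<integral>x. \<bar>s - s'\<bar> * (2 * (\<bar>s\<bar> + \<bar>s'\<bar>)) * x\<^sup>2 \<partial>M)"
    proof (rule integral_mono)
      show "integrable M (\<lambda>x. cmod (?d x))" using it int1 by auto
      show "integrable M (\<lambda>x. \<bar>s - s'\<bar> * (2 * (\<bar>s\<bar> + \<bar>s'\<bar>)) * x\<^sup>2)" using sq by simp
      fix x
      have "cmod (?d x) \<le> \<bar>s * x - s' * x\<bar> * (\<bar>s * x - s' * x\<bar> / 2 + \<bar>s' * x\<bar>)"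
        by (rule iexp_diff_linear_bound)
      also have e: "s * x - s' * x = (s - s') * x" by (simp add: algebra_simps)
      also have "\<bar>(s - s') * x\<bar> * (\<bar>(s - s') * x\<bar> / 2 + \<bar>s' * x\<bar>) = \<bar>s - s'\<bar> * (\<bar>s - s'\<bar> / 2 + \<bar>s'\<bar>) * x\<^sup>2"
      proof -
        have "x\<^sup>2 = \<bar>x\<bar> * \<bar>x\<bar>" by (simp add: power2_eq_square)
        moreover have "(a * y) * ((a * y) / 2 + b * y) = a * (a / 2 + b) * (y * y)" for a b y :: real
          by (simp add: algebra_simps)
        ultimately show ?thesis by (simp only: abs_mult)
      qed
      also have "\<dots> \<le> \<bar>s - s'\<bar> * (2 * (\<bar>s\<bar> + \<bar>s'\<bar>)) * x\<^sup>2"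
        by (intro mult_right_mono mult_left_mono) auto
      finally show "cmod (?d x) \<le> \<bar>s - s'\<bar> * (2 * (\<bar>s\<bar> + \<bar>s'\<bar>)) * x\<^sup>2" unfolding e .
    qed
    also have "\<dots> = (\<bar>s - s'\<bar> * (\<bar>s\<bar> + \<bar>s'\<bar>)) * (2 * (\<integral>x. x\<^sup>2 \<partial>M))" by simp
    also have "\<dots> \<le> (\<bar>s - s'\<bar> * (\<bar>s\<bar> + \<bar>s'\<bar>)) * C" using C by (intro mult_left_mono) auto
    finally show ?thesis by (simp add: mult_ac)
  qed
  have 1: "cmod (char M s - 1) \<le> C * \<bar>s\<bar>" for s
  proof -
    have "char M s - 1 = (\<integral>x. iexp (s * x) - iexp 0 \<partial>M)"
      using it by (simp add: char_def prob_space[unfolded space_eq_univ])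
    also have "cmod \<dots> \<le> (\<integral>x. cmod (iexp (s * x) - iexp 0) \<partial>M)" by (rule integral_norm_bound)
    also have "\<dots> \<le> (\<integral>x. \<bar>s\<bar> * (1 + x\<^sup>2) \<partial>M)"
    proof (rule integral_mono)
      show "integrable M (\<lambda>x. cmod (iexp (s * x) - iexp 0))" using it by auto
      show "integrable M (\<lambda>x. \<bar>s\<bar> * (1 + x\<^sup>2))" using sq by simp
      fix x :: real
      have "\<bar>x\<bar> \<le> 1 + x\<^sup>2" using zero_le_power2[of "\<bar>x\<bar> - 1"] zero_le_power2[of x]
        by (simp add: power2_eq_square algebra_simps abs_mult_self_eq)
      then have "\<bar>s\<bar> * \<bar>x\<bar> \<le> \<bar>s\<bar> * (1 + x\<^sup>2)" by (intro mult_left_mono) auto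
      then show "cmod (iexp (s * x) - iexp 0) \<le> \<bar>s\<bar> * (1 + x\<^sup>2)"
        using iexp_diff_bound[of "s * x" 0] by (simp add: abs_mult)
    qed
    also have "\<dots> = \<bar>s\<bar> * (1 + (\<integral>x. x\<^sup>2 \<partial>M))" using sq by (simp add: prob_space[unfolded space_eq_univ])
    also have "\<dots> \<le> \<bar>s\<bar> * C"
    proof -
      have "1 + m \<le> C" if "2 * (1 + m) \<le> C" "0 \<le> m" for m using that by simp
      from this[OF C sq0] show ?thesis by (intro mult_left_mono) auto
    qed
    finally show ?thesis by (simp add: mult_ac)
  qed
  show ?thesis unfolding cf_regular_def using 1 2 cmod_char_le_1 by blast
qed

lemma cf_regular_prod:
  assumes "finite I" "\<And>i. i \<in> I \<Longrightarrow> cf_regular C (\<psi> i)"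
  shows "cmod (\<Prod>i\<in>I. \<psi> i (s i)) \<le> 1" "cmod ((\<Prod>i\<in>I. \<psi> i (s i)) - 1) \<le> C * (\<Sum>i\<in>I. \<bar>s i\<bar>)"
proof -
  have n: "cmod (\<psi> i (s i)) \<le> 1" if "i \<in> I" for i using assms(2)[OF that] by (auto simp: cf_regular_def)
  show "cmod (\<Prod>i\<in>I. \<psi> i (s i)) \<le> 1" unfolding prod_norm[symmetric] using n by (intro prod_le_1) auto
  have "cmod ((\<Prod>i\<in>I. \<psi> i (s i)) - (\<Prod>i\<in>I. 1)) \<le> (\<Sum>i\<in>I. cmod (\<psi> i (s i) - 1))"
    using n by (intro norm_prod_diff) auto
  also have "\<dots> \<le> (\<Sum>i\<in>I. C * \<bar>s i\<bar>)"
    using assms(2) by (intro sum_mono) (auto simp: cf_regular_def)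
  finally show "cmod ((\<Prod>i\<in>I. \<psi> i (s i)) - 1) \<le> C * (\<Sum>i\<in>I. \<bar>s i\<bar>)" by (simp add: sum_distrib_left)
qed

text \<open>The first-order terms of the two sides cancel in expectation, which leaves an error
  quadratic in \<open>t\<close>.\<close>

lemma (in prob_space) cf_recursion_diff:
  fixes b b' :: "'a \<Rightarrow> real" and A A' :: "'a \<Rightarrow> 'i \<Rightarrow> real" and \<psi> \<psi>' :: "'a \<Rightarrow> 'i \<Rightarrow> real \<Rightarrow> complex"
  assumes I: "finite I" and C: "C \<ge> 0"
    and [measurable]: "b \<in> borel_measurable M" "b' \<in> borel_measurable M"
      "\<And>i. i \<in> I \<Longrightarrow> (\<lambda>\<omega>. \<psi> \<omega> i (t * A \<omega> i)) \<in> borel_measurable M"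
      "\<And>i. i \<in> I \<Longrightarrow> (\<lambda>\<omega>. \<psi>' \<omega> i (t * A' \<omega> i)) \<in> borel_measurable M"
    and b: "AE \<omega> in M. \<bar>b \<omega>\<bar> \<le> \<beta> \<and> \<bar>b' \<omega>\<bar> \<le> \<beta>" and mean: "expectation b = expectation b'"
    and A: "AE \<omega> in M. (\<forall>i\<in>I. 0 \<le> A \<omega> i \<and> A \<omega> i \<le> 1 \<and> 0 \<le> A' \<omega> i \<and> A' \<omega> i \<le> 1) \<and> (\<Sum>i\<in>I. A' \<omega> i) \<le> 1"
    and \<psi>: "AE \<omega> in M. \<forall>i\<in>I. cf_regular C (\<psi> \<omega> i) \<and> cf_regular C (\<psi>' \<omega> i)"
    and \<delta>: "AE \<omega> in M. \<forall>i\<in>I. \<forall>s. cmod (\<psi> \<omega> i s - \<psi>' \<omega> i s) \<le> \<delta> \<omega> i * s\<^sup>2"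
    and int: "integrable M (\<lambda>\<omega>. \<Sum>i\<in>I. \<delta> \<omega> i * (A \<omega> i)\<^sup>2)"
      "integrable M (\<lambda>\<omega>. \<Sum>i\<in>I. \<bar>A \<omega> i - A' \<omega> i\<bar>)"
  shows "cmod (expectation (\<lambda>\<omega>. iexp (t * b \<omega>) * (\<Prod>i\<in>I. \<psi> \<omega> i (t * A \<omega> i)))
       - expectation (\<lambda>\<omega>. iexp (t * b' \<omega>) * (\<Prod>i\<in>I. \<psi>' \<omega> i (t * A' \<omega> i))))
     \<le> t\<^sup>2 * (expectation (\<lambda>\<omega>. \<Sum>i\<in>I. \<delta> \<omega> i * (A \<omega> i)\<^sup>2)
          + 2 * C * expectation (\<lambda>\<omega>. \<Sum>i\<in>I. \<bar>A \<omega> i - A' \<omega> i\<bar>)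
          + (C + 2 * \<beta>) * expectation (\<lambda>\<omega>. \<bar>b \<omega> - b' \<omega>\<bar>))"
proof -
  define G where "G \<omega> = (\<Prod>i\<in>I. \<psi> \<omega> i (t * A \<omega> i))" for \<omega>
  define G' where "G' \<omega> = (\<Prod>i\<in>I. \<psi>' \<omega> i (t * A' \<omega> i))" for \<omega>
  define F where "F \<omega> = iexp (t * b \<omega>)" for \<omega>
  define F' where "F' \<omega> = iexp (t * b' \<omega>)" for \<omega>
  \<comment> \<open>The subtracted linear term has integral 0 because \<open>b\<close> and
    \<open>b'\<close> have the same mean. Without it the difference of the tolls would contribute
    only to first order in \<open>t\<close>.\<close>
  define X where "X \<omega> = F \<omega> * G \<omega> - F' \<omega> * G' \<omega> - \<i> * complex_of_real (t * b \<omega> - t * b' \<omega>)" for \<omega>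
  define S1 where "S1 \<omega> = (\<Sum>i\<in>I. \<delta> \<omega> i * (A \<omega> i)\<^sup>2)" for \<omega>
  define S2 where "S2 \<omega> = (\<Sum>i\<in>I. \<bar>A \<omega> i - A' \<omega> i\<bar>)" for \<omega>
  have [measurable]: "G \<in> borel_measurable M" "G' \<in> borel_measurable M" "F \<in> borel_measurable M" "F' \<in> borel_measurable M"
    unfolding G_def G'_def F_def F'_def using I by measurable
  have t2: "t\<^sup>2 = \<bar>t\<bar> * \<bar>t\<bar>" by (simp add: power2_eq_square)
  have nF: "cmod (F \<omega>) = 1" "cmod (F' \<omega>) = 1" for \<omega> by (simp_all add: F_def F'_def)
  have ib: "integrable M b" "integrable M b'"
    using b by (auto intro!: integrable_const_bound[where B=\<beta>])
  have nG: "AE \<omega> in M. cmod (G \<omega>) \<le> 1 \<and> cmod (G' \<omega>) \<le> 1"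
    using \<psi> by eventually_elim (auto simp: G_def G'_def intro!: cf_regular_prod(1) I)
  have iFG: "integrable M (\<lambda>\<omega>. F \<omega> * G \<omega>)" "integrable M (\<lambda>\<omega>. F' \<omega> * G' \<omega>)"
    using nG by (auto intro!: integrable_const_bound[where B=1] simp: norm_mult nF)
  have ptw: "AE \<omega> in M. cmod (X \<omega>) \<le> t\<^sup>2 * (S1 \<omega> + 2 * C * S2 \<omega> + (C + 2 * \<beta>) * \<bar>b \<omega> - b' \<omega>\<bar>)"
    using b A \<psi> \<delta>
  proof eventually_elim
    case (elim \<omega>)
    have reg: "\<And>i. i \<in> I \<Longrightarrow> cf_regular C (\<psi> \<omega> i)" "\<And>i. i \<in> I \<Longrightarrow> cf_regular C (\<psi>' \<omega> i)" using elim by auto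
    \<comment> \<open>The first summand compares the children. The second is quadratic in
      \<open>t\<close> because \<open>G' - 1\<close> supplies another factor \<open>t\<close>. The
      third is a Taylor remainder.\<close>
    have X: "X \<omega> = F \<omega> * (G \<omega> - G' \<omega>) + (F \<omega> - F' \<omega>) * (G' \<omega> - 1)
         + (F \<omega> - F' \<omega> - \<i> * complex_of_real (t * b \<omega> - t * b' \<omega>))"
      by (simp add: X_def algebra_simps)
    have "cmod (G \<omega> - G' \<omega>) \<le> (\<Sum>i\<in>I. cmod (\<psi> \<omega> i (t * A \<omega> i) - \<psi>' \<omega> i (t * A' \<omega> i)))"
      unfolding G_def G'_def using reg by (intro norm_prod_diff) (auto simp: cf_regular_def)
    also have "\<dots> \<le> (\<Sum>i\<in>I. t\<^sup>2 * (\<delta> \<omega> i * (A \<omega> i)\<^sup>2) + t\<^sup>2 * (2 * C * \<bar>A \<omega> i - A' \<omega> i\<bar>))"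
    proof (rule sum_mono)
      fix i assume i: "i \<in> I"
      \<comment> \<open>The functions are compared at the common argument \<open>t * A\<close>
        first, so that \<open>\<delta>\<close> enters with the factor \<open>A\<^sup>2\<close>; this
        factor is the source of the contraction.\<close>
      have "\<psi> \<omega> i (t * A \<omega> i) - \<psi>' \<omega> i (t * A' \<omega> i) =
        (\<psi> \<omega> i (t * A \<omega> i) - \<psi>' \<omega> i (t * A \<omega> i)) + (\<psi>' \<omega> i (t * A \<omega> i) - \<psi>' \<omega> i (t * A' \<omega> i))" by simp
      also have "cmod \<dots> \<le> cmod (\<psi> \<omega> i (t * A \<omega> i) - \<psi>' \<omega> i (t * A \<omega> i)) + cmod (\<psi>' \<omega> i (t * A \<omega> i) - \<psi>' \<omega> i (t * A' \<omega> i))"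
        by (rule norm_triangle_ineq)
      also have "cmod (\<psi> \<omega> i (t * A \<omega> i) - \<psi>' \<omega> i (t * A \<omega> i)) \<le> \<delta> \<omega> i * (t * A \<omega> i)\<^sup>2"
        using elim i by blast
      also have "cmod (\<psi>' \<omega> i (t * A \<omega> i) - \<psi>' \<omega> i (t * A' \<omega> i)) \<le>
          C * \<bar>t * A \<omega> i - t * A' \<omega> i\<bar> * (\<bar>t * A \<omega> i\<bar> + \<bar>t * A' \<omega> i\<bar>)"
        using reg(2)[OF i] unfolding cf_regular_def by blast
      also have "t * A \<omega> i - t * A' \<omega> i = t * (A \<omega> i - A' \<omega> i)" by (simp add: algebra_simps)
      also have "C * \<bar>t * (A \<omega> i - A' \<omega> i)\<bar> * (\<bar>t * A \<omega> i\<bar> + \<bar>t * A' \<omega> i\<bar>)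
          = C * \<bar>t\<bar> * \<bar>A \<omega> i - A' \<omega> i\<bar> * (\<bar>t\<bar> * (A \<omega> i + A' \<omega> i))"
        using elim i by (simp add: abs_mult distrib_left mult_ac)
      also have "\<dots> \<le> C * \<bar>t\<bar> * \<bar>A \<omega> i - A' \<omega> i\<bar> * (\<bar>t\<bar> * 2)"
      proof -
        have "A \<omega> i \<le> 1" "A' \<omega> i \<le> 1" using elim i by auto
        then show ?thesis using C by (intro mult_left_mono mult_nonneg_nonneg) auto
      qed
      also have "\<dots> = t\<^sup>2 * (2 * C * \<bar>A \<omega> i - A' \<omega> i\<bar>)"
        by (simp only: t2 mult_ac)
      finally show "cmod (\<psi> \<omega> i (t * A \<omega> i) - \<psi>' \<omega> i (t * A' \<omega> i))
          \<le> t\<^sup>2 * (\<delta> \<omega> i * (A \<omega> i)\<^sup>2) + t\<^sup>2 * (2 * C * \<bar>A \<omega> i - A' \<omega> i\<bar>)"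
        by (simp add: power_mult_distrib mult_ac)
    qed
    also have "\<dots> = t\<^sup>2 * (S1 \<omega> + 2 * C * S2 \<omega>)"
      by (simp add: S1_def S2_def sum.distrib sum_distrib_left distrib_left)
    finally have 1: "cmod (F \<omega> * (G \<omega> - G' \<omega>)) \<le> t\<^sup>2 * (S1 \<omega> + 2 * C * S2 \<omega>)"
      by (simp add: norm_mult nF)
    have "cmod (G' \<omega> - 1) \<le> C * (\<Sum>i\<in>I. \<bar>t * A' \<omega> i\<bar>)"
      unfolding G'_def using reg by (intro cf_regular_prod I)
    also have "(\<Sum>i\<in>I. \<bar>t * A' \<omega> i\<bar>) = \<bar>t\<bar> * (\<Sum>i\<in>I. A' \<omega> i)"
      unfolding sum_distrib_left using elim by (intro sum.cong) (auto simp: abs_mult)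
    also have "C * (\<bar>t\<bar> * (\<Sum>i\<in>I. A' \<omega> i)) \<le> C * (\<bar>t\<bar> * 1)" using elim C by (intro mult_left_mono) auto
    finally have G1: "cmod (G' \<omega> - 1) \<le> C * \<bar>t\<bar>" by simp
    have "cmod (F \<omega> - F' \<omega>) \<le> \<bar>t\<bar> * \<bar>b \<omega> - b' \<omega>\<bar>"
      using iexp_diff_bound[of "t * b \<omega>" "t * b' \<omega>"] by (simp add: F_def F'_def abs_mult flip: right_diff_distrib)
    then have "cmod ((F \<omega> - F' \<omega>) * (G' \<omega> - 1)) \<le> (\<bar>t\<bar> * \<bar>b \<omega> - b' \<omega>\<bar>) * (C * \<bar>t\<bar>)"
      unfolding norm_mult using G1 by (intro mult_mono) auto
    also have "\<dots> = t\<^sup>2 * (C * \<bar>b \<omega> - b' \<omega>\<bar>)"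
      by (simp only: t2 mult_ac)
    finally have 2: "cmod ((F \<omega> - F' \<omega>) * (G' \<omega> - 1)) \<le> t\<^sup>2 * (C * \<bar>b \<omega> - b' \<omega>\<bar>)" .
    have "cmod (F \<omega> - F' \<omega> - \<i> * complex_of_real (t * b \<omega> - t * b' \<omega>))
       \<le> \<bar>t * b \<omega> - t * b' \<omega>\<bar> * (\<bar>t * b \<omega> - t * b' \<omega>\<bar> / 2 + \<bar>t * b' \<omega>\<bar>)"
      unfolding F_def F'_def by (rule iexp_diff_linear_bound)
    also have "\<dots> = (\<bar>t\<bar> * \<bar>b \<omega> - b' \<omega>\<bar>) * (\<bar>t\<bar> * (\<bar>b \<omega> - b' \<omega>\<bar> / 2 + \<bar>b' \<omega>\<bar>))"
      by (simp add: abs_mult distrib_left flip: right_diff_distrib)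
    also have "\<dots> \<le> (\<bar>t\<bar> * \<bar>b \<omega> - b' \<omega>\<bar>) * (\<bar>t\<bar> * (2 * \<beta>))"
    proof -
      have "\<bar>b \<omega>\<bar> \<le> \<beta>" "\<bar>b' \<omega>\<bar> \<le> \<beta>" using elim by auto
      moreover have "\<bar>b \<omega> - b' \<omega>\<bar> \<le> \<bar>b \<omega>\<bar> + \<bar>b' \<omega>\<bar>" by (rule abs_triangle_ineq4)
      ultimately have "\<bar>b \<omega> - b' \<omega>\<bar> / 2 \<le> \<beta>" "\<bar>b' \<omega>\<bar> \<le> \<beta>" by simp_all
      then have "\<bar>b \<omega> - b' \<omega>\<bar> / 2 + \<bar>b' \<omega>\<bar> \<le> 2 * \<beta>" by simp
      then show ?thesis by (intro mult_left_mono) auto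
    qed
    also have "\<dots> = t\<^sup>2 * (2 * \<beta> * \<bar>b \<omega> - b' \<omega>\<bar>)"
      by (simp only: t2 mult_ac)
    finally have 3: "cmod (F \<omega> - F' \<omega> - \<i> * complex_of_real (t * b \<omega> - t * b' \<omega>)) \<le> t\<^sup>2 * (2 * \<beta> * \<bar>b \<omega> - b' \<omega>\<bar>)" .
    have "cmod (X \<omega>) \<le> cmod (F \<omega> * (G \<omega> - G' \<omega>)) + cmod ((F \<omega> - F' \<omega>) * (G' \<omega> - 1))
        + cmod (F \<omega> - F' \<omega> - \<i> * complex_of_real (t * b \<omega> - t * b' \<omega>))"
      unfolding X by (intro norm_triangle_mono order_refl norm_triangle_ineq)
    also have "\<dots> \<le> t\<^sup>2 * (S1 \<omega> + 2 * C * S2 \<omega>) + t\<^sup>2 * (C * \<bar>b \<omega> - b' \<omega>\<bar>) + t\<^sup>2 * (2 * \<beta> * \<bar>b \<omega> - b' \<omega>\<bar>)"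
      using 1 2 3 by linarith
    also have "\<dots> = t\<^sup>2 * (S1 \<omega> + 2 * C * S2 \<omega> + (C + 2 * \<beta>) * \<bar>b \<omega> - b' \<omega>\<bar>)" by (simp add: algebra_simps)
    finally show ?case .
  qed
  have iX: "integrable M X" unfolding X_def using iFG ib by auto
  have iS: "integrable M S1" "integrable M S2" unfolding S1_def S2_def by (fact int)+
  have "(\<integral>\<omega>. \<i> * complex_of_real (t * b \<omega> - t * b' \<omega>) \<partial>M) = \<i> * complex_of_real (\<integral>\<omega>. t * b \<omega> - t * b' \<omega> \<partial>M)"
    by (simp only: integral_mult_right_zero integral_complex_of_real)
  also have "(\<integral>\<omega>. t * b \<omega> - t * b' \<omega> \<partial>M) = 0" using ib mean by simp
  finally have "expectation (\<lambda>\<omega>. F \<omega> * G \<omega>) - expectation (\<lambda>\<omega>. F' \<omega> * G' \<omega>) = expectation X"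
    unfolding X_def using iFG ib by simp
  also have "cmod \<dots> \<le> expectation (\<lambda>\<omega>. cmod (X \<omega>))" by (rule integral_norm_bound)
  also have "\<dots> \<le> expectation (\<lambda>\<omega>. t\<^sup>2 * (S1 \<omega> + 2 * C * S2 \<omega> + (C + 2 * \<beta>) * \<bar>b \<omega> - b' \<omega>\<bar>))"
    using ptw iX iS ib by (intro integral_mono_AE) auto
  also have "\<dots> = t\<^sup>2 * (expectation S1 + 2 * C * expectation S2 + (C + 2 * \<beta>) * expectation (\<lambda>\<omega>. \<bar>b \<omega> - b' \<omega>\<bar>))"
    using iS ib by simp
  finally show ?thesis unfolding F_def F'_def G_def G'_def S1_def S2_def .
qed

section \<open>Classification trees\<close>

lemma finite_trees: "finite A \<Longrightarrow> finite {t :: 'a tree. set_tree t \<subseteq> A \<and> height t \<le> h}"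
proof (induction h)
  case 0
  have "{t :: 'a tree. set_tree t \<subseteq> A \<and> height t \<le> 0} \<subseteq> {Leaf}" by auto
  then show ?case using finite_subset by blast
next
  case (Suc h)
  let ?S = "{t :: 'a tree. set_tree t \<subseteq> A \<and> height t \<le> h}"
  have sub: "{t. set_tree t \<subseteq> A \<and> height t \<le> Suc h} \<subseteq> insert Leaf ((\<lambda>(l, a, r). Node l a r) ` (?S \<times> A \<times> ?S))"
  proof
    fix t assume "t \<in> {t. set_tree t \<subseteq> A \<and> height t \<le> Suc h}"
    then show "t \<in> insert Leaf ((\<lambda>(l, a, r). Node l a r) ` (?S \<times> A \<times> ?S))"
      by (cases t) (auto intro!: image_eqI[of _ _ "(_, _, _)"])
  qed
  show ?case
    by (rule finite_subset[OF sub]) (intro finite.insertI finite_imageI finite_cartesian_product Suc)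
qed

lemma size_search_tree: "t \<in> search_trees K \<Longrightarrow> size t = K"
proof -
  assume t: "t \<in> search_trees K"
  then have "sorted_wrt (<) (inorder t)" and s: "set (inorder t) = {1..K}"
    by (auto simp: search_trees_def bst_iff_sorted_wrt_less)
  then have "distinct (inorder t)" by (simp add: strict_sorted_iff)
  then show "size t = K" using distinct_card[of "inorder t"] s by simp
qed

lemma finite_search_trees: "finite (search_trees K)"
proof (rule finite_subset)
  show "search_trees K \<subseteq> {t. set_tree t \<subseteq> {1..K} \<and> height t \<le> K}"
    using size_search_tree height_le_size_tree by (auto simp: search_trees_def) 
qed (rule finite_trees, simp)

lemma search_trees_nonempty: "search_trees K \<noteq> {}"
proof -
  have "\<exists>t. bst t \<and> set_tree t = {1..K}"
  proof (induction K)
    case 0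
    then show ?case by (intro exI[of _ Leaf]) auto
  next
    case (Suc K)
    then obtain t where "bst t" "set_tree t = {1..K}" by blast
    then show ?case by (intro exI[of _ "Node t (Suc K) Leaf"]) (auto simp: atLeastAtMostSuc_conv)
  qed
  then show ?thesis by (auto simp: search_trees_def)
qed

lemma length_leaf_depths: "length (leaf_depths t) = size t + 1"
  by (induction t) auto

lemma leaf_depths_le_height: "d \<in> set (leaf_depths t) \<Longrightarrow> d \<le> height t"
  by (induction t arbitrary: d) (auto simp: le_max_iff_disj)

lemma leaf_depth_le:
  assumes "t \<in> search_trees K" "i \<le> K"
  shows "leaf_depth t i \<le> K"
proof -
  have "leaf_depths t ! i \<in> set (leaf_depths t)"
    using assms size_search_tree by (intro nth_mem) (simp add: length_leaf_depths)
  then show ?thesis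
    using leaf_depths_le_height height_le_size_tree size_search_tree[OF assms(1)]
    by (metis leaf_depth_def order_trans)
qed

lemma opt_cost_le: "t \<in> search_trees K \<Longrightarrow> opt_cost K x \<le> tree_cost K t x"
  unfolding opt_cost_def by (intro Min_le) (auto simp: finite_search_trees)

lemma opt_cost_attained: "\<exists>t\<in>search_trees K. opt_cost K x = tree_cost K t x"
proof -
  have "opt_cost K x \<in> (\<lambda>t. tree_cost K t x) ` search_trees K"
    unfolding opt_cost_def by (intro Min_in) (auto simp: finite_search_trees search_trees_nonempty)
  then show ?thesis by auto
qed

lemma tree_cost_lipschitz:
  assumes "t \<in> search_trees K"
  shows "\<bar>tree_cost K t x - tree_cost K t y\<bar> \<le> K * (\<Sum>i=0..K. \<bar>x i - y i\<bar>)"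
proof -
  have "\<bar>tree_cost K t x - tree_cost K t y\<bar> = \<bar>\<Sum>i=0..K. (x i - y i) * leaf_depth t i\<bar>"
    by (simp add: tree_cost_def sum_subtractf left_diff_distrib)
  also have "\<dots> \<le> (\<Sum>i=0..K. \<bar>(x i - y i) * leaf_depth t i\<bar>)" by (rule sum_abs)
  also have "\<dots> \<le> (\<Sum>i=0..K. \<bar>x i - y i\<bar> * K)"
  proof (rule sum_mono)
    fix i assume "i \<in> {0..K}"
    then have "real (leaf_depth t i) \<le> real K" using leaf_depth_le[OF assms] by simp
    then show "\<bar>(x i - y i) * leaf_depth t i\<bar> \<le> \<bar>x i - y i\<bar> * K"
      by (simp add: abs_mult mult_left_mono)
  qed
  finally show ?thesis by (simp add: sum_distrib_left mult.commute)
qed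

lemma opt_cost_lipschitz_aux: "opt_cost K x \<le> opt_cost K y + K * (\<Sum>i=0..K. \<bar>x i - y i\<bar>)"
proof -
  obtain t where t: "t \<in> search_trees K" "opt_cost K y = tree_cost K t y" using opt_cost_attained by blast
  have "opt_cost K x \<le> tree_cost K t x" by (rule opt_cost_le) (use t in simp)
  then show ?thesis using tree_cost_lipschitz[OF t(1), of x y] t(2) by linarith
qed

lemma opt_cost_lipschitz: "\<bar>opt_cost K x - opt_cost K y\<bar> \<le> K * (\<Sum>i=0..K. \<bar>x i - y i\<bar>)"
proof -
  have "(\<Sum>i=0..K. \<bar>x i - y i\<bar>) = (\<Sum>i=0..K. \<bar>y i - x i\<bar>)" by (intro sum.cong abs_minus_commute refl)
  then show ?thesis
    using opt_cost_lipschitz_aux[of K x y] opt_cost_lipschitz_aux[of K y x] by (simp add: abs_le_iff)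
qed

lemma tree_cost_scale: "tree_cost K t (\<lambda>i. c * x i) = c * tree_cost K t x"
  by (simp add: tree_cost_def sum_distrib_left mult_ac)

lemma opt_cost_scale: assumes "c \<ge> 0" shows "opt_cost K (\<lambda>i. c * x i) = c * opt_cost K x"
proof (rule antisym)
  obtain t where t: "t \<in> search_trees K" "opt_cost K x = tree_cost K t x" using opt_cost_attained by blast
  then show "opt_cost K (\<lambda>i. c * x i) \<le> c * opt_cost K x"
    using opt_cost_le[OF t(1), of "\<lambda>i. c * x i"] by (simp add: tree_cost_scale)
  obtain s where s: "s \<in> search_trees K" "opt_cost K (\<lambda>i. c * x i) = tree_cost K s (\<lambda>i. c * x i)" using opt_cost_attained by blast
  then show "c * opt_cost K x \<le> opt_cost K (\<lambda>i. c * x i)"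
    using opt_cost_le[OF s(1), of x] assms by (simp add: tree_cost_scale mult_left_mono)
qed

lemma opt_cost_bounds:
  assumes "\<And>i. i \<le> K \<Longrightarrow> 0 \<le> x i"
  shows "0 \<le> opt_cost K x" "opt_cost K x \<le> K * (\<Sum>i=0..K. x i)"
proof -
  obtain t where t: "t \<in> search_trees K" "opt_cost K x = tree_cost K t x" using opt_cost_attained by blast
  show "0 \<le> opt_cost K x" unfolding t tree_cost_def using assms by (intro sum_nonneg) auto
  have "tree_cost K t x \<le> (\<Sum>i=0..K. x i * K)" unfolding tree_cost_def
    using assms leaf_depth_le[OF t(1)] by (intro sum_mono mult_left_mono) auto
  then show "opt_cost K x \<le> K * (\<Sum>i=0..K. x i)" unfolding t by (simp add: sum_distrib_left mult.commute)
qed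

lemma finite_linear_order_least:
  assumes "linear_order_on A r" "finite S" "S \<noteq> {}" "S \<subseteq> A"
  shows "\<exists>!t. t \<in> S \<and> (\<forall>s\<in>S. (t, s) \<in> r)"
proof -
  have r: "refl_on A r" "trans r" "antisym r" "total_on A r"
    using assms(1) by (auto simp: linear_order_on_def partial_order_on_def preorder_on_def)
  have "\<exists>t\<in>S. \<forall>s\<in>S. (t, s) \<in> r" using assms(2,3,4)
  proof (induction rule: finite_ne_induct)
    case (singleton x)
    then show ?case using r(1) by (auto simp: refl_on_def)
  next
    case (insert x F)
    then obtain t where t: "t \<in> F" "\<forall>s\<in>F. (t, s) \<in> r" by auto
    have "t \<noteq> x" using t insert by auto
    then have "(t, x) \<in> r \<or> (x, t) \<in> r" using r(4) t insert by (auto simp: total_on_def)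
    then show ?case
    proof
      assume "(t, x) \<in> r" then show ?thesis using t by auto
    next
      assume x: "(x, t) \<in> r"
      have "(x, x) \<in> r" using r(1) insert by (auto simp: refl_on_def)
      then show ?thesis using x t r(2) by (auto elim: transE)
    qed
  qed
  then show ?thesis using r(3) by (auto simp: antisym_def)
qed

lemma opt_tree_in:
  assumes "linear_order_on (search_trees K) ord"
  shows "opt_tree K ord x \<in> opt_trees K x"
proof -
  have "opt_trees K x \<noteq> {}"
  proof -
    obtain t where "t \<in> search_trees K" "opt_cost K x = tree_cost K t x" using opt_cost_attained by blast
    then show ?thesis using opt_cost_le[of _ K x] by (auto simp: opt_trees_def)
  qed
  moreover have "opt_trees K x \<subseteq> search_trees K" by (auto simp: opt_trees_def)
  ultimately have "\<exists>!t. t \<in> opt_trees K x \<and> (\<forall>s\<in>opt_trees K x. (t, s) \<in> ord)"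
    using finite_subset[OF _ finite_search_trees] by (intro finite_linear_order_least[OF assms]) auto
  from theI'[OF this] show ?thesis unfolding opt_tree_def by blast
qed

lemma tree_cost_opt_tree:
  assumes "linear_order_on (search_trees K) ord"
  shows "opt_tree K ord x \<in> search_trees K" "tree_cost K (opt_tree K ord x) x = opt_cost K x"
proof -
  show 1: "opt_tree K ord x \<in> search_trees K"
    using opt_tree_in[OF assms, of x] by (auto simp: opt_trees_def)
  obtain t where "t \<in> search_trees K" "opt_cost K x = tree_cost K t x" using opt_cost_attained by blast
  then show "tree_cost K (opt_tree K ord x) x = opt_cost K x"
    using opt_tree_in[OF assms, of x] opt_cost_le[OF 1, of x] by (auto simp: opt_trees_def intro: antisym)
qed

lemma tree_cost_cong: "(\<And>i. i \<le> K \<Longrightarrow> x i = y i) \<Longrightarrow> tree_cost K t x = tree_cost K t y"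
  unfolding tree_cost_def by (intro sum.cong) auto

lemma opt_tree_cong:
  assumes "\<And>i. i \<le> K \<Longrightarrow> x i = y i"
  shows "opt_tree K ord x = opt_tree K ord y"
proof -
  have "opt_trees K x = opt_trees K y"
    using tree_cost_cong[OF assms] by (auto simp: opt_trees_def)
  then show ?thesis by (simp add: opt_tree_def)
qed

lemma cmp_count_measurable:
  fixes M :: "'a measure" and x :: "'a \<Rightarrow> nat \<Rightarrow> real"
  assumes "cmp_indices t \<subseteq> A" and [measurable]: "\<And>i. i \<in> A \<Longrightarrow> (\<lambda>\<omega>. x \<omega> i) \<in> borel_measurable M"
  shows "(\<lambda>\<omega>. cmp_count t (x \<omega>)) \<in> measurable M (count_space UNIV)"
  using assms(1)
proof (induction t)
  case (Compare i j s t)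
  then have [measurable]: "i \<in> A" "j \<in> A" "(\<lambda>\<omega>. cmp_count s (x \<omega>)) \<in> measurable M (count_space UNIV)"
    "(\<lambda>\<omega>. cmp_count t (x \<omega>)) \<in> measurable M (count_space UNIV)" by auto
  show ?case unfolding cmp_count.simps by measurable
qed simp

section \<open>Spacings of uniform pivots\<close>

abbreviation unif_prod :: "'i set \<Rightarrow> ('i \<Rightarrow> real) measure" where
  "unif_prod I \<equiv> PiM I (\<lambda>_. unif)"

lemma prob_space_unif: "prob_space unif"
  unfolding unif_def by (rule prob_space_uniform_measure) auto

lemma sets_unif [measurable_cong, simp]: "sets unif = sets borel"
  by (simp add: unif_def)

lemma space_unif [simp]: "space unif = UNIV"
  by (simp add: unif_def)

lemma emeasure_unif: "A \<in> sets borel \<Longrightarrow> emeasure unif A = emeasure lborel ({0..1} \<inter> A)"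
  by (simp add: unif_def divide_ennreal_def)

interpretation unif: prob_space unif by (rule prob_space_unif)

lemma prob_space_unif_prod: "prob_space (unif_prod I)"
  by (intro prob_space_PiM prob_space_unif)

interpretation unif_prod: prob_space "unif_prod I" for I by (rule prob_space_unif_prod)

lemma measure_unif_Ioo: "0 \<le> a \<Longrightarrow> a \<le> b \<Longrightarrow> b \<le> 1 \<Longrightarrow> measure unif {a<..<b} = b - a"
proof -
  assume "0 \<le> a" "a \<le> b" "b \<le> 1"
  then have "{0..1} \<inter> {a<..<b} = {a<..<b}" by auto
  then show ?thesis using \<open>a \<le> b\<close> by (simp add: measure_def emeasure_unif)
qed

lemma measure_unif_compl_Ioc:
  assumes "0 \<le> a" "a + x \<le> 1" "0 \<le> x" shows "emeasure unif (- {a<..a+x}) = ennreal (1 - x)"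
proof -
  have "{0..1} \<inter> {a<..a+x} = {a<..a+x}" using assms by auto
  then have "measure unif {a<..a+x} = x" using assms by (simp add: measure_def emeasure_unif)
  moreover have "measure unif (- {a<..a+x}) = 1 - measure unif {a<..a+x}"
    using unif.prob_compl[of "{a<..a+x}"] by (simp add: Compl_eq_Diff_UNIV)
  ultimately show ?thesis by (simp add: unif.emeasure_eq_measure)
qed

lemma AE_unif_neq: "AE x in unif. x \<noteq> y"
proof (rule AE_I[where N="{y}"])
  have "emeasure lborel ({0..1} \<inter> {y}) \<le> emeasure lborel {y}" by (intro emeasure_mono) auto
  then show "emeasure unif {y} = 0" by (simp add: emeasure_unif)
qed auto

lemma AE_unif_01: "AE x in unif. 0 < x \<and> x < 1"
proof -
  have "AE x in unif. x \<in> {0..1}"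
  proof (rule AE_I[where N="- {0..1}"])
    have "{0..1::real} \<inter> - {0..1} = {}" by auto
    then show "emeasure unif (- {0..1}) = 0" by (simp add: emeasure_unif)
  qed auto
  then show ?thesis using AE_unif_neq[of 0] AE_unif_neq[of 1] by eventually_elim auto
qed

lemma measurable_unif_component: "i \<in> I \<Longrightarrow> (\<lambda>v. v i) \<in> borel_measurable (unif_prod I)"
  by measurable

text \<open>Splits one coordinate off a possibly infinite product, so that Fubini applies to that
  coordinate alone.\<close>

lemma unif_prod_split:
  assumes "i \<in> I"
  shows "unif_prod I = distr (unif \<Otimes>\<^sub>M unif_prod (I - {i})) (unif_prod I) (\<lambda>(x, X). X(i := x))"
  using distr_pair_PiM_eq_PiM[of "I - {i}" "\<lambda>_. unif" i] assms by (simp add: prob_space_unif insert_absorb)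

lemma measurable_upd_unif:
  assumes "i \<in> I"
  shows "(\<lambda>(x, X). X(i := x)) \<in> measurable (unif \<Otimes>\<^sub>M unif_prod (I - {i})) (unif_prod I)"
proof -
  have "(\<lambda>(x, X). X(i := x)) \<in> measurable (unif \<Otimes>\<^sub>M unif_prod (I - {i})) (unif_prod (insert i (I - {i})))"
    by measurable
  then show ?thesis using assms by (simp add: insert_absorb)
qed

lemma AE_unif_prod_component: "i \<in> I \<Longrightarrow> AE x in unif. P x \<Longrightarrow> AE v in unif_prod I. P (v i)"
  by (rule AE_PiM_component[where M="\<lambda>_. unif"]) (auto intro: prob_space_unif)

lemma AE_unif_prod_neq:
  assumes "i \<in> I" "j \<in> I" "i \<noteq> j"
  shows "AE v in unif_prod I. v i \<noteq> v j"
proof -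
  interpret P: pair_sigma_finite unif "unif_prod (I - {i})" ..
  have [measurable]: "(\<lambda>v. v j) \<in> borel_measurable (unif_prod I)"
    "(\<lambda>v. v i) \<in> borel_measurable (unif_prod I)"
    "(\<lambda>v. v j) \<in> borel_measurable (unif_prod (I - {i}))"
    using assms by (auto intro!: measurable_unif_component)
  have "AE p in unif \<Otimes>\<^sub>M unif_prod (I - {i}). fst p \<noteq> snd p j"
  proof (rule P.AE_pair_measure)
    show "{x \<in> space (unif \<Otimes>\<^sub>M unif_prod (I - {i})). fst x \<noteq> snd x j} \<in> sets (unif \<Otimes>\<^sub>M unif_prod (I - {i}))"
      by measurable
    have "AE X in unif_prod (I - {i}). x \<noteq> X j" for x
    proof (rule AE_unif_prod_component[where P="\<lambda>y. x \<noteq> y"])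
      show "AE y in unif. x \<noteq> y" using AE_unif_neq[of x] by eventually_elim auto
    qed (use assms in auto)
    then show "AE x in unif. AE y in unif_prod (I - {i}). fst (x, y) \<noteq> snd (x, y) j"
      by simp
  qed
  moreover have "{v \<in> space (unif_prod I). v i \<noteq> v j} \<in> sets (unif_prod I)"
    using assms by (intro borel_measurable_neq measurable_unif_component)
  ultimately show ?thesis using assms
    by (subst unif_prod_split[OF assms(1)])
       (subst AE_distr_iff, auto simp: split_beta intro!: measurable_upd_unif)
qed

section \<open>Sorted pivots and the intervals between them\<close>

definition good_pivots :: "nat \<Rightarrow> (nat \<Rightarrow> real) \<Rightarrow> bool" where
  "good_pivots K v \<longleftrightarrow> inj_on v {1..K} \<and> v ` {1..K} \<subseteq> {0<..<1}"

lemma AE_good_pivots: "AE v in pivot_space K. good_pivots K v"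
proof -
  have "AE v in pivot_space K. \<forall>i\<in>{1..K}. \<forall>j\<in>{1..K}. i \<noteq> j \<longrightarrow> v i \<noteq> v j"
    unfolding pivot_space_def by (intro AE_finite_allI AE_impI AE_unif_prod_neq) auto
  moreover have "AE v in pivot_space K. \<forall>i\<in>{1..K}. 0 < v i \<and> v i < 1"
    unfolding pivot_space_def
    by (intro AE_finite_allI AE_unif_prod_component[where P="\<lambda>x. 0 < x \<and> x < 1"] AE_unif_01) auto
  ultimately show ?thesis by eventually_elim (auto simp: good_pivots_def inj_on_def)
qed

lemma measurable_pivot_component:
  "i \<in> {1..K} \<Longrightarrow> (\<lambda>v. v i) \<in> borel_measurable (pivot_space K)"
  unfolding pivot_space_def by measurable

text \<open>An order statistic lies below a level iff enough entries do. Measurability of the sorted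
  pivots thereby reduces to that of a count.\<close>

lemma sort_nth_le_iff:
  fixes xs :: "'a::linorder list"
  assumes "j < length xs"
  shows "sort xs ! j \<le> c \<longleftrightarrow> j < length (filter (\<lambda>x. x \<le> c) xs)"
proof -
  define ys where "ys = sort xs"
  have ys: "sorted ys" "j < length ys" using assms by (auto simp: ys_def)
  have "length (filter (\<lambda>x. x \<le> c) xs) = length (filter (\<lambda>x. x \<le> c) ys)"
    unfolding ys_def by (simp add: filter_sort)
  also have "\<dots> = card {i. i < length ys \<and> ys ! i \<le> c}" by (rule length_filter_conv_card)
  finally have l: "length (filter (\<lambda>x. x \<le> c) xs) = card {i. i < length ys \<and> ys ! i \<le> c}" .
  show ?thesis
  proof (cases "ys ! j \<le> c")
    case True
    have "{..j} \<subseteq> {i. i < length ys \<and> ys ! i \<le> c}"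
      using ys True sorted_nth_mono[OF ys(1)] by (auto intro: order_trans)
    then have "card {..j} \<le> card {i. i < length ys \<and> ys ! i \<le> c}" by (intro card_mono) auto
    then show ?thesis using True l by (simp add: ys_def)
  next
    case False
    have "{i. i < length ys \<and> ys ! i \<le> c} \<subseteq> {..<j}"
    proof (intro subsetI, rule ccontr)
      fix i assume "i \<in> {i. i < length ys \<and> ys ! i \<le> c}" "i \<notin> {..<j}"
      then show False using False sorted_nth_mono[OF ys(1), of j i] by auto
    qed
    then have "card {i. i < length ys \<and> ys ! i \<le> c} \<le> card {..<j}" by (intro card_mono) auto
    then show ?thesis using False l by (simp add: ys_def)
  qed
qed

lemma measurable_pivot [measurable]: "(\<lambda>v. pivot K v i) \<in> borel_measurable (pivot_space K)"
proof (cases "i = 0 \<or> i > K")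
  case False
  have *: "(\<lambda>v. length (filter (\<lambda>x. x \<le> c) (map v is))) \<in> measurable (pivot_space K) (count_space UNIV)"
    if "set is \<subseteq> {1..K}" for c :: real and "is"
    using that
  proof (induction "is")
    case (Cons i "is")
    then have [measurable]: "(\<lambda>v. v i) \<in> borel_measurable (pivot_space K)"
      "(\<lambda>v. length (filter (\<lambda>x. x \<le> c) (map v is))) \<in> measurable (pivot_space K) (count_space UNIV)"
      by (auto intro!: measurable_pivot_component)
    have "(\<lambda>v. length (filter (\<lambda>x. x \<le> c) (map v (i # is)))) =
       (\<lambda>v. if v i \<le> c then Suc (length (filter (\<lambda>x. x \<le> c) (map v is))) else length (filter (\<lambda>x. x \<le> c) (map v is)))"
      by auto
    then show ?case by (simp only:) measurable
  qed simp
  show ?thesis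
  proof (subst borel_measurable_iff_le, intro allI)
    fix c
    have [measurable]: "(\<lambda>v. length (filter (\<lambda>x. x \<le> c) (map v [1..<Suc K]))) \<in> measurable (pivot_space K) (count_space UNIV)"
      by (rule *) auto
    have "{v \<in> space (pivot_space K). pivot K v i \<le> c} =
      {v \<in> space (pivot_space K). i - 1 < length (filter (\<lambda>x. x \<le> c) (map v [1..<Suc K]))}"
      using False by (auto simp: pivot_def sort_nth_le_iff simp del: upt_Suc)
    also have "\<dots> \<in> sets (pivot_space K)" by measurable
    finally show "{v \<in> space (pivot_space K). pivot K v i \<le> c} \<in> sets (pivot_space K)" .
  qed
qed (auto simp: pivot_def)

lemma measurable_spacing [measurable]: "(\<lambda>v. spacing K v i) \<in> borel_measurable (pivot_space K)"
  unfolding spacing_def by measurable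

lemma measurable_opt_cost_spacing [measurable]:
  "(\<lambda>v. opt_cost K (spacing K v)) \<in> borel_measurable (pivot_space K)"
  unfolding opt_cost_def tree_cost_def
  by (intro borel_measurable_Min finite_search_trees) measurable

context
  fixes K v assumes good: "good_pivots K v"
begin

lemma pivot_simps: "pivot K v 0 = 0" "pivot K v (Suc K) = 1"
  by (auto simp: pivot_def)

lemma sorted_pivots:
  defines "xs \<equiv> sort (map v [1..<Suc K])"
  shows "sorted_wrt (<) xs" "set xs = v ` {1..K}" "length xs = K"
proof -
  have "distinct (map v [1..<Suc K])" using good
    by (auto simp: distinct_map good_pivots_def atLeastLessThanSuc_atLeastAtMost simp del: upt_Suc)
  then show "sorted_wrt (<) xs" unfolding xs_def strict_sorted_iff by simp
  show "set xs = v ` {1..K}" unfolding xs_def by (auto simp del: upt_Suc)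
  show "length xs = K" unfolding xs_def by (simp del: upt_Suc)
qed

lemma pivot_image: "pivot K v ` {1..K} = v ` {1..K}"
proof -
  define xs where "xs = sort (map v [1..<Suc K])"
  have "pivot K v ` {1..K} = (\<lambda>i. xs ! (i - 1)) ` {1..K}"
    by (intro image_cong) (auto simp: pivot_def xs_def simp del: upt_Suc)
  also have "\<dots> = (\<lambda>i. xs ! i) ` (\<lambda>i. i - 1) ` {1..K}" by (simp add: image_image)
  also have "(\<lambda>i. i - 1) ` {1..K} = {..<K}" by (auto simp: image_iff intro!: bexI[of _ "Suc _"])
  also have "(\<lambda>i. xs ! i) ` {..<K} = set xs"
  proof -
    have "length xs = K" unfolding xs_def by (rule sorted_pivots(3))
    then show ?thesis by (auto simp: set_conv_nth)
  qed
  finally show ?thesis using sorted_pivots(2) by (simp add: xs_def del: upt_Suc)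
qed

lemma pivot_in: "i \<in> {1..K} \<Longrightarrow> pivot K v i \<in> {0<..<1}"
  using pivot_image good unfolding good_pivots_def by blast

lemma pivot_less_Suc: "i \<le> K \<Longrightarrow> pivot K v i < pivot K v (Suc i)"
proof -
  assume i: "i \<le> K"
  consider "i = 0" "K = 0" | "i = 0" "K > 0" | "i > 0" "i = K" | "i > 0" "i < K" using i by linarith
  then show ?thesis
  proof cases
    case 4
    then show ?thesis using sorted_wrt_nth_less[OF sorted_pivots(1), of "i - 1" i] sorted_pivots(3)
      by (simp add: pivot_def del: upt_Suc)
  qed (use pivot_in[of 1] pivot_in[of K] pivot_simps in auto)
qed

lemma pivot_strict_mono: "i < j \<Longrightarrow> j \<le> Suc K \<Longrightarrow> pivot K v i < pivot K v j"
proof (induction j)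
  case (Suc j)
  then show ?case using pivot_less_Suc[of j] by (cases "i = j") auto
qed simp

lemma spacing_pos: "i \<le> K \<Longrightarrow> 0 < spacing K v i"
  using pivot_less_Suc[of i] by (simp add: spacing_def)

lemma sum_spacing: "(\<Sum>i=0..K. spacing K v i) = 1"
  using sum_Suc_diff[of 0 K "pivot K v"] by (simp add: spacing_def pivot_simps)

lemma spacing_le_1: "i \<le> K \<Longrightarrow> spacing K v i \<le> 1"
proof -
  assume "i \<le> K"
  then have "spacing K v i \<le> (\<Sum>i=0..K. spacing K v i)"
    by (intro member_le_sum) (auto intro: less_imp_le spacing_pos)
  then show ?thesis by (simp add: sum_spacing)
qed

lemma measure_sublist_interval: "i \<le> K \<Longrightarrow> measure unif (sublist_interval K v i) = spacing K v i"
proof -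
  assume i: "i \<le> K"
  have "0 \<le> pivot K v i" using pivot_strict_mono[of 0 i] i pivot_simps by (cases "i = 0") auto
  moreover have "pivot K v (Suc i) \<le> 1" using pivot_strict_mono[of "Suc i" "Suc K"] i pivot_simps by (cases "i = K") auto
  ultimately show ?thesis using pivot_less_Suc[OF i] by (simp add: sublist_interval_def spacing_def measure_unif_Ioo)
qed

lemma disjoint_sublist_intervals:
  "disjoint_family_on (sublist_interval K v) {0..K}"
proof -
  have "sublist_interval K v i \<inter> sublist_interval K v j = {}" if "i < j" "j \<le> K" for i j
    using that pivot_strict_mono[of "Suc i" j] by (cases "Suc i = j") (auto simp: sublist_interval_def)
  then show ?thesis unfolding disjoint_family_on_def
    by (metis atLeastAtMost_iff inf_commute linorder_neqE_nat)
qed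

text \<open>The index wanted is that of the last pivot below \<open>x\<close>; the convention
  \<open>pivot K v 0 = 0\<close> ensures that there is one, and \<open>pivot K v (K + 1) = 1\<close>
  bounds the last interval.\<close>

lemma sublist_intervals_cover:
  assumes "x \<in> {0<..<1}" "x \<notin> v ` {1..K}"
  shows "\<exists>i\<le>K. x \<in> sublist_interval K v i"
proof -
  define i where "i = (GREATEST i. i \<le> K \<and> pivot K v i < x)"
  have i: "i \<le> K \<and> pivot K v i < x" unfolding i_def
    by (rule GreatestI_nat[where k=0 and b=K]) (use assms pivot_simps in auto)
  have "x < pivot K v (Suc i)"
  proof (cases "i = K")
    case True then show ?thesis using assms pivot_simps by simp
  next
    case False
    have "\<not> pivot K v (Suc i) < x"
    proof
      assume "pivot K v (Suc i) < x"
      then have "Suc i \<le> K \<and> pivot K v (Suc i) < x" using False i by simp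
      then have "Suc i \<le> (GREATEST i. i \<le> K \<and> pivot K v i < x)"
        by (rule Greatest_le_nat[where b=K]) auto
      then have "Suc i \<le> i" by (simp only: i_def)
      then show False by simp
    qed
    moreover have "pivot K v (Suc i) \<in> v ` {1..K}" using pivot_image False i by (metis atLeastAtMost_iff imageI Suc_leI le_neq_implies_less One_nat_def Suc_le_mono le0)
    ultimately show ?thesis using assms(2) by force
  qed
  then show ?thesis using i by (auto simp: sublist_interval_def)
qed

end

section \<open>Spacings as gaps to the right of unsorted points, and their common law\<close>

definition right_gap :: "real set \<Rightarrow> real \<Rightarrow> real" where
  "right_gap S u = Min (insert 1 {x \<in> S. u < x}) - u"

lemma right_gap_greater_iff:
  assumes "finite S" shows "x < right_gap S u \<longleftrightarrow> u + x < 1 \<and> (\<forall>y\<in>S. u < y \<longrightarrow> u + x < y)"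
proof -
  have "x < right_gap S u \<longleftrightarrow> u + x < Min (insert 1 {x \<in> S. u < x})" by (auto simp: right_gap_def)
  also have "\<dots> \<longleftrightarrow> (\<forall>y\<in>insert 1 {x \<in> S. u < x}. u + x < y)" using assms by (subst Min_gr_iff) auto
  finally show ?thesis by auto
qed

text \<open>The left end points of the spacings are 0 and the pivots in some order. Indexing gaps by
  their left end point instead of by rank eliminates sorting: the sum then runs over the independent
  variables \<open>v a\<close> themselves.\<close>

lemma sum_spacing_eq_sum_right_gap:
  fixes F :: "real \<Rightarrow> real"
  assumes good: "good_pivots K v"
  shows "(\<Sum>i=0..K. F (spacing K v i)) =
     F (right_gap (v ` {1..K}) 0) + (\<Sum>a=1..K. F (right_gap (v ` {1..K}) (v a)))"
proof -
  define S where "S = v ` {1..K}"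
  have S: "S = pivot K v ` {1..K}" unfolding S_def using pivot_image[OF good] by simp
  have gap: "spacing K v i = right_gap S (pivot K v i)" if "i \<le> K" for i
  proof -
    have "Min (insert 1 {x \<in> S. pivot K v i < x}) = pivot K v (Suc i)"
    proof (rule Min_eqI)
      show "finite (insert 1 {x \<in> S. pivot K v i < x})" by (simp add: S)
      show "pivot K v (Suc i) \<in> insert 1 {x \<in> S. pivot K v i < x}"
        using that pivot_less_Suc[OF good that] pivot_simps[OF good] by (cases "i = K") (auto simp: S)
      fix y assume "y \<in> insert 1 {x \<in> S. pivot K v i < x}"
      then consider "y = 1" | k where "y = pivot K v k" "k \<in> {1..K}" "pivot K v i < pivot K v k" by (auto simp: S)
      then show "pivot K v (Suc i) \<le> y"
      proof cases
        case 1
        then show ?thesis using pivot_strict_mono[OF good, of "Suc i" "Suc K"] that pivot_simps[OF good]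
          by (cases "i = K") auto
      next
        case 2
        have "i < k"
        proof (rule ccontr)
          assume "\<not> i < k"
          then show False using pivot_strict_mono[OF good, of k i] 2 that by (cases "i = k") auto
        qed
        then show ?thesis using pivot_strict_mono[OF good, of "Suc i" k] 2 by (cases "Suc i = k") auto
      qed
    qed
    then show ?thesis by (simp add: right_gap_def spacing_def)
  qed
  have inj: "inj_on (pivot K v) {0..K}"
    by (rule strict_mono_on_imp_inj_on) (auto simp: strict_mono_on_def intro!: pivot_strict_mono[OF good])
  have im: "pivot K v ` {0..K} = insert 0 S"
  proof -
    have "{0..K} = insert 0 {1..K}" by auto
    then show ?thesis by (simp add: S pivot_simps[OF good])
  qed
  have "0 \<notin> S" using good by (auto simp: S_def good_pivots_def)
  have "(\<Sum>i=0..K. F (spacing K v i)) = (\<Sum>i=0..K. F (right_gap S (pivot K v i)))"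
    by (intro sum.cong) (auto simp: gap)
  also have "\<dots> = (\<Sum>u\<in>insert 0 S. F (right_gap S u))" unfolding im[symmetric] by (simp add: sum.reindex[OF inj])
  also have "\<dots> = F (right_gap S 0) + (\<Sum>u\<in>S. F (right_gap S u))"
    using \<open>0 \<notin> S\<close> by (simp add: S_def)
  also have "(\<Sum>u\<in>S. F (right_gap S u)) = (\<Sum>a=1..K. F (right_gap S (v a)))"
    unfolding S_def using good by (subst sum.reindex) (auto simp: good_pivots_def)
  finally show ?thesis by (simp add: S_def)
qed

text \<open>The Beta(1, \<open>K\<close>) law.\<close>

definition spacing_law :: "nat \<Rightarrow> real measure" where
  "spacing_law K = density lborel (\<lambda>x. ennreal (real K * (1 - x) ^ (K - 1)) * indicator {0..1} x)"

lemma emeasure_spacing_law_Icc: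
  assumes "K \<ge> 1" "0 \<le> x" "x \<le> 1"
  shows "emeasure (spacing_law K) {0..x} = ennreal (1 - (1 - x) ^ K)"
proof -
  have "emeasure (spacing_law K) {0..x} =
     (\<integral>\<^sup>+y. ennreal (real K * (1 - y) ^ (K - 1)) * indicator {0..1} y * indicator {0..x} y \<partial>lborel)"
    unfolding spacing_law_def by (rule emeasure_density) auto
  also have "\<dots> = (\<integral>\<^sup>+y. ennreal (real K * (1 - y) ^ (K - 1)) * indicator {0..x} y \<partial>lborel)"
    using assms by (intro nn_integral_cong) (auto simp: indicator_def)
  also have "\<dots> = ennreal (- ((1 - x) ^ K) - (- ((1 - 0) ^ K)))"
  proof (rule nn_integral_FTC_Icc)
    show "((\<lambda>y. - ((1 - y) ^ K)) has_real_derivative real K * (1 - y) ^ (K - 1)) (at y)" for y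
      by (auto intro!: derivative_eq_intros)
  qed (use assms in auto)
  finally show ?thesis by simp
qed

lemma real_distribution_spacing_law: assumes "K \<ge> 1" shows "real_distribution (spacing_law K)"
proof -
  have "emeasure (spacing_law K) UNIV = (\<integral>\<^sup>+y. ennreal (real K * (1 - y) ^ (K - 1)) * indicator {0..1} y * indicator UNIV y \<partial>lborel)"
    unfolding spacing_law_def by (rule emeasure_density) auto
  also have "\<dots> = (\<integral>\<^sup>+y. ennreal (real K * (1 - y) ^ (K - 1)) * indicator {0..1} y * indicator {0..1} y \<partial>lborel)"
    by (intro nn_integral_cong) (auto simp: indicator_def)
  also have "\<dots> = emeasure (spacing_law K) {0..1}"
    unfolding spacing_law_def by (rule emeasure_density[symmetric]) auto
  also have "\<dots> = 1" using emeasure_spacing_law_Icc[OF assms, of 1] assms by simp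
  finally have "prob_space (spacing_law K)" by (intro prob_spaceI) (simp add: spacing_law_def)
  then show ?thesis by (auto simp: real_distribution_def real_distribution_axioms_def spacing_law_def)
qed

lemma emeasure_spacing_law_atMost:
  assumes "K \<ge> 1"
  shows "emeasure (spacing_law K) {..x} = emeasure (spacing_law K) {0..min x 1}"
proof -
  have "emeasure (spacing_law K) {..x} =
     (\<integral>\<^sup>+y. ennreal (real K * (1 - y) ^ (K - 1)) * indicator {0..1} y * indicator {..x} y \<partial>lborel)"
    unfolding spacing_law_def by (rule emeasure_density) auto
  also have "\<dots> = (\<integral>\<^sup>+y. ennreal (real K * (1 - y) ^ (K - 1)) * indicator {0..1} y * indicator {0..min x 1} y \<partial>lborel)"
    by (intro nn_integral_cong) (auto simp: indicator_def)
  also have "\<dots> = emeasure (spacing_law K) {0..min x 1}"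
    unfolding spacing_law_def by (rule emeasure_density[symmetric]) auto
  finally show ?thesis .
qed

text \<open>Beta(1, \<open>K\<close>) has the tail \<open>(1 - x) ^ K\<close> on the unit interval,
  and agreement of the tails gives agreement of the distribution functions; positivity settles
  arguments below 0.\<close>

lemma eq_spacing_law:
  assumes K: "K \<ge> 1" and M: "prob_space M" and X[measurable]: "X \<in> borel_measurable M"
    and tail: "\<And>x. 0 \<le> x \<Longrightarrow> x \<le> 1 \<Longrightarrow> emeasure M {\<omega> \<in> space M. x < X \<omega>} = ennreal ((1 - x) ^ K)"
    and pos: "AE \<omega> in M. 0 < X \<omega>"
  shows "distr M borel X = spacing_law K"
proof (rule cdf_unique)
  interpret prob_space M by fact
  show "real_distribution (distr M borel X)" by (rule real_distribution_distr) simp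
  show "real_distribution (spacing_law K)" by (rule real_distribution_spacing_law[OF K])
  interpret S: real_distribution "spacing_law K" by (rule real_distribution_spacing_law[OF K])
  have cd: "cdf (distr M borel X) x = 1 - prob {\<omega> \<in> space M. x < X \<omega>}" for x
  proof -
    have "cdf (distr M borel X) x = prob {\<omega> \<in> space M. X \<omega> \<le> x}"
      unfolding cdf_def by (subst measure_distr) (auto intro!: arg_cong[where f=prob])
    also have "{\<omega> \<in> space M. X \<omega> \<le> x} = space M - {\<omega> \<in> space M. x < X \<omega>}" by auto
    finally show ?thesis using prob_compl[of "{\<omega> \<in> space M. x < X \<omega>}"] by simp
  qed
  have tail': "prob {\<omega> \<in> space M. x < X \<omega>} = (1 - x) ^ K" if "0 \<le> x" "x \<le> 1" for x
    using tail[OF that] that by (simp add: measure_def)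
  show "cdf (distr M borel X) = cdf (spacing_law K)"
  proof
    fix x
    have S: "cdf (spacing_law K) x = measure (spacing_law K) {0..min x 1}"
      by (simp add: cdf_def measure_def emeasure_spacing_law_atMost[OF K])
    consider "x < 0" | "0 \<le> x" "x \<le> 1" | "1 < x" by linarith
    then show "cdf (distr M borel X) x = cdf (spacing_law K) x"
    proof cases
      case 1
      have "prob {\<omega> \<in> space M. x < X \<omega>} = 1"
        using pos by (subst prob_Collect_eq_1) (auto elim!: eventually_mono simp: 1[THEN less_trans])
      then show ?thesis using 1 by (simp add: cd S)
    next
      case 2
      then show ?thesis using emeasure_spacing_law_Icc[OF K 2] tail'[OF 2]
        by (simp add: cd S measure_def power_le_one)
    next
      case 3
      have "prob {\<omega> \<in> space M. x < X \<omega>} \<le> prob {\<omega> \<in> space M. 1 < X \<omega>}"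
        using 3 by (intro finite_measure_mono) auto
      also have "\<dots> = 0" using tail'[of 1] K by simp
      finally have "prob {\<omega> \<in> space M. x < X \<omega>} = 0" by (simp add: measure_le_0_iff)
      then show ?thesis using 3 emeasure_spacing_law_Icc[OF K, of 1] K by (simp add: cd S measure_def)
    qed
  qed
qed

lemma measurable_right_gap:
  assumes [measurable]: "u \<in> borel_measurable (pivot_space K)"
  shows "(\<lambda>v. right_gap (v ` {1..K}) (u v)) \<in> borel_measurable (pivot_space K)"
proof (subst borel_measurable_iff_greater, intro allI)
  fix x
  have "{v \<in> space (pivot_space K). x < right_gap (v ` {1..K}) (u v)} =
    {v \<in> space (pivot_space K). u v + x < 1 \<and> (\<forall>b\<in>{1..K}. u v < v b \<longrightarrow> u v + x < v b)}"
    by (auto simp: right_gap_greater_iff)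
  also have "\<dots> \<in> sets (pivot_space K)"
  proof (intro sets.sets_Collect_conj sets.sets_Collect_finite_All sets.sets_Collect_imp)
    fix b assume "b \<in> {1..K}"
    then have [measurable]: "(\<lambda>v. v b) \<in> borel_measurable (pivot_space K)" by (rule measurable_pivot_component)
    show "{v \<in> space (pivot_space K). u v < v b} \<in> sets (pivot_space K)"
      "{v \<in> space (pivot_space K). u v + x < v b} \<in> sets (pivot_space K)" by measurable
  qed auto
  finally show "{v \<in> space (pivot_space K). x < right_gap (v ` {1..K}) (u v)} \<in> sets (pivot_space K)" .
qed

lemma emeasure_unif_prod_avoid:
  assumes "finite I" "0 \<le> u" "u + x \<le> 1" "0 \<le> x"
  shows "emeasure (unif_prod I) {X \<in> space (unif_prod I). \<forall>b\<in>I. X b \<in> - {u<..u+x}} = ennreal ((1 - x) ^ card I)"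
proof -
  interpret product_prob_space "\<lambda>_. unif" I ..
  have "emeasure (unif_prod I) {X \<in> space (unif_prod I). \<forall>b\<in>I. X b \<in> - {u<..u+x}} = (\<Prod>b\<in>I. emeasure unif (- {u<..u+x}))"
    by (rule emeasure_PiM_Collect) (use assms in auto)
  then show ?thesis using assms by (simp add: measure_unif_compl_Ioc ennreal_power)
qed

text \<open>For \<open>x < 1\<close> the gap at 0 exceeds \<open>x\<close> iff each of the
  \<open>K\<close> independent pivots avoids \<open>{0<..x}\<close>.\<close>

lemma right_gap_law_0:
  assumes K: "K \<ge> 1"
  shows "distr (pivot_space K) borel (\<lambda>v. right_gap (v ` {1..K}) 0) = spacing_law K"
proof (rule eq_spacing_law[OF K])
  show "prob_space (pivot_space K)" unfolding pivot_space_def by (rule prob_space_unif_prod)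
  show "(\<lambda>v. right_gap (v ` {1..K}) 0) \<in> borel_measurable (pivot_space K)"
    by (rule measurable_right_gap) simp
  show "AE v in pivot_space K. 0 < right_gap (v ` {1..K}) 0"
    using AE_good_pivots by eventually_elim (auto simp: right_gap_greater_iff)
  fix x :: real assume x: "0 \<le> x" "x \<le> 1"
  show "emeasure (pivot_space K) {v \<in> space (pivot_space K). x < right_gap (v ` {1..K}) 0} = ennreal ((1 - x) ^ K)"
  proof (cases "x < 1")
    case True
    have "{v \<in> space (pivot_space K). x < right_gap (v ` {1..K}) 0} =
        {X \<in> space (unif_prod {1..K}). \<forall>b\<in>{1..K}. X b \<in> - {0<..0+x}}"
      using True by (auto simp: right_gap_greater_iff pivot_space_def not_less not_le)
    then show ?thesis using emeasure_unif_prod_avoid[of "{1..K}" 0 x] x by (simp add: pivot_space_def)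
  next
    case False
    then show ?thesis using x K by (simp add: right_gap_greater_iff)
  qed
qed

text \<open>Condition on the left end point \<open>u = v a\<close>: the gap exceeds \<open>x\<close>
  iff \<open>u + x < 1\<close> and the other \<open>K - 1\<close> pivots avoid
  \<open>{u<..u+x}\<close>. The avoidance has probability \<open>(1 - x) ^ (K - 1)\<close> whatever
  \<open>u\<close> is, and \<open>u < 1 - x\<close> supplies the last factor.\<close>

lemma right_gap_law:
  assumes a: "a \<in> {1..K}"
  shows "distr (pivot_space K) borel (\<lambda>v. right_gap (v ` {1..K}) (v a)) = spacing_law K"
proof (rule eq_spacing_law)
  show "K \<ge> 1" using a by simp
  show "prob_space (pivot_space K)" unfolding pivot_space_def by (rule prob_space_unif_prod)
  show meas: "(\<lambda>v. right_gap (v ` {1..K}) (v a)) \<in> borel_measurable (pivot_space K)"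
    by (intro measurable_right_gap measurable_pivot_component a)
  show "AE v in pivot_space K. 0 < right_gap (v ` {1..K}) (v a)"
    using AE_good_pivots
  proof eventually_elim
    case (elim v)
    then have "v a < 1" using a unfolding good_pivots_def by force
    then show ?case by (auto simp: right_gap_greater_iff)
  qed
  fix x :: real assume x: "0 \<le> x" "x \<le> 1"
  let ?J = "{1..K} - {a}"
  have cJ: "card ?J = K - 1" using a by simp
  define E where "E = {v \<in> space (unif_prod {1..K}). x < right_gap (v ` {1..K}) (v a)}"
  have E: "E \<in> sets (unif_prod {1..K})" unfolding E_def using meas by (simp add: pivot_space_def)
  have "emeasure (unif_prod {1..K}) E =
     emeasure (unif \<Otimes>\<^sub>M unif_prod ?J) ((\<lambda>(x, X). X(a := x)) -` E \<inter> space (unif \<Otimes>\<^sub>M unif_prod ?J))"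
    using E measurable_upd_unif[OF a] by (subst unif_prod_split[OF a]) (simp add: emeasure_distr)
  also have "\<dots> = (\<integral>\<^sup>+u. emeasure (unif_prod ?J) (Pair u -` ((\<lambda>(x, X). X(a := x)) -` E \<inter> space (unif \<Otimes>\<^sub>M unif_prod ?J))) \<partial>unif)"
    by (rule unif_prod.emeasure_pair_measure_alt) (use E measurable_upd_unif[OF a] in measurable)
  also have "\<dots> = (\<integral>\<^sup>+u. ennreal ((1 - x) ^ (K - 1)) * indicator {0..<1 - x} u \<partial>unif)"
  proof (rule nn_integral_cong_AE)
    show "AE u in unif. emeasure (unif_prod ?J) (Pair u -` ((\<lambda>(x, X). X(a := x)) -` E \<inter> space (unif \<Otimes>\<^sub>M unif_prod ?J)))
       = ennreal ((1 - x) ^ (K - 1)) * indicator {0..<1 - x} u"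
      using AE_unif_01
    proof eventually_elim
      case (elim u)
      have "X(a := u) \<in> space (unif_prod {1..K})" if "X \<in> space (unif_prod ?J)" for X
        using that a by (auto simp: space_PiM PiE_def extensional_def)
      then have "Pair u -` ((\<lambda>(x, X). X(a := x)) -` E \<inter> space (unif \<Otimes>\<^sub>M unif_prod ?J)) =
        {X \<in> space (unif_prod ?J). u + x < 1 \<and> (\<forall>b\<in>?J. X b \<in> - {u<..u+x})}"
      proof -
        have im: "(X(a := u)) ` {1..K} = insert u (X ` ?J)" for X :: "nat \<Rightarrow> real"
          using a by (auto simp: image_iff)
        have "x < right_gap ((X(a := u)) ` {1..K}) u \<longleftrightarrow> u + x < 1 \<and> (\<forall>b\<in>?J. X b \<in> - {u<..u+x})" for X
          unfolding im by (subst right_gap_greater_iff) (simp, force simp: not_less not_le)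
        then show ?thesis using \<open>\<And>X. X \<in> space (unif_prod ?J) \<Longrightarrow> X(a := u) \<in> space (unif_prod {1..K})\<close>
          unfolding E_def by (auto simp: space_pair_measure simp del: One_nat_def)
      qed
      then show ?case
        using emeasure_unif_prod_avoid[of ?J u x] elim x cJ
        by (cases "u + x < 1") (auto simp: indicator_def)
    qed
  qed
  also have "\<dots> = ennreal ((1 - x) ^ (K - 1)) * emeasure unif {0..<1 - x}"
    by (subst nn_integral_cmult_indicator) auto
  also have "emeasure unif {0..<1 - x} = ennreal (1 - x)"
  proof -
    have "{0..1} \<inter> {0..<1 - x} = {0..<1 - x}" using x by auto
    then show ?thesis using x by (simp add: emeasure_unif)
  qed
  also have "ennreal ((1 - x) ^ (K - 1)) * ennreal (1 - x) = ennreal ((1 - x) ^ K)"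
    using x a by (simp add: ennreal_mult[symmetric] power_Suc2[symmetric] del: power_Suc)
  finally show "emeasure (pivot_space K) {v \<in> space (pivot_space K). x < right_gap (v ` {1..K}) (v a)} = ennreal ((1 - x) ^ K)"
    by (simp add: E_def pivot_space_def)
qed

text \<open>All \<open>K + 1\<close> right gaps have the same law, so expectations of symmetric sums
  over the spacings become one-dimensional integrals.\<close>

theorem expectation_sum_spacing:
  fixes F :: "real \<Rightarrow> real"
  assumes K: "K \<ge> 1" and [measurable]: "F \<in> borel_measurable borel" and F: "integrable (spacing_law K) F"
  shows "integrable (pivot_space K) (\<lambda>v. \<Sum>i=0..K. F (spacing K v i))"
    "(\<integral>v. (\<Sum>i=0..K. F (spacing K v i)) \<partial>pivot_space K) = real (K + 1) * (\<integral>x. F x \<partial>spacing_law K)"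
proof -
  have m0: "(\<lambda>v. right_gap (v ` {1..K}) 0) \<in> borel_measurable (pivot_space K)"
    by (intro measurable_right_gap) simp
  have ma: "(\<lambda>v. right_gap (v ` {1..K}) (v a)) \<in> borel_measurable (pivot_space K)" if "a \<in> {1..K}" for a
    by (intro measurable_right_gap measurable_pivot_component that)
  have i0: "integrable (pivot_space K) (\<lambda>v. F (right_gap (v ` {1..K}) 0))"
    "(\<integral>v. F (right_gap (v ` {1..K}) 0) \<partial>pivot_space K) = (\<integral>x. F x \<partial>spacing_law K)"
    using integrable_distr[OF m0, of F] integral_distr[OF m0, of F] F by (simp_all only: right_gap_law_0[OF K] assms(2))
  have ia: "integrable (pivot_space K) (\<lambda>v. F (right_gap (v ` {1..K}) (v a)))"
    "(\<integral>v. F (right_gap (v ` {1..K}) (v a)) \<partial>pivot_space K) = (\<integral>x. F x \<partial>spacing_law K)" if a: "a \<in> {1..K}" for a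
    using integrable_distr[OF ma[OF a], of F] integral_distr[OF ma[OF a], of F] F
    by (simp_all only: right_gap_law[OF a] assms(2))
  let ?G = "\<lambda>v. F (right_gap (v ` {1..K}) 0) + (\<Sum>a=1..K. F (right_gap (v ` {1..K}) (v a)))"
  have AE: "AE v in pivot_space K. (\<Sum>i=0..K. F (spacing K v i)) = ?G v"
    using AE_good_pivots by eventually_elim (rule sum_spacing_eq_sum_right_gap)
  have G: "integrable (pivot_space K) ?G"
    by (intro Bochner_Integration.integrable_add Bochner_Integration.integrable_sum i0 ia)
  have [measurable]: "(\<lambda>v. \<Sum>i=0..K. F (spacing K v i)) \<in> borel_measurable (pivot_space K)" by measurable
  show "integrable (pivot_space K) (\<lambda>v. \<Sum>i=0..K. F (spacing K v i))"
    by (rule iffD2[OF integrable_cong_AE G]) (use G AE in auto)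
  have "(\<integral>v. (\<Sum>i=0..K. F (spacing K v i)) \<partial>pivot_space K) = (\<integral>v. ?G v \<partial>pivot_space K)"
    using G AE by (intro integral_cong_AE) auto
  also have "\<dots> = real (K + 1) * (\<integral>x. F x \<partial>spacing_law K)"
    by (simp only: Bochner_Integration.integral_add[OF i0(1) Bochner_Integration.integrable_sum[OF ia(1)]]
          Bochner_Integration.integral_sum[OF ia(1)] i0(2) sum.cong[OF refl ia(2)]) (simp add: algebra_simps)
  finally show "(\<integral>v. (\<Sum>i=0..K. F (spacing K v i)) \<partial>pivot_space K) = real (K + 1) * (\<integral>x. F x \<partial>spacing_law K)" .
qed

lemma spacing_law_integral:
  fixes F :: "real \<Rightarrow> real"
  assumes [measurable]: "F \<in> borel_measurable borel" and cont: "continuous_on {0..1} F"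
    and I: "((\<lambda>x. F x * (1 - x) ^ (K - 1)) has_integral c) {0..1}"
  shows "integrable (spacing_law K) F" "(\<integral>x. F x \<partial>spacing_law K) = real K * c"
proof -
  let ?g = "\<lambda>x. real K * (1 - x) ^ (K - 1) * indicator {0..1} x"
  have den: "spacing_law K = density lborel (\<lambda>x. ennreal (?g x))"
    unfolding spacing_law_def by (intro density_cong) (auto simp: indicator_def)
  have c2: "continuous_on {0..1} (\<lambda>x. F x * (1 - x) ^ (K - 1))" using cont by (intro continuous_intros)
  have si: "set_integrable lborel {0..1} (\<lambda>x. F x * (1 - x) ^ (K - 1))"
    by (rule borel_integrable_atLeastAtMost'[OF c2])
  have c: "(LBINT x:{0..1}. F x * (1 - x) ^ (K - 1)) = c"
    using set_borel_integral_eq_integral(2)[OF si] I by (simp add: integral_unique)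
  have eq: "?g x *\<^sub>R F x = real K * (indicator {0..1} x *\<^sub>R (F x * (1 - x) ^ (K - 1)))" for x
    by simp
  show "integrable (spacing_law K) F"
    unfolding den
  proof (subst integrable_density)
    show "AE x in lborel. 0 \<le> ?g x" by (auto simp: indicator_def)
    show "integrable lborel (\<lambda>x. ?g x *\<^sub>R F x)"
      unfolding eq using si unfolding set_integrable_def by (rule integrable_mult_right)
  qed auto
  have "(\<integral>x. F x \<partial>spacing_law K) = (\<integral>x. ?g x *\<^sub>R F x \<partial>lborel)"
    unfolding den by (rule integral_density) (auto simp: indicator_def)
  also have "\<dots> = real K * c"
    unfolding eq c[symmetric] set_lebesgue_integral_def by simp
  finally show "(\<integral>x. F x \<partial>spacing_law K) = real K * c" .
qed

section \<open>Sublist sizes and classification cost\<close>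

text \<open>Independence of one coordinate, phrased through invariance of \<open>g\<close> under
  updates at \<open>i\<close>. In this form it applies to the counters and to the tree chosen before
  an element is seen.\<close>

lemma integral_unif_prod_mult_component:
  fixes g :: "('i \<Rightarrow> real) \<Rightarrow> real"
  assumes i: "i \<in> I" and g[measurable]: "g \<in> borel_measurable (unif_prod I)"
    and B: "\<And>a. \<bar>g a\<bar> \<le> B" and indep: "\<And>a x. g (a(i := x)) = g a"
    and A[measurable]: "A \<in> sets borel"
  shows "(\<integral>a. g a * indicator A (a i) \<partial>unif_prod I) = measure unif A * (\<integral>a. g a \<partial>unif_prod I)"
proof -
  let ?J = "unif_prod (I - {i})"
  interpret P: pair_sigma_finite unif ?J ..
  interpret PP: prob_space "unif \<Otimes>\<^sub>M ?J"
    by (rule prob_space_pair) (rule prob_space_unif prob_space_unif_prod)+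
  have [measurable]: "(\<lambda>a. a i) \<in> borel_measurable (unif_prod I)" by (rule measurable_unif_component[OF i])
  note upd = measurable_upd_unif[OF i]
  have mg: "(\<lambda>p. g ((snd p)(i := fst p))) \<in> borel_measurable (unif \<Otimes>\<^sub>M ?J)"
    using measurable_compose[OF upd g] by (simp add: split_beta)
  define c where "c = (\<integral>X. g (X(i := 0)) \<partial>?J)"
  have gi: "g (X(i := x)) = g (X(i := 0))" for X x
    using indep[of "X(i := 0)" x] by simp
  have *: "(\<integral>a. g a * indicator A' (a i) \<partial>unif_prod I) = measure unif A' * c" if A'[measurable]: "A' \<in> sets borel" for A'
  proof -
    have meas: "(\<lambda>p. g ((snd p)(i := fst p)) * indicator A' (fst p)) \<in> borel_measurable (unif \<Otimes>\<^sub>M ?J)"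
      using mg by measurable
    have int: "integrable (unif \<Otimes>\<^sub>M ?J) (\<lambda>p. g ((snd p)(i := fst p)) * indicator A' (fst p))"
      by (rule PP.integrable_const_bound[where B=B])
         (use meas B in \<open>auto simp: abs_mult indicator_def intro: order_trans[OF abs_ge_zero B]\<close>)
    have "(\<integral>a. g a * indicator A' (a i) \<partial>unif_prod I) =
        (\<integral>a. g a * indicator A' (a i) \<partial>distr (unif \<Otimes>\<^sub>M ?J) (unif_prod I) (\<lambda>(x, X). X(i := x)))"
      by (simp only: unif_prod_split[OF i, symmetric])
    also have "\<dots> = (\<integral>p. g ((snd p)(i := fst p)) * indicator A' (fst p) \<partial>(unif \<Otimes>\<^sub>M ?J))"
      by (subst integral_distr[OF upd]) (auto simp: split_beta)
    also have "\<dots> = (\<integral>x. (\<integral>X. g ((snd (x, X))(i := fst (x, X))) * indicator A' (fst (x, X)) \<partial>?J) \<partial>unif)"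
      using P.integral_fst'[OF int] by simp
    also have "\<dots> = (\<integral>x. c * indicator A' x \<partial>unif)"
    proof (intro Bochner_Integration.integral_cong refl)
      fix x
      show "(\<integral>X. g ((snd (x, X))(i := fst (x, X))) * indicator A' (fst (x, X)) \<partial>?J) = c * indicator A' x"
        unfolding fst_conv snd_conv gi[of _ x] c_def by simp
    qed
    also have "\<dots> = measure unif A' * c" by simp
    finally show ?thesis .
  qed
  \<comment> \<open>The case of the whole line identifies the constant \<open>c\<close>.\<close>
  have "(\<integral>a. g a \<partial>unif_prod I) = c" using *[of UNIV] unif.prob_space by simp
  then show ?thesis using *[OF A] by simp
qed

section \<open>Numbers of hits in a fixed set\<close>

definition seq_space :: "(nat \<Rightarrow> real) measure" where
  "seq_space = unif_prod {1..}"

lemma prob_space_seq_space: "prob_space seq_space"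
  unfolding seq_space_def by (rule prob_space_unif_prod)

interpretation seq_space: prob_space seq_space by (rule prob_space_seq_space)

lemma measurable_seq_component: "k \<ge> 1 \<Longrightarrow> (\<lambda>a. a k) \<in> borel_measurable seq_space"
  unfolding seq_space_def by (intro measurable_unif_component) simp

lemma integral_seq_mult_component:
  assumes "k \<ge> 1" "g \<in> borel_measurable seq_space" "\<And>a. \<bar>g a\<bar> \<le> B" "\<And>a x. g (a(k := x)) = g a" "A \<in> sets borel"
  shows "(\<integral>a. g a * indicator A (a k) \<partial>seq_space) = measure unif A * (\<integral>a. g a \<partial>seq_space)"
  using assms unfolding seq_space_def by (intro integral_unif_prod_mult_component) auto

lemma input_space_eq: "input_space K = pivot_space K \<Otimes>\<^sub>M seq_space"
  by (simp add: input_space_def seq_space_def)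

definition hits :: "real set \<Rightarrow> (nat \<Rightarrow> real) \<Rightarrow> nat \<Rightarrow> nat" where
  "hits A a m = card {j \<in> {1..m}. a j \<in> A}"

lemma hits_0 [simp]: "hits A a 0 = 0"
  by (simp add: hits_def)

lemma hits_Suc: "hits A a (Suc m) = hits A a m + (if a (Suc m) \<in> A then 1 else 0)"
proof -
  have "{j \<in> {1..Suc m}. a j \<in> A} = {j \<in> {1..m}. a j \<in> A} \<union> (if a (Suc m) \<in> A then {Suc m} else {})"
    by (auto simp: le_Suc_eq)
  then show ?thesis unfolding hits_def by (auto simp: card_insert_if)
qed

lemma hits_le: "hits A a m \<le> m"
  by (induction m) (auto simp: hits_Suc)

lemma hits_upd: "k > m \<Longrightarrow> hits A (a(k := x)) m = hits A a m"
  by (induction m) (auto simp: hits_Suc)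

lemma measurable_hits [measurable]:
  assumes [measurable]: "A \<in> sets borel"
  shows "(\<lambda>a. hits A a m) \<in> measurable seq_space (count_space UNIV)"
proof (induction m)
  case (Suc m)
  have [measurable]: "(\<lambda>a. a (Suc m)) \<in> borel_measurable seq_space"
    by (rule measurable_seq_component) simp
  note [measurable] = Suc
  have "(\<lambda>a. hits A a (Suc m)) = (\<lambda>a. if a (Suc m) \<in> A then Suc (hits A a m) else hits A a m)"
    by (auto simp: hits_Suc)
  then show ?case by (simp only:) measurable
qed simp

text \<open>Conditioning on the last element turns the induction step into Pascal's rule.\<close>

lemma hits_binomial:
  assumes A[measurable]: "A \<in> sets borel"
  defines "p \<equiv> measure unif A"
  shows "(\<integral>a. (of_bool (hits A a m = j) :: real) \<partial>seq_space) = real (m choose j) * p ^ j * (1 - p) ^ (m - j)"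
proof (induction m arbitrary: j)
  case 0
  show ?case using seq_space.prob_space by (cases j) auto
next
  case (Suc m)
  define P where "P j = (\<integral>a. (of_bool (hits A a m = j) :: real) \<partial>seq_space)" for j
  have int: "integrable seq_space (\<lambda>a. of_bool (hits A a m = j) * f a :: real)"
    if "f \<in> borel_measurable seq_space" "\<And>a. \<bar>f a\<bar> \<le> 1" for j f
  proof (rule seq_space.integrable_const_bound[where B=1])
    note [measurable] = that(1)
    show "(\<lambda>a. of_bool (hits A a m = j) * f a) \<in> borel_measurable seq_space" by measurable
  qed (use that in \<open>auto simp: abs_mult\<close>)
  have [measurable]: "(\<lambda>a. a (Suc m)) \<in> borel_measurable seq_space"
    by (rule measurable_seq_component) simp
  have ind: "(\<integral>a. of_bool (hits A a m = j) * indicator A (a (Suc m)) \<partial>seq_space) = p * P j" for j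
    unfolding P_def p_def
    by (rule integral_seq_mult_component[where B=1]) (auto simp: hits_upd)
  have i1: "integrable seq_space (\<lambda>a. of_bool (hits A a m = j) * indicator A (a (Suc m)) :: real)" for j
    by (rule int) auto
  have i2: "integrable seq_space (\<lambda>a. of_bool (hits A a m = j) :: real)" for j
    using int[of "\<lambda>_. 1"] by simp
  have P: "P j = real (m choose j) * p ^ j * (1 - p) ^ (m - j)" for j
    unfolding P_def by (rule Suc.IH)
  show ?case
  proof (cases j)
    case 0
    have "(\<integral>a. (of_bool (hits A a (Suc m) = j) :: real) \<partial>seq_space) =
       (\<integral>a. (of_bool (hits A a m = 0) :: real) - of_bool (hits A a m = 0) * indicator A (a (Suc m)) \<partial>seq_space)"
      using 0 by (intro Bochner_Integration.integral_cong) (auto simp: hits_Suc)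
    also have "\<dots> = P 0 - p * P 0"
      by (subst Bochner_Integration.integral_diff[OF i2 i1]) (simp only: ind P_def)
    finally show ?thesis using 0 by (simp add: P algebra_simps)
  next
    case (Suc i)
    have "(\<integral>a. (of_bool (hits A a (Suc m) = j) :: real) \<partial>seq_space) =
       (\<integral>a. ((of_bool (hits A a m = j) :: real) - of_bool (hits A a m = j) * indicator A (a (Suc m))) +
          of_bool (hits A a m = i) * indicator A (a (Suc m)) \<partial>seq_space)"
      using Suc by (intro Bochner_Integration.integral_cong) (auto simp: hits_Suc)
    also have "\<dots> = P j - p * P j + p * P i"
      by (subst Bochner_Integration.integral_add[OF Bochner_Integration.integrable_diff[OF i2 i1] i1],
          subst Bochner_Integration.integral_diff[OF i2 i1]) (simp only: ind P_def)
    also have "\<dots> = real (Suc m choose Suc i) * p ^ Suc i * (1 - p) ^ (m - i)"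
    proof (cases "Suc i \<le> m")
      case True
      then have e: "m - i = Suc (m - Suc i)" by simp
      show ?thesis unfolding P Suc e by (simp add: algebra_simps)
    next
      case False
      then show ?thesis unfolding P Suc by (simp add: algebra_simps binomial_eq_0)
    qed
    finally show ?thesis using Suc by simp
  qed
qed

text \<open>The cross term with the new summand vanishes by independence, since the indicator has
  mean \<open>p\<close>; every summand adds at most 1.\<close>

lemma hits_second_moment:
  assumes A[measurable]: "A \<in> sets borel"
  defines "p \<equiv> measure unif A"
  shows "(\<integral>a. (real (hits A a m) - real m * p)\<^sup>2 \<partial>seq_space) \<le> real m"
proof (induction m)
  case (Suc m)
  have p: "0 \<le> p" "p \<le> 1" by (auto simp: p_def)
  define S where "S a = real (hits A a m) - real m * p" for a
  have [measurable]: "S \<in> borel_measurable seq_space" unfolding S_def by measurable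
  have [measurable]: "(\<lambda>a. a (Suc m)) \<in> borel_measurable seq_space"
    by (rule measurable_seq_component) simp
  have S: "\<bar>S a\<bar> \<le> real m" for a
  proof -
    have "0 \<le> real m * p" "real m * p \<le> real m" using p by (auto simp: mult_left_le)
    moreover have "real (hits A a m) \<le> real m" using hits_le[of A a m] by simp
    ultimately show ?thesis unfolding S_def by (simp add: abs_le_iff)
  qed
  have SS: "\<bar>(S a)\<^sup>2\<bar> \<le> (real m)\<^sup>2" for a using S[of a] by (simp add: abs_le_square_iff[symmetric])
  let ?I = "\<lambda>a. indicator A (a (Suc m)) :: real"
  have i1: "integrable seq_space (\<lambda>a. (S a)\<^sup>2)"
    by (rule seq_space.integrable_const_bound[where B="(real m)\<^sup>2"]) (use SS in auto)
  have i2: "integrable seq_space S"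
    by (rule seq_space.integrable_const_bound[where B="real m"]) (use S in auto)
  have i3: "integrable seq_space (\<lambda>a. S a * ?I a)"
    by (rule seq_space.integrable_const_bound[where B="real m"]) (use S in \<open>auto simp: indicator_def\<close>)
  have i4: "integrable seq_space (\<lambda>a. (?I a - p)\<^sup>2)"
    by (rule seq_space.integrable_const_bound[where B=1])
       (use p in \<open>auto simp: indicator_def power_le_one abs_square_le_1\<close>)
  have E3: "(\<integral>a. S a * ?I a \<partial>seq_space) = p * (\<integral>a. S a \<partial>seq_space)"
    unfolding p_def
  proof (rule integral_seq_mult_component[where B="real m"])
    show "S (a(Suc m := x)) = S a" for a x by (simp add: S_def hits_upd)
  qed (use S in auto)
  have E4: "(\<integral>a. (?I a - p)\<^sup>2 \<partial>seq_space) \<le> 1"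
  proof -
    have "(\<integral>a. (?I a - p)\<^sup>2 \<partial>seq_space) \<le> (\<integral>a. 1 \<partial>seq_space)"
      using i4 p by (intro integral_mono) (auto simp: indicator_def power_le_one abs_square_le_1)
    then show ?thesis using seq_space.prob_space by simp
  qed
  have "(\<integral>a. (real (hits A a (Suc m)) - real (Suc m) * p)\<^sup>2 \<partial>seq_space) =
     (\<integral>a. (S a)\<^sup>2 + (2 * (S a * ?I a) - 2 * p * S a) + (?I a - p)\<^sup>2 \<partial>seq_space)"
  proof (intro Bochner_Integration.integral_cong refl)
    fix a
    have "real (hits A a (Suc m)) - real (Suc m) * p = S a + (?I a - p)"
      by (simp add: S_def hits_Suc indicator_def algebra_simps)
    then show "(real (hits A a (Suc m)) - real (Suc m) * p)\<^sup>2 = (S a)\<^sup>2 + (2 * (S a * ?I a) - 2 * p * S a) + (?I a - p)\<^sup>2"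
      by (simp add: power2_eq_square algebra_simps)
  qed
  also have "\<dots> = (\<integral>a. (S a)\<^sup>2 \<partial>seq_space) + (2 * (p * (\<integral>a. S a \<partial>seq_space)) - 2 * p * (\<integral>a. S a \<partial>seq_space))
      + (\<integral>a. (?I a - p)\<^sup>2 \<partial>seq_space)"
    using i1 i2 i3 i4 E3 by simp
  also have "\<dots> \<le> real m + 1" using Suc.IH E4 by (simp add: S_def)
  finally show ?case by simp
qed simp

lemma hits_abs_deviation:
  assumes A[measurable]: "A \<in> sets borel"
  defines "p \<equiv> measure unif A"
  shows "integrable seq_space (\<lambda>a. \<bar>real (hits A a m) - real m * p\<bar>)"
    "(\<integral>a. \<bar>real (hits A a m) - real m * p\<bar> \<partial>seq_space) \<le> sqrt (real m)"
proof -
  have p: "0 \<le> p" "p \<le> 1" by (auto simp: p_def)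
  have X: "\<bar>real (hits A a m) - real m * p\<bar> \<le> real m" for a
  proof -
    have "0 \<le> real m * p" "real m * p \<le> real m" using p by (auto simp: mult_left_le)
    moreover have "real (hits A a m) \<le> real m" using hits_le[of A a m] by simp
    ultimately show ?thesis by (simp add: abs_le_iff)
  qed
  have [measurable]: "(\<lambda>a. real (hits A a m) - real m * p) \<in> borel_measurable seq_space" by measurable
  show i: "integrable seq_space (\<lambda>a. \<bar>real (hits A a m) - real m * p\<bar>)"
  proof (rule seq_space.integrable_const_bound[where B="real m"])
    show "AE a in seq_space. norm \<bar>real (hits A a m) - real m * p\<bar> \<le> real m" using X by simp
  qed measurable
  have i2: "integrable seq_space (\<lambda>a. (real (hits A a m) - real m * p)\<^sup>2)"
  proof (rule seq_space.integrable_const_bound[where B="(real m)\<^sup>2"])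
    have "(real (hits A a m) - real m * p)\<^sup>2 \<le> (real m)\<^sup>2" for a
      using X[of a] by (simp add: abs_le_square_iff[symmetric])
    then show "AE a in seq_space. norm ((real (hits A a m) - real m * p)\<^sup>2) \<le> (real m)\<^sup>2" by simp
  qed measurable
  show "(\<integral>a. \<bar>real (hits A a m) - real m * p\<bar> \<partial>seq_space) \<le> sqrt (real m)"
  proof (cases "m = 0")
    case False
    \<comment> \<open>The inequality \<open>2 * x * s \<le> x\<^sup>2 + s\<^sup>2\<close> at
      \<open>s = sqrt m\<close> takes the place of Cauchy-Schwarz.\<close>
    define s where "s = sqrt (real m)"
    have s: "s > 0" "s\<^sup>2 = real m" using False by (auto simp: s_def)
    have "(\<integral>a. \<bar>real (hits A a m) - real m * p\<bar> \<partial>seq_space) \<le>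
       (\<integral>a. ((real (hits A a m) - real m * p)\<^sup>2 / s + s) / 2 \<partial>seq_space)"
    proof (rule integral_mono[OF i])
      fix a
      define x where "x = \<bar>real (hits A a m) - real m * p\<bar>"
      have "0 \<le> (x - s)\<^sup>2" by simp
      then have "2 * x * s \<le> x\<^sup>2 + s\<^sup>2" by (simp add: power2_eq_square algebra_simps)
      then have "x \<le> (x\<^sup>2 / s + s) / 2" using s by (simp add: field_simps power2_eq_square)
      then show "\<bar>real (hits A a m) - real m * p\<bar> \<le> ((real (hits A a m) - real m * p)\<^sup>2 / s + s) / 2"
        by (simp add: x_def)
    qed (use i2 in auto)
    also have "\<dots> = ((\<integral>a. (real (hits A a m) - real m * p)\<^sup>2 \<partial>seq_space) / s + s) / 2"
      using i2 seq_space.prob_space by simp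
    also have "\<dots> \<le> (real m / s + s) / 2"
      using hits_second_moment[OF A, of m] s unfolding p_def
      by (intro divide_right_mono add_right_mono) auto
    also have "real m / s = s" using s by (simp add: power2_eq_square field_simps)
    finally show ?thesis by (simp add: s_def)
  qed simp
qed

lemma sublist_count_eq_hits: "sublist_count K (v, a) m i = hits (sublist_interval K v i) a m"
  by (simp add: sublist_count_def hits_def)

lemma sets_sublist_interval [measurable]: "sublist_interval K v i \<in> sets borel"
  by (simp add: sublist_interval_def)

lemma prob_space_pivot_space: "prob_space (pivot_space K)"
  unfolding pivot_space_def by (rule prob_space_unif_prod)

interpretation pivot_space: prob_space "pivot_space K" for K by (rule prob_space_pivot_space)

interpretation input_pair: pair_sigma_finite "pivot_space K" seq_space for K ..

lemma prob_space_input_space: "prob_space (input_space K)"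
  unfolding input_space_eq by (rule prob_space_pair) (rule prob_space_pivot_space prob_space_seq_space)+

interpretation input_space: prob_space "input_space K" for K by (rule prob_space_input_space)

section \<open>Measurability of the counters, the chosen trees and the step costs\<close>

lemma measurable_sublist_count [measurable]:
  "(\<lambda>\<omega>. sublist_count K \<omega> m i) \<in> measurable (input_space K) (count_space UNIV)"
proof (induction m)
  case 0
  have "sublist_count K \<omega> 0 i = 0" for \<omega> by (cases \<omega>) (simp add: sublist_count_eq_hits)
  then show ?case by simp
next
  case (Suc m)
  note [measurable] = Suc
  have [measurable]: "(\<lambda>\<omega>. snd \<omega> (Suc m)) \<in> borel_measurable (input_space K)"
    unfolding input_space_eq by (intro measurable_compose[OF measurable_snd] measurable_seq_component) simp
  have [measurable]: "(\<lambda>\<omega>. pivot K (fst \<omega>) j) \<in> borel_measurable (input_space K)" for j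
    unfolding input_space_eq by measurable
  have "(\<lambda>\<omega>. sublist_count K \<omega> (Suc m) i) = (\<lambda>\<omega>. if pivot K (fst \<omega>) i < snd \<omega> (Suc m) \<and> snd \<omega> (Suc m) < pivot K (fst \<omega>) (i + 1)
      then Suc (sublist_count K \<omega> m i) else sublist_count K \<omega> m i)"
  proof
    fix \<omega> :: "(nat \<Rightarrow> real) \<times> (nat \<Rightarrow> real)"
    obtain v a where "\<omega> = (v, a)" by force
    then show "sublist_count K \<omega> (Suc m) i = (if pivot K (fst \<omega>) i < snd \<omega> (Suc m) \<and> snd \<omega> (Suc m) < pivot K (fst \<omega>) (i + 1)
      then Suc (sublist_count K \<omega> m i) else sublist_count K \<omega> m i)"
      by (simp add: sublist_count_eq_hits hits_Suc sublist_interval_def)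
  qed
  then show ?case by (simp only:) measurable
qed

text \<open>The tree is a function of the list of counters, and lists of naturals form a countable
  type, so any function of that list is measurable.\<close>

lemma measurable_chosen_tree [measurable]:
  "(\<lambda>\<omega>. chosen_tree K ord \<omega> k) \<in> measurable (input_space K) (count_space UNIV)"
proof -
  let ?N = "\<lambda>is \<omega>. map (\<lambda>i. sublist_count K \<omega> (k - 1) i) is"
  have "?N is \<in> measurable (input_space K) (count_space UNIV)" for "is"
  proof (induction "is")
    case (Cons i "is")
    have "(\<lambda>\<omega>. (\<lambda>l \<omega>. sublist_count K \<omega> (k - 1) i # l) (?N is \<omega>) \<omega>) \<in> measurable (input_space K) (count_space UNIV)"
      by (rule measurable_compose_countable[OF _ Cons]) measurable
    then show ?case by simp
  qed simp
  then have "(\<lambda>\<omega>. opt_tree K ord (\<lambda>i. real (?N [0..<Suc K] \<omega> ! i + 1))) \<in> measurable (input_space K) (count_space UNIV)"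
    by (rule measurable_compose) simp
  moreover have "chosen_tree K ord \<omega> k = opt_tree K ord (\<lambda>i. real (?N [0..<Suc K] \<omega> ! i + 1))" for \<omega>
    unfolding chosen_tree_def by (rule opt_tree_cong) (simp del: upt_Suc)
  ultimately show ?thesis by simp
qed

definition step_cost :: "nat \<Rightarrow> nat tree rel \<Rightarrow> (nat \<Rightarrow> real) \<times> (nat \<Rightarrow> real) \<Rightarrow> nat \<Rightarrow> real" where
  "step_cost K ord \<omega> k = (\<Sum>i=0..K. of_bool (snd \<omega> k \<in> sublist_interval K (fst \<omega>) i) * real (leaf_depth (chosen_tree K ord \<omega> k) i))"

lemma measurable_step_cost:
  assumes "k \<ge> 1" shows "(\<lambda>\<omega>. step_cost K ord \<omega> k) \<in> borel_measurable (input_space K)"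
proof -
  have [measurable]: "(\<lambda>\<omega>. snd \<omega> k) \<in> borel_measurable (input_space K)"
    unfolding input_space_eq by (intro measurable_compose[OF measurable_snd] measurable_seq_component assms)
  have [measurable]: "(\<lambda>\<omega>. pivot K (fst \<omega>) j) \<in> borel_measurable (input_space K)" for j
    unfolding input_space_eq by measurable
  have [measurable]: "(\<lambda>\<omega>. real (leaf_depth (chosen_tree K ord \<omega> k) i)) \<in> borel_measurable (input_space K)" for i
    by (rule measurable_compose[OF measurable_chosen_tree]) simp
  show ?thesis unfolding step_cost_def sublist_interval_def greaterThanLessThan_iff
    by (intro borel_measurable_sum borel_measurable_times) measurable
qed

context
  fixes K :: nat and ord :: "nat tree rel"
  assumes ord: "linear_order_on (search_trees K) ord"
begin

lemma chosen_tree_in: "chosen_tree K ord \<omega> k \<in> search_trees K"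
  unfolding chosen_tree_def by (rule tree_cost_opt_tree(1)[OF ord])

lemma partition_cost_eq:
  "partition_cost K ord piv n \<omega> = (\<Sum>k=1..n-K. step_cost K ord \<omega> k) + real (cmp_count piv (fst \<omega>))"
proof -
  obtain v a where \<omega>: "\<omega> = (v, a)" by force
  have "(\<Sum>t\<in>search_trees K. \<Sum>i=0..K.
        of_bool (chosen_tree K ord (v, a) k = t) * of_bool (a k \<in> sublist_interval K v i) * real (leaf_depth t i))
     = step_cost K ord \<omega> k" for k
  proof -
    have "(\<Sum>t\<in>search_trees K. \<Sum>i=0..K.
        of_bool (chosen_tree K ord (v, a) k = t) * of_bool (a k \<in> sublist_interval K v i) * real (leaf_depth t i))
      = (\<Sum>t\<in>search_trees K. if chosen_tree K ord (v, a) k = t then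
          (\<Sum>i=0..K. of_bool (a k \<in> sublist_interval K v i) * real (leaf_depth t i)) else 0)"
      by (intro sum.cong) auto
    also have "\<dots> = step_cost K ord \<omega> k"
      using chosen_tree_in[of "(v, a)" k] by (simp add: finite_search_trees step_cost_def \<omega>)
    finally show ?thesis .
  qed
  then show ?thesis by (simp add: partition_cost_def \<omega>)
qed

lemma step_cost_bounds:
  assumes good: "good_pivots K v"
  shows "0 \<le> step_cost K ord (v, a) k" "step_cost K ord (v, a) k \<le> real K"
proof -
  show "0 \<le> step_cost K ord (v, a) k" unfolding step_cost_def by (intro sum_nonneg) auto
  have "step_cost K ord (v, a) k \<le> (\<Sum>i=0..K. of_bool (a k \<in> sublist_interval K v i) * real K)"
    unfolding step_cost_def using leaf_depth_le[OF chosen_tree_in] by (intro sum_mono mult_mono) auto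
  also have "\<dots> = (\<Sum>i=0..K. of_bool (a k \<in> sublist_interval K v i)) * real K" by (simp add: sum_distrib_right)
  also have "(\<Sum>i=0..K. of_bool (a k \<in> sublist_interval K v i)) \<le> (1 :: real)"
  proof (cases "\<exists>i\<in>{0..K}. a k \<in> sublist_interval K v i")
    case True
    then obtain i where i: "i \<in> {0..K}" "a k \<in> sublist_interval K v i" by blast
    have "(\<Sum>j=0..K. of_bool (a k \<in> sublist_interval K v j)) = (\<Sum>j\<in>{0..K}. if j = i then 1 else 0 :: real)"
      using disjoint_family_onD[OF disjoint_sublist_intervals[OF good]] i by (intro sum.cong) auto
    then show ?thesis using i by simp
  next
    case False
    then have "(\<Sum>j=0..K. of_bool (a k \<in> sublist_interval K v j)) = (0 :: real)" by (intro sum.neutral) auto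
    then show ?thesis by simp
  qed
  finally show "step_cost K ord (v, a) k \<le> real K" by (simp add: mult_right_mono)
qed

text \<open>Passing to the optimal tree after each classification can only lower the total cost, so the
  optimal costs telescope to a lower bound.\<close>

lemma sum_step_cost_ge:
  "opt_cost K (\<lambda>i. real (sublist_count K (v, a) m i) + 1) - opt_cost K (\<lambda>i. 1) \<le> (\<Sum>k=1..m. step_cost K ord (v, a) k)"
proof (induction m)
  case 0
  then show ?case by (simp add: sublist_count_eq_hits)
next
  case (Suc m)
  define T where "T = chosen_tree K ord (v, a) (Suc m)"
  have T: "T \<in> search_trees K" unfolding T_def by (rule chosen_tree_in)
  have "opt_cost K (\<lambda>i. real (sublist_count K (v, a) (Suc m) i) + 1)
      \<le> tree_cost K T (\<lambda>i. real (sublist_count K (v, a) (Suc m) i) + 1)" by (rule opt_cost_le[OF T])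
  also have "\<dots> = tree_cost K T (\<lambda>i. real (sublist_count K (v, a) m i + 1)) + step_cost K ord (v, a) (Suc m)"
    unfolding tree_cost_def step_cost_def T_def[symmetric] sum.distrib[symmetric]
    by (intro sum.cong) (auto simp: sublist_count_eq_hits hits_Suc algebra_simps)
  also have "tree_cost K T (\<lambda>i. real (sublist_count K (v, a) m i + 1)) = opt_cost K (\<lambda>i. real (sublist_count K (v, a) m i + 1))"
    unfolding T_def chosen_tree_def using tree_cost_opt_tree(2)[OF ord] by simp
  finally show ?case using Suc by (simp add: add.commute)
qed

end

section \<open>Expected partition cost\<close>

lemma integral_input_space:
  fixes f :: "_ \<Rightarrow> real"
  assumes "integrable (input_space K) f"
  shows "(\<integral>\<omega>. f \<omega> \<partial>input_space K) = (\<integral>v. (\<integral>a. f (v, a) \<partial>seq_space) \<partial>pivot_space K)"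
    "integrable (pivot_space K) (\<lambda>v. \<integral>a. f (v, a) \<partial>seq_space)"
  using input_pair.integral_fst'[of K f] input_pair.integrable_fst'[of K f] assms by (simp_all add: input_space_eq)

lemma AE_input_space_fst:
  assumes "AE v in pivot_space K. P v" shows "AE \<omega> in input_space K. P (fst \<omega>)"
proof -
  obtain N where N: "N \<in> null_sets (pivot_space K)" "{v \<in> space (pivot_space K). \<not> P v} \<subseteq> N"
    using assms by (auto simp: eventually_ae_filter)
  then have [measurable]: "N \<in> sets (pivot_space K)" by auto
  have "AE \<omega> in pivot_space K \<Otimes>\<^sub>M seq_space. fst \<omega> \<notin> N"
  proof (rule input_pair.AE_pair_measure)
    show "AE v in pivot_space K. AE a in seq_space. fst (v, a) \<notin> N"
      using AE_not_in[OF N(1)] by eventually_elim simp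
  qed measurable
  then show ?thesis unfolding input_space_eq using AE_space
    by eventually_elim (use N(2) in \<open>auto simp: space_pair_measure\<close>)
qed

lemma AE_input_spaceI:
  assumes "{\<omega> \<in> space (input_space K). P \<omega>} \<in> sets (input_space K)"
    and "\<And>v. v \<in> space (pivot_space K) \<Longrightarrow> good_pivots K v \<Longrightarrow> AE a in seq_space. P (v, a)"
  shows "AE \<omega> in input_space K. P \<omega>"
  unfolding input_space_eq
proof (rule input_pair.AE_pair_measure)
  show "{x \<in> space (pivot_space K \<Otimes>\<^sub>M seq_space). P x} \<in> sets (pivot_space K \<Otimes>\<^sub>M seq_space)"
    using assms(1) by (simp add: input_space_eq)
  show "AE v in pivot_space K. AE a in seq_space. P (v, a)"
    using AE_good_pivots AE_space by eventually_elim (rule assms(2))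
qed

lemma integral_input_space_le:
  fixes f :: "_ \<Rightarrow> real"
  assumes "integrable (input_space K) f"
    and "\<And>v. v \<in> space (pivot_space K) \<Longrightarrow> good_pivots K v \<Longrightarrow> (\<integral>a. f (v, a) \<partial>seq_space) \<le> c"
  shows "(\<integral>\<omega>. f \<omega> \<partial>input_space K) \<le> c"
proof -
  have "(\<integral>v. (\<integral>a. f (v, a) \<partial>seq_space) \<partial>pivot_space K) \<le> (\<integral>v. c \<partial>pivot_space K)"
  proof (rule integral_mono_AE)
    show "AE v in pivot_space K. (\<integral>a. f (v, a) \<partial>seq_space) \<le> c"
      using AE_good_pivots AE_space by eventually_elim (rule assms(2))
  qed (use integral_input_space(2)[OF assms(1)] in auto)
  then show ?thesis using integral_input_space(1)[OF assms(1)] pivot_space.prob_space by simp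
qed

lemma measurable_section:
  assumes "f \<in> borel_measurable (input_space K)" "v \<in> space (pivot_space K)"
  shows "(\<lambda>a. f (v, a)) \<in> borel_measurable seq_space"
  using measurable_compose[OF measurable_Pair1'[OF assms(2)] assms(1)[unfolded input_space_eq]] by simp

lemma sqrt_sum_bound: "(\<Sum>k=1..m. 1 / sqrt (real k)) \<le> 2 * sqrt (real m)"
proof (induction m)
  case (Suc m)
  define x where "x = sqrt (real m)"
  define y where "y = sqrt (real (Suc m))"
  have xy: "0 \<le> x" "x \<le> y" "0 < y" "y\<^sup>2 = x\<^sup>2 + 1" by (auto simp: x_def y_def)
  then have "1 = (y - x) * (y + x)" by (simp add: power2_eq_square algebra_simps)
  also have "\<dots> \<le> (y - x) * (2 * y)" using xy by (intro mult_left_mono) auto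
  finally have "1 / y \<le> (y - x) * (2 * y) / y" using xy by (intro divide_right_mono) auto
  then have "1 / y \<le> 2 * y - 2 * x" using xy by simp
  then show ?case using Suc by (simp add: x_def y_def)
qed simp

section \<open>Classification cost for fixed pivots\<close>

context
  fixes K :: nat and ord :: "nat tree rel" and v :: "nat \<Rightarrow> real"
  assumes ord: "linear_order_on (search_trees K) ord"
    and good: "good_pivots K v" and space: "v \<in> space (pivot_space K)"
begin

lemma sum_abs_deviation:
  "integrable seq_space (\<lambda>a. \<Sum>i=0..K. \<bar>real (sublist_count K (v, a) m i) - real m * spacing K v i\<bar>)"
  "(\<integral>a. (\<Sum>i=0..K. \<bar>real (sublist_count K (v, a) m i) - real m * spacing K v i\<bar>) \<partial>seq_space) \<le> real (K + 1) * sqrt (real m)"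
proof -
  have i: "integrable seq_space (\<lambda>a. \<bar>real (sublist_count K (v, a) m i) - real m * spacing K v i\<bar>)"
    "(\<integral>a. \<bar>real (sublist_count K (v, a) m i) - real m * spacing K v i\<bar> \<partial>seq_space) \<le> sqrt (real m)" if "i \<in> {0..K}" for i
    using that hits_abs_deviation[OF sets_sublist_interval[of K v i], of m] measure_sublist_interval[OF good, of i]
    by (auto simp: sublist_count_eq_hits)
  show "integrable seq_space (\<lambda>a. \<Sum>i=0..K. \<bar>real (sublist_count K (v, a) m i) - real m * spacing K v i\<bar>)"
    by (intro Bochner_Integration.integrable_sum i)
  have "(\<integral>a. (\<Sum>i=0..K. \<bar>real (sublist_count K (v, a) m i) - real m * spacing K v i\<bar>) \<partial>seq_space)
     = (\<Sum>i=0..K. \<integral>a. \<bar>real (sublist_count K (v, a) m i) - real m * spacing K v i\<bar> \<partial>seq_space)"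
    by (intro Bochner_Integration.integral_sum i)
  also have "\<dots> \<le> (\<Sum>i=0..K. sqrt (real m))" by (intro sum_mono i)
  finally show "(\<integral>a. (\<Sum>i=0..K. \<bar>real (sublist_count K (v, a) m i) - real m * spacing K v i\<bar>) \<partial>seq_space) \<le> real (K + 1) * sqrt (real m)"
    by simp
qed

text \<open>The chosen tree is exactly optimal for the counters plus one, which approximate
  \<open>k\<close> times the spacings. Tree costs and optimal costs are both Lipschitz with constant
  \<open>K\<close>, so replacing the spacings by the counters and going back costs twice
  \<open>K\<close> times the deviation.\<close>

lemma chosen_tree_near_optimal:
  assumes k: "k \<ge> 1"
  shows "tree_cost K (chosen_tree K ord (v, a) k) (spacing K v) \<le> opt_cost K (spacing K v) +
    2 * real K / real k * (real (K + 1) + (\<Sum>i=0..K. \<bar>real (sublist_count K (v, a) (k - 1) i) - real (k - 1) * spacing K v i\<bar>))"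
proof -
  define N where "N i = real (sublist_count K (v, a) (k - 1) i)" for i
  define T where "T = chosen_tree K ord (v, a) k"
  define D where "D = spacing K v"
  have T: "T \<in> search_trees K" unfolding T_def by (rule chosen_tree_in[OF ord])
  have kk: "real k = real (k - 1) + 1" using k by simp
  have dev: "(\<Sum>i=0..K. \<bar>real k * D i - (N i + 1)\<bar>) \<le> real (K + 1) + (\<Sum>i=0..K. \<bar>N i - real (k - 1) * D i\<bar>)"
  proof -
    have "\<bar>real k * D i - (N i + 1)\<bar> \<le> 1 + \<bar>N i - real (k - 1) * D i\<bar>" if "i \<in> {0..K}" for i
      using that spacing_pos[OF good, of i] spacing_le_1[OF good, of i]
      unfolding kk D_def by (simp add: distrib_right)
    then have "(\<Sum>i=0..K. \<bar>real k * D i - (N i + 1)\<bar>) \<le> (\<Sum>i=0..K. 1 + \<bar>N i - real (k - 1) * D i\<bar>)" by (rule sum_mono)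
    then show ?thesis by (simp add: sum.distrib)
  qed
  have "real k * tree_cost K T D = tree_cost K T (\<lambda>i. real k * D i)" by (simp add: tree_cost_scale)
  also have "\<dots> \<le> tree_cost K T (\<lambda>i. N i + 1) + K * (\<Sum>i=0..K. \<bar>real k * D i - (N i + 1)\<bar>)"
    using tree_cost_lipschitz[OF T, of "\<lambda>i. real k * D i" "\<lambda>i. N i + 1"] by linarith
  also have "tree_cost K T (\<lambda>i. N i + 1) = opt_cost K (\<lambda>i. N i + 1)"
    using tree_cost_opt_tree(2)[OF ord, of "\<lambda>i. N i + 1"] by (simp add: T_def chosen_tree_def N_def add.commute)
  also have "\<dots> \<le> opt_cost K (\<lambda>i. real k * D i) + K * (\<Sum>i=0..K. \<bar>real k * D i - (N i + 1)\<bar>)"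
    using opt_cost_lipschitz[of K "\<lambda>i. real k * D i" "\<lambda>i. N i + 1"] by linarith
  also have "opt_cost K (\<lambda>i. real k * D i) = real k * opt_cost K D" by (simp add: opt_cost_scale)
  finally have "real k * tree_cost K T D \<le> real k * opt_cost K D + 2 * (K * (\<Sum>i=0..K. \<bar>real k * D i - (N i + 1)\<bar>))"
    by simp
  also have "\<dots> \<le> real k * opt_cost K D + 2 * (K * (real (K + 1) + (\<Sum>i=0..K. \<bar>N i - real (k - 1) * D i\<bar>)))"
    by (intro add_left_mono mult_left_mono dev) auto
  finally have "tree_cost K T D \<le> (real k * opt_cost K D + 2 * (K * (real (K + 1) + (\<Sum>i=0..K. \<bar>N i - real (k - 1) * D i\<bar>)))) / real k"
    using k by (simp add: le_divide_eq mult.commute)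
  also have "\<dots> = opt_cost K D + 2 * real K / real k * (real (K + 1) + (\<Sum>i=0..K. \<bar>N i - real (k - 1) * D i\<bar>))"
    using k by (simp add: add_divide_distrib)
  finally show ?thesis by (simp only: N_def T_def D_def)
qed

lemma measurable_depth:
  "(\<lambda>a. real (leaf_depth (chosen_tree K ord (v, a) k) i)) \<in> borel_measurable seq_space"
proof (rule measurable_section[OF _ space])
  show "(\<lambda>\<omega>. real (leaf_depth (chosen_tree K ord \<omega> k) i)) \<in> borel_measurable (input_space K)"
    by (rule measurable_compose[OF measurable_chosen_tree]) simp
qed

text \<open>The tree used for \<open>a k\<close> depends on earlier elements only, so averaging over
  \<open>a k\<close> leaves the cost of that tree at the spacings. The counters deviate by order
  \<open>sqrt k\<close>; dividing by \<open>k\<close> gives the excess of order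
  \<open>1 / sqrt k\<close>.\<close>

lemma step_cost_expectation:
  assumes k: "k \<ge> 1"
  shows "integrable seq_space (\<lambda>a. step_cost K ord (v, a) k)"
    "(\<integral>a. step_cost K ord (v, a) k \<partial>seq_space) \<le> opt_cost K (spacing K v) + 4 * real K * real (K + 1) / sqrt (real k)"
proof -
  define d where "d i a = real (leaf_depth (chosen_tree K ord (v, a) k) i)" for i a
  have dm: "d i \<in> borel_measurable seq_space" for i unfolding d_def by (rule measurable_depth)
  have db: "\<bar>d i a\<bar> \<le> real K" if "i \<in> {0..K}" for i a
    using leaf_depth_le[OF chosen_tree_in[OF ord]] that by (simp add: d_def)
  have di: "integrable seq_space (d i)" if "i \<in> {0..K}" for i
    by (rule seq_space.integrable_const_bound[where B="real K"]) (use db[OF that] dm in auto)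
  have ind: "d i (a(k := x)) = d i a" for i a x
    using k by (simp add: d_def chosen_tree_def sublist_count_eq_hits hits_upd)
  have [measurable]: "(\<lambda>a. a k) \<in> borel_measurable seq_space" by (rule measurable_seq_component[OF k])
  have ii: "integrable seq_space (\<lambda>a. d i a * indicator (sublist_interval K v i) (a k))" if "i \<in> {0..K}" for i
    by (rule seq_space.integrable_const_bound[where B="real K"])
       (use db[OF that] dm in \<open>auto simp: abs_mult indicator_def\<close>)
  have E: "(\<integral>a. d i a * indicator (sublist_interval K v i) (a k) \<partial>seq_space) = spacing K v i * (\<integral>a. d i a \<partial>seq_space)"
    if i: "i \<in> {0..K}" for i
  proof -
    have "(\<integral>a. max (- real K) (min (real K) (d i a)) * indicator (sublist_interval K v i) (a k) \<partial>seq_space)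
        = measure unif (sublist_interval K v i) * (\<integral>a. max (- real K) (min (real K) (d i a)) \<partial>seq_space)"
      by (rule integral_seq_mult_component[where B="real K"]) (use k dm in \<open>auto simp: ind\<close>)
    moreover have "max (- real K) (min (real K) (d i a)) = d i a" for a using db[OF i, of a] by auto
    ultimately show ?thesis using measure_sublist_interval[OF good, of i] i by simp
  qed
  have sc: "step_cost K ord (v, a) k = (\<Sum>i=0..K. d i a * indicator (sublist_interval K v i) (a k))" for a
    unfolding step_cost_def d_def by (intro sum.cong) (auto simp: indicator_def)
  show int: "integrable seq_space (\<lambda>a. step_cost K ord (v, a) k)"
    unfolding sc by (intro Bochner_Integration.integrable_sum ii)
  have "(\<integral>a. step_cost K ord (v, a) k \<partial>seq_space) = (\<Sum>i=0..K. \<integral>a. d i a * indicator (sublist_interval K v i) (a k) \<partial>seq_space)"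
    unfolding sc by (intro Bochner_Integration.integral_sum ii)
  also have "\<dots> = (\<Sum>i=0..K. \<integral>a. spacing K v i * d i a \<partial>seq_space)" by (intro sum.cong) (auto simp: E)
  also have "\<dots> = (\<integral>a. (\<Sum>i=0..K. spacing K v i * d i a) \<partial>seq_space)"
    by (intro Bochner_Integration.integral_sum[symmetric] integrable_mult_right di)
  also have "\<dots> \<le> (\<integral>a. opt_cost K (spacing K v) +
    2 * real K / real k * (real (K + 1) + (\<Sum>i=0..K. \<bar>real (sublist_count K (v, a) (k - 1) i) - real (k - 1) * spacing K v i\<bar>)) \<partial>seq_space)"
  proof (rule integral_mono)
    show "integrable seq_space (\<lambda>a. \<Sum>i=0..K. spacing K v i * d i a)"
      by (intro Bochner_Integration.integrable_sum integrable_mult_right di)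
    show "integrable seq_space (\<lambda>a. opt_cost K (spacing K v) +
      2 * real K / real k * (real (K + 1) + (\<Sum>i=0..K. \<bar>real (sublist_count K (v, a) (k - 1) i) - real (k - 1) * spacing K v i\<bar>)))"
      by (intro Bochner_Integration.integrable_add integrable_mult_right sum_abs_deviation) auto
    show "(\<Sum>i=0..K. spacing K v i * d i a) \<le> opt_cost K (spacing K v) +
      2 * real K / real k * (real (K + 1) + (\<Sum>i=0..K. \<bar>real (sublist_count K (v, a) (k - 1) i) - real (k - 1) * spacing K v i\<bar>))" for a
      using chosen_tree_near_optimal[OF k, of a] by (simp only: tree_cost_def d_def)
  qed
  also have "\<dots> = opt_cost K (spacing K v) +
    2 * real K / real k * (real (K + 1) + (\<integral>a. (\<Sum>i=0..K. \<bar>real (sublist_count K (v, a) (k - 1) i) - real (k - 1) * spacing K v i\<bar>) \<partial>seq_space))"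
    using sum_abs_deviation(1)[of "k - 1"]
    by (subst Bochner_Integration.integral_add integral_mult_right | simp add: seq_space.prob_space)+
  also have "\<dots> \<le> opt_cost K (spacing K v) + 2 * real K / real k * (real (K + 1) + real (K + 1) * sqrt (real (k - 1)))"
    by (intro add_left_mono mult_left_mono sum_abs_deviation(2)) auto
  also have "\<dots> \<le> opt_cost K (spacing K v) + 2 * real K / real k * (real (K + 1) * (2 * sqrt (real k)))"
  proof -
    have "1 \<le> sqrt (real k)" using k by simp
    moreover have "sqrt (real (k - 1)) \<le> sqrt (real k)" by simp
    ultimately have "1 + sqrt (real (k - 1)) \<le> 2 * sqrt (real k)" by linarith
    then have "real (K + 1) * (1 + sqrt (real (k - 1))) \<le> real (K + 1) * (2 * sqrt (real k))" by (rule mult_left_mono) simp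
    then have "real (K + 1) + real (K + 1) * sqrt (real (k - 1)) \<le> real (K + 1) * (2 * sqrt (real k))"
      by (simp only: distrib_left mult_1_right)
    then show ?thesis by (intro add_left_mono mult_left_mono) auto
  qed
  also have "2 * real K / real k * (real (K + 1) * (2 * sqrt (real k))) = 4 * real K * real (K + 1) / sqrt (real k)"
  proof -
    have "sqrt (real k) * sqrt (real k) = real k" by simp
    then have "1 / sqrt (real k) = sqrt (real k) / real k" using k by (simp add: field_simps)
    moreover have "4 * real K * real (K + 1) / sqrt (real k) = 4 * real K * real (K + 1) * (1 / sqrt (real k))" by simp
    ultimately show ?thesis by (simp only:) simp
  qed
  finally show "(\<integral>a. step_cost K ord (v, a) k \<partial>seq_space) \<le> opt_cost K (spacing K v) + 4 * real K * real (K + 1) / sqrt (real k)" .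
qed

text \<open>An upper bound on the mean and a pointwise lower bound together control the absolute
  value: if \<open>X \<ge> - e\<close> and \<open>e \<ge> 0\<close>, then
  \<open>\<bar>X\<bar> \<le> X + 2 * e\<close>. Near-optimality of the steps bounds the mean of
  \<open>X\<close>; the telescoped optimal costs give the pointwise bound.\<close>

lemma total_step_cost_deviation:
  "(\<integral>a. \<bar>(\<Sum>k=1..m. step_cost K ord (v, a) k) - real m * opt_cost K (spacing K v)\<bar> \<partial>seq_space)
     \<le> 10 * real K * real (K + 1) * sqrt (real m) + 4 * real K * real (K + 1)"
proof -
  define L where "L = opt_cost K (spacing K v)"
  define X where "X a = (\<Sum>k=1..m. step_cost K ord (v, a) k) - real m * L" for a
  define e where "e a = real K * (\<Sum>i=0..K. \<bar>real (sublist_count K (v, a) m i) - real m * spacing K v i\<bar>) + 2 * real K * real (K + 1)" for a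
  have Xi: "integrable seq_space X"
    unfolding X_def by (intro Bochner_Integration.integrable_diff Bochner_Integration.integrable_sum step_cost_expectation) auto
  have ei: "integrable seq_space e"
    unfolding e_def by (intro Bochner_Integration.integrable_add integrable_mult_right sum_abs_deviation) auto
  have EX: "(\<integral>a. X a \<partial>seq_space) \<le> 8 * real K * real (K + 1) * sqrt (real m)"
  proof -
    have "(\<integral>a. X a \<partial>seq_space) = (\<Sum>k=1..m. \<integral>a. step_cost K ord (v, a) k \<partial>seq_space) - real m * L"
      unfolding X_def
      by (subst Bochner_Integration.integral_diff, (intro Bochner_Integration.integrable_sum step_cost_expectation; simp), simp,
          subst Bochner_Integration.integral_sum) (auto intro!: step_cost_expectation simp: seq_space.prob_space)
    also have "\<dots> \<le> (\<Sum>k=1..m. L + 4 * real K * real (K + 1) * (1 / sqrt (real k))) - real m * L"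
      using step_cost_expectation(2) by (intro diff_right_mono sum_mono) (auto simp: L_def)
    also have "\<dots> = 4 * real K * real (K + 1) * (\<Sum>k=1..m. 1 / sqrt (real k))"
      by (simp only: sum.distrib sum_distrib_left) simp
    also have "\<dots> \<le> 4 * real K * real (K + 1) * (2 * sqrt (real m))" by (intro mult_left_mono sqrt_sum_bound) auto
    finally show ?thesis by (simp add: mult_ac)
  qed
  have Ee: "(\<integral>a. e a \<partial>seq_space) \<le> real K * real (K + 1) * sqrt (real m) + 2 * real K * real (K + 1)"
  proof -
    have "(\<integral>a. e a \<partial>seq_space) = real K * (\<integral>a. (\<Sum>i=0..K. \<bar>real (sublist_count K (v, a) m i) - real m * spacing K v i\<bar>) \<partial>seq_space) + 2 * real K * real (K + 1)"
      unfolding e_def using sum_abs_deviation(1)[of m]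
      by (subst Bochner_Integration.integral_add integral_mult_right | simp add: seq_space.prob_space)+
    also have "\<dots> \<le> real K * (real (K + 1) * sqrt (real m)) + 2 * real K * real (K + 1)"
      by (intro add_right_mono mult_left_mono sum_abs_deviation(2)) auto
    finally show ?thesis by simp
  qed
  have Xe: "- e a \<le> X a" and e0: "0 \<le> e a" for a
  proof -
    have o1: "opt_cost K (\<lambda>i. 1) \<le> real K * real (K + 1)" using opt_cost_bounds(2)[of K "\<lambda>_. 1"] by simp
    have "real m * L = opt_cost K (\<lambda>i. real m * spacing K v i)" by (simp add: L_def opt_cost_scale)
    also have "\<dots> \<le> opt_cost K (\<lambda>i. real (sublist_count K (v, a) m i) + 1) +
        real K * (\<Sum>i=0..K. \<bar>real m * spacing K v i - (real (sublist_count K (v, a) m i) + 1)\<bar>)"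
      using opt_cost_lipschitz[of K "\<lambda>i. real m * spacing K v i" "\<lambda>i. real (sublist_count K (v, a) m i) + 1"] by linarith
    also have "(\<Sum>i=0..K. \<bar>real m * spacing K v i - (real (sublist_count K (v, a) m i) + 1)\<bar>)
       \<le> (\<Sum>i=0..K. \<bar>real (sublist_count K (v, a) m i) - real m * spacing K v i\<bar> + 1)"
      by (intro sum_mono) linarith
    also have "\<dots> = (\<Sum>i=0..K. \<bar>real (sublist_count K (v, a) m i) - real m * spacing K v i\<bar>) + real (K + 1)"
      by (simp add: sum.distrib)
    finally have "real m * L \<le> opt_cost K (\<lambda>i. real (sublist_count K (v, a) m i) + 1) +
        real K * ((\<Sum>i=0..K. \<bar>real (sublist_count K (v, a) m i) - real m * spacing K v i\<bar>) + real (K + 1))"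
      by (simp add: mult_left_mono)
    then show "- e a \<le> X a" using sum_step_cost_ge[OF ord, of v a m] o1
      unfolding X_def e_def by (simp add: distrib_left)
    show "0 \<le> e a" unfolding e_def by (intro add_nonneg_nonneg mult_nonneg_nonneg sum_nonneg) auto
  qed
  have "(\<integral>a. \<bar>X a\<bar> \<partial>seq_space) \<le> (\<integral>a. X a + 2 * e a \<partial>seq_space)"
  proof (rule integral_mono)
    show "\<bar>X a\<bar> \<le> X a + 2 * e a" for a using Xe[of a] e0[of a] by linarith
  qed (use Xi ei in auto)
  also have "\<dots> = (\<integral>a. X a \<partial>seq_space) + 2 * (\<integral>a. e a \<partial>seq_space)" using Xi ei by simp
  also have "\<dots> \<le> 8 * real K * real (K + 1) * sqrt (real m) + 2 * (real K * real (K + 1) * sqrt (real m) + 2 * real K * real (K + 1))"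
    using EX Ee by (intro add_mono mult_left_mono) auto
  also have "\<dots> = 10 * real K * real (K + 1) * sqrt (real m) + 4 * real K * real (K + 1)" by (simp add: algebra_simps)
  finally show ?thesis by (simp add: X_def L_def)
qed

text \<open>An element escapes all sublists only if it equals a pivot or lies outside the open unit
  interval, which almost surely does not happen.\<close>

lemma AE_sum_sublist_count: "AE a in seq_space. (\<Sum>i=0..K. sublist_count K (v, a) m i) = m"
proof -
  have "AE a in seq_space. \<forall>j\<in>{1..m}. a j \<in> {0<..<1} \<and> a j \<notin> v ` {1..K}"
  proof (rule AE_finite_allI)
    fix j assume "j \<in> {1..m}"
    have "AE x in unif. \<forall>y\<in>v ` {1..K}. x \<noteq> y" by (intro AE_finite_allI AE_unif_neq) auto
    then have "AE x in unif. x \<in> {0<..<1} \<and> x \<notin> v ` {1..K}" using AE_unif_01 by eventually_elim auto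
    then show "AE a in seq_space. a j \<in> {0<..<1} \<and> a j \<notin> v ` {1..K}"
      unfolding seq_space_def using \<open>j \<in> {1..m}\<close>
      by (intro AE_unif_prod_component[where P="\<lambda>x. x \<in> {0<..<1} \<and> x \<notin> v ` {1..K}"]) auto
  qed simp
  then show ?thesis
  proof eventually_elim
    case (elim a)
    have "(\<Sum>i=0..K. hits (sublist_interval K v i) a l) = l" if "l \<le> m" for l
      using that
    proof (induction l)
      case (Suc l)
      have "a (Suc l) \<in> {0<..<1}" "a (Suc l) \<notin> v ` {1..K}" using elim Suc.prems by auto
      from sublist_intervals_cover[OF good this] obtain i where i: "i \<le> K" "a (Suc l) \<in> sublist_interval K v i" by blast
      have "(\<Sum>j=0..K. if a (Suc l) \<in> sublist_interval K v j then 1 else 0) = (\<Sum>j\<in>{0..K}. if j = i then 1 else 0 :: nat)"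
        using disjoint_family_onD[OF disjoint_sublist_intervals[OF good]] i by (intro sum.cong) auto
      then show ?case using Suc i by (simp add: hits_Suc sum.distrib)
    qed simp
    then show ?case by (simp add: sublist_count_eq_hits)
  qed
qed

end

text \<open>The ratio is \<open>1 / (m + 1)\<close> times \<open>K - 1\<close> quotients. Replacing
  \<open>m - j\<close> by \<open>m\<close> bounds it by a telescoping product; for the lower bound
  each numerator is at least a quarter of the one in that product.\<close>

lemma factorial_ratio_bounds:
  assumes j: "j \<le> m" and K: "K \<ge> 1"
  shows "(fact m * fact (m - j + K - 1) / (fact (m - j) * fact (m + K)) :: real) \<le> 1 / real (m + K)"
    "4 * j \<le> 3 * (m + 1) \<Longrightarrow> (1 / 4) ^ (K - 1) / real (m + K) \<le> (fact m * fact (m - j + K - 1) / (fact (m - j) * fact (m + K)) :: real)"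
proof -
  define g where "g k = (fact m * fact (m - j + k) / (fact (m - j) * fact (m + Suc k)) :: real)" for k
  have "g 0 = fact m * fact (m - j) / (fact (m - j) * (real (Suc m) * fact m))"
    by (simp only: g_def fact_Suc add_0_right add_Suc_right)
  then have g0: "g 0 = 1 / real (m + 1)" by (simp del: of_nat_Suc)
  have gS: "g (Suc k) = g k * (real (m - j + Suc k) / real (m + Suc (Suc k)))" for k
    by (simp add: g_def mult_ac)
  have gpos: "g k \<ge> 0" for k by (simp add: g_def)
  have "g k \<le> 1 / real (m + Suc k)" for k
  proof (induction k)
    case (Suc k)
    have "g (Suc k) \<le> 1 / real (m + Suc k) * (real (m + Suc k) / real (m + Suc (Suc k)))"
      unfolding gS using Suc gpos by (intro mult_mono divide_right_mono) auto
    then show ?case by simp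
  qed (simp add: g0)
  from this[of "K - 1"] show "(fact m * fact (m - j + K - 1) / (fact (m - j) * fact (m + K)) :: real) \<le> 1 / real (m + K)"
    using K by (simp add: g_def)
  assume "4 * j \<le> 3 * (m + 1)"
  have "(1 / 4) ^ k / real (m + Suc k) \<le> g k" for k
  proof (induction k)
    case (Suc k)
    have "m + Suc k \<le> 4 * (m - j + Suc k)" using \<open>4 * j \<le> 3 * (m + 1)\<close> j by simp
    then have "real (m + Suc k) \<le> real (4 * (m - j + Suc k))" by (rule of_nat_mono)
    then have "1 / 4 * real (m + Suc k) \<le> real (m - j + Suc k)" by simp
    then have 1: "(1 / 4) ^ k / real (m + Suc k) * (1 / 4 * real (m + Suc k) / real (m + Suc (Suc k))) \<le> g (Suc k)"
      unfolding gS using Suc gpos by (intro mult_mono divide_right_mono) auto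
    have e: "(1 / 4) ^ k / x * (1 / 4 * x / y) = (1 / 4) ^ Suc k / y" if "x \<noteq> 0" for x y :: real
      using that by simp
    have "real (m + Suc k) \<noteq> 0" by simp
    then show ?case using 1 unfolding e[OF \<open>real (m + Suc k) \<noteq> 0\<close>] by simp
  qed (simp add: g0)
  from this[of "K - 1"] show "(1 / 4) ^ (K - 1) / real (m + K) \<le> (fact m * fact (m - j + K - 1) / (fact (m - j) * fact (m + K)) :: real)"
    using K by (simp add: g_def)
qed

section \<open>Beta-binomial law of the sublist sizes\<close>

definition sublist_weight :: "nat \<Rightarrow> nat \<Rightarrow> nat \<Rightarrow> real" where
  "sublist_weight K n j = (\<integral>\<omega>. (\<Sum>i=0..K. of_bool (sublist_count K \<omega> (n - K) i = j)) \<partial>input_space K)"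

text \<open>Given the pivots, each size is binomial with its spacing as parameter. Mixing over the
  Beta(1, \<open>K\<close>) law of a spacing turns the binomial weight into a beta integral.\<close>

lemma sublist_weight_eq:
  assumes K: "K \<ge> 1" and n: "K < n" and j: "j \<le> n - K"
  shows "sublist_weight K n j = real (K + 1) * real K *
     (fact (n - K) * fact (n - K - j + K - 1) / (fact (n - K - j) * fact n))"
proof -
  define m where "m = n - K"
  define F where "F x = real (m choose j) * (x ^ j * (1 - x) ^ (m - j))" for x :: real
  have int: "integrable (input_space K) (\<lambda>\<omega>. \<Sum>i=0..K. of_bool (sublist_count K \<omega> m i = j) :: real)"
    by (intro Bochner_Integration.integrable_sum input_space.integrable_const_bound[where B=1]) (auto, measurable)
  have inner: "(\<integral>a. (\<Sum>i=0..K. of_bool (sublist_count K (v, a) m i = j) :: real) \<partial>seq_space) = (\<Sum>i=0..K. F (spacing K v i))"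
    if good: "good_pivots K v" for v
  proof -
    have "(\<integral>a. (\<Sum>i=0..K. of_bool (sublist_count K (v, a) m i = j) :: real) \<partial>seq_space) =
      (\<Sum>i=0..K. \<integral>a. (of_bool (hits (sublist_interval K v i) a m = j) :: real) \<partial>seq_space)"
      unfolding sublist_count_eq_hits
      by (intro Bochner_Integration.integral_sum seq_space.integrable_const_bound[where B=1]) (auto, measurable)
    also have "\<dots> = (\<Sum>i=0..K. F (spacing K v i))"
      using measure_sublist_interval[OF good] by (intro sum.cong refl) (simp add: hits_binomial F_def)
    finally show ?thesis .
  qed
  have F: "F \<in> borel_measurable borel" "continuous_on {0..1} F" unfolding F_def by (measurable, intro continuous_intros)
  have "((\<lambda>x. real (m choose j) * (x ^ j * (1 - x) ^ (m - j + K - 1))) has_integral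
     real (m choose j) * (fact j * fact (m - j + K - 1) / fact (j + (m - j + K - 1) + 1))) {0..1}"
    by (intro has_integral_mult_right beta_integral_nat)
  also have "(\<lambda>x. real (m choose j) * (x ^ j * (1 - x) ^ (m - j + K - 1))) = (\<lambda>x. F x * (1 - x) ^ (K - 1))"
    using K by (auto simp: F_def power_add[symmetric] fun_eq_iff)
  also have "j + (m - j + K - 1) + 1 = n" using j K n by (simp add: m_def)
  also have "real (m choose j) * (fact j * fact (m - j + K - 1) / fact n) = fact m * fact (m - j + K - 1) / (fact (m - j) * fact n)"
    using j by (simp add: binomial_fact m_def)
  finally have I: "((\<lambda>x. F x * (1 - x) ^ (K - 1)) has_integral fact m * fact (m - j + K - 1) / (fact (m - j) * fact n)) {0..1}" .
  note SL = spacing_law_integral[OF F I]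
  have "sublist_weight K n j = (\<integral>v. (\<integral>a. (\<Sum>i=0..K. of_bool (sublist_count K (v, a) m i = j) :: real) \<partial>seq_space) \<partial>pivot_space K)"
    unfolding sublist_weight_def m_def[symmetric] by (rule integral_input_space(1)[OF int])
  also have "\<dots> = (\<integral>v. (\<Sum>i=0..K. F (spacing K v i)) \<partial>pivot_space K)"
  proof (rule integral_cong_AE)
    show "(\<lambda>v. \<integral>a. (\<Sum>i=0..K. of_bool (sublist_count K (v, a) m i = j) :: real) \<partial>seq_space) \<in> borel_measurable (pivot_space K)"
      using integral_input_space(2)[OF int] by (rule borel_measurable_integrable)
    show "(\<lambda>v. \<Sum>i=0..K. F (spacing K v i)) \<in> borel_measurable (pivot_space K)"
      using expectation_sum_spacing(1)[OF K F(1) SL(1)] by (rule borel_measurable_integrable)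
    show "AE v in pivot_space K. (\<integral>a. (\<Sum>i=0..K. of_bool (sublist_count K (v, a) m i = j) :: real) \<partial>seq_space) = (\<Sum>i=0..K. F (spacing K v i))"
      using AE_good_pivots by eventually_elim (rule inner)
  qed
  also have "\<dots> = real (K + 1) * (real K * (fact m * fact (m - j + K - 1) / (fact (m - j) * fact n)))"
    using expectation_sum_spacing(2)[OF K F(1) SL(1)] SL(2) by simp
  finally show ?thesis by (simp add: m_def)
qed

lemma sublist_weight_nonneg: "0 \<le> sublist_weight K n j"
  unfolding sublist_weight_def by (intro Bochner_Integration.integral_nonneg sum_nonneg) auto

lemma sublist_weight_upper:
  assumes K: "K \<ge> 1" and n: "K < n"
  shows "sublist_weight K n j \<le> real (K + 1) * real K / real n"
proof (cases "j \<le> n - K")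
  case True
  have "sublist_weight K n j \<le> real (K + 1) * real K * (1 / real (n - K + K))"
    unfolding sublist_weight_eq[OF K n True] using factorial_ratio_bounds(1)[OF True K] n
    by (intro mult_left_mono) auto
  then show ?thesis using n by simp
next
  case False
  have "sublist_count K \<omega> (n - K) i \<noteq> j" for \<omega> i
    using hits_le[of _ "snd \<omega>" "n - K"] False by (cases \<omega>) (auto simp: sublist_count_eq_hits) 
  then show ?thesis by (simp add: sublist_weight_def)
qed

lemma sublist_weight_lower:
  assumes K: "K \<ge> 1" and n: "3 * K \<le> n" and j: "2 * j \<le> n"
  shows "real (K + 1) * real K * (1 / 4) ^ (K - 1) / real n \<le> sublist_weight K n j"
proof -
  have n': "K < n" and j': "j \<le> n - K" using assms by linarith+
  \<comment> \<open>With \<open>m = n - K\<close> the hypothesis on \<open>n\<close> reads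
    \<open>2 * K \<le> m\<close>, hence
    \<open>4 * j \<le> 2 * m + 2 * K \<le> 3 * m\<close>.\<close>
  have "4 * j \<le> 3 * (n - K + 1)"
  proof -
    define m where "m = n - K"
    have "n = m + K" using n' by (simp add: m_def)
    then have "4 * j \<le> 3 * (m + 1)" using n j by simp
    then show ?thesis by (simp add: m_def)
  qed
  from factorial_ratio_bounds(2)[OF j' K this]
  have "real (K + 1) * real K * ((1 / 4) ^ (K - 1) / real (n - K + K)) \<le> sublist_weight K n j"
    unfolding sublist_weight_eq[OF K n' j'] using n' by (intro mult_left_mono) auto
  then show ?thesis using n' by simp
qed

section \<open>The recursion for the law\<close>

locale quicksort =
  fixes K :: nat and ord :: "nat tree rel" and piv :: cmp_tree and alg :: "nat \<Rightarrow> cmp_tree"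
  assumes K_pos: "K \<ge> 1"
    and ord: "linear_order_on (search_trees K) ord"
    and piv: "sorting_algorithm K piv"
    and piv_count: "\<And>x. inj_on x {1..K} \<Longrightarrow> cmp_count piv x \<le> K\<^sup>2"
    and alg: "\<And>n. n \<le> K \<Longrightarrow> sorting_algorithm n (alg n)"
    and alg_count: "\<And>n x. n \<le> K \<Longrightarrow> inj_on x {1..n} \<Longrightarrow> cmp_count (alg n) x \<le> K\<^sup>2"
begin

abbreviation L :: "nat \<Rightarrow> real measure" where "L \<equiv> quicksort_law K ord piv alg"

abbreviation I :: "nat \<Rightarrow> (nat \<Rightarrow> real) \<times> (nat \<Rightarrow> real) \<Rightarrow> nat \<Rightarrow> nat" where
  "I n \<omega> i \<equiv> sublist_count K \<omega> (n - K) i"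

abbreviation P :: "nat \<Rightarrow> (nat \<Rightarrow> real) \<times> (nat \<Rightarrow> real) \<Rightarrow> real" where
  "P n \<equiv> partition_cost K ord piv n"

abbreviation copies :: "nat \<Rightarrow> (nat \<Rightarrow> nat \<Rightarrow> real) measure" where
  "copies n \<equiv> PiM {0..K} (\<lambda>i. PiM {..<n} L)"

lemma sublist_count_le: "sublist_count K \<omega> m i \<le> m"
  by (cases \<omega>) (simp add: sublist_count_eq_hits hits_le)

lemma I_less: "K < n \<Longrightarrow> I n \<omega> i < n"
  using sublist_count_le[of \<omega> "n - K" i] K_pos by linarith

lemma measurable_P [measurable]: "P n \<in> borel_measurable (input_space K)"
proof -
  have [measurable]: "(\<lambda>\<omega>. fst \<omega> i) \<in> borel_measurable (input_space K)" if "i \<in> {1..K}" for i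
    unfolding input_space_eq by (intro measurable_compose[OF measurable_fst] measurable_pivot_component that)
  have "(\<lambda>\<omega>. real (cmp_count piv (fst \<omega>))) \<in> borel_measurable (input_space K)"
    by (rule measurable_compose[OF cmp_count_measurable[where A="{1..K}"]])
       (use piv in \<open>auto simp: sorting_algorithm_def\<close>)
  moreover have "(\<lambda>\<omega>. \<Sum>k=1..n-K. step_cost K ord \<omega> k) \<in> borel_measurable (input_space K)"
    by (intro borel_measurable_sum measurable_step_cost) auto
  ultimately have "(\<lambda>\<omega>. (\<Sum>k=1..n-K. step_cost K ord \<omega> k) + real (cmp_count piv (fst \<omega>))) \<in> borel_measurable (input_space K)"
    by (rule borel_measurable_add[rotated])
  then show ?thesis by (simp add: partition_cost_eq[OF ord, abs_def])
qed

lemma L_small: "n \<le> K \<Longrightarrow> L n = distr (measure_pmf (pmf_of_set {\<pi>. \<pi> permutes {1..n}})) borel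
          (\<lambda>\<pi>. real (cmp_count (alg n) (\<lambda>i. real (\<pi> i))))"
  by (subst quicksort_law.simps) simp

lemma L_large: "K < n \<Longrightarrow> L n = distr (input_space K \<Otimes>\<^sub>M copies n) borel
          (\<lambda>(\<omega>, x). (\<Sum>i=0..K. x i (I n \<omega> i)) + P n \<omega>)"
  by (subst quicksort_law.simps) simp

lemma sets_L [measurable_cong, simp]: "sets (L n) = sets borel"
  by (cases "n \<le> K") (simp_all add: L_small L_large)

lemma space_L [simp]: "space (L n) = UNIV"
  using sets_eq_imp_space_eq[OF sets_L] by simp

text \<open>The coordinate that is read is itself random; as it takes countably many values, the
  evaluations at fixed coordinates can be glued together.\<close>

lemma measurable_copy:
  assumes n: "K < n" and i: "i \<in> {0..K}"
  shows "(\<lambda>p. snd p i (I n (fst p) i)) \<in> borel_measurable (input_space K \<Otimes>\<^sub>M copies n)"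
proof -
  have [measurable]: "(\<lambda>p. I n (fst p) i) \<in> measurable (input_space K \<Otimes>\<^sub>M copies n) (count_space UNIV)"
    by (rule measurable_compose[OF measurable_fst measurable_sublist_count])
  \<comment> \<open>Only coordinates below \<open>n\<close> belong to the product, hence the guard;
    \<open>I_less\<close> removes it afterwards.\<close>
  have "(\<lambda>p. (\<lambda>m p. if m < n then snd p i m else 0) (I n (fst p) i) p) \<in> borel_measurable (input_space K \<Otimes>\<^sub>M copies n)"
  proof (rule measurable_compose_countable)
    fix m
    show "(\<lambda>p. if m < n then snd p i m else 0) \<in> borel_measurable (input_space K \<Otimes>\<^sub>M copies n)"
    proof (cases "m < n")
      case True
      have "(\<lambda>x. x i m) \<in> measurable (copies n) (L m)"
        by (rule measurable_compose[OF measurable_component_singleton[OF i] measurable_component_singleton]) (use True in simp)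
      then have "(\<lambda>x. x i m) \<in> borel_measurable (copies n)" by (simp cong: measurable_cong_sets)
      then show ?thesis using True by (auto intro: measurable_compose[OF measurable_snd])
    qed simp
  qed simp
  then show ?thesis using I_less[OF n] by simp
qed

lemma measurable_total:
  assumes n: "K < n"
  shows "(\<lambda>(\<omega>, x). (\<Sum>i=0..K. x i (I n \<omega> i)) + P n \<omega>) \<in> borel_measurable (input_space K \<Otimes>\<^sub>M copies n)"
  unfolding split_beta
  by (intro borel_measurable_add borel_measurable_sum measurable_copy n measurable_compose[OF measurable_fst measurable_P])

lemma prob_space_copies:
  assumes "\<And>m. m < n \<Longrightarrow> prob_space (L m)" shows "prob_space (copies n)"
  by (intro prob_space_PiM) (use assms in auto)

lemma prob_space_L: "prob_space (L n)"
proof (induction n rule: less_induct)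
  case (less n)
  show ?case
  proof (cases "n \<le> K")
    case True
    then show ?thesis by (simp add: L_small measure_pmf.prob_space_distr)
  next
    case False
    then have n: "K < n" by simp
    have "prob_space (input_space K \<Otimes>\<^sub>M copies n)"
      by (intro prob_space_pair prob_space_input_space prob_space_copies less)
    then show ?thesis unfolding L_large[OF n] by (rule prob_space.prob_space_distr) (rule measurable_total[OF n])
  qed
qed

sublocale L: prob_space "L n" for n by (rule prob_space_L)

sublocale copies: prob_space "copies n" for n by (intro prob_space_copies prob_space_L)

sublocale input_copies: pair_sigma_finite "input_space K" "copies n" for n ..

sublocale input_copies: prob_space "input_space K \<Otimes>\<^sub>M copies n" for n
  by (intro prob_space_pair prob_space_input_space copies.prob_space_axioms)

lemma distr_copies:
  assumes "i \<in> {0..K}" "m < n"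
  shows "distr (copies n) (L m) (\<lambda>x. x i m) = L m"
proof -
  have 1: "(\<lambda>x. x i) \<in> measurable (copies n) (PiM {..<n} L)" using assms by (intro measurable_component_singleton) auto
  have 2: "(\<lambda>y. y m) \<in> measurable (PiM {..<n} L) (L m)" using assms by (intro measurable_component_singleton) auto
  have "distr (copies n) (L m) (\<lambda>x. x i m) = distr (distr (copies n) (PiM {..<n} L) (\<lambda>x. x i)) (L m) (\<lambda>y. y m)"
    by (subst distr_distr[OF 2 1]) (simp add: comp_def)
  also have "distr (copies n) (PiM {..<n} L) (\<lambda>x. x i) = PiM {..<n} L"
    using assms by (intro distr_PiM_component[where M="\<lambda>_. PiM {..<n} L"] prob_space_PiM prob_space_L) auto
  also have "distr (PiM {..<n} L) (L m) (\<lambda>y. y m) = L m"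
    using assms by (intro distr_PiM_component prob_space_L) auto
  finally show ?thesis .
qed

lemma measurable_copies_component:
  assumes "i \<in> {0..K}" "m < n"
  shows "(\<lambda>x. x i m) \<in> measurable (copies n) (L m)"
  by (rule measurable_compose[OF measurable_component_singleton[OF assms(1)] measurable_component_singleton]) (use assms in simp)

lemma good_bounds:
  assumes "good_pivots K v"
  shows "0 \<le> P n (v, a)" "P n (v, a) \<le> real K * real n + (real K)\<^sup>2"
proof -
  have c: "real (cmp_count piv v) \<le> (real K)\<^sup>2"
  proof -
    have "cmp_count piv v \<le> K\<^sup>2" using piv_count[of v] assms by (simp add: good_pivots_def)
    then have "real (cmp_count piv v) \<le> real (K\<^sup>2)" by (rule of_nat_mono)
    then show ?thesis by simp
  qed
  have P: "P n (v, a) = (\<Sum>k=1..n-K. step_cost K ord (v, a) k) + real (cmp_count piv v)"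
    using partition_cost_eq[OF ord] by simp
  show "0 \<le> P n (v, a)" unfolding P using step_cost_bounds(1)[OF ord assms]
    by (intro add_nonneg_nonneg sum_nonneg) auto
  have "(\<Sum>k=1..n-K. step_cost K ord (v, a) k) \<le> (\<Sum>k=1..n-K. real K)"
    by (intro sum_mono step_cost_bounds(2)[OF ord assms])
  also have "\<dots> = real (n - K) * real K" by simp
  also have "\<dots> \<le> real n * real K" by (intro mult_right_mono) auto
  also have "\<dots> = real K * real n" by (rule mult.commute)
  finally show "P n (v, a) \<le> real K * real n + (real K)\<^sup>2" unfolding P using c by (rule add_mono)
qed

lemma AE_P_bounds: "AE \<omega> in input_space K. 0 \<le> P n \<omega> \<and> P n \<omega> \<le> real K * real n + (real K)\<^sup>2"
  using AE_input_space_fst[OF AE_good_pivots] by eventually_elim (metis good_bounds prod.collapse)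

lemma L_small_bounded: assumes "n \<le> K" shows "AE x in L n. 0 \<le> x \<and> x \<le> (real K)\<^sup>2"
proof -
  have fin: "finite {\<pi>. \<pi> permutes {1..n}}" by (intro finite_permutations) simp
  have ne: "{\<pi>. \<pi> permutes {1..n}} \<noteq> {}" using permutes_id by blast
  have "AE \<pi> in measure_pmf (pmf_of_set {\<pi>. \<pi> permutes {1..n}}).
    0 \<le> real (cmp_count (alg n) (\<lambda>i. real (\<pi> i))) \<and> real (cmp_count (alg n) (\<lambda>i. real (\<pi> i))) \<le> (real K)\<^sup>2"
  proof (subst AE_measure_pmf_iff, intro ballI conjI)
    fix \<pi> assume "\<pi> \<in> set_pmf (pmf_of_set {\<pi>. \<pi> permutes {1..n}})"
    then have "\<pi> permutes {1..n}" using set_pmf_of_set[OF ne fin] by blast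
    then have "inj_on (\<lambda>i. real (\<pi> i)) {1..n}" by (auto simp: inj_on_def dest: permutes_inj[THEN injD])
    from alg_count[OF assms this] have "real (cmp_count (alg n) (\<lambda>i. real (\<pi> i))) \<le> real (K\<^sup>2)" by (rule of_nat_mono)
    then show "real (cmp_count (alg n) (\<lambda>i. real (\<pi> i))) \<le> (real K)\<^sup>2" by simp
  qed simp
  then show ?thesis unfolding L_small[OF assms] by (subst AE_distr_iff) auto
qed

text \<open>Bounded support for each single \<open>n\<close>, with no uniformity, already makes
  every continuous function integrable. Integrability of powers, exponentials and characters is
  therefore automatic, and only uniform bounds require work.\<close>

lemma L_bounded: "\<exists>B\<ge>0. AE x in L n. \<bar>x\<bar> \<le> B"
proof (induction n rule: less_induct)
  case (less n)
  show ?case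
  proof (cases "n \<le> K")
    case True
    have "AE x in L n. \<bar>x\<bar> \<le> (real K)\<^sup>2" using L_small_bounded[OF True] by eventually_elim auto
    then show ?thesis by (intro exI[of _ "(real K)\<^sup>2"]) auto
  next
    case False
    then have n: "K < n" by simp
    from less obtain b where b: "\<And>m. m < n \<Longrightarrow> 0 \<le> b m" "\<And>m. m < n \<Longrightarrow> AE x in L m. \<bar>x\<bar> \<le> b m" by metis
    define B where "B = (\<Sum>m<n. b m)"
    have bB: "b m \<le> B" if "m < n" for m unfolding B_def using that b by (intro member_le_sum) auto
    have "AE x in copies n. \<forall>i\<in>{0..K}. \<forall>m\<in>{..<n}. \<bar>x i m\<bar> \<le> B"
    proof (intro AE_finite_allI)
      fix i m assume im: "i \<in> {0..K}" "m \<in> {..<n}"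
      have "AE y in L m. \<bar>y\<bar> \<le> B" using b(2)[of m] im bB[of m] by (auto elim: eventually_mono)
      then have "AE y in distr (copies n) (L m) (\<lambda>x. x i m). \<bar>y\<bar> \<le> B"
        using distr_copies[of i m n] im by (simp only: lessThan_iff)
      then show "AE x in copies n. \<bar>x i m\<bar> \<le> B"
        by (rule AE_distrD[rotated]) (use im in \<open>auto intro: measurable_copies_component\<close>)
    qed auto
    then have "AE p in input_space K \<Otimes>\<^sub>M copies n. \<forall>i\<in>{0..K}. \<forall>m\<in>{..<n}. \<bar>snd p i m\<bar> \<le> B"
    proof -
      obtain N where N: "N \<in> null_sets (copies n)" "{x \<in> space (copies n). \<not> (\<forall>i\<in>{0..K}. \<forall>m\<in>{..<n}. \<bar>x i m\<bar> \<le> B)} \<subseteq> N"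
        using \<open>AE x in copies n. _\<close> by (auto simp: eventually_ae_filter)
      then have [measurable]: "N \<in> sets (copies n)" by auto
      have "AE p in input_space K \<Otimes>\<^sub>M copies n. snd p \<notin> N"
      proof (rule input_copies.AE_pair_measure)
        show "AE \<omega> in input_space K. AE x in copies n. snd (\<omega>, x) \<notin> N"
          using AE_not_in[OF N(1)] by simp
      qed measurable
      then show ?thesis using AE_space
      proof eventually_elim
        case (elim p)
        then have "snd p \<in> space (copies n)" by (auto simp: space_pair_measure)
        then show ?case using elim N(2) by blast
      qed
    qed
    moreover have "AE p in input_space K \<Otimes>\<^sub>M copies n. 0 \<le> P n (fst p) \<and> P n (fst p) \<le> real K * real n + (real K)\<^sup>2"
    proof (rule input_copies.AE_pair_measure)
      show "AE \<omega> in input_space K. AE x in copies n. 0 \<le> P n (fst (\<omega>, x)) \<and> P n (fst (\<omega>, x)) \<le> real K * real n + (real K)\<^sup>2"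
        using AE_P_bounds[of n] by eventually_elim simp
      have [measurable]: "(\<lambda>p. P n (fst p)) \<in> borel_measurable (input_space K \<Otimes>\<^sub>M copies n)"
        by (rule measurable_compose[OF measurable_fst measurable_P])
      show "{p \<in> space (input_space K \<Otimes>\<^sub>M copies n). 0 \<le> P n (fst p) \<and> P n (fst p) \<le> real K * real n + (real K)\<^sup>2}
         \<in> sets (input_space K \<Otimes>\<^sub>M copies n)" by measurable
    qed
    ultimately have "AE p in input_space K \<Otimes>\<^sub>M copies n.
       \<bar>(\<lambda>(\<omega>, x). (\<Sum>i=0..K. x i (I n \<omega> i)) + P n \<omega>) p\<bar> \<le> real (K + 1) * B + (real K * real n + (real K)\<^sup>2)"
    proof eventually_elim
      case (elim p)
      obtain \<omega> x where p: "p = (\<omega>, x)" by (cases p)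
      have "\<bar>\<Sum>i=0..K. x i (I n \<omega> i)\<bar> \<le> (\<Sum>i=0..K. \<bar>x i (I n \<omega> i)\<bar>)" by (rule sum_abs)
      also have "\<dots> \<le> (\<Sum>i=0..K. B)" using elim(1) I_less[OF n] by (intro sum_mono) (auto simp: p)
      finally show ?case using elim(2) by (auto simp: p)
    qed
    then have "AE x in L n. \<bar>x\<bar> \<le> real (K + 1) * B + (real K * real n + (real K)\<^sup>2)"
      unfolding L_large[OF n] by (subst AE_distr_iff[OF measurable_total[OF n]]) auto
    moreover have "0 \<le> B" unfolding B_def using b by (intro sum_nonneg) auto
    ultimately show ?thesis by (intro exI[of _ "real (K + 1) * B + (real K * real n + (real K)\<^sup>2)"]) auto
  qed
qed

lemma integrable_L_continuous:
  fixes f :: "real \<Rightarrow> 'b :: {banach, second_countable_topology}"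
  assumes "continuous_on UNIV f"
  shows "integrable (L n) f"
proof -
  obtain B where B: "AE x in L n. \<bar>x\<bar> \<le> B" using L_bounded by blast
  have "compact (f ` {-B..B})" by (intro compact_continuous_image continuous_on_subset[OF assms]) auto
  then obtain c where c: "\<And>x. x \<in> {-B..B} \<Longrightarrow> norm (f x) \<le> c"
    using compact_imp_bounded bounded_iff by (metis imageI)
  show ?thesis
  proof (rule L.integrable_const_bound)
    show "AE x in L n. norm (f x) \<le> c" using B by eventually_elim (rule c, auto)
    show "f \<in> borel_measurable (L n)" using borel_measurable_continuous_onI[OF assms] by simp
  qed
qed

section \<open>Recursions for the mean and for multiplicative functionals\<close>

definition \<mu> :: "nat \<Rightarrow> real" where "\<mu> n = (\<integral>x. x \<partial>L n)"

lemma integral_copies: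
  fixes f :: "real \<Rightarrow> 'b :: {banach, second_countable_topology}"
  assumes i: "i \<in> {0..K}" and m: "m < n" and f: "f \<in> borel_measurable borel"
  shows "(\<integral>x. f (x i m) \<partial>copies n) = (\<integral>x. f x \<partial>L m)"
proof -
  have "(\<integral>x. f x \<partial>distr (copies n) (L m) (\<lambda>x. x i m)) = (\<integral>x. f (x i m) \<partial>copies n)"
    by (rule integral_distr[OF measurable_copies_component[OF i m]]) (use f in simp)
  then show ?thesis using distr_copies[OF i m] by simp
qed

lemma mean_recursion:
  assumes n: "K < n"
  shows "\<mu> n = (\<integral>\<omega>. P n \<omega> + (\<Sum>i=0..K. \<mu> (I n \<omega> i)) \<partial>input_space K)"
proof -
  let ?G = "\<lambda>(\<omega>, x). (\<Sum>i=0..K. x i (I n \<omega> i)) + P n \<omega>"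
  have "integrable (L n) (\<lambda>x. x)" by (intro integrable_L_continuous continuous_intros)
  then have int: "integrable (input_space K \<Otimes>\<^sub>M copies n) ?G"
    unfolding L_large[OF n] using integrable_distr[OF measurable_total[OF n], of "\<lambda>x. x"] by simp
  have ic: "integrable (copies n) (\<lambda>x. x i m)" if "i \<in> {0..K}" "m < n" for i m
  proof -
    have "integrable (distr (copies n) (L m) (\<lambda>x. x i m)) (\<lambda>x. x)"
      unfolding distr_copies[OF that] by (intro integrable_L_continuous continuous_intros)
    then show ?thesis by (rule integrable_distr[OF measurable_copies_component[OF that]])
  qed
  have "\<mu> n = (\<integral>p. ?G p \<partial>(input_space K \<Otimes>\<^sub>M copies n))"
    unfolding \<mu>_def L_large[OF n] by (rule integral_distr[OF measurable_total[OF n]]) simp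
  also have "\<dots> = (\<integral>\<omega>. (\<integral>x. ?G (\<omega>, x) \<partial>copies n) \<partial>input_space K)"
    using input_copies.integral_fst'[OF int] by simp
  also have "\<dots> = (\<integral>\<omega>. P n \<omega> + (\<Sum>i=0..K. \<mu> (I n \<omega> i)) \<partial>input_space K)"
  proof (intro Bochner_Integration.integral_cong refl)
    fix \<omega>
    have i: "integrable (copies n) (\<lambda>x. x i (I n \<omega> i))" if "i \<in> {0..K}" for i
      by (rule ic[OF that I_less[OF n]])
    have "(\<integral>x. ?G (\<omega>, x) \<partial>copies n) = (\<integral>x. (\<Sum>i=0..K. x i (I n \<omega> i)) \<partial>copies n) + (\<integral>x. P n \<omega> \<partial>copies n)"
      unfolding prod.case by (intro Bochner_Integration.integral_add Bochner_Integration.integrable_sum i copies.integrable_const)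
    also have "(\<integral>x. P n \<omega> \<partial>copies n) = P n \<omega>" by (simp add: copies.prob_space)
    also have "(\<integral>x. (\<Sum>i=0..K. x i (I n \<omega> i)) \<partial>copies n) = (\<Sum>i=0..K. \<integral>x. x i (I n \<omega> i) \<partial>copies n)"
      by (intro Bochner_Integration.integral_sum i)
    also have "(\<Sum>i=0..K. \<integral>x. x i (I n \<omega> i) \<partial>copies n) = (\<Sum>i=0..K. \<mu> (I n \<omega> i))"
      unfolding \<mu>_def by (intro sum.cong refl integral_copies[where f="\<lambda>x. x"] I_less[OF n]) auto
    finally show "(\<integral>x. ?G (\<omega>, x) \<partial>copies n) = P n \<omega> + (\<Sum>i=0..K. \<mu> (I n \<omega> i))" by simp
  qed
  finally show ?thesis .
qed

text \<open>For a multiplicative \<open>h\<close> the sum over the sublists becomes a product, which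
  factorizes by independence of the copies once \<open>\<omega>\<close> is fixed. A general target
  field lets one computation serve both the moment generating and the characteristic
  functions.\<close>

lemma centered_recursion:
  fixes h :: "real \<Rightarrow> 'b :: {real_normed_field, banach, second_countable_topology}"
  assumes n: "K < n" and cont: "continuous_on UNIV h" and add: "\<And>x y. h (x + y) = h x * h y" and h0: "h 0 = 1"
  shows "(\<integral>x. h (x - \<mu> n) \<partial>L n) =
     (\<integral>\<omega>. h (P n \<omega> + (\<Sum>i=0..K. \<mu> (I n \<omega> i)) - \<mu> n) *
           (\<Prod>i=0..K. \<integral>x. h (x - \<mu> (I n \<omega> i)) \<partial>L (I n \<omega> i)) \<partial>input_space K)"
proof -
  let ?G = "\<lambda>(\<omega>, x). (\<Sum>i=0..K. x i (I n \<omega> i)) + P n \<omega>"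
  have hm: "h \<in> borel_measurable borel" by (rule borel_measurable_continuous_onI[OF cont])
  have cs: "continuous_on UNIV (\<lambda>x. h (x - c))" for c
    by (rule continuous_on_compose2[OF cont]) (auto intro: continuous_intros)
  have sm: "(\<lambda>x. h (x - c)) \<in> borel_measurable borel" for c by (rule borel_measurable_continuous_onI[OF cs])
  have hsum: "h (\<Sum>i\<in>S. f i) = (\<Prod>i\<in>S. h (f i))" if "finite S" for f :: "nat \<Rightarrow> real" and S
    using that by (induction rule: finite_induct) (auto simp: h0 add)
  have "integrable (L n) (\<lambda>x. h (x - \<mu> n))" by (intro integrable_L_continuous cs)
  then have int: "integrable (input_space K \<Otimes>\<^sub>M copies n) (\<lambda>p. h (?G p - \<mu> n))"
    unfolding L_large[OF n] using integrable_distr[OF measurable_total[OF n], of "\<lambda>x. h (x - \<mu> n)"] by simp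
  interpret X: product_sigma_finite "\<lambda>i::nat. PiM {..<n} L"
    by (intro product_sigma_finite.intro prob_space_imp_sigma_finite prob_space_PiM prob_space_L)
  have prod: "(\<integral>x. (\<Prod>i=0..K. h (x i (m i) - \<mu> (m i))) \<partial>copies n) = (\<Prod>i=0..K. \<integral>x. h (x - \<mu> (m i)) \<partial>L (m i))"
    if m: "\<And>i. m i < n" for m
  proof -
    have c: "integrable (PiM {..<n} L) (\<lambda>y. h (y (m i) - \<mu> (m i)))"
      "(\<integral>y. h (y (m i) - \<mu> (m i)) \<partial>PiM {..<n} L) = (\<integral>x. h (x - \<mu> (m i)) \<partial>L (m i))" for i
    proof -
      have mi: "m i \<in> {..<n}" using m by simp
      have d: "distr (PiM {..<n} L) (L (m i)) (\<lambda>y. y (m i)) = L (m i)"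
        by (rule distr_PiM_component[OF prob_space_L mi])
      have mm: "(\<lambda>y. y (m i)) \<in> measurable (PiM {..<n} L) (L (m i))" by (rule measurable_component_singleton[OF mi])
      have "integrable (distr (PiM {..<n} L) (L (m i)) (\<lambda>y. y (m i))) (\<lambda>x. h (x - \<mu> (m i)))"
        unfolding d by (intro integrable_L_continuous cs)
      then show "integrable (PiM {..<n} L) (\<lambda>y. h (y (m i) - \<mu> (m i)))" by (rule integrable_distr[OF mm])
      have "(\<integral>x. h (x - \<mu> (m i)) \<partial>distr (PiM {..<n} L) (L (m i)) (\<lambda>y. y (m i))) = (\<integral>y. h (y (m i) - \<mu> (m i)) \<partial>PiM {..<n} L)"
        by (rule integral_distr[OF mm]) (use sm in simp)
      then show "(\<integral>y. h (y (m i) - \<mu> (m i)) \<partial>PiM {..<n} L) = (\<integral>x. h (x - \<mu> (m i)) \<partial>L (m i))" unfolding d by simp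
    qed
    show ?thesis
      using X.product_integral_prod[of "{0..K}" "\<lambda>i y. h (y (m i) - \<mu> (m i))"] c by simp
  qed
  have "(\<integral>x. h (x - \<mu> n) \<partial>L n) = (\<integral>p. h (?G p - \<mu> n) \<partial>(input_space K \<Otimes>\<^sub>M copies n))"
    unfolding L_large[OF n] by (rule integral_distr[OF measurable_total[OF n] sm])
  also have "\<dots> = (\<integral>\<omega>. (\<integral>x. h (?G (\<omega>, x) - \<mu> n) \<partial>copies n) \<partial>input_space K)"
    using input_copies.integral_fst'[OF int] by simp
  also have "\<dots> = (\<integral>\<omega>. h (P n \<omega> + (\<Sum>i=0..K. \<mu> (I n \<omega> i)) - \<mu> n) *
           (\<Prod>i=0..K. \<integral>x. h (x - \<mu> (I n \<omega> i)) \<partial>L (I n \<omega> i)) \<partial>input_space K)"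
  proof (intro Bochner_Integration.integral_cong refl)
    fix \<omega>
    have "?G (\<omega>, x) - \<mu> n = (P n \<omega> + (\<Sum>i=0..K. \<mu> (I n \<omega> i)) - \<mu> n) + (\<Sum>i=0..K. x i (I n \<omega> i) - \<mu> (I n \<omega> i))" for x
      by (simp add: sum_subtractf)
    then have "(\<integral>x. h (?G (\<omega>, x) - \<mu> n) \<partial>copies n) = (\<integral>x. h (P n \<omega> + (\<Sum>i=0..K. \<mu> (I n \<omega> i)) - \<mu> n) *
         (\<Prod>i=0..K. h (x i (I n \<omega> i) - \<mu> (I n \<omega> i))) \<partial>copies n)"
      by (simp only: add hsum finite_atLeastAtMost)
    also have "\<dots> = h (P n \<omega> + (\<Sum>i=0..K. \<mu> (I n \<omega> i)) - \<mu> n) * (\<integral>x. (\<Prod>i=0..K. h (x i (I n \<omega> i) - \<mu> (I n \<omega> i))) \<partial>copies n)"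
      by (rule integral_mult_right_zero)
    also have "(\<integral>x. (\<Prod>i=0..K. h (x i (I n \<omega> i) - \<mu> (I n \<omega> i))) \<partial>copies n)
       = (\<Prod>i=0..K. \<integral>x. h (x - \<mu> (I n \<omega> i)) \<partial>L (I n \<omega> i))"
      by (rule prod) (rule I_less[OF n])
    finally show "(\<integral>x. h (?G (\<omega>, x) - \<mu> n) \<partial>copies n) = h (P n \<omega> + (\<Sum>i=0..K. \<mu> (I n \<omega> i)) - \<mu> n) *
           (\<Prod>i=0..K. \<integral>x. h (x - \<mu> (I n \<omega> i)) \<partial>L (I n \<omega> i))" .
  qed
  finally show ?thesis .
qed

text \<open>The empty list has a single permutation, so its cost is a constant. This makes the
  recursion consistent at empty sublists, where the normalization divides by 0.\<close>

lemma L_0: "AE x in L 0. x = \<mu> 0"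
proof -
  define c where "c = real (cmp_count (alg 0) (\<lambda>i. real (id i)))"
  have eq: "L 0 = distr (return_pmf id) borel (\<lambda>\<pi>. real (cmp_count (alg 0) (\<lambda>i. real (\<pi> i))))"
    by (subst L_small) (auto simp: pmf_of_set_singleton)
  have *: "AE x in L 0. x = c"
    by (subst eq, subst AE_distr_iff) (auto simp: c_def AE_measure_pmf_iff)
  have "\<mu> 0 = (\<integral>x. c \<partial>L 0)" unfolding \<mu>_def using * by (intro integral_cong_AE) auto
  then have "\<mu> 0 = c" using L.prob_space[of 0] by simp
  with * show ?thesis by simp
qed

section \<open>Deviations of partition cost and sublist sizes from their limits\<close>

definition \<gamma> :: real where "\<gamma> = gamma_const K"

lemma opt_cost_spacing_bounds:
  assumes "good_pivots K v" shows "0 \<le> opt_cost K (spacing K v)" "opt_cost K (spacing K v) \<le> real K"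
  using opt_cost_bounds[of K "spacing K v"] spacing_pos[OF assms] sum_spacing[OF assms] by (auto simp: less_imp_le)

lemma measurable_fst_input [measurable]:
  "f \<in> borel_measurable (pivot_space K) \<Longrightarrow> (\<lambda>\<omega>. f (fst \<omega>)) \<in> borel_measurable (input_space K)"
  unfolding input_space_eq by (rule measurable_compose[OF measurable_fst])

lemma AE_good: "AE \<omega> in input_space K. good_pivots K (fst \<omega>)"
  by (rule AE_input_space_fst[OF AE_good_pivots])

lemma integrable_P: "integrable (input_space K) (P n)"
  by (rule input_space.integrable_const_bound[where B="real K * real n + (real K)\<^sup>2"])
     (use AE_P_bounds[of n] in auto)

lemma integrable_opt: "integrable (input_space K) (\<lambda>\<omega>. opt_cost K (spacing K (fst \<omega>)))"
proof (rule input_space.integrable_const_bound[where B="real K"])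
  show "AE \<omega> in input_space K. norm (opt_cost K (spacing K (fst \<omega>))) \<le> real K"
    using AE_good by eventually_elim (use opt_cost_spacing_bounds in auto)
qed measurable

text \<open>For fixed good pivots, the deviation of the step costs is supplemented by two bounded
  corrections, each at most \<open>K\<^sup>2\<close>: the cost of sorting the pivots, and the
  optimal cost attributed to the \<open>K\<close> items that are not classified.\<close>

theorem partition_cost_deviation:
  assumes n: "K < n"
  shows "(\<integral>\<omega>. \<bar>P n \<omega> - real n * opt_cost K (spacing K (fst \<omega>))\<bar> \<partial>input_space K) \<le> 16 * (real (K + 1))\<^sup>2 * sqrt (real n)"
proof (rule integral_input_space_le)
  show "integrable (input_space K) (\<lambda>\<omega>. \<bar>P n \<omega> - real n * opt_cost K (spacing K (fst \<omega>))\<bar>)"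
    using integrable_P integrable_opt by auto
  fix v assume v: "v \<in> space (pivot_space K)" "good_pivots K v"
  define opt where "opt = opt_cost K (spacing K v)"
  define m where "m = n - K"
  define S where "S a = (\<Sum>k=1..m. step_cost K ord (v, a) k)" for a
  have Si: "integrable seq_space S" unfolding S_def
    by (intro Bochner_Integration.integrable_sum step_cost_expectation[OF ord v(2,1)]) auto
  have opt: "0 \<le> opt" "opt \<le> real K" unfolding opt_def using opt_cost_spacing_bounds[OF v(2)] by auto
  have c: "real (cmp_count piv v) \<le> (real K)\<^sup>2"
  proof -
    have "cmp_count piv v \<le> K\<^sup>2" using piv_count[of v] v(2) by (simp add: good_pivots_def)
    then have "real (cmp_count piv v) \<le> real (K\<^sup>2)" by (rule of_nat_mono)
    then show ?thesis by simp
  qed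
  have nm: "real n = real m + real K" using n by (simp add: m_def)
  have pt: "\<bar>P n (v, a) - real n * opt\<bar> \<le> \<bar>S a - real m * opt\<bar> + 2 * (real K)\<^sup>2" for a
  proof -
    have "P n (v, a) - real n * opt = (S a - real m * opt) + (real (cmp_count piv v) - real K * opt)"
      using partition_cost_eq[OF ord, of piv n "(v, a)"] by (simp add: S_def m_def[symmetric] nm algebra_simps)
    moreover have "0 \<le> real K * opt" "real K * opt \<le> (real K)\<^sup>2" using opt by (auto simp: power2_eq_square mult_left_mono)
    moreover have "0 \<le> real (cmp_count piv v)" by simp
    ultimately show ?thesis using c by linarith
  qed
  have "(\<integral>a. \<bar>P n (v, a) - real n * opt\<bar> \<partial>seq_space) \<le> (\<integral>a. \<bar>S a - real m * opt\<bar> + 2 * (real K)\<^sup>2 \<partial>seq_space)"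
  proof (rule integral_mono)
    have "P n (v, a) = S a + real (cmp_count piv v)" for a
      using partition_cost_eq[OF ord, of piv n "(v, a)"] by (simp add: S_def m_def)
    then show "integrable seq_space (\<lambda>a. \<bar>P n (v, a) - real n * opt\<bar>)" using Si by simp
  qed (use Si pt in auto)
  also have "\<dots> = (\<integral>a. \<bar>S a - real m * opt\<bar> \<partial>seq_space) + 2 * (real K)\<^sup>2"
    using Si by (simp add: seq_space.prob_space)
  also have "\<dots> \<le> (10 * real K * real (K + 1) * sqrt (real m) + 4 * real K * real (K + 1)) + 2 * (real K)\<^sup>2"
    using total_step_cost_deviation[OF ord v(2,1), of m] by (simp add: S_def opt_def)
  also have "\<dots> \<le> 16 * (real (K + 1))\<^sup>2 * sqrt (real n)"
  \<comment> \<open>Source of the 16: collecting \<open>10 * k * (k + 1)\<close>,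
    \<open>4 * k * (k + 1)\<close> and \<open>2 * k\<^sup>2\<close> gives
    \<open>16 * k\<^sup>2 + 14 * k\<close>.\<close>
  proof -
    define s where "s = sqrt (real n)"
    define k where "k = real K"
    have s: "1 \<le> s" "sqrt (real m) \<le> s" using n by (auto simp: s_def m_def)
    have k: "0 \<le> k" by (simp add: k_def)
    have "10 * k * (k + 1) * sqrt (real m) \<le> 10 * k * (k + 1) * s" using s k by (intro mult_left_mono) auto
    moreover have "(4 * k * (k + 1) + 2 * k\<^sup>2) * 1 \<le> (4 * k * (k + 1) + 2 * k\<^sup>2) * s" using s k by (intro mult_left_mono) auto
    moreover have "(16 * k\<^sup>2 + 14 * k) * s \<le> (16 * (k + 1)\<^sup>2) * s"
      using s k by (intro mult_right_mono) (auto simp: power2_eq_square algebra_simps)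
    ultimately have "(10 * k * (k + 1) * sqrt (real m) + 4 * k * (k + 1)) + 2 * k\<^sup>2 \<le> 16 * (k + 1)\<^sup>2 * s"
      by (simp add: power2_eq_square algebra_simps)
    then show ?thesis by (simp add: k_def s_def add.commute)
  qed
  finally show "(\<integral>a. \<bar>P n (v, a) - real n * opt_cost K (spacing K (fst (v, a)))\<bar> \<partial>seq_space) \<le> 16 * (real (K + 1))\<^sup>2 * sqrt (real n)"
    by (simp add: opt_def)
qed

lemma AE_sum_I: "AE \<omega> in input_space K. (\<Sum>i=0..K. I n \<omega> i) = n - K"
proof (rule AE_input_spaceI)
  show "{\<omega> \<in> space (input_space K). (\<Sum>i=0..K. I n \<omega> i) = n - K} \<in> sets (input_space K)"
  proof -
    have "{\<omega> \<in> space (input_space K). (\<Sum>i=0..K. I n \<omega> i) = n - K} =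
       {\<omega> \<in> space (input_space K). (\<Sum>i=0..K. real (I n \<omega> i)) = real (n - K)}"
      by (simp flip: of_nat_sum)
    also have "\<dots> \<in> sets (input_space K)" by measurable
    finally show ?thesis .
  qed
  show "AE a in seq_space. (\<Sum>i=0..K. I n (v, a) i) = n - K" if "v \<in> space (pivot_space K)" "good_pivots K v" for v
    by (rule AE_sum_sublist_count[OF ord that(2,1)])
qed

theorem sublist_size_deviation:
  assumes n: "K < n"
  shows "integrable (input_space K) (\<lambda>\<omega>. \<Sum>i=0..K. \<bar>real (I n \<omega> i) / real n - spacing K (fst \<omega>) i\<bar>)"
    "(\<integral>\<omega>. (\<Sum>i=0..K. \<bar>real (I n \<omega> i) / real n - spacing K (fst \<omega>) i\<bar>) \<partial>input_space K) \<le> 2 * (real (K + 1))\<^sup>2 / sqrt (real n)"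
proof -
  have n0: "real n > 0" using n by simp
  have [measurable]: "(\<lambda>\<omega>. spacing K (fst \<omega>) i) \<in> borel_measurable (input_space K)" for i
    by (rule measurable_fst_input[OF measurable_spacing])
  show int: "integrable (input_space K) (\<lambda>\<omega>. \<Sum>i=0..K. \<bar>real (I n \<omega> i) / real n - spacing K (fst \<omega>) i\<bar>)"
  proof (intro Bochner_Integration.integrable_sum input_space.integrable_const_bound[where B=2])
    fix i assume i: "i \<in> {0..K}"
    show "AE \<omega> in input_space K. norm \<bar>real (I n \<omega> i) / real n - spacing K (fst \<omega>) i\<bar> \<le> 2"
      using AE_good
    proof eventually_elim
      case (elim \<omega>)
      have "real (I n \<omega> i) / real n \<le> 1" using I_less[OF n, of \<omega> i] n by simp
      moreover have "0 \<le> real (I n \<omega> i) / real n" by simp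
      moreover have "\<bar>x - y\<bar> \<le> 2" if "0 \<le> x" "x \<le> 1" "0 < y" "y \<le> 1" for x y :: real
        using that by (auto simp: abs_le_iff)
      ultimately show ?case using spacing_pos[OF elim, of i] spacing_le_1[OF elim, of i] i
        by (simp only: real_norm_def abs_abs atLeastAtMost_iff)
    qed
  qed measurable
  show "(\<integral>\<omega>. (\<Sum>i=0..K. \<bar>real (I n \<omega> i) / real n - spacing K (fst \<omega>) i\<bar>) \<partial>input_space K) \<le> 2 * (real (K + 1))\<^sup>2 / sqrt (real n)"
  proof (rule integral_input_space_le[OF int])
    fix v assume v: "v \<in> space (pivot_space K)" "good_pivots K v"
    define m where "m = n - K"
    define S where "S a = (\<Sum>i=0..K. \<bar>real (sublist_count K (v, a) m i) - real m * spacing K v i\<bar>)" for a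
    have Si: "integrable seq_space S" unfolding S_def by (rule sum_abs_deviation(1)[OF ord v(2,1)])
    have nm: "real n = real m + real K" using n by (simp add: m_def)
    have pt: "(\<Sum>i=0..K. \<bar>real (I n (v, a) i) / real n - spacing K v i\<bar>) \<le> S a / real n + real K * real (K + 1) / real n" for a
    proof -
      have "\<bar>real (I n (v, a) i) / real n - spacing K v i\<bar> \<le> (\<bar>real (sublist_count K (v, a) m i) - real m * spacing K v i\<bar> + real K) / real n"
        if i: "i \<in> {0..K}" for i
      proof -
        have "real (I n (v, a) i) / real n - spacing K v i = ((real (sublist_count K (v, a) m i) - real m * spacing K v i) - real K * spacing K v i) / real n"
          using n0 by (simp add: m_def[symmetric] divide_simps) (simp add: nm algebra_simps)
        also have "\<bar>\<dots>\<bar> = \<bar>(real (sublist_count K (v, a) m i) - real m * spacing K v i) - real K * spacing K v i\<bar> / real n"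
          by (simp add: abs_divide)
        also have "\<dots> \<le> (\<bar>real (sublist_count K (v, a) m i) - real m * spacing K v i\<bar> + real K) / real n"
        proof (rule divide_right_mono)
          have "spacing K v i \<le> 1" "0 \<le> spacing K v i"
            using spacing_pos[OF v(2), of i] spacing_le_1[OF v(2), of i] i by auto
          then have "0 \<le> real K * spacing K v i" "real K * spacing K v i \<le> real K * 1"
            by (intro mult_nonneg_nonneg mult_left_mono; simp)+
          then show "\<bar>(real (sublist_count K (v, a) m i) - real m * spacing K v i) - real K * spacing K v i\<bar>
             \<le> \<bar>real (sublist_count K (v, a) m i) - real m * spacing K v i\<bar> + real K" by linarith
        qed simp
        finally show ?thesis .
      qed
      then have "(\<Sum>i=0..K. \<bar>real (I n (v, a) i) / real n - spacing K v i\<bar>) \<le>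
        (\<Sum>i=0..K. (\<bar>real (sublist_count K (v, a) m i) - real m * spacing K v i\<bar> + real K) / real n)" by (rule sum_mono)
      also have "\<dots> = S a / real n + real K * real (K + 1) / real n"
        unfolding S_def by (simp only: sum_divide_distrib[symmetric] sum.distrib add_divide_distrib) (simp add: algebra_simps)
      finally show ?thesis .
    qed
    have mi: "integrable seq_space (\<lambda>a. \<Sum>i=0..K. \<bar>real (I n (v, a) i) / real n - spacing K v i\<bar>)"
    proof (rule Bochner_Integration.integrable_bound)
      show "integrable seq_space (\<lambda>a. S a / real n + real K * real (K + 1) / real n)" using Si by simp
      show "(\<lambda>a. \<Sum>i=0..K. \<bar>real (I n (v, a) i) / real n - spacing K v i\<bar>) \<in> borel_measurable seq_space"
        unfolding sublist_count_eq_hits by measurable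
      show "AE a in seq_space. norm (\<Sum>i=0..K. \<bar>real (I n (v, a) i) / real n - spacing K v i\<bar>) \<le> norm (S a / real n + real K * real (K + 1) / real n)"
        using pt by (intro AE_I2) (smt (verit) real_norm_def sum_nonneg abs_ge_zero)
    qed
    have "(\<integral>a. (\<Sum>i=0..K. \<bar>real (I n (v, a) i) / real n - spacing K v i\<bar>) \<partial>seq_space) \<le> (\<integral>a. S a / real n + real K * real (K + 1) / real n \<partial>seq_space)"
      using mi Si pt by (intro integral_mono) auto
    also have "\<dots> = (\<integral>a. S a \<partial>seq_space) / real n + real K * real (K + 1) / real n"
      using Si by (simp add: seq_space.prob_space)
    also have "\<dots> \<le> real (K + 1) * sqrt (real n) / real n + real K * real (K + 1) * sqrt (real n) / real n"
    proof (intro add_mono divide_right_mono)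
      have "(\<integral>a. S a \<partial>seq_space) \<le> real (K + 1) * sqrt (real m)" unfolding S_def by (rule sum_abs_deviation(2)[OF ord v(2,1)])
      also have "\<dots> \<le> real (K + 1) * sqrt (real n)" by (intro mult_left_mono) (auto simp: m_def)
      finally show "(\<integral>a. S a \<partial>seq_space) \<le> real (K + 1) * sqrt (real n)" .
      have "1 \<le> sqrt (real n)" using n by simp
      then have "real K * real (K + 1) * 1 \<le> real K * real (K + 1) * sqrt (real n)" by (intro mult_left_mono) auto
      then show "real K * real (K + 1) \<le> real K * real (K + 1) * sqrt (real n)" by simp
    qed auto
    also have "\<dots> = (real (K + 1))\<^sup>2 * (sqrt (real n) / real n)"
      by (simp add: power2_eq_square algebra_simps add_divide_distrib)
    also have "sqrt (real n) / real n = 1 / sqrt (real n)"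
      using n0 by (simp add: divide_simps)
    also have "(real (K + 1))\<^sup>2 * (1 / sqrt (real n)) \<le> 2 * (real (K + 1))\<^sup>2 / sqrt (real n)" by (simp add: divide_right_mono)
    finally show "(\<integral>a. (\<Sum>i=0..K. \<bar>real (I n (v, a) i) / real n - spacing K (fst (v, a)) i\<bar>) \<partial>seq_space) \<le> 2 * (real (K + 1))\<^sup>2 / sqrt (real n)"
      by simp
  qed
qed

end

section \<open>The asymptotic mean and the toll\<close>

context renewal_kernel
begin

text \<open>A fixed initial block \<open>{..<N}\<close> receives mass of order
  \<open>N\<^sup>2 / n\<^sup>2\<close>, so the average is governed by the tail of
  \<open>u\<close>.\<close>

lemma average_tendsto_0:
  assumes u: "u \<longlonglongrightarrow> 0" and u0: "\<And>j. 0 \<le> u j"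
  shows "(\<lambda>n. \<Sum>j<n. q n j * u j) \<longlonglongrightarrow> 0"
proof (rule LIMSEQ_I)
  fix e :: real assume e: "0 < e"
  obtain B where B: "\<And>j. u j \<le> B"
  proof -
    obtain B where "\<forall>n. norm (u n) \<le> B" using convergent_imp_Bseq[OF convergentI[OF u]] by (auto simp: Bseq_def)
    then show ?thesis by (intro that[of B]) (auto simp: abs_le_iff)
  qed
  have B0: "0 \<le> B" using B[of 0] u0[of 0] by linarith
  obtain N where N0: "\<forall>j\<ge>N. norm (u j - 0) < e / 2" using LIMSEQ_D[OF u, of "e / 2"] e by auto
  have N: "u j \<le> e / 2" if "j \<ge> N" for j
  proof -
    have "norm (u j - 0) < e / 2" using N0 that by blast
    then show ?thesis by (simp add: abs_less_iff)
  qed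
  have C: "0 \<le> C" using c_le_C c_pos by simp
  have "(\<lambda>n. B * (C * (real N)\<^sup>2) * (1 / real n)\<^sup>2) \<longlonglongrightarrow> B * (C * (real N)\<^sup>2) * 0\<^sup>2"
    by (intro tendsto_intros lim_const_over_n)
  then have "\<forall>\<^sub>F n in sequentially. B * (C * (real N)\<^sup>2) * (1 / real n)\<^sup>2 < e / 2"
    using e by (intro order_tendstoD(2)) auto
  then have "\<forall>\<^sub>F n in sequentially. norm ((\<Sum>j<n. q n j * u j) - 0) < e"
    using eventually_gt_at_top[of K] eventually_gt_at_top[of N]
  proof eventually_elim
    case (elim n)
    have "(\<Sum>j<n. q n j * u j) = (\<Sum>j\<in>{..<N} \<union> {N..<n}. q n j * u j)"
      using elim by (intro sum.cong) auto
    also have "\<dots> = (\<Sum>j<N. q n j * u j) + (\<Sum>j\<in>{N..<n}. q n j * u j)"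
      by (rule sum.union_disjoint) auto
    also have "(\<Sum>j<N. q n j * u j) \<le> (\<Sum>j<N. C * real N / (real n + 1)\<^sup>2 * B)"
    proof (rule sum_mono)
      fix j assume j: "j \<in> {..<N}"
      have "q n j \<le> C * (real j + 1) / (real n + 1)\<^sup>2" using q_upper elim by blast
      also have "\<dots> \<le> C * real N / (real n + 1)\<^sup>2" using j C by (intro divide_right_mono mult_left_mono) auto
      finally show "q n j * u j \<le> C * real N / (real n + 1)\<^sup>2 * B"
        using B u0 q_nonneg elim C by (intro mult_mono) auto
    qed
    also have "\<dots> = B * (C * (real N)\<^sup>2) * (1 / (real n + 1))\<^sup>2" by (simp add: power2_eq_square)
    also have "\<dots> \<le> B * (C * (real N)\<^sup>2) * (1 / real n)\<^sup>2"
      using elim B0 C by (intro mult_left_mono power_mono divide_left_mono) auto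
    also have "(\<Sum>j\<in>{N..<n}. q n j * u j) \<le> (\<Sum>j\<in>{N..<n}. q n j * (e / 2))"
      using N q_nonneg elim by (intro sum_mono mult_left_mono) auto
    also have "\<dots> \<le> (\<Sum>j<n. q n j * (e / 2))" using q_nonneg elim e by (intro sum_mono2) auto
    also have "\<dots> = (\<Sum>j<n. q n j) * (e / 2)" by (rule sum_distrib_right[symmetric])
    also have "\<dots> = e / 2" using q_sum[of n] elim by simp
    finally have "(\<Sum>j<n. q n j * u j) < e" using elim(1) by linarith
    moreover have "0 \<le> (\<Sum>j<n. q n j * u j)" using u0 q_nonneg elim by (intro sum_nonneg) auto
    ultimately show ?case by simp
  qed
  then show "\<exists>no. \<forall>n\<ge>no. norm ((\<Sum>j<n. q n j * u j) - 0) < e" by (simp add: eventually_sequentially)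
qed

text \<open>Compare both \<open>r j\<close> and \<open>r n\<close> with the limit. These averages
  measure what the second-order term of the mean contributes to the toll.\<close>

lemma oscillation_tendsto_0:
  assumes "convergent r"
  shows "(\<lambda>n. \<Sum>j<n. q n j * \<bar>r j - r n\<bar>) \<longlonglongrightarrow> 0"
proof -
  obtain l where l: "r \<longlonglongrightarrow> l" using assms by (auto simp: convergent_def)
  have u: "(\<lambda>j. \<bar>r j - l\<bar>) \<longlonglongrightarrow> 0" using l by (intro tendsto_rabs_zero) (rule LIM_zero)
  have lim: "(\<lambda>n. (\<Sum>j<n. q n j * \<bar>r j - l\<bar>) + \<bar>r n - l\<bar>) \<longlonglongrightarrow> 0"
    using tendsto_add[OF average_tendsto_0[OF u] u] by simp
  show ?thesis
  proof (rule tendsto_sandwich[OF _ _ tendsto_const lim])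
    show "\<forall>\<^sub>F n in sequentially. 0 \<le> (\<Sum>j<n. q n j * \<bar>r j - r n\<bar>)"
      using eventually_gt_at_top[of K] by eventually_elim (auto intro!: sum_nonneg mult_nonneg_nonneg q_nonneg)
    show "\<forall>\<^sub>F n in sequentially. (\<Sum>j<n. q n j * \<bar>r j - r n\<bar>) \<le> (\<Sum>j<n. q n j * \<bar>r j - l\<bar>) + \<bar>r n - l\<bar>"
      using eventually_gt_at_top[of K]
    proof eventually_elim
      case (elim n)
      have "(\<Sum>j<n. q n j * \<bar>r j - r n\<bar>) \<le> (\<Sum>j<n. q n j * (\<bar>r j - l\<bar> + \<bar>r n - l\<bar>))"
        using q_nonneg[OF elim] by (intro sum_mono mult_left_mono) auto
      also have "\<dots> = (\<Sum>j<n. q n j * \<bar>r j - l\<bar>) + (\<Sum>j<n. q n j) * \<bar>r n - l\<bar>"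
        by (simp add: distrib_left sum.distrib sum_distrib_right)
      finally show ?case using q_sum[OF elim] by simp
    qed
  qed
qed


end

section \<open>Second-order behaviour of the mean\<close>

context quicksort
begin

definition \<alpha> :: real where "\<alpha> = alpha_const K"

abbreviation D :: "(nat \<Rightarrow> real) \<times> (nat \<Rightarrow> real) \<Rightarrow> nat \<Rightarrow> real" where
  "D \<omega> \<equiv> spacing K (fst \<omega>)"

text \<open>The negative entropy of the relative sizes; an empty sublist contributes 0. Its limit is
  \<open>entD\<close>.\<close>

definition ent :: "nat \<Rightarrow> (nat \<Rightarrow> real) \<times> (nat \<Rightarrow> real) \<Rightarrow> real" where
  "ent n \<omega> = (\<Sum>i=0..K. real (I n \<omega> i) / real n * ln (real (I n \<omega> i) / real n))"

definition entD :: "(nat \<Rightarrow> real) \<times> (nat \<Rightarrow> real) \<Rightarrow> real" where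
  "entD \<omega> = (\<Sum>i=0..K. D \<omega> i * ln (D \<omega> i))"

lemma harm_gt_1: "harm (K + 1) > (1 :: real)"
proof -
  obtain k where k: "K = Suc k" using K_pos by (cases K) auto
  have "harm (Suc 0) \<le> (harm K :: real)" using K_pos by (intro harm_mono) simp
  then have "1 \<le> (harm K :: real)" by (simp add: harm_Suc harm_def)
  moreover have "harm (K + 1) = (harm K :: real) + 1 / (real K + 1)" by (simp add: harm_Suc inverse_eq_divide add.commute)
  moreover have "1 / (real K + 1) > 0" by simp
  ultimately show ?thesis by linarith
qed

lemma \<alpha>_harm: "\<alpha> * (harm (K + 1) - 1) = \<gamma>"
  using harm_gt_1 by (simp add: \<alpha>_def alpha_const_def \<gamma>_def)

lemma measurable_ent [measurable]: "ent n \<in> borel_measurable (input_space K)"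
  unfolding ent_def by measurable

lemma measurable_D [measurable]: "(\<lambda>\<omega>. D \<omega> i) \<in> borel_measurable (input_space K)"
  by (rule measurable_fst_input[OF measurable_spacing])

lemma measurable_entD [measurable]: "entD \<in> borel_measurable (input_space K)"
  unfolding entD_def by measurable

lemma I_div_bounds: assumes "K < n" shows "0 \<le> real (I n \<omega> i) / real n" "real (I n \<omega> i) / real n \<le> 1"
  using I_less[OF assms, of \<omega> i] by auto

lemma ent_bound: assumes n: "K < n" shows "\<bar>ent n \<omega>\<bar> \<le> 2 * real (K + 1)"
proof -
  have "\<bar>ent n \<omega>\<bar> \<le> (\<Sum>i=0..K. \<bar>real (I n \<omega> i) / real n * ln (real (I n \<omega> i) / real n)\<bar>)"
    unfolding ent_def by (rule sum_abs)
  also have "\<dots> \<le> (\<Sum>i=0..K. 2)" by (intro sum_mono abs_xlnx_le I_div_bounds n)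
  finally show ?thesis by simp
qed

lemma entD_bound: assumes "good_pivots K (fst \<omega>)" shows "\<bar>entD \<omega>\<bar> \<le> 2 * real (K + 1)"
proof -
  have "\<bar>entD \<omega>\<bar> \<le> (\<Sum>i=0..K. \<bar>D \<omega> i * ln (D \<omega> i)\<bar>)" unfolding entD_def by (rule sum_abs)
  also have "\<dots> \<le> (\<Sum>i=0..K. 2)"
    using spacing_pos[OF assms] spacing_le_1[OF assms] by (intro sum_mono abs_xlnx_le) (auto simp: less_imp_le)
  finally show ?thesis by simp
qed

lemma integrable_ent: "K < n \<Longrightarrow> integrable (input_space K) (ent n)"
  by (rule input_space.integrable_const_bound[where B="2 * real (K + 1)"]) (use ent_bound in auto)

lemma integrable_entD: "integrable (input_space K) entD"
proof (rule input_space.integrable_const_bound)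
  show "AE \<omega> in input_space K. norm (entD \<omega>) \<le> 2 * real (K + 1)"
    using AE_good by eventually_elim (use entD_bound in auto)
qed measurable

text \<open>The summands are symmetric in the spacings, so this is the logarithmic beta integral
  with exponent \<open>K - 1\<close>. The value explains the denominator of
  \<open>alpha_const\<close>: with that choice, \<open>\<alpha>\<close> times the mean cancels
  \<open>\<gamma>\<close>.\<close>

lemma expectation_entD: "(\<integral>\<omega>. entD \<omega> \<partial>input_space K) = - (harm (K + 1) - 1)"
proof -
  have "((\<lambda>x::real. x * ln x * (1 - x) ^ (K - 1)) has_integral - (harm (K - 1 + 2) - 1) / (real (K - 1 + 1) * real (K - 1 + 2))) {0..1}"
    by (rule xlnx_beta_integral)
  moreover have "K - 1 + 2 = K + 1" "K - 1 + 1 = K" using K_pos by auto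
  ultimately have I: "((\<lambda>x::real. x * ln x * (1 - x) ^ (K - 1)) has_integral - (harm (K + 1) - 1) / (real K * real (K + 1))) {0..1}"
    by simp
  have m: "(\<lambda>x::real. x * ln x) \<in> borel_measurable borel" by measurable
  note SL = spacing_law_integral[OF m continuous_on_xlnx I]
  have "(\<integral>\<omega>. entD \<omega> \<partial>input_space K) = (\<integral>v. (\<integral>a. entD (v, a) \<partial>seq_space) \<partial>pivot_space K)"
    by (rule integral_input_space(1)[OF integrable_entD])
  also have "\<dots> = (\<integral>v. (\<Sum>i=0..K. spacing K v i * ln (spacing K v i)) \<partial>pivot_space K)"
    by (simp add: entD_def seq_space.prob_space)
  also have "\<dots> = real (K + 1) * (\<integral>x. x * ln x \<partial>spacing_law K)"
    by (rule expectation_sum_spacing(2)[OF K_pos m SL(1)])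
  also have "\<dots> = real (K + 1) * (real K * (- (harm (K + 1) - 1) / (real K * real (K + 1))))" unfolding SL(2) ..
  also have "\<dots> = - (harm (K + 1) - 1)"
  proof -
    have "real (K + 1) \<noteq> 0" "real K \<noteq> 0" using K_pos by auto
    moreover have "a * (c * (x / (c * a))) = x" if "a \<noteq> 0" "c \<noteq> 0" for a c x :: real using that by simp
    ultimately show ?thesis by blast
  qed
  finally show ?thesis .
qed

lemma expectation_opt: "(\<integral>\<omega>. opt_cost K (D \<omega>) \<partial>input_space K) = \<gamma>"
  unfolding integral_input_space(1)[OF integrable_opt] by (simp add: seq_space.prob_space \<gamma>_def gamma_const_def)

text \<open>Hoelder continuity yields the root of a deviation whose mean is of order
  \<open>n powr (- 1 / 2)\<close>. The inequality \<open>2 * sqrt x \<le> x / s + s\<close>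
  linearizes the root, and \<open>s = n powr (- 1 / 4)\<close> balances its two terms.\<close>

lemma ent_deviation:
  assumes n: "K < n"
  shows "(\<integral>\<omega>. \<bar>ent n \<omega> - entD \<omega>\<bar> \<partial>input_space K) \<le> 3 * (real (K + 1))\<^sup>2 * real n powr (- 1 / 4)"
proof -
  define s where "s = real n powr (- 1 / 4)"
  have n0: "real n > 0" using n by simp
  have s: "s > 0" using n0 by (simp add: s_def)
  define X where "X \<omega> = (\<Sum>i=0..K. \<bar>real (I n \<omega> i) / real n - D \<omega> i\<bar>)" for \<omega>
  have Xi: "integrable (input_space K) X" and EX: "(\<integral>\<omega>. X \<omega> \<partial>input_space K) \<le> 2 * (real (K + 1))\<^sup>2 / sqrt (real n)"
    unfolding X_def by (fact sublist_size_deviation[OF n])+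
  have "(\<integral>\<omega>. \<bar>ent n \<omega> - entD \<omega>\<bar> \<partial>input_space K) \<le> (\<integral>\<omega>. X \<omega> / s + real (K + 1) * s \<partial>input_space K)"
  proof (rule integral_mono_AE)
    show "integrable (input_space K) (\<lambda>\<omega>. \<bar>ent n \<omega> - entD \<omega>\<bar>)" using integrable_ent[OF n] integrable_entD by auto
    show "integrable (input_space K) (\<lambda>\<omega>. X \<omega> / s + real (K + 1) * s)" using Xi by simp
    show "AE \<omega> in input_space K. \<bar>ent n \<omega> - entD \<omega>\<bar> \<le> X \<omega> / s + real (K + 1) * s"
      using AE_good
    proof eventually_elim
      case (elim \<omega>)
      have "\<bar>ent n \<omega> - entD \<omega>\<bar> = \<bar>\<Sum>i=0..K. real (I n \<omega> i) / real n * ln (real (I n \<omega> i) / real n) - D \<omega> i * ln (D \<omega> i)\<bar>"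
        by (simp only: ent_def entD_def sum_subtractf)
      also have "\<dots> \<le> (\<Sum>i=0..K. \<bar>real (I n \<omega> i) / real n * ln (real (I n \<omega> i) / real n) - D \<omega> i * ln (D \<omega> i)\<bar>)"
        by (rule sum_abs)
      also have "\<dots> \<le> (\<Sum>i=0..K. \<bar>real (I n \<omega> i) / real n - D \<omega> i\<bar> / s + s)"
      proof (rule sum_mono)
        fix i assume i: "i \<in> {0..K}"
        define x where "x = \<bar>real (I n \<omega> i) / real n - D \<omega> i\<bar>"
        have "\<bar>real (I n \<omega> i) / real n * ln (real (I n \<omega> i) / real n) - D \<omega> i * ln (D \<omega> i)\<bar> \<le> 2 * sqrt x"
          unfolding x_def using spacing_pos[OF elim, of i] spacing_le_1[OF elim, of i] i
          by (intro xlnx_holder I_div_bounds n) auto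
        also have "\<dots> \<le> x / s + s"
        proof -
          have "0 \<le> (sqrt x - s)\<^sup>2" by simp
          then have "2 * sqrt x * s \<le> x + s\<^sup>2"
            unfolding power2_diff by (simp add: x_def)
          then have "2 * sqrt x * s / s \<le> (x + s\<^sup>2) / s" using s by (intro divide_right_mono) auto
          then show ?thesis using s by (simp add: add_divide_distrib power2_eq_square)
        qed
        finally show "\<bar>real (I n \<omega> i) / real n * ln (real (I n \<omega> i) / real n) - D \<omega> i * ln (D \<omega> i)\<bar>
            \<le> \<bar>real (I n \<omega> i) / real n - D \<omega> i\<bar> / s + s" by (simp only: x_def)
      qed
      also have "\<dots> = X \<omega> / s + real (K + 1) * s" by (simp add: X_def sum.distrib sum_divide_distrib)
      finally show ?case .
    qed
  qed
  also have "\<dots> = (\<integral>\<omega>. X \<omega> \<partial>input_space K) / s + real (K + 1) * s" using Xi by (simp add: input_space.prob_space)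
  also have "\<dots> \<le> 2 * (real (K + 1))\<^sup>2 / sqrt (real n) / s + real (K + 1) * s"
    using EX s by (intro add_right_mono divide_right_mono) auto
  also have "2 * (real (K + 1))\<^sup>2 / sqrt (real n) / s = 2 * (real (K + 1))\<^sup>2 * s"
  proof -
    have "s * s = real n powr (- 1 / 2)" unfolding s_def by (simp only: powr_add[symmetric]) simp
    also have "\<dots> = 1 / sqrt (real n)" using n0 by (simp add: powr_minus_divide powr_half_sqrt)
    finally have ss: "1 / sqrt (real n) = s * s" by simp
    have "2 * (real (K + 1))\<^sup>2 / sqrt (real n) / s = 2 * (real (K + 1))\<^sup>2 * (1 / sqrt (real n)) / s" by simp
    then show ?thesis unfolding ss using s by simp
  qed
  also have "2 * (real (K + 1))\<^sup>2 * s + real (K + 1) * s \<le> 2 * (real (K + 1))\<^sup>2 * s + (real (K + 1))\<^sup>2 * s"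
    using s by (intro add_left_mono mult_right_mono self_le_power) auto
  also have "\<dots> = 3 * (real (K + 1))\<^sup>2 * s" by simp
  finally show ?thesis by (simp only: s_def)
qed

text \<open>The \<open>K + 1\<close> sizes sum to \<open>n - K\<close>, so the numbers
  \<open>I + 1\<close> sum to \<open>n + 1\<close>. Dividing by \<open>n + 1\<close> rather than by
  \<open>n\<close> thus makes the coefficients in the recursion for \<open>r\<close> sum to exactly
  1.\<close>

definition r :: "nat \<Rightarrow> real" where
  "r n = (\<mu> n - \<alpha> * (real n * ln (real n))) / (real n + 1)"

lemma \<mu>_eq: "\<mu> n = \<alpha> * (real n * ln (real n)) + (real n + 1) * r n"
proof -
  have "real n + 1 \<noteq> 0" by linarith
  then show ?thesis by (simp add: r_def)
qed

text \<open>Law of the size of a sublist picked with probability proportional to its size plus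
  one.\<close>

definition q :: "nat \<Rightarrow> nat \<Rightarrow> real" where
  "q n j = sublist_weight K n j * (real j + 1) / (real n + 1)"

lemma sum_weight:
  assumes n: "K < n"
  shows "integrable (input_space K) (\<lambda>\<omega>. \<Sum>i=0..K. g (I n \<omega> i))"
    "(\<integral>\<omega>. (\<Sum>i=0..K. g (I n \<omega> i)) \<partial>input_space K) = (\<Sum>j<n. sublist_weight K n j * g j)"
proof -
  have eq: "(\<Sum>i=0..K. g (I n \<omega> i)) = (\<Sum>j<n. (\<Sum>i=0..K. of_bool (I n \<omega> i = j)) * g j)" for \<omega>
  proof -
    have gi: "g (I n \<omega> i) = (\<Sum>j<n. of_bool (I n \<omega> i = j) * g j)" for i
    proof -
      have "(\<Sum>j<n. of_bool (I n \<omega> i = j) * g j) = (\<Sum>j<n. if j = I n \<omega> i then g j else 0)"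
        by (intro sum.cong) auto
      then show ?thesis using I_less[OF n, of \<omega> i] by simp
    qed
    have "(\<Sum>i=0..K. g (I n \<omega> i)) = (\<Sum>i=0..K. \<Sum>j<n. of_bool (I n \<omega> i = j) * g j)"
      by (intro sum.cong refl gi)
    also have "\<dots> = (\<Sum>j<n. \<Sum>i=0..K. of_bool (I n \<omega> i = j) * g j)" by (rule sum.swap)
    finally show ?thesis by (simp only: sum_distrib_right)
  qed
  have int: "integrable (input_space K) (\<lambda>\<omega>. \<Sum>i=0..K. of_bool (I n \<omega> i = j) :: real)" for j
    by (intro Bochner_Integration.integrable_sum input_space.integrable_const_bound[where B=1]) (auto, measurable)
  show "integrable (input_space K) (\<lambda>\<omega>. \<Sum>i=0..K. g (I n \<omega> i))"
    unfolding eq by (intro Bochner_Integration.integrable_sum integrable_mult_left int)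
  have "(\<integral>\<omega>. (\<Sum>i=0..K. g (I n \<omega> i)) \<partial>input_space K) = (\<Sum>j<n. \<integral>\<omega>. (\<Sum>i=0..K. of_bool (I n \<omega> i = j)) * g j \<partial>input_space K)"
    unfolding eq by (intro Bochner_Integration.integral_sum integrable_mult_left int)
  also have "\<dots> = (\<Sum>j<n. sublist_weight K n j * g j)"
    unfolding sublist_weight_def by (intro sum.cong refl integral_mult_left_zero)
  finally show "(\<integral>\<omega>. (\<Sum>i=0..K. g (I n \<omega> i)) \<partial>input_space K) = (\<Sum>j<n. sublist_weight K n j * g j)" .
qed

lemma sum_q:
  assumes n: "K < n"
  shows "(\<integral>\<omega>. (\<Sum>i=0..K. (real (I n \<omega> i) + 1) * g (I n \<omega> i)) \<partial>input_space K) = (real n + 1) * (\<Sum>j<n. q n j * g j)"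
proof -
  have "(real n + 1) * (\<Sum>j<n. q n j * g j) = (\<Sum>j<n. sublist_weight K n j * ((real j + 1) * g j))"
  proof -
    have "real n + 1 \<noteq> 0" by linarith
    then show ?thesis unfolding sum_distrib_left q_def by (intro sum.cong) auto
  qed
  then show ?thesis using sum_weight(2)[OF n, of "\<lambda>j. (real j + 1) * g j"] by simp
qed

lemma AE_sum_I_Suc:
  assumes n: "K < n" shows "AE \<omega> in input_space K. (\<Sum>i=0..K. real (I n \<omega> i) + 1) = real n + 1"
  using AE_sum_I[of n]
proof eventually_elim
  case (elim \<omega>)
  have "(\<Sum>i=0..K. real (I n \<omega> i)) = real (n - K)" by (simp only: elim of_nat_sum[symmetric])
  then show ?case using n by (simp add: sum.distrib of_nat_diff)
qed

text \<open>The threshold combines \<open>3 * K \<le> n\<close> for the lower bound on the weights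
  with the 15 required by the locale. The factor 2 in the upper constant absorbs
  \<open>1 / n \<le> 2 / (n + 1)\<close>.\<close>

lemma renewal_kernel_q:
  "renewal_kernel q (3 * K + 15) K (real (K + 1) * real K * (1 / 4) ^ (K - 1)) (2 * real (K + 1) * real K)"
proof
  fix n j :: nat assume n: "K < n"
  have n0: "real n > 0" using n by simp
  show "0 \<le> q n j" unfolding q_def using sublist_weight_nonneg by (intro divide_nonneg_pos mult_nonneg_nonneg) auto
  have "sublist_weight K n j * (real j + 1) / (real n + 1) \<le> (real (K + 1) * real K / real n) * (real j + 1) / (real n + 1)"
    using sublist_weight_upper[OF K_pos n, of j] by (intro divide_right_mono mult_right_mono) auto
  also have "\<dots> = (real (K + 1) * real K * (real j + 1) / (real n + 1)) * (1 / real n)" by simp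
  also have "\<dots> \<le> (real (K + 1) * real K * (real j + 1) / (real n + 1)) * (2 / (real n + 1))"
  proof (intro mult_left_mono)
    show "1 / real n \<le> 2 / (real n + 1)" using n0 n by (simp add: divide_simps)
  qed auto
  also have "\<dots> = 2 * real (K + 1) * real K * (real j + 1) / (real n + 1)\<^sup>2"
  proof -
    have "x * y * z / m * (2 / m) = 2 * x * y * z / m\<^sup>2" for x y z m :: real by (simp add: power2_eq_square)
    then show ?thesis .
  qed
  finally show "q n j \<le> 2 * real (K + 1) * real K * (real j + 1) / (real n + 1)\<^sup>2" by (simp only: q_def)
next
  fix n assume n: "K < n"
  have "(real n + 1) * (\<Sum>j<n. q n j * 1) = (\<integral>\<omega>. (\<Sum>i=0..K. (real (I n \<omega> i) + 1) * 1) \<partial>input_space K)"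
    by (rule sum_q[OF n, symmetric])
  also have "\<dots> = (\<integral>\<omega>. real n + 1 \<partial>input_space K)"
    using AE_sum_I_Suc[OF n] by (intro integral_cong_AE) (auto, measurable)
  also have "\<dots> = real n + 1" by (simp add: input_space.prob_space)
  finally have *: "(real n + 1) * (\<Sum>j<n. q n j) = (real n + 1) * 1" by simp
  have "real n + 1 \<noteq> 0" by linarith
  with * show "(\<Sum>j<n. q n j) = 1" using mult_left_cancel by blast
next
  fix n j :: nat assume n: "3 * K + 15 \<le> n" and j: "2 * j \<le> n"
  let ?c = "real (K + 1) * real K * (1 / 4) ^ (K - 1)"
  have n0: "real n > 0" using n by simp
  have "?c * (real j + 1) / (real n + 1)\<^sup>2 = (?c * (real j + 1) / (real n + 1)) * (1 / (real n + 1))" by (simp add: power2_eq_square)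
  also have "\<dots> \<le> (?c * (real j + 1) / (real n + 1)) * (1 / real n)"
    using n0 by (intro mult_left_mono divide_left_mono) auto
  also have "\<dots> = (?c / real n) * (real j + 1) / (real n + 1)" by simp
  also have "\<dots> \<le> sublist_weight K n j * (real j + 1) / (real n + 1)"
    using sublist_weight_lower[OF K_pos _ j] n by (intro divide_right_mono mult_right_mono) auto
  finally show "?c * (real j + 1) / (real n + 1)\<^sup>2 \<le> q n j" by (simp only: q_def)
next
  show "K < 3 * K + 15" "15 \<le> 3 * K + 15" by simp_all
  show "0 < real (K + 1) * real K * (1 / 4) ^ (K - 1)" using K_pos by simp
qed

sublocale ker: renewal_kernel q "3 * K + 15" K "real (K + 1) * real K * (1 / 4) ^ (K - 1)" "2 * real (K + 1) * real K"
  by (rule renewal_kernel_q)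

text \<open>Write \<open>ln I\<close> as \<open>ln (I / n) + ln n\<close>. The sizes sum to
  \<open>n - K\<close> instead of \<open>n\<close>, which leaves the correction with
  \<open>ln n\<close>.\<close>

lemma AE_toll:
  assumes n: "K < n"
  shows "AE \<omega> in input_space K. \<alpha> * (\<Sum>i=0..K. real (I n \<omega> i) * ln (real (I n \<omega> i))) - \<alpha> * (real n * ln (real n))
    = \<alpha> * real n * ent n \<omega> - \<alpha> * real K * ln (real n)"
  using AE_sum_I[of n]
proof eventually_elim
  case (elim \<omega>)
  have n0: "real n > 0" using n by simp
  have S: "(\<Sum>i=0..K. real (I n \<omega> i)) = real n - real K"
    using n unfolding of_nat_sum[symmetric] elim by (simp add: of_nat_diff)
  have "real k * ln (real k) = real n * (real k / real n * ln (real k / real n)) + real k * ln (real n)" for k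
    using n0 by (cases "k = 0") (auto simp: ln_div algebra_simps)
  then have "(\<Sum>i=0..K. real (I n \<omega> i) * ln (real (I n \<omega> i)))
     = (\<Sum>i=0..K. real n * (real (I n \<omega> i) / real n * ln (real (I n \<omega> i) / real n)) + real (I n \<omega> i) * ln (real n))"
    by (intro sum.cong refl) blast
  also have "\<dots> = real n * ent n \<omega> + (\<Sum>i=0..K. real (I n \<omega> i)) * ln (real n)"
    by (simp only: sum.distrib ent_def sum_distrib_left sum_distrib_right)
  finally have e: "(\<Sum>i=0..K. real (I n \<omega> i) * ln (real (I n \<omega> i))) = real n * ent n \<omega> + (\<Sum>i=0..K. real (I n \<omega> i)) * ln (real n)" .
  show ?case unfolding e S by (simp add: algebra_simps)
qed

text \<open>The inhomogeneity \<open>T\<close> has linear part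
  \<open>n * (\<gamma> + \<alpha> * E entD) = 0\<close>. The remainder is of order
  \<open>n powr (3 / 4)\<close>, with the entropy deviation as its largest contribution; division by
  \<open>n + 1\<close> gives the scale \<open>\<phi>\<close>.\<close>

theorem r_convergent: "convergent r"
proof -
  define C where "C = 16 * (real (K + 1))\<^sup>2 + \<bar>\<alpha>\<bar> * (3 * (real (K + 1))\<^sup>2) + 2 * \<bar>\<alpha>\<bar> * real K"
  have "ker.perturbed_harmonic C r"
    unfolding ker.perturbed_harmonic_def
  proof (intro allI impI)
    fix n assume n: "K < n"
    have n0: "real n > 0" and n1: "real n \<ge> 1" using n by simp_all
    let ?M = "input_space K"
    define T where "T = (\<integral>\<omega>. P n \<omega> + (\<alpha> * real n * ent n \<omega> - \<alpha> * real K * ln (real n)) \<partial>?M)"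
    have rint: "integrable ?M (\<lambda>\<omega>. \<Sum>i=0..K. (real (I n \<omega> i) + 1) * r (I n \<omega> i))"
      using sum_weight(1)[OF n, of "\<lambda>j. (real j + 1) * r j"] by simp
    have tint: "integrable ?M (\<lambda>\<omega>. P n \<omega> + (\<alpha> * real n * ent n \<omega> - \<alpha> * real K * ln (real n)))"
      using integrable_P integrable_ent[OF n] by auto
    have "\<mu> n - \<alpha> * (real n * ln (real n)) = (\<integral>\<omega>. P n \<omega> + (\<Sum>i=0..K. \<mu> (I n \<omega> i)) \<partial>?M) - \<alpha> * (real n * ln (real n))"
      using mean_recursion[OF n] by simp
    also have "\<dots> = (\<integral>\<omega>. P n \<omega> + (\<Sum>i=0..K. \<mu> (I n \<omega> i)) - \<alpha> * (real n * ln (real n)) \<partial>?M)"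
      using integrable_P sum_weight(1)[OF n, of \<mu>] by (simp add: input_space.prob_space)
    also have "\<dots> = (\<integral>\<omega>. (\<Sum>i=0..K. (real (I n \<omega> i) + 1) * r (I n \<omega> i)) + (P n \<omega> + (\<alpha> * real n * ent n \<omega> - \<alpha> * real K * ln (real n))) \<partial>?M)"
    proof (rule integral_cong_AE)
      show "AE \<omega> in ?M. P n \<omega> + (\<Sum>i=0..K. \<mu> (I n \<omega> i)) - \<alpha> * (real n * ln (real n)) =
        (\<Sum>i=0..K. (real (I n \<omega> i) + 1) * r (I n \<omega> i)) + (P n \<omega> + (\<alpha> * real n * ent n \<omega> - \<alpha> * real K * ln (real n)))"
        using AE_toll[OF n]
      proof eventually_elim
        case (elim \<omega>)
        have "(\<Sum>i=0..K. \<mu> (I n \<omega> i)) = \<alpha> * (\<Sum>i=0..K. real (I n \<omega> i) * ln (real (I n \<omega> i))) + (\<Sum>i=0..K. (real (I n \<omega> i) + 1) * r (I n \<omega> i))"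
          by (simp only: \<mu>_eq sum.distrib sum_distrib_left)
        then show ?case using elim by linarith
      qed
      show "(\<lambda>\<omega>. P n \<omega> + (\<Sum>i=0..K. \<mu> (I n \<omega> i)) - \<alpha> * (real n * ln (real n))) \<in> borel_measurable ?M"
        using integrable_P[of n] sum_weight(1)[OF n, of \<mu>] by auto
      show "(\<lambda>\<omega>. (\<Sum>i=0..K. (real (I n \<omega> i) + 1) * r (I n \<omega> i)) + (P n \<omega> + (\<alpha> * real n * ent n \<omega> - \<alpha> * real K * ln (real n)))) \<in> borel_measurable ?M"
        using rint tint by auto
    qed
    also have "\<dots> = (real n + 1) * (\<Sum>j<n. q n j * r j) + T"
      unfolding T_def sum_q[OF n, symmetric] by (rule Bochner_Integration.integral_add[OF rint tint])
    finally have e: "r n - (\<Sum>j<n. q n j * r j) = T / (real n + 1)"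
      unfolding r_def[of n] using n0 by (simp add: field_simps)
    have Tb: "\<bar>T\<bar> \<le> C * real n powr (3 / 4)"
    proof -
      have "T = (\<integral>\<omega>. P n \<omega> \<partial>?M) + \<alpha> * real n * (\<integral>\<omega>. ent n \<omega> \<partial>?M) - \<alpha> * real K * ln (real n)"
        unfolding T_def using integrable_P integrable_ent[OF n] by (simp add: input_space.prob_space)
      \<comment> \<open>Inserting \<open>\<gamma> = - \<alpha> * E entD\<close> pairs each
        expectation with its limit.\<close>
      also have "\<dots> = ((\<integral>\<omega>. P n \<omega> \<partial>?M) - real n * \<gamma>) + \<alpha> * real n * ((\<integral>\<omega>. ent n \<omega> \<partial>?M) - (\<integral>\<omega>. entD \<omega> \<partial>?M)) - \<alpha> * real K * ln (real n)"
        unfolding expectation_entD \<alpha>_harm[symmetric] by (simp add: algebra_simps)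
      finally have T: "T = \<dots>" .
      have 1: "\<bar>(\<integral>\<omega>. P n \<omega> \<partial>?M) - real n * \<gamma>\<bar> \<le> 16 * (real (K + 1))\<^sup>2 * real n powr (3 / 4)"
      proof -
        have "(\<integral>\<omega>. P n \<omega> \<partial>?M) - real n * \<gamma> = (\<integral>\<omega>. P n \<omega> - real n * opt_cost K (D \<omega>) \<partial>?M)"
          using integrable_P[of n] integrable_opt expectation_opt by simp
        also have "\<bar>\<dots>\<bar> \<le> (\<integral>\<omega>. \<bar>P n \<omega> - real n * opt_cost K (D \<omega>)\<bar> \<partial>?M)" by (rule integral_abs_bound)
        also have "\<dots> \<le> 16 * (real (K + 1))\<^sup>2 * sqrt (real n)" by (rule partition_cost_deviation[OF n])
        also have "sqrt (real n) = real n powr (1 / 2)" using n0 by (simp add: powr_half_sqrt)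
        also have "16 * (real (K + 1))\<^sup>2 * real n powr (1 / 2) \<le> 16 * (real (K + 1))\<^sup>2 * real n powr (3 / 4)"
          using n1 by (intro mult_left_mono powr_mono) auto
        finally show ?thesis .
      qed
      have 2: "\<bar>\<alpha> * real n * ((\<integral>\<omega>. ent n \<omega> \<partial>?M) - (\<integral>\<omega>. entD \<omega> \<partial>?M))\<bar> \<le> \<bar>\<alpha>\<bar> * (3 * (real (K + 1))\<^sup>2) * real n powr (3 / 4)"
      proof -
        have "\<bar>(\<integral>\<omega>. ent n \<omega> \<partial>?M) - (\<integral>\<omega>. entD \<omega> \<partial>?M)\<bar> = \<bar>\<integral>\<omega>. ent n \<omega> - entD \<omega> \<partial>?M\<bar>"
          using integrable_ent[OF n] integrable_entD by simp
        also have "\<dots> \<le> (\<integral>\<omega>. \<bar>ent n \<omega> - entD \<omega>\<bar> \<partial>?M)" by (rule integral_abs_bound)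
        also have "\<dots> \<le> 3 * (real (K + 1))\<^sup>2 * real n powr (- 1 / 4)" by (rule ent_deviation[OF n])
        finally have "\<bar>\<alpha>\<bar> * real n * \<bar>(\<integral>\<omega>. ent n \<omega> \<partial>?M) - (\<integral>\<omega>. entD \<omega> \<partial>?M)\<bar> \<le> \<bar>\<alpha>\<bar> * real n * (3 * (real (K + 1))\<^sup>2 * real n powr (- 1 / 4))"
          by (intro mult_left_mono) auto
        also have "\<dots> = \<bar>\<alpha>\<bar> * (3 * (real (K + 1))\<^sup>2) * (real n powr 1 * real n powr (- 1 / 4))" using n0 by simp
        also have "real n powr 1 * real n powr (- 1 / 4) = real n powr (3 / 4)" by (simp only: powr_add[symmetric]) simp
        finally show ?thesis by (simp add: abs_mult)
      qed
      have 3: "\<bar>\<alpha> * real K * ln (real n)\<bar> \<le> 2 * \<bar>\<alpha>\<bar> * real K * real n powr (3 / 4)"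
      proof -
        have "ln (sqrt (real n)) \<le> sqrt (real n) - 1" using n0 by (intro ln_le_minus_one) simp
        then have "ln (real n) \<le> 2 * sqrt (real n)" using n0 by (simp add: ln_sqrt)
        also have "sqrt (real n) = real n powr (1 / 2)" using n0 by (simp add: powr_half_sqrt)
        also have "2 * real n powr (1 / 2) \<le> 2 * real n powr (3 / 4)" using n1 by (intro mult_left_mono powr_mono) auto
        finally have "\<bar>\<alpha>\<bar> * real K * ln (real n) \<le> \<bar>\<alpha>\<bar> * real K * (2 * real n powr (3 / 4))" by (intro mult_left_mono) auto
        then show ?thesis using n1 by (simp add: abs_mult)
      qed
      have "\<bar>T\<bar> \<le> 16 * (real (K + 1))\<^sup>2 * real n powr (3 / 4) + \<bar>\<alpha>\<bar> * (3 * (real (K + 1))\<^sup>2) * real n powr (3 / 4) + 2 * \<bar>\<alpha>\<bar> * real K * real n powr (3 / 4)"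
        using 1 2 3 unfolding T by linarith
      also have "\<dots> = C * real n powr (3 / 4)" by (simp add: C_def distrib_right)
      finally show ?thesis .
    qed
    have C0: "C \<ge> 0" unfolding C_def by (intro add_nonneg_nonneg mult_nonneg_nonneg) auto
    have "\<bar>r n - (\<Sum>j<n. q n j * r j)\<bar> = \<bar>T\<bar> / (real n + 1)" unfolding e by simp
    also have "\<dots> \<le> C * (real n + 1) powr (3 / 4) / (real n + 1)"
    proof (rule divide_right_mono)
      have "C * real n powr (3 / 4) \<le> C * (real n + 1) powr (3 / 4)" using C0 by (intro mult_left_mono powr_mono2) auto
      then show "\<bar>T\<bar> \<le> C * (real n + 1) powr (3 / 4)" using Tb by linarith
    qed simp
    also have "\<dots> = C * ((real n + 1) powr (3 / 4) * (real n + 1) powr (- 1))" by (simp add: powr_minus_divide)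
    also have "(real n + 1) powr (3 / 4) * (real n + 1) powr (- 1) = (real n + 1) powr (- 1 / 4)"
      by (simp only: powr_add[symmetric]) simp
    finally show "\<bar>r n - (\<Sum>j<n. q n j * r j)\<bar> \<le> C * ker.\<phi> n" by (simp only: ker.\<phi>_def)
  qed
  moreover have "C \<ge> 0" unfolding C_def by (intro add_nonneg_nonneg mult_nonneg_nonneg) auto
  ultimately show ?thesis by (rule ker.perturbed_harmonic_convergent)
qed

section \<open>The toll and its limit\<close>

definition toll :: "nat \<Rightarrow> (nat \<Rightarrow> real) \<times> (nat \<Rightarrow> real) \<Rightarrow> real" where
  "toll n \<omega> = (P n \<omega> + (\<Sum>i=0..K. \<mu> (I n \<omega> i)) - \<mu> n) / real n"

definition b :: "(nat \<Rightarrow> real) \<times> (nat \<Rightarrow> real) \<Rightarrow> real" where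
  "b \<omega> = opt_cost K (D \<omega>) + \<alpha> * entD \<omega>"

text \<open>Majorant for the part of the toll caused by the variation of \<open>r\<close>; its mean
  is a kernel average of \<open>\<bar>r j - r n\<bar>\<close>, up to the factor
  \<open>(n + 1) / n\<close>.\<close>

definition osc :: "nat \<Rightarrow> (nat \<Rightarrow> real) \<times> (nat \<Rightarrow> real) \<Rightarrow> real" where
  "osc n \<omega> = (\<Sum>i=0..K. (real (I n \<omega> i) + 1) * \<bar>r (I n \<omega> i) - r n\<bar>) / real n"

lemma measurable_b [measurable]: "b \<in> borel_measurable (input_space K)"
  unfolding b_def by (intro borel_measurable_add borel_measurable_times measurable_fst_input[OF measurable_opt_cost_spacing] measurable_entD) auto

lemma measurable_toll [measurable]: "toll n \<in> borel_measurable (input_space K)"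
proof -
  have "(\<lambda>\<omega>. \<mu> (I n \<omega> i)) \<in> borel_measurable (input_space K)" for i
    by (rule measurable_compose[OF measurable_sublist_count]) simp
  then show ?thesis unfolding toll_def
    by (intro borel_measurable_divide borel_measurable_diff borel_measurable_add borel_measurable_sum measurable_P) auto
qed

lemma integrable_osc: "K < n \<Longrightarrow> integrable (input_space K) (osc n)"
  unfolding osc_def using sum_weight(1)[of n "\<lambda>j. (real j + 1) * \<bar>r j - r n\<bar>"] by simp

text \<open>Since the sizes plus one sum to \<open>n + 1\<close>, the term
  \<open>(n + 1) * r n\<close> of \<open>\<mu> n\<close> can be distributed over the sublists, and
  only differences of \<open>r\<close> survive.\<close>

lemma toll_decomp:
  assumes n: "K < n"
  shows "AE \<omega> in input_space K. toll n \<omega> = P n \<omega> / real n + \<alpha> * ent n \<omega> - \<alpha> * real K * ln (real n) / real n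
     + (\<Sum>i=0..K. (real (I n \<omega> i) + 1) * (r (I n \<omega> i) - r n)) / real n"
  using AE_toll[OF n] AE_sum_I_Suc[OF n]
proof eventually_elim
  case (elim \<omega>)
  have n0: "real n > 0" using n by simp
  have 1: "(\<Sum>i=0..K. \<mu> (I n \<omega> i)) = \<alpha> * (\<Sum>i=0..K. real (I n \<omega> i) * ln (real (I n \<omega> i))) + (\<Sum>i=0..K. (real (I n \<omega> i) + 1) * r (I n \<omega> i))"
    by (simp only: \<mu>_eq sum.distrib sum_distrib_left)
  have "(\<Sum>i=0..K. (real (I n \<omega> i) + 1) * (r (I n \<omega> i) - r n)) = (\<Sum>i=0..K. (real (I n \<omega> i) + 1) * r (I n \<omega> i)) - (\<Sum>i=0..K. real (I n \<omega> i) + 1) * r n"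
    by (simp only: right_diff_distrib sum_subtractf sum_distrib_right)
  then have 2: "(\<Sum>i=0..K. (real (I n \<omega> i) + 1) * (r (I n \<omega> i) - r n)) = (\<Sum>i=0..K. (real (I n \<omega> i) + 1) * r (I n \<omega> i)) - (real n + 1) * r n"
    unfolding elim(2) .
  have E: "P n \<omega> + (\<Sum>i=0..K. \<mu> (I n \<omega> i)) - \<mu> n = P n \<omega> + \<alpha> * real n * ent n \<omega> - \<alpha> * real K * ln (real n) + (\<Sum>i=0..K. (real (I n \<omega> i) + 1) * (r (I n \<omega> i) - r n))"
    unfolding 1 2 \<mu>_eq[of n] using elim(1) by linarith
  show ?case unfolding toll_def E using n0 by (simp add: add_divide_distrib diff_divide_distrib)
qed

text \<open>Convergence in mean does not suffice for exponentials of the toll; they need this almost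
  sure bound, uniform in \<open>n\<close>. It rests on the boundedness of the convergent sequence
  \<open>r\<close>.\<close>

lemma toll_bounded: "\<exists>\<beta>. (\<forall>n>K. AE \<omega> in input_space K. \<bar>toll n \<omega>\<bar> \<le> \<beta>) \<and> (AE \<omega> in input_space K. \<bar>b \<omega>\<bar> \<le> \<beta>)"
proof -
  obtain R where R: "\<And>n. \<bar>r n\<bar> \<le> R" using convergent_imp_Bseq[OF r_convergent] by (auto simp: Bseq_def)
  have R0: "0 \<le> R" using R[of 0] by linarith
  define \<beta> where "\<beta> = real K + (real K)\<^sup>2 + \<bar>\<alpha>\<bar> * (2 * real (K + 1)) + \<bar>\<alpha>\<bar> * real K + 4 * R"
  have "AE \<omega> in input_space K. \<bar>toll n \<omega>\<bar> \<le> \<beta>" if n: "K < n" for n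
    using toll_decomp[OF n] AE_P_bounds[of n] AE_sum_I_Suc[OF n]
  proof eventually_elim
    case (elim \<omega>)
    have n1: "real n \<ge> 1" using n by simp
    have "P n \<omega> / real n \<le> (real K * real n + (real K)\<^sup>2) / real n" using elim n1 by (intro divide_right_mono) auto
    also have "\<dots> = real K + (real K)\<^sup>2 / real n" using n1 by (simp add: add_divide_distrib)
    also have "\<dots> \<le> real K + (real K)\<^sup>2 / 1" using n1 by (intro add_left_mono divide_left_mono) auto
    finally have 1: "\<bar>P n \<omega> / real n\<bar> \<le> real K + (real K)\<^sup>2" using elim n1 by simp
    have 2: "\<bar>\<alpha> * ent n \<omega>\<bar> \<le> \<bar>\<alpha>\<bar> * (2 * real (K + 1))"
      unfolding abs_mult by (intro mult_left_mono ent_bound n) simp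
    have "ln (real n) \<le> real n" using n1 ln_le_minus_one[of "real n"] by simp
    then have "ln (real n) / real n \<le> 1" using n1 by simp
    moreover have "0 \<le> ln (real n) / real n" using n1 by simp
    ultimately have "\<bar>\<alpha>\<bar> * real K * (ln (real n) / real n) \<le> \<bar>\<alpha>\<bar> * real K * 1" by (intro mult_left_mono) auto
    then have 3: "\<bar>\<alpha> * real K * ln (real n) / real n\<bar> \<le> \<bar>\<alpha>\<bar> * real K" using n1 by (simp add: abs_mult)
    have "\<bar>\<Sum>i=0..K. (real (I n \<omega> i) + 1) * (r (I n \<omega> i) - r n)\<bar> \<le> (\<Sum>i=0..K. \<bar>(real (I n \<omega> i) + 1) * (r (I n \<omega> i) - r n)\<bar>)"
      by (rule sum_abs)
    also have "\<dots> \<le> (\<Sum>i=0..K. (real (I n \<omega> i) + 1) * (2 * R))"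
    proof (rule sum_mono)
      fix i
      have "\<bar>r (I n \<omega> i) - r n\<bar> \<le> 2 * R" using R[of "I n \<omega> i"] R[of n] by linarith
      then show "\<bar>(real (I n \<omega> i) + 1) * (r (I n \<omega> i) - r n)\<bar> \<le> (real (I n \<omega> i) + 1) * (2 * R)"
        by (simp add: abs_mult mult_left_mono)
    qed
    also have "\<dots> = (real n + 1) * (2 * R)" unfolding sum_distrib_right[symmetric] elim ..
    also have "\<dots> \<le> (2 * real n) * (2 * R)" using n1 R0 by (intro mult_right_mono) auto
    finally have "\<bar>\<Sum>i=0..K. (real (I n \<omega> i) + 1) * (r (I n \<omega> i) - r n)\<bar> / real n \<le> (2 * real n) * (2 * R) / real n"
      by (rule divide_right_mono) simp
    then have 4: "\<bar>(\<Sum>i=0..K. (real (I n \<omega> i) + 1) * (r (I n \<omega> i) - r n)) / real n\<bar> \<le> 4 * R" using n1 by simp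
    have tri: "\<bar>w + x - y + z\<bar> \<le> \<bar>w\<bar> + \<bar>x\<bar> + \<bar>y\<bar> + \<bar>z\<bar>" for w x y z :: real by linarith
    show ?case unfolding elim(1) \<beta>_def by (rule order_trans[OF tri]) (intro add_mono 1 2 3 4)
  qed
  moreover have "AE \<omega> in input_space K. \<bar>b \<omega>\<bar> \<le> \<beta>"
    using AE_good
  proof eventually_elim
    case (elim \<omega>)
    have "\<bar>\<alpha> * entD \<omega>\<bar> \<le> \<bar>\<alpha>\<bar> * (2 * real (K + 1))"
      unfolding abs_mult by (intro mult_left_mono entD_bound elim) simp
    moreover have "0 \<le> (real K)\<^sup>2" "0 \<le> \<bar>\<alpha>\<bar> * real K" by simp_all
    ultimately show ?case unfolding b_def \<beta>_def using opt_cost_spacing_bounds[OF elim] R0 by linarith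
  qed
  ultimately show ?thesis by blast
qed

lemma expectation_toll: assumes n: "K < n" shows "(\<integral>\<omega>. toll n \<omega> \<partial>input_space K) = 0"
proof -
  have "(\<integral>\<omega>. toll n \<omega> \<partial>input_space K) = (\<integral>\<omega>. P n \<omega> + (\<Sum>i=0..K. \<mu> (I n \<omega> i)) - \<mu> n \<partial>input_space K) / real n"
    unfolding toll_def by simp
  also have "(\<integral>\<omega>. P n \<omega> + (\<Sum>i=0..K. \<mu> (I n \<omega> i)) - \<mu> n \<partial>input_space K) = \<mu> n - \<mu> n"
    unfolding mean_recursion[OF n, symmetric]
    using integrable_P[of n] sum_weight(1)[OF n, of \<mu>] mean_recursion[OF n] by (simp add: input_space.prob_space)
  finally show ?thesis by simp
qed

lemma integrable_b: "integrable (input_space K) b"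
  unfolding b_def using integrable_opt integrable_entD by simp

lemma integrable_toll: "integrable (input_space K) (toll n)"
  if "K < n"
  unfolding toll_def using integrable_P[of n] sum_weight(1)[OF that, of \<mu>] by simp

theorem toll_tendsto: "(\<lambda>n. \<integral>\<omega>. \<bar>toll n \<omega> - b \<omega>\<bar> \<partial>input_space K) \<longlonglongrightarrow> 0"
proof (rule tendsto_sandwich[OF _ _ tendsto_const])
  let ?M = "input_space K"
  let ?e = "\<lambda>n. 16 * (real (K + 1))\<^sup>2 / sqrt (real n) + \<bar>\<alpha>\<bar> * (3 * (real (K + 1))\<^sup>2 * real n powr (- 1 / 4))
       + \<bar>\<alpha>\<bar> * real K * (ln (real n) / real n) + 2 * (\<Sum>j<n. q n j * \<bar>r j - r n\<bar>)"
  show "\<forall>\<^sub>F n in sequentially. 0 \<le> (\<integral>\<omega>. \<bar>toll n \<omega> - b \<omega>\<bar> \<partial>?M)" by simp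
  show "\<forall>\<^sub>F n in sequentially. (\<integral>\<omega>. \<bar>toll n \<omega> - b \<omega>\<bar> \<partial>?M) \<le> ?e n"
    using eventually_gt_at_top[of K]
  proof eventually_elim
    case (elim n)
    note n = this
    have n0: "real n > 0" and n1: "real n \<ge> 1" using n by simp_all
    define X where "X \<omega> = \<bar>P n \<omega> - real n * opt_cost K (D \<omega>)\<bar>" for \<omega>
    define Y where "Y \<omega> = \<bar>ent n \<omega> - entD \<omega>\<bar>" for \<omega>
    have Xi: "integrable ?M X" unfolding X_def using integrable_P integrable_opt by auto
    have Yi: "integrable ?M Y" unfolding Y_def using integrable_ent[OF n] integrable_entD by auto
    have "(\<integral>\<omega>. \<bar>toll n \<omega> - b \<omega>\<bar> \<partial>?M) \<le> (\<integral>\<omega>. X \<omega> / real n + \<bar>\<alpha>\<bar> * Y \<omega> + \<bar>\<alpha>\<bar> * real K * (ln (real n) / real n) + osc n \<omega> \<partial>?M)"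
    proof (rule integral_mono_AE)
      show "integrable ?M (\<lambda>\<omega>. \<bar>toll n \<omega> - b \<omega>\<bar>)" using integrable_toll[OF n] integrable_b by auto
      show "integrable ?M (\<lambda>\<omega>. X \<omega> / real n + \<bar>\<alpha>\<bar> * Y \<omega> + \<bar>\<alpha>\<bar> * real K * (ln (real n) / real n) + osc n \<omega>)"
        using Xi Yi integrable_osc[OF n] by simp
      show "AE \<omega> in ?M. \<bar>toll n \<omega> - b \<omega>\<bar> \<le> X \<omega> / real n + \<bar>\<alpha>\<bar> * Y \<omega> + \<bar>\<alpha>\<bar> * real K * (ln (real n) / real n) + osc n \<omega>"
        using toll_decomp[OF n]
      proof eventually_elim
        case (elim \<omega>)
        have "P n \<omega> / real n - opt_cost K (D \<omega>) = (P n \<omega> - real n * opt_cost K (D \<omega>)) / real n"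
          using n0 by (simp add: diff_divide_distrib)
        then have 1: "\<bar>P n \<omega> / real n - opt_cost K (D \<omega>)\<bar> = X \<omega> / real n" by (simp add: X_def)
        have 2: "\<bar>\<alpha> * ent n \<omega> - \<alpha> * entD \<omega>\<bar> = \<bar>\<alpha>\<bar> * Y \<omega>"
          unfolding Y_def by (simp only: right_diff_distrib[symmetric] abs_mult)
        have 3: "\<bar>\<alpha> * real K * ln (real n) / real n\<bar> = \<bar>\<alpha>\<bar> * real K * (ln (real n) / real n)"
          using n1 by (simp add: abs_mult)
        have "\<bar>\<Sum>i=0..K. (real (I n \<omega> i) + 1) * (r (I n \<omega> i) - r n)\<bar> \<le> (\<Sum>i=0..K. \<bar>(real (I n \<omega> i) + 1) * (r (I n \<omega> i) - r n)\<bar>)"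
          by (rule sum_abs)
        also have "\<dots> = (\<Sum>i=0..K. (real (I n \<omega> i) + 1) * \<bar>r (I n \<omega> i) - r n\<bar>)" by (simp add: abs_mult)
        finally have 4: "\<bar>(\<Sum>i=0..K. (real (I n \<omega> i) + 1) * (r (I n \<omega> i) - r n)) / real n\<bar> \<le> osc n \<omega>"
          unfolding osc_def using n0 by (simp add: divide_right_mono)
        have tri: "\<bar>w + x - y + z - (w' + x')\<bar> \<le> \<bar>w - w'\<bar> + \<bar>x - x'\<bar> + \<bar>y\<bar> + \<bar>z\<bar>" for w x y z w' x' :: real
          by linarith
        show ?case unfolding elim b_def by (rule order_trans[OF tri]) (intro add_mono 4, simp_all only: 1 2 3 order_refl)
      qed
    qed
    also have "\<dots> = (\<integral>\<omega>. X \<omega> \<partial>?M) / real n + \<bar>\<alpha>\<bar> * (\<integral>\<omega>. Y \<omega> \<partial>?M) + \<bar>\<alpha>\<bar> * real K * (ln (real n) / real n) + (\<integral>\<omega>. osc n \<omega> \<partial>?M)"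
      using Xi Yi integrable_osc[OF n] by (simp add: input_space.prob_space)
    also have "\<dots> \<le> ?e n"
    proof (intro add_mono order_refl)
      have "(\<integral>\<omega>. X \<omega> \<partial>?M) / real n \<le> 16 * (real (K + 1))\<^sup>2 * sqrt (real n) / real n"
        unfolding X_def by (intro divide_right_mono partition_cost_deviation n) simp
      also have "\<dots> = 16 * (real (K + 1))\<^sup>2 / sqrt (real n)" using n0 by (simp add: divide_simps)
      finally show "(\<integral>\<omega>. X \<omega> \<partial>?M) / real n \<le> 16 * (real (K + 1))\<^sup>2 / sqrt (real n)" .
      show "\<bar>\<alpha>\<bar> * (\<integral>\<omega>. Y \<omega> \<partial>?M) \<le> \<bar>\<alpha>\<bar> * (3 * (real (K + 1))\<^sup>2 * real n powr (- 1 / 4))"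
        unfolding Y_def by (intro mult_left_mono ent_deviation n) simp
      have "(\<integral>\<omega>. osc n \<omega> \<partial>?M) = (real n + 1) * (\<Sum>j<n. q n j * \<bar>r j - r n\<bar>) / real n"
        unfolding osc_def using sum_q[OF n, of "\<lambda>j. \<bar>r j - r n\<bar>"] by simp
      also have "\<dots> = (real n + 1) / real n * (\<Sum>j<n. q n j * \<bar>r j - r n\<bar>)" by simp
      also have "\<dots> \<le> 2 * (\<Sum>j<n. q n j * \<bar>r j - r n\<bar>)"
        using n1 ker.q_nonneg[OF n] by (intro mult_right_mono sum_nonneg) (auto simp: divide_simps)
      finally show "(\<integral>\<omega>. osc n \<omega> \<partial>?M) \<le> 2 * (\<Sum>j<n. q n j * \<bar>r j - r n\<bar>)" .
    qed
    finally show ?case .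
  qed
  have s: "filterlim (\<lambda>n. sqrt (real n)) at_top sequentially"
    by (rule filterlim_compose[OF sqrt_at_top filterlim_real_sequentially])
  have "?e \<longlonglongrightarrow> 0 + \<bar>\<alpha>\<bar> * (3 * (real (K + 1))\<^sup>2 * 0) + \<bar>\<alpha>\<bar> * real K * 0 + 2 * 0"
  proof (intro tendsto_add tendsto_mult tendsto_const)
    show "(\<lambda>n. 16 * (real (K + 1))\<^sup>2 / sqrt (real n)) \<longlonglongrightarrow> 0"
      by (rule tendsto_divide_0[OF tendsto_const filterlim_at_top_imp_at_infinity[OF s]])
    show "(\<lambda>n. real n powr (- 1 / 4)) \<longlonglongrightarrow> 0" by (rule tendsto_neg_powr[OF _ filterlim_real_sequentially]) simp
    show "(\<lambda>n. ln (real n) / real n) \<longlonglongrightarrow> 0" by (rule lim_ln_over_n)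
    show "(\<lambda>n. \<Sum>j<n. q n j * \<bar>r j - r n\<bar>) \<longlonglongrightarrow> 0" by (rule ker.oscillation_tendsto_0[OF r_convergent])
  qed
  then show "?e \<longlonglongrightarrow> 0" by simp
qed

lemma expectation_b: "(\<integral>\<omega>. b \<omega> \<partial>input_space K) = 0"
proof -
  have "(\<integral>\<omega>. b \<omega> \<partial>input_space K) = (\<integral>\<omega>. opt_cost K (D \<omega>) \<partial>input_space K) + \<alpha> * (\<integral>\<omega>. entD \<omega> \<partial>input_space K)"
    unfolding b_def using integrable_opt integrable_entD by simp
  also have "\<dots> = \<gamma> - \<alpha> * (harm (K + 1) - 1)" by (simp only: expectation_opt expectation_entD)
  finally show ?thesis by (simp only: \<alpha>_harm)
qed

end

section \<open>Uniform exponential moments\<close>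

lemma exp_quadratic_bound:
  fixes y :: real
  assumes "\<bar>y\<bar> \<le> c"
  shows "exp y \<le> 1 + y + y\<^sup>2 * exp c"
proof -
  obtain t where t: "\<bar>t\<bar> \<le> \<bar>y\<bar>" "exp y = (\<Sum>m<2. y ^ m / fact m) + exp t / fact 2 * y ^ 2"
    using Maclaurin_exp_le[of y 2] by blast
  have "exp t \<le> exp c" using t(1) assms by simp
  then have "exp t / 2 \<le> exp c" using exp_ge_zero[of c] by linarith
  then have "exp t / 2 * y\<^sup>2 \<le> exp c * y\<^sup>2" by (intro mult_right_mono) auto
  then show ?thesis using t(2) by (simp add: numeral_2_eq_2 mult.commute)
qed

lemma power_le_fact_exp:
  fixes x :: real
  shows "\<bar>x\<bar> ^ k \<le> fact k * (exp x + exp (- x))"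
proof -
  have "(\<Sum>n\<in>{k}. \<bar>x\<bar> ^ n /\<^sub>R fact n) \<le> (\<Sum>n. \<bar>x\<bar> ^ n /\<^sub>R fact n)"
    by (rule sum_le_suminf[OF summable_exp_generic]) auto
  then have "\<bar>x\<bar> ^ k / fact k \<le> exp \<bar>x\<bar>" by (simp add: exp_def divide_inverse mult.commute)
  also have "\<dots> \<le> exp x + exp (- x)" by (auto simp: abs_if)
  finally show ?thesis by (simp add: divide_le_eq mult.commute)
qed

section \<open>Normalized laws, their recursion and their moment generating functions\<close>

context quicksort
begin

abbreviation Y :: "nat \<Rightarrow> real measure" where "Y \<equiv> normalized_law K ord piv alg"

lemma measure_L_UNIV [simp]: "measure (L n) UNIV = 1"
  using L.prob_space[of n] by simp

lemma Y_eq: "Y n = distr (L n) borel (\<lambda>x. (x - \<mu> n) / real n)"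
  by (simp add: normalized_law_def \<mu>_def)

lemma real_distribution_Y: "real_distribution (Y n)"
  unfolding Y_eq by (rule L.real_distribution_distr) simp

lemma space_Y [simp]: "space (Y n) = UNIV"
  by (simp add: Y_eq)

lemma measure_Y_UNIV [simp]: "measure (Y n) UNIV = 1"
proof -
  interpret Yn: real_distribution "Y n" by (rule real_distribution_Y)
  show ?thesis using Yn.prob_space by simp
qed

lemma integral_Y:
  fixes f :: "real \<Rightarrow> 'b :: {banach, second_countable_topology}"
  assumes "continuous_on UNIV f"
  shows "integrable (Y n) f" "(\<integral>y. f y \<partial>Y n) = (\<integral>x. f ((x - \<mu> n) / real n) \<partial>L n)"
proof -
  have fm: "f \<in> borel_measurable borel" by (rule borel_measurable_continuous_onI[OF assms])
  have m: "(\<lambda>x. (x - \<mu> n) / real n) \<in> measurable (L n) borel" by simp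
  have c: "continuous_on UNIV (\<lambda>x. f ((x - \<mu> n) / real n))"
    by (rule continuous_on_compose2[OF assms]) (auto intro!: continuous_intros simp: divide_inverse)
  show "integrable (Y n) f" unfolding Y_eq
    by (subst integrable_distr_eq[OF m fm]) (rule integrable_L_continuous[OF c])
  show "(\<integral>y. f y \<partial>Y n) = (\<integral>x. f ((x - \<mu> n) / real n) \<partial>L n)"
    unfolding Y_eq by (rule integral_distr[OF m fm])
qed

lemma mean_Y: "(\<integral>y. y \<partial>Y n) = 0"
proof -
  have "integrable (L n) (\<lambda>x. x)" by (intro integrable_L_continuous continuous_intros)
  then have "(\<integral>x. (x - \<mu> n) / real n \<partial>L n) = ((\<integral>x. x \<partial>L n) - \<mu> n) / real n"
    by simp
  then show ?thesis using integral_Y(2)[of "\<lambda>x. x" n] by (simp add: \<mu>_def)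
qed

text \<open>Passes from the centered law to the normalized one. At \<open>m = 0\<close> the factor
  \<open>real m\<close> vanishes on the right, and on the left the law is a point mass at its mean,
  so both sides are the integral of \<open>h 0\<close>.\<close>

lemma centered_integral_eq:
  fixes h :: "real \<Rightarrow> 'b :: {banach, second_countable_topology}"
  assumes "continuous_on UNIV h"
  shows "(\<integral>x. h (s * (x - \<mu> m)) \<partial>L m) = (\<integral>y. h (s * real m * y) \<partial>Y m)"
proof -
  have c: "continuous_on UNIV (\<lambda>y. h (s * real m * y))"
    by (rule continuous_on_compose2[OF assms]) (auto intro!: continuous_intros)
  have c': "continuous_on UNIV (\<lambda>x. h (s * (x - \<mu> m)))"
    by (rule continuous_on_compose2[OF assms]) (auto intro!: continuous_intros)
  show ?thesis
  proof (cases "m = 0")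
    case True
    have "(\<integral>x. h (s * (x - \<mu> 0)) \<partial>L 0) = (\<integral>x. h 0 \<partial>L 0)"
    proof (rule integral_cong_AE)
      show "AE x in L 0. h (s * (x - \<mu> 0)) = h 0" using L_0 by eventually_elim simp
      show "(\<lambda>x. h (s * (x - \<mu> 0))) \<in> borel_measurable (L 0)"
        using borel_measurable_continuous_onI[OF c'] True by simp
    qed simp
    also have "\<dots> = (\<integral>y. h 0 \<partial>Y 0)" by (simp add: lebesgue_integral_const space_Y)
    finally show ?thesis using True by simp
  next
    case False
    then show ?thesis unfolding integral_Y(2)[OF c] by simp
  qed
qed

lemma Y_recursion:
  fixes h :: "real \<Rightarrow> 'b :: {real_normed_field, banach, second_countable_topology}"
  assumes n: "K < n" and cont: "continuous_on UNIV h" and add: "\<And>x y. h (x + y) = h x * h y" and h0: "h 0 = 1"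
  shows "(\<integral>y. h (t * y) \<partial>Y n) = (\<integral>\<omega>. h (t * toll n \<omega>) *
      (\<Prod>i=0..K. \<integral>y. h (t * (real (I n \<omega> i) / real n) * y) \<partial>Y (I n \<omega> i)) \<partial>input_space K)"
proof -
  have n0: "real n \<noteq> 0" using n by (cases n) auto
  have c: "continuous_on UNIV (\<lambda>x. h (t / real n * x))"
    by (rule continuous_on_compose2[OF cont]) (use n0 in \<open>auto intro!: continuous_intros\<close>)
  have "(\<integral>y. h (t * y) \<partial>Y n) = (\<integral>y. h (t / real n * real n * y) \<partial>Y n)" using n0 by simp
  also have "\<dots> = (\<integral>x. h (t / real n * (x - \<mu> n)) \<partial>L n)" by (rule centered_integral_eq[OF cont, symmetric])
  also have "\<dots> = (\<integral>\<omega>. h (t / real n * (P n \<omega> + (\<Sum>i=0..K. \<mu> (I n \<omega> i)) - \<mu> n)) *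
           (\<Prod>i=0..K. \<integral>x. h (t / real n * (x - \<mu> (I n \<omega> i))) \<partial>L (I n \<omega> i)) \<partial>input_space K)"
    by (rule centered_recursion[OF n c]) (auto simp: add[symmetric] distrib_left h0)
  also have "\<dots> = (\<integral>\<omega>. h (t * toll n \<omega>) *
      (\<Prod>i=0..K. \<integral>y. h (t * (real (I n \<omega> i) / real n) * y) \<partial>Y (I n \<omega> i)) \<partial>input_space K)"
    unfolding centered_integral_eq[OF cont] toll_def by simp
  finally show ?thesis .
qed

definition \<psi> :: "nat \<Rightarrow> real \<Rightarrow> complex" where "\<psi> n = char (Y n)"

definition mgf :: "nat \<Rightarrow> real \<Rightarrow> real" where "mgf n s = (\<integral>y. exp (s * y) \<partial>Y n)"

lemma \<psi>_recursion:
  assumes n: "K < n"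
  shows "\<psi> n t = (\<integral>\<omega>. iexp (t * toll n \<omega>) * (\<Prod>i=0..K. \<psi> (I n \<omega> i) (t * (real (I n \<omega> i) / real n))) \<partial>input_space K)"
proof -
  have "(\<integral>y. (\<lambda>x. iexp x) (t * y) \<partial>Y n) = (\<integral>\<omega>. (\<lambda>x. iexp x) (t * toll n \<omega>) *
      (\<Prod>i=0..K. \<integral>y. (\<lambda>x. iexp x) (t * (real (I n \<omega> i) / real n) * y) \<partial>Y (I n \<omega> i)) \<partial>input_space K)"
    by (rule Y_recursion[OF n]) (auto intro!: continuous_intros simp: exp_add distrib_left)
  then show ?thesis by (simp only: \<psi>_def char_def)
qed

lemma mgf_recursion:
  assumes n: "K < n"
  shows "mgf n s = (\<integral>\<omega>. exp (s * toll n \<omega>) * (\<Prod>i=0..K. mgf (I n \<omega> i) (s * (real (I n \<omega> i) / real n))) \<partial>input_space K)"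
  unfolding mgf_def by (rule Y_recursion[OF n]) (auto intro!: continuous_intros simp: exp_add)

lemma mgf_nonneg: "0 \<le> mgf n s"
  unfolding mgf_def by (rule Bochner_Integration.integral_nonneg) simp

text \<open>The quadratic deficit of the split. If all sublists satisfy
  \<open>mgf m s \<le> exp (c * s\<^sup>2)\<close>, then
  \<open>exp (- (c * s\<^sup>2 * \<U> n \<omega>))\<close> is the slack available to pay for the
  toll.\<close>

definition \<U> :: "nat \<Rightarrow> (nat \<Rightarrow> real) \<times> (nat \<Rightarrow> real) \<Rightarrow> real" where
  "\<U> n \<omega> = 1 - (\<Sum>i=0..K. (real (I n \<omega> i) / real n)\<^sup>2)"

text \<open>A sum of indicators rather than the indicator of the union, so that its mean can be read
  off \<open>sublist_weight\<close>.\<close>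

definition large :: "nat \<Rightarrow> real \<Rightarrow> (nat \<Rightarrow> real) \<times> (nat \<Rightarrow> real) \<Rightarrow> real" where
  "large n \<epsilon> \<omega> = (\<Sum>i=0..K. of_bool ((1 - \<epsilon>) * real n < real (I n \<omega> i)))"

lemma measurable_\<U> [measurable]: "\<U> n \<in> borel_measurable (input_space K)"
  unfolding \<U>_def by measurable

lemma I_square_le: "K < n \<Longrightarrow> (real (I n \<omega> i) / real n)\<^sup>2 \<le> real (I n \<omega> i) / real n"
  unfolding power2_eq_square by (rule mult_left_le[OF I_div_bounds(2) I_div_bounds(1)])

text \<open>If no relative size exceeds \<open>1 - \<epsilon>\<close>, the sum of the squares is at
  most \<open>1 - \<epsilon>\<close> times the sum of the sizes, which is at most 1.\<close>

lemma AE_\<U>: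
  assumes n: "K < n" and \<epsilon>: "0 \<le> \<epsilon>" "\<epsilon> \<le> 1"
  shows "AE \<omega> in input_space K. 0 \<le> \<U> n \<omega> \<and> \<U> n \<omega> \<le> 1 \<and> (large n \<epsilon> \<omega> < 1 \<longrightarrow> \<epsilon> \<le> \<U> n \<omega>) \<and> (\<Sum>i=0..K. real (I n \<omega> i) / real n) \<le> 1"
  using AE_sum_I[of n]
proof eventually_elim
  case (elim \<omega>)
  have n0: "real n > 0" using n by simp
  have "(\<Sum>i=0..K. real (I n \<omega> i) / real n) = real (n - K) / real n"
    by (simp only: sum_divide_distrib[symmetric] of_nat_sum[symmetric] elim)
  then have s: "(\<Sum>i=0..K. real (I n \<omega> i) / real n) \<le> 1" using n0 by simp
  have "(\<Sum>i=0..K. (real (I n \<omega> i) / real n)\<^sup>2) \<le> (\<Sum>i=0..K. real (I n \<omega> i) / real n)"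
    by (intro sum_mono I_square_le n)
  then have "0 \<le> \<U> n \<omega>" using s by (simp add: \<U>_def)
  moreover have "\<U> n \<omega> \<le> 1" unfolding \<U>_def by (simp add: sum_nonneg)
  moreover have "\<epsilon> \<le> \<U> n \<omega>" if "large n \<epsilon> \<omega> < 1"
  proof -
    have sm: "real (I n \<omega> i) / real n \<le> 1 - \<epsilon>" if i: "i \<in> {0..K}" for i
    proof (rule ccontr)
      assume "\<not> real (I n \<omega> i) / real n \<le> 1 - \<epsilon>"
      then have "(1 - \<epsilon>) * real n < real (I n \<omega> i)" using n0 by (simp add: not_le less_divide_eq)
      then have "1 = (of_bool ((1 - \<epsilon>) * real n < real (I n \<omega> i)) :: real)" by simp
      also have "\<dots> \<le> large n \<epsilon> \<omega>" unfolding large_def using i by (intro member_le_sum) auto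
      finally show False using \<open>large n \<epsilon> \<omega> < 1\<close> by simp
    qed
    have "(\<Sum>i=0..K. (real (I n \<omega> i) / real n)\<^sup>2) \<le> (\<Sum>i=0..K. (1 - \<epsilon>) * (real (I n \<omega> i) / real n))"
      unfolding power2_eq_square using sm I_div_bounds[OF n] by (intro sum_mono mult_right_mono) auto
    also have "\<dots> = (1 - \<epsilon>) * (\<Sum>i=0..K. real (I n \<omega> i) / real n)" by (simp only: sum_distrib_left)
    also have "\<dots> \<le> (1 - \<epsilon>) * 1" using s \<epsilon> by (intro mult_left_mono) auto
    finally show ?thesis by (simp add: \<U>_def)
  qed
  ultimately show ?case using s by blast
qed

text \<open>Every size has weight at most \<open>K * (K + 1) / n\<close>, and at most
  \<open>\<epsilon> * n\<close> sizes below \<open>n\<close> count as large.\<close>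

lemma expectation_large:
  assumes n: "K < n" and \<epsilon>: "0 \<le> \<epsilon>"
  shows "integrable (input_space K) (large n \<epsilon>)" "(\<integral>\<omega>. large n \<epsilon> \<omega> \<partial>input_space K) \<le> real (K + 1) * real K * \<epsilon>"
proof -
  have n0: "real n > 0" using n by simp
  show "integrable (input_space K) (large n \<epsilon>)"
    unfolding large_def using sum_weight(1)[OF n, of "\<lambda>j. of_bool ((1 - \<epsilon>) * real n < real j)"] by simp
  define J where "J = {j \<in> {..<n}. (1 - \<epsilon>) * real n < real j}"
  have "(\<integral>\<omega>. large n \<epsilon> \<omega> \<partial>input_space K) = (\<Sum>j<n. sublist_weight K n j * of_bool ((1 - \<epsilon>) * real n < real j))"
    unfolding large_def by (rule sum_weight(2)[OF n])
  also have "\<dots> \<le> (\<Sum>j<n. real (K + 1) * real K / real n * of_bool ((1 - \<epsilon>) * real n < real j))"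
    by (intro sum_mono mult_right_mono sublist_weight_upper K_pos n) auto
  also have "\<dots> = real (K + 1) * real K / real n * real (card J)"
  proof -
    have "(\<Sum>j<n. of_bool ((1 - \<epsilon>) * real n < real j)) = real (card J)"
      unfolding J_def by (simp add: of_bool_def sum.If_cases Collect_conj_eq lessThan_def)
    then show ?thesis by (simp only: sum_distrib_left[symmetric])
  qed
  finally have up: "(\<integral>\<omega>. large n \<epsilon> \<omega> \<partial>input_space K) \<le> real (K + 1) * real K / real n * real (card J)" .
  have "real (card J) \<le> \<epsilon> * real n"
  proof -
    \<comment> \<open>Reflection at \<open>n\<close> turns the large sizes into positive integers up
      to \<open>\<epsilon> * n\<close>.\<close>
    have "(\<lambda>j. n - j) ` J \<subseteq> {1..nat \<lfloor>\<epsilon> * real n\<rfloor>}"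
    proof
      fix k assume "k \<in> (\<lambda>j. n - j) ` J"
      then obtain j where j: "k = n - j" "j < n" "(1 - \<epsilon>) * real n < real j" by (auto simp: J_def)
      then have "real k = real n - real j" by (simp add: of_nat_diff)
      then have "real k \<le> \<epsilon> * real n" using j(3) by (simp add: algebra_simps)
      then have "k \<le> nat \<lfloor>\<epsilon> * real n\<rfloor>" by (simp add: le_nat_floor)
      then show "k \<in> {1..nat \<lfloor>\<epsilon> * real n\<rfloor>}" using j by simp
    qed
    moreover have "inj_on (\<lambda>j. n - j) J" by (auto simp: inj_on_def J_def)
    ultimately have "card J \<le> card {1..nat \<lfloor>\<epsilon> * real n\<rfloor>}" by (metis card_image card_mono finite_atLeastAtMost)
    then have "real (card J) \<le> real (nat \<lfloor>\<epsilon> * real n\<rfloor>)" by simp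
    also have "\<dots> \<le> \<epsilon> * real n" using \<epsilon> by (simp add: of_nat_nat)
    finally show ?thesis .
  qed
  note up
  also have "real (K + 1) * real K / real n * real (card J) \<le> real (K + 1) * real K / real n * (\<epsilon> * real n)"
    by (rule mult_left_mono[OF \<open>real (card J) \<le> \<epsilon> * real n\<close>]) simp
  also have "\<dots> = real (K + 1) * real K * \<epsilon>" using n0 by simp
  finally show "(\<integral>\<omega>. large n \<epsilon> \<omega> \<partial>input_space K) \<le> real (K + 1) * real K * \<epsilon>" .
qed

lemma large_nonneg: "0 \<le> large n \<epsilon> \<omega>"
  unfolding large_def by (intro sum_nonneg) auto

text \<open>Where \<open>large n \<epsilon> \<omega> < 1\<close>, the deficit is at least
  \<open>\<epsilon>\<close>; elsewhere \<open>large\<close> is at least 1 and pays for the trivial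
  bound. All three estimates follow this split.\<close>

lemma expectation_exp_\<U>:
  assumes n: "K < n" and \<sigma>: "0 \<le> \<sigma>" and \<epsilon>: "0 \<le> \<epsilon>" "\<epsilon> \<le> 1"
  shows "(\<integral>\<omega>. exp (- (\<sigma> * \<U> n \<omega>)) \<partial>input_space K) \<le> exp (- (\<sigma> * \<epsilon>)) + real (K + 1) * real K * \<epsilon>"
    and "(\<integral>\<omega>. 1 - exp (- (\<sigma> * \<U> n \<omega>)) \<partial>input_space K) \<ge> (1 - exp (- (\<sigma> * \<epsilon>))) * (1 - real (K + 1) * real K * \<epsilon>)"
    and "(\<integral>\<omega>. \<U> n \<omega> \<partial>input_space K) \<ge> \<epsilon> * (1 - real (K + 1) * real K * \<epsilon>)"
proof -
  let ?M = "input_space K"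
  note AE = AE_\<U>[OF n \<epsilon>] and lg = expectation_large[OF n \<epsilon>(1)]
  have ie: "integrable ?M (\<lambda>\<omega>. exp (- (\<sigma> * \<U> n \<omega>)))"
  proof (rule input_space.integrable_const_bound[where B=1])
    show "AE \<omega> in ?M. norm (exp (- (\<sigma> * \<U> n \<omega>))) \<le> 1" using AE by eventually_elim (use \<sigma> in auto)
  qed measurable
  have iu: "integrable ?M (\<U> n)"
  proof (rule input_space.integrable_const_bound[where B=1])
    show "AE \<omega> in ?M. norm (\<U> n \<omega>) \<le> 1" using AE by eventually_elim auto
  qed measurable
  have "(\<integral>\<omega>. exp (- (\<sigma> * \<U> n \<omega>)) \<partial>?M) \<le> (\<integral>\<omega>. exp (- (\<sigma> * \<epsilon>)) + large n \<epsilon> \<omega> \<partial>?M)"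
  proof (rule integral_mono_AE)
    show "AE \<omega> in ?M. exp (- (\<sigma> * \<U> n \<omega>)) \<le> exp (- (\<sigma> * \<epsilon>)) + large n \<epsilon> \<omega>"
      using AE
    proof eventually_elim
      case (elim \<omega>)
      show ?case
      proof (cases "large n \<epsilon> \<omega> < 1")
        case True
        then have "\<sigma> * \<epsilon> \<le> \<sigma> * \<U> n \<omega>" using elim \<sigma> by (intro mult_left_mono) auto
        then have "exp (- (\<sigma> * \<U> n \<omega>)) \<le> exp (- (\<sigma> * \<epsilon>))" by simp
        then show ?thesis using large_nonneg[of n \<epsilon> \<omega>] by linarith
      next
        case False
        have "exp (- (\<sigma> * \<U> n \<omega>)) \<le> 1" using elim \<sigma> by simp
        then show ?thesis using False exp_ge_zero[of "- (\<sigma> * \<epsilon>)"] by linarith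
      qed
    qed
  qed (use ie lg in auto)
  also have "\<dots> = exp (- (\<sigma> * \<epsilon>)) + (\<integral>\<omega>. large n \<epsilon> \<omega> \<partial>?M)" using lg by (simp add: input_space.prob_space)
  finally show "(\<integral>\<omega>. exp (- (\<sigma> * \<U> n \<omega>)) \<partial>?M) \<le> exp (- (\<sigma> * \<epsilon>)) + real (K + 1) * real K * \<epsilon>"
    using lg(2) by linarith
  have lower: "c * (1 - real (K + 1) * real K * \<epsilon>) \<le> (\<integral>\<omega>. g \<omega> \<partial>?M)"
    if c: "0 \<le> c" and g: "integrable ?M g" "AE \<omega> in ?M. 0 \<le> g \<omega> \<and> (large n \<epsilon> \<omega> < 1 \<longrightarrow> c \<le> g \<omega>)" for c g
  proof -
    have "c * (1 - real (K + 1) * real K * \<epsilon>) \<le> c * (1 - (\<integral>\<omega>. large n \<epsilon> \<omega> \<partial>?M))"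
      using lg(2) c by (intro mult_left_mono) auto
    also have "\<dots> = (\<integral>\<omega>. c * (1 - large n \<epsilon> \<omega>) \<partial>?M)" using lg(1) by (simp add: input_space.prob_space)
    also have "\<dots> \<le> (\<integral>\<omega>. g \<omega> \<partial>?M)"
    proof (rule integral_mono_AE)
      show "AE \<omega> in ?M. c * (1 - large n \<epsilon> \<omega>) \<le> g \<omega>"
        using g(2)
      proof eventually_elim
        case (elim \<omega>)
        show ?case
        proof (cases "large n \<epsilon> \<omega> < 1")
          case True
          have "c * (1 - large n \<epsilon> \<omega>) \<le> c * 1" using large_nonneg[of n \<epsilon> \<omega>] c by (intro mult_left_mono) auto
          then show ?thesis using True elim by linarith
        next
          case False
          then have "c * (1 - large n \<epsilon> \<omega>) \<le> 0" using c by (intro mult_nonneg_nonpos) auto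
          then show ?thesis using elim by linarith
        qed
      qed
    qed (use g lg in auto)
    finally show ?thesis .
  qed
  show "(\<integral>\<omega>. 1 - exp (- (\<sigma> * \<U> n \<omega>)) \<partial>?M) \<ge> (1 - exp (- (\<sigma> * \<epsilon>))) * (1 - real (K + 1) * real K * \<epsilon>)"
  proof (rule lower)
    show "0 \<le> 1 - exp (- (\<sigma> * \<epsilon>))" using \<sigma> \<epsilon> by simp
    show "integrable ?M (\<lambda>\<omega>. 1 - exp (- (\<sigma> * \<U> n \<omega>)))" using ie by simp
    show "AE \<omega> in ?M. 0 \<le> 1 - exp (- (\<sigma> * \<U> n \<omega>)) \<and> (large n \<epsilon> \<omega> < 1 \<longrightarrow> 1 - exp (- (\<sigma> * \<epsilon>)) \<le> 1 - exp (- (\<sigma> * \<U> n \<omega>)))"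
      using AE by eventually_elim (use \<sigma> in \<open>auto intro!: mult_left_mono\<close>)
  qed
  show "(\<integral>\<omega>. \<U> n \<omega> \<partial>?M) \<ge> \<epsilon> * (1 - real (K + 1) * real K * \<epsilon>)"
  proof (rule lower)
    show "AE \<omega> in ?M. 0 \<le> \<U> n \<omega> \<and> (large n \<epsilon> \<omega> < 1 \<longrightarrow> \<epsilon> \<le> \<U> n \<omega>)" using AE by eventually_elim auto
  qed (use \<epsilon> iu in auto)
qed

text \<open>Chosen so that a dominating sublist has probability at most 1/2.\<close>

definition \<epsilon>0 :: real where "\<epsilon>0 = 1 / (2 * real (K + 1) * real K)"

lemma \<epsilon>0: "0 < \<epsilon>0" "\<epsilon>0 \<le> 1" "1 - real (K + 1) * real K * \<epsilon>0 = 1 / 2"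
proof -
  define x where "x = real (K + 1) * real K"
  have "x \<ge> 1 * 1" unfolding x_def using K_pos by (intro mult_mono) auto
  then have x: "x \<ge> 1" by simp
  have e: "\<epsilon>0 = 1 / (2 * x)" by (simp only: \<epsilon>0_def x_def mult.assoc)
  show "0 < \<epsilon>0" "\<epsilon>0 \<le> 1" unfolding e using x by auto
  have "1 - x * \<epsilon>0 = 1 / 2" unfolding e using x by simp
  then show "1 - real (K + 1) * real K * \<epsilon>0 = 1 / 2" by (simp only: x_def)
qed

text \<open>A deficit of \<open>\<epsilon>0\<close> with probability at least 1/2: a lower bound for
  the mean of \<open>\<U> n\<close>, and hence the contraction gap, valid for all
  \<open>n > K\<close>.\<close>

definition \<kappa>0 :: real where "\<kappa>0 = \<epsilon>0 / 2"

lemma \<kappa>0: "0 < \<kappa>0" "\<kappa>0 \<le> 1" using \<epsilon>0 by (auto simp: \<kappa>0_def)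

lemma sum_squares:
  assumes n: "K < n"
  shows "integrable (input_space K) (\<lambda>\<omega>. \<Sum>i=0..K. (real (I n \<omega> i) / real n)\<^sup>2)"
    "(\<integral>\<omega>. (\<Sum>i=0..K. (real (I n \<omega> i) / real n)\<^sup>2) \<partial>input_space K) \<le> 1 - \<kappa>0"
proof -
  show i: "integrable (input_space K) (\<lambda>\<omega>. \<Sum>i=0..K. (real (I n \<omega> i) / real n)\<^sup>2)"
    using sum_weight(1)[OF n, of "\<lambda>j. (real j / real n)\<^sup>2"] by simp
  have "\<epsilon>0 * (1 - real (K + 1) * real K * \<epsilon>0) \<le> (\<integral>\<omega>. \<U> n \<omega> \<partial>input_space K)"
    using expectation_exp_\<U>(3)[OF n, of 0 \<epsilon>0] \<epsilon>0 by simp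
  then have "\<kappa>0 \<le> (\<integral>\<omega>. \<U> n \<omega> \<partial>input_space K)" unfolding \<epsilon>0(3) by (simp add: \<kappa>0_def)
  also have "\<dots> = 1 - (\<integral>\<omega>. (\<Sum>i=0..K. (real (I n \<omega> i) / real n)\<^sup>2) \<partial>input_space K)"
    unfolding \<U>_def using i by (simp add: input_space.prob_space)
  finally show "(\<integral>\<omega>. (\<Sum>i=0..K. (real (I n \<omega> i) / real n)\<^sup>2) \<partial>input_space K) \<le> 1 - \<kappa>0" by simp
qed

text \<open>For small \<open>\<bar>s\<bar>\<close> the quadratic terms decide; there the threshold does not depend on \<open>c\<close>.
  Away from \<open>0\<close> the inequality holds once \<open>c\<close> is large, since \<open>\<U> n\<close> is rarely close to \<open>0\<close>.\<close>

lemma exponent_dominated: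
  assumes \<Lambda>: "0 \<le> \<Lambda>"
  shows "\<exists>c0. \<forall>c\<ge>c0. \<forall>n>K. \<forall>s. \<bar>s\<bar> \<le> \<Lambda> \<longrightarrow> (\<integral>\<omega>. exp (s * toll n \<omega> - c * s\<^sup>2 * \<U> n \<omega>) \<partial>input_space K) \<le> 1"
proof -
  let ?M = "input_space K"
  obtain \<beta>' where \<beta>': "\<And>n. n > K \<Longrightarrow> AE \<omega> in ?M. \<bar>toll n \<omega>\<bar> \<le> \<beta>'" using toll_bounded by blast
  define \<beta> where "\<beta> = max 1 \<beta>'"
  have \<beta>: "\<beta> \<ge> 1" by (simp add: \<beta>_def)
  have b\<beta>: "AE \<omega> in ?M. \<bar>toll n \<omega>\<bar> \<le> \<beta>" if "n > K" for n
    using \<beta>'[OF that] by (simp add: \<beta>_def, eventually_elim, simp add: \<beta>_def)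
  define Q where "Q = \<beta>\<^sup>2 * exp (\<Lambda> * \<beta>)"
  have Q: "Q \<ge> 1"
  proof -
    have "1 * 1 \<le> \<beta>\<^sup>2 * exp (\<Lambda> * \<beta>)" using \<beta> \<Lambda> by (intro mult_mono) (auto simp: one_le_power)
    then show ?thesis by (simp add: Q_def)
  qed
  \<comment> \<open>The first entry keeps \<open>\<bar>s * toll\<bar>\<close> below 1/2, so that
    half of \<open>1 - e \<omega>\<close> pays for the correction to the linear term. The second
    makes \<open>8 * Q * s\<^sup>2\<close> at most 1.\<close>
  define s0 where "s0 = min (1 / (2 * \<beta>)) (1 / (8 * Q))"
  have s0: "0 < s0" "s0 * \<beta> \<le> 1 / 2" "8 * Q * s0\<^sup>2 \<le> 1"
  proof -
    show pos: "0 < s0" using \<beta> Q by (simp add: s0_def)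
    have "s0 * \<beta> \<le> 1 / (2 * \<beta>) * \<beta>" using \<beta> by (intro mult_right_mono) (auto simp: s0_def)
    then show "s0 * \<beta> \<le> 1 / 2" using \<beta> by simp
    have "s0 \<le> 1 / 8 / Q" by (simp add: s0_def)
    also have "1 / 8 / Q \<le> 1" using Q by (simp add: divide_le_eq)
    finally have "s0 \<le> 1" .
    have "8 * Q * s0 \<le> 8 * Q * (1 / (8 * Q))" using Q by (intro mult_left_mono) (auto simp: s0_def)
    then have "8 * Q * s0 \<le> 1" using Q by simp
    then have "(8 * Q * s0) * s0 \<le> 1 * 1" using pos \<open>s0 \<le> 1\<close> Q by (intro mult_mono) auto
    then show "8 * Q * s0\<^sup>2 \<le> 1" by (simp add: power2_eq_square)
  qed
  define k where "k = real (K + 1) * real K"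
  have k: "k > 0" using K_pos by (simp add: k_def)
  \<comment> \<open>Even with the largest factor \<open>exp (\<Lambda> * \<beta>)\<close> the event
    of a dominating sublist contributes at most 1/2.\<close>
  define \<epsilon> where "\<epsilon> = min 1 (1 / (2 * k * exp (\<Lambda> * \<beta>)))"
  have \<epsilon>: "0 < \<epsilon>" "\<epsilon> \<le> 1" "exp (\<Lambda> * \<beta>) * (k * \<epsilon>) \<le> 1 / 2"
  proof -
    show "0 < \<epsilon>" "\<epsilon> \<le> 1" using k by (auto simp: \<epsilon>_def)
    have "exp (\<Lambda> * \<beta>) * (k * \<epsilon>) \<le> exp (\<Lambda> * \<beta>) * (k * (1 / (2 * k * exp (\<Lambda> * \<beta>))))"
      using k by (intro mult_left_mono) (auto simp: \<epsilon>_def)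
    also have "\<dots> = 1 / 2" using k by simp
    finally show "exp (\<Lambda> * \<beta>) * (k * \<epsilon>) \<le> 1 / 2" .
  qed
  \<comment> \<open>The first entry serves \<open>\<bar>s\<bar> \<le> s0\<close>, where both sides
    scale with \<open>s\<^sup>2\<close>. The second serves \<open>\<bar>s\<bar> > s0\<close> and
    makes the typical event contribute at most \<open>exp (- 1)\<close>.\<close>
  define c0 where "c0 = max (8 * Q / \<epsilon>0) ((\<Lambda> * \<beta> + 1) / (s0\<^sup>2 * \<epsilon>))"
  show ?thesis
  proof (intro exI[of _ c0] allI impI)
    fix c n s assume c: "c0 \<le> c" and n: "K < n" and s: "\<bar>s\<bar> \<le> \<Lambda>"
    have c1: "8 * Q \<le> c * \<epsilon>0" using c \<epsilon>0(1) by (simp add: c0_def divide_le_eq)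
    have c2: "\<Lambda> * \<beta> + 1 \<le> c * (s0\<^sup>2 * \<epsilon>)" using c s0(1) \<epsilon>(1) by (simp add: c0_def divide_le_eq)
    have cpos: "0 < c" using c1 Q \<epsilon>0(1) by (smt (verit) mult_nonpos_nonneg)
    define \<sigma> where "\<sigma> = c * s\<^sup>2"
    have \<sigma>: "0 \<le> \<sigma>" using cpos by (simp add: \<sigma>_def)
    define e where "e \<omega> = exp (- (\<sigma> * \<U> n \<omega>))" for \<omega>
    have [measurable]: "e \<in> borel_measurable ?M" unfolding e_def by measurable
    have e01: "AE \<omega> in ?M. 0 \<le> e \<omega> \<and> e \<omega> \<le> 1"
      using AE_\<U>[OF n order_refl zero_le_one] by eventually_elim (use \<sigma> in \<open>auto simp: e_def\<close>)
    have ie: "integrable ?M e"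
      by (rule input_space.integrable_const_bound[where B=1]) (use e01 in \<open>auto elim: eventually_mono\<close>)
    have ib: "integrable ?M (toll n)" by (rule integrable_toll[OF n])
    have eq: "exp (s * toll n \<omega> - c * s\<^sup>2 * \<U> n \<omega>) = exp (s * toll n \<omega>) * e \<omega>" for \<omega>
      by (simp add: e_def \<sigma>_def exp_diff exp_minus divide_inverse)
    have sb: "AE \<omega> in ?M. \<bar>s * toll n \<omega>\<bar> \<le> \<Lambda> * \<beta>"
      using b\<beta>[OF n] by eventually_elim (use s \<Lambda> in \<open>auto simp: abs_mult intro!: mult_mono\<close>)
    have il: "integrable ?M (\<lambda>\<omega>. exp (s * toll n \<omega>) * e \<omega>)"
    proof (rule input_space.integrable_const_bound[where B="exp (\<Lambda> * \<beta>)"])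
      show "AE \<omega> in ?M. norm (exp (s * toll n \<omega>) * e \<omega>) \<le> exp (\<Lambda> * \<beta>)"
        using sb e01
      proof eventually_elim
        case (elim \<omega>)
        have "exp (s * toll n \<omega>) * e \<omega> \<le> exp (\<Lambda> * \<beta>) * 1" using elim by (intro mult_mono) auto
        then show ?case using elim by (simp add: abs_mult)
      qed
    qed measurable
    show "(\<integral>\<omega>. exp (s * toll n \<omega> - c * s\<^sup>2 * \<U> n \<omega>) \<partial>?M) \<le> 1"
    proof (cases "\<bar>s\<bar> \<le> s0")
      case True
      \<comment> \<open>Writing \<open>e = 1 - (1 - e)\<close> in the linear term isolates
        \<open>s * toll\<close>, whose mean is 0; the remainder is charged to
        \<open>1 - e\<close>.\<close>
      have ptw: "AE \<omega> in ?M. exp (s * toll n \<omega>) * e \<omega> \<le> e \<omega> + s * toll n \<omega> + 1 / 2 * (1 - e \<omega>) + Q * s\<^sup>2"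
        using sb e01 b\<beta>[OF n]
      proof eventually_elim
        case (elim \<omega>)
        have "exp (s * toll n \<omega>) \<le> 1 + s * toll n \<omega> + (s * toll n \<omega>)\<^sup>2 * exp (\<Lambda> * \<beta>)"
          by (rule exp_quadratic_bound) (use elim in simp)
        also have "(s * toll n \<omega>)\<^sup>2 * exp (\<Lambda> * \<beta>) \<le> Q * s\<^sup>2"
        proof -
          have "(toll n \<omega>)\<^sup>2 \<le> \<beta>\<^sup>2" using elim \<beta> by (simp add: abs_le_square_iff[symmetric])
          then have "s\<^sup>2 * (toll n \<omega>)\<^sup>2 * exp (\<Lambda> * \<beta>) \<le> s\<^sup>2 * \<beta>\<^sup>2 * exp (\<Lambda> * \<beta>)" by (intro mult_right_mono mult_left_mono) auto
          then show ?thesis by (simp add: Q_def power_mult_distrib mult_ac)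
        qed
        finally have "exp (s * toll n \<omega>) * e \<omega> \<le> (1 + s * toll n \<omega> + Q * s\<^sup>2) * e \<omega>"
          using elim by (intro mult_right_mono) auto
        also have "\<dots> = e \<omega> + s * toll n \<omega> + (- (s * toll n \<omega>)) * (1 - e \<omega>) + Q * s\<^sup>2 * e \<omega>" by (simp add: algebra_simps)
        also have "\<dots> \<le> e \<omega> + s * toll n \<omega> + 1 / 2 * (1 - e \<omega>) + Q * s\<^sup>2 * 1"
        proof (intro add_mono order_refl mult_right_mono mult_left_mono)
          have "\<bar>s * toll n \<omega>\<bar> \<le> s0 * \<beta>" unfolding abs_mult using True elim s0 by (intro mult_mono) auto
          then show "- (s * toll n \<omega>) \<le> 1 / 2" using s0 by linarith
        qed (use elim Q in auto)
        finally show ?case by simp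
      qed
      have "(\<integral>\<omega>. exp (s * toll n \<omega>) * e \<omega> \<partial>?M) \<le> (\<integral>\<omega>. e \<omega> + s * toll n \<omega> + 1 / 2 * (1 - e \<omega>) + Q * s\<^sup>2 \<partial>?M)"
        by (rule integral_mono_AE[OF il _ ptw]) (use ie ib in auto)
      also have "\<dots> = (\<integral>\<omega>. e \<omega> \<partial>?M) + s * (\<integral>\<omega>. toll n \<omega> \<partial>?M) + 1 / 2 * (1 - (\<integral>\<omega>. e \<omega> \<partial>?M)) + Q * s\<^sup>2"
        using ie ib by (simp add: input_space.prob_space)
      also have "\<dots> = 1 - 1 / 2 * (\<integral>\<omega>. 1 - e \<omega> \<partial>?M) + Q * s\<^sup>2"
        using ie expectation_toll[OF n] by (simp add: input_space.prob_space field_simps)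
      also have "\<dots> \<le> 1"
      proof -
        have "(1 - exp (- (\<sigma> * \<epsilon>0))) * (1 / 2) \<le> (\<integral>\<omega>. 1 - e \<omega> \<partial>?M)"
          using expectation_exp_\<U>(2)[OF n \<sigma>, of \<epsilon>0] \<epsilon>0 unfolding \<epsilon>0(3) by (simp add: e_def)
        \<comment> \<open>With \<open>x = \<sigma> * \<epsilon>0\<close> one has
          \<open>1 - exp (- x) \<ge> x / (1 + x)\<close>, and \<open>8 * Q * s\<^sup>2\<close> is at
          most both \<open>x\<close> and 1.\<close>
        moreover have "4 * Q * s\<^sup>2 \<le> 1 - exp (- (\<sigma> * \<epsilon>0))"
        proof -
          define x where "x = \<sigma> * \<epsilon>0"
          have x: "0 \<le> x" using \<sigma> \<epsilon>0 by (simp add: x_def)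
          have "8 * Q * s\<^sup>2 \<le> x" using mult_right_mono[OF c1, of "s\<^sup>2"] by (simp add: x_def \<sigma>_def mult_ac)
          have "s\<^sup>2 \<le> s0\<^sup>2" using True s0(1) by (simp add: abs_le_square_iff[symmetric])
          then have "8 * Q * s\<^sup>2 \<le> 8 * Q * s0\<^sup>2" using Q by (intro mult_left_mono) auto
          then have q1: "8 * Q * s\<^sup>2 \<le> 1" using s0(3) by linarith
          have "4 * Q * s\<^sup>2 * (1 + x) = 4 * Q * s\<^sup>2 + 4 * Q * s\<^sup>2 * x" by (simp add: algebra_simps)
          also have "\<dots> \<le> x / 2 + 1 / 2 * x"
            using \<open>8 * Q * s\<^sup>2 \<le> x\<close> q1 x by (intro add_mono mult_right_mono) auto
          finally have "4 * Q * s\<^sup>2 * (1 + x) \<le> x" by simp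
          then have "4 * Q * s\<^sup>2 \<le> x / (1 + x)" using x by (simp add: le_divide_eq)
          also have "\<dots> = 1 - 1 / (1 + x)" using x by (simp add: field_simps)
          also have "\<dots> \<le> 1 - exp (- x)"
          proof -
            have "1 / exp x \<le> 1 / (1 + x)" using x exp_ge_add_one_self[of x] by (intro divide_left_mono) auto
            then show ?thesis by (simp add: exp_minus inverse_eq_divide)
          qed
          finally show ?thesis by (simp add: x_def)
        qed
        then have "4 * (Q * s\<^sup>2) \<le> 1 - exp (- (\<sigma> * \<epsilon>0))" by (simp only: mult.assoc)
        moreover have "1 - 1 / 2 * x + y \<le> 1" if "w * (1 / 2) \<le> x" "4 * y \<le> w" for x y w :: real
          using that by linarith
        ultimately show ?thesis by blast
      qed
      finally show ?thesis unfolding eq .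
    next
      case False
      have "(\<integral>\<omega>. exp (s * toll n \<omega>) * e \<omega> \<partial>?M) \<le> (\<integral>\<omega>. exp (\<Lambda> * \<beta>) * e \<omega> \<partial>?M)"
      proof (rule integral_mono_AE[OF il])
        show "AE \<omega> in ?M. exp (s * toll n \<omega>) * e \<omega> \<le> exp (\<Lambda> * \<beta>) * e \<omega>"
          using sb e01 by eventually_elim (auto intro!: mult_right_mono)
      qed (use ie in simp)
      also have "\<dots> = exp (\<Lambda> * \<beta>) * (\<integral>\<omega>. e \<omega> \<partial>?M)" by simp
      also have "\<dots> \<le> exp (\<Lambda> * \<beta>) * (exp (- (\<sigma> * \<epsilon>)) + k * \<epsilon>)"
        using expectation_exp_\<U>(1)[OF n \<sigma>, of \<epsilon>] \<epsilon> by (intro mult_left_mono) (auto simp: e_def k_def)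
      also have "\<dots> = exp (\<Lambda> * \<beta> - \<sigma> * \<epsilon>) + exp (\<Lambda> * \<beta>) * (k * \<epsilon>)"
        by (simp add: distrib_left exp_diff exp_minus divide_inverse)
      also have "\<dots> \<le> exp (- 1) + 1 / 2"
      proof (intro add_mono \<epsilon>(3))
        have "s0\<^sup>2 \<le> s\<^sup>2" using False s0(1) by (simp add: abs_le_square_iff[symmetric])
        then have "c * (s0\<^sup>2 * \<epsilon>) \<le> c * (s\<^sup>2 * \<epsilon>)" using cpos \<epsilon> by (intro mult_left_mono mult_right_mono) auto
        then have "\<Lambda> * \<beta> + 1 \<le> \<sigma> * \<epsilon>" using c2 by (simp add: \<sigma>_def mult_ac)
        then show "exp (\<Lambda> * \<beta> - \<sigma> * \<epsilon>) \<le> exp (- 1)" by simp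
      qed
      also have "exp (- 1) \<le> (1 / 2 :: real)"
      proof -
        have "1 / exp 1 \<le> 1 / (2::real)" using exp_ge_add_one_self[of 1] by (intro divide_left_mono) auto
        then show ?thesis by (simp add: exp_minus inverse_eq_divide)
      qed
      finally show ?thesis unfolding eq by simp
    qed
  qed
qed

text \<open>Strong induction with the Gaussian bound: the sublists contribute
  \<open>exp (c * s\<^sup>2 * (1 - \<U>))\<close>, and \<open>exponent_dominated\<close> says that
  the missing part outweighs the toll. The arguments \<open>s * I / n\<close> stay within the range
  of \<open>s\<close>. For \<open>n \<le> K\<close> centering and boundedness give the quadratic
  bound directly.\<close>

theorem mgf_bound:
  assumes \<Lambda>: "0 \<le> \<Lambda>"
  shows "\<exists>c\<ge>0. \<forall>n s. \<bar>s\<bar> \<le> \<Lambda> \<longrightarrow> mgf n s \<le> exp (c * s\<^sup>2)"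
proof -
  let ?M = "input_space K"
  obtain c0 where c0: "\<And>c n s. c0 \<le> c \<Longrightarrow> K < n \<Longrightarrow> \<bar>s\<bar> \<le> \<Lambda> \<Longrightarrow> (\<integral>\<omega>. exp (s * toll n \<omega> - c * s\<^sup>2 * \<U> n \<omega>) \<partial>?M) \<le> 1"
    using exponent_dominated[OF \<Lambda>] by blast
  define k2 where "k2 = (real K)\<^sup>2"
  \<comment> \<open>The threshold in \<open>exponent_dominated\<close> admits every larger
    \<open>c\<close>, so one constant can also cover the small lists.\<close>
  define c where "c = max (max 0 c0) (k2\<^sup>2 * exp (\<Lambda> * k2))"
  have c: "0 \<le> c" "c0 \<le> c" "k2\<^sup>2 * exp (\<Lambda> * k2) \<le> c" by (auto simp: c_def)
  have "mgf n s \<le> exp (c * s\<^sup>2)" if "\<bar>s\<bar> \<le> \<Lambda>" for n s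
    using that
  proof (induction n arbitrary: s rule: less_induct)
    case (less n)
    show ?case
    proof (cases "n \<le> K")
      case True
      have \<mu>b: "0 \<le> \<mu> n" "\<mu> n \<le> k2"
      proof -
        have i: "integrable (L n) (\<lambda>x. x)" by (intro integrable_L_continuous continuous_intros)
        have AE: "AE x in L n. 0 \<le> x \<and> x \<le> k2" using L_small_bounded[OF True] by (simp add: k2_def)
        show "0 \<le> \<mu> n" unfolding \<mu>_def using AE by (intro integral_nonneg_AE) auto
        have "\<mu> n \<le> (\<integral>x. k2 \<partial>L n)" unfolding \<mu>_def using AE i by (intro integral_mono_AE) auto
        then show "\<mu> n \<le> k2" by simp
      qed
      have c1: "continuous_on UNIV (\<lambda>y. exp (s * y))" "continuous_on UNIV (\<lambda>y. 1 + s * y + k2\<^sup>2 * exp (\<Lambda> * k2) * s\<^sup>2)"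
        by (auto intro!: continuous_intros)
      have "mgf n s \<le> (\<integral>y. 1 + s * y + k2\<^sup>2 * exp (\<Lambda> * k2) * s\<^sup>2 \<partial>Y n)"
        unfolding mgf_def
      proof (rule integral_mono_AE)
        have "AE x in L n. \<bar>(x - \<mu> n) / real n\<bar> \<le> k2"
          using L_small_bounded[OF True]
        proof eventually_elim
          case (elim x)
          then have "\<bar>x - \<mu> n\<bar> \<le> k2" using \<mu>b by (auto simp: k2_def abs_le_iff)
          moreover have "\<bar>(x - \<mu> n) / real n\<bar> \<le> \<bar>x - \<mu> n\<bar>"
          proof (cases "n = 0")
            case False
            then have "\<bar>x - \<mu> n\<bar> / real n \<le> \<bar>x - \<mu> n\<bar> / 1" by (intro divide_left_mono) auto
            then show ?thesis by simp
          qed simp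
          ultimately show ?case by linarith
        qed
        then have "AE y in Y n. \<bar>y\<bar> \<le> k2" unfolding Y_eq by (subst AE_distr_iff) auto
        then show "AE y in Y n. exp (s * y) \<le> 1 + s * y + k2\<^sup>2 * exp (\<Lambda> * k2) * s\<^sup>2"
        proof eventually_elim
          case (elim y)
          have "\<bar>s * y\<bar> \<le> \<Lambda> * k2" unfolding abs_mult using less.prems elim \<Lambda> by (intro mult_mono) auto
          then have "exp (s * y) \<le> 1 + s * y + (s * y)\<^sup>2 * exp (\<Lambda> * k2)" by (rule exp_quadratic_bound)
          also have "(s * y)\<^sup>2 * exp (\<Lambda> * k2) \<le> k2\<^sup>2 * exp (\<Lambda> * k2) * s\<^sup>2"
          proof -
            have "y\<^sup>2 \<le> k2\<^sup>2" using elim by (simp add: abs_le_square_iff[symmetric])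
            then have "s\<^sup>2 * y\<^sup>2 * exp (\<Lambda> * k2) \<le> s\<^sup>2 * k2\<^sup>2 * exp (\<Lambda> * k2)" by (intro mult_right_mono mult_left_mono) auto
            then show ?thesis by (simp add: power_mult_distrib mult_ac)
          qed
          finally show ?case by simp
        qed
      qed (use integral_Y(1)[OF c1(1)] integral_Y(1)[OF c1(2)] in auto)
      also have "\<dots> = 1 + k2\<^sup>2 * exp (\<Lambda> * k2) * s\<^sup>2"
      proof -
        have "integrable (Y n) (\<lambda>y. y)" by (rule integral_Y(1)) (intro continuous_intros)
        moreover define q where "q = 1 + k2\<^sup>2 * exp (\<Lambda> * k2) * s\<^sup>2"
        moreover have "integrable (Y n) (\<lambda>y. q)" by (rule integral_Y(1)) (intro continuous_intros)
        ultimately have "(\<integral>y. q + s * y \<partial>Y n) = q" using mean_Y[of n] by (simp add: lebesgue_integral_const)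
        then show ?thesis by (simp only: q_def add_ac)
      qed
      also have "\<dots> \<le> 1 + c * s\<^sup>2" using c by (intro add_left_mono mult_right_mono) auto
      also have "\<dots> \<le> exp (c * s\<^sup>2)" by (rule exp_ge_add_one_self)
      finally show ?thesis .
    next
      case False
      then have n: "K < n" by simp
      have "mgf n s = (\<integral>\<omega>. exp (s * toll n \<omega>) * (\<Prod>i=0..K. mgf (I n \<omega> i) (s * (real (I n \<omega> i) / real n))) \<partial>?M)"
        by (rule mgf_recursion[OF n])
      also have "\<dots> \<le> (\<integral>\<omega>. exp (c * s\<^sup>2) * exp (s * toll n \<omega> - c * s\<^sup>2 * \<U> n \<omega>) \<partial>?M)"
      proof -
        have ptw: "exp (s * toll n \<omega>) * (\<Prod>i=0..K. mgf (I n \<omega> i) (s * (real (I n \<omega> i) / real n)))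
           \<le> exp (c * s\<^sup>2) * exp (s * toll n \<omega> - c * s\<^sup>2 * \<U> n \<omega>)" for \<omega>
        proof -
          have "(\<Prod>i=0..K. mgf (I n \<omega> i) (s * (real (I n \<omega> i) / real n))) \<le> (\<Prod>i=0..K. exp (c * (s * (real (I n \<omega> i) / real n))\<^sup>2))"
          proof (intro prod_mono conjI mgf_nonneg less.IH I_less n)
            fix i
            have "\<bar>s\<bar> * (real (I n \<omega> i) / real n) \<le> \<bar>s\<bar> * 1" by (intro mult_left_mono I_div_bounds n) auto
            then show "\<bar>s * (real (I n \<omega> i) / real n)\<bar> \<le> \<Lambda>" using less.prems by (simp add: abs_mult)
          qed
          also have "\<dots> = exp (c * s\<^sup>2 * (\<Sum>i=0..K. (real (I n \<omega> i) / real n)\<^sup>2))"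
            by (simp only: exp_sum[symmetric] finite_atLeastAtMost sum_distrib_left power_mult_distrib mult.assoc)
          also have "\<dots> = exp (c * s\<^sup>2 * (1 - \<U> n \<omega>))" by (simp add: \<U>_def)
          finally have "exp (s * toll n \<omega>) * (\<Prod>i=0..K. mgf (I n \<omega> i) (s * (real (I n \<omega> i) / real n)))
              \<le> exp (s * toll n \<omega>) * exp (c * s\<^sup>2 * (1 - \<U> n \<omega>))" by (intro mult_left_mono) auto
          also have "\<dots> = exp (c * s\<^sup>2) * exp (s * toll n \<omega> - c * s\<^sup>2 * \<U> n \<omega>)"
            by (simp add: exp_add[symmetric] algebra_simps)
          finally show ?thesis .
        qed
        obtain \<beta> where \<beta>: "AE \<omega> in ?M. \<bar>toll n \<omega>\<bar> \<le> \<beta>" using toll_bounded n by blast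
        have i2: "integrable ?M (\<lambda>\<omega>. exp (c * s\<^sup>2) * exp (s * toll n \<omega> - c * s\<^sup>2 * \<U> n \<omega>))"
        proof (rule input_space.integrable_const_bound[where B="exp (c * s\<^sup>2) * exp (\<bar>s\<bar> * \<beta>)"])
          show "AE \<omega> in ?M. norm (exp (c * s\<^sup>2) * exp (s * toll n \<omega> - c * s\<^sup>2 * \<U> n \<omega>)) \<le> exp (c * s\<^sup>2) * exp (\<bar>s\<bar> * \<beta>)"
            using \<beta> AE_\<U>[OF n order_refl zero_le_one]
          proof eventually_elim
            case (elim \<omega>)
            have "s * toll n \<omega> \<le> \<bar>s * toll n \<omega>\<bar>" by simp
            also have "\<dots> \<le> \<bar>s\<bar> * \<beta>" unfolding abs_mult using elim by (intro mult_left_mono) auto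
            finally have 1: "s * toll n \<omega> \<le> \<bar>s\<bar> * \<beta>" .
            have "0 \<le> c * s\<^sup>2 * \<U> n \<omega>" using c elim by (intro mult_nonneg_nonneg) auto
            then have "s * toll n \<omega> - c * s\<^sup>2 * \<U> n \<omega> \<le> \<bar>s\<bar> * \<beta>" using 1 by linarith
            then show ?case by simp
          qed
        qed measurable
        have i1: "integrable ?M (\<lambda>\<omega>. exp (s * toll n \<omega>) * (\<Prod>i=0..K. mgf (I n \<omega> i) (s * (real (I n \<omega> i) / real n))))"
        proof (rule Bochner_Integration.integrable_bound[OF i2])
          have "(\<lambda>\<omega>. mgf (I n \<omega> i) (s * (real (I n \<omega> i) / real n))) \<in> borel_measurable ?M" for i
            by (rule measurable_compose[OF measurable_sublist_count]) simp
          then show "(\<lambda>\<omega>. exp (s * toll n \<omega>) * (\<Prod>i=0..K. mgf (I n \<omega> i) (s * (real (I n \<omega> i) / real n)))) \<in> borel_measurable ?M"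
            by (intro borel_measurable_times borel_measurable_prod) (auto, measurable)
          show "AE \<omega> in ?M. norm (exp (s * toll n \<omega>) * (\<Prod>i=0..K. mgf (I n \<omega> i) (s * (real (I n \<omega> i) / real n))))
             \<le> norm (exp (c * s\<^sup>2) * exp (s * toll n \<omega> - c * s\<^sup>2 * \<U> n \<omega>))"
            using ptw mgf_nonneg by (intro AE_I2) (simp add: abs_mult prod_nonneg)
        qed
        show ?thesis by (rule integral_mono[OF i1 i2 ptw])
      qed
      also have "\<dots> = exp (c * s\<^sup>2) * (\<integral>\<omega>. exp (s * toll n \<omega> - c * s\<^sup>2 * \<U> n \<omega>) \<partial>?M)" by simp
      also have "\<dots> \<le> exp (c * s\<^sup>2) * 1" using c0[OF c(2) n less.prems] by (intro mult_left_mono) auto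
      finally show ?thesis by simp
    qed
  qed
  then show ?thesis using c(1) by blast
qed

lemma mgf_uniform: "\<exists>B. \<forall>n. mgf n s \<le> B"
proof -
  obtain c where "\<forall>n t. \<bar>t\<bar> \<le> \<bar>s\<bar> \<longrightarrow> mgf n t \<le> exp (c * t\<^sup>2)" using mgf_bound[of "\<bar>s\<bar>"] by auto
  then show ?thesis by (intro exI[of _ "exp (c * s\<^sup>2)"]) auto
qed

lemma moment_uniform: "\<exists>B. \<forall>n. (\<integral>y. \<bar>y\<bar> ^ k \<partial>Y n) \<le> B"
proof -
  obtain B1 B2 where B: "\<And>n. mgf n 1 \<le> B1" "\<And>n. mgf n (- 1) \<le> B2" using mgf_uniform by metis
  have "(\<integral>y. \<bar>y\<bar> ^ k \<partial>Y n) \<le> fact k * (B1 + B2)" for n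
  proof -
    have i: "integrable (Y n) (\<lambda>y. exp y)" "integrable (Y n) (\<lambda>y. exp (- y))" "integrable (Y n) (\<lambda>y. \<bar>y\<bar> ^ k)"
      by (auto intro!: integral_Y(1) continuous_intros)
    have "(\<integral>y. \<bar>y\<bar> ^ k \<partial>Y n) \<le> (\<integral>y. fact k * (exp y + exp (- y)) \<partial>Y n)"
      using i by (intro integral_mono power_le_fact_exp) auto
    also have "\<dots> = fact k * (mgf n 1 + mgf n (- 1))" using i by (simp add: mgf_def)
    also have "\<dots> \<le> fact k * (B1 + B2)" using B by (intro mult_left_mono add_mono) auto
    finally show ?thesis .
  qed
  then show ?thesis by blast
qed

end

section \<open>Convergence of the characteristic functions\<close>

text \<open>Both functions equal 1 at 0 and differ from 1 by at most \<open>C * s\<^sup>2\<close>.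
  This gives a finite initial distance for the contraction and a fallback bound for small
  sublists.\<close>

lemma cf_regular_quadratic:
  assumes "cf_regular C f" "cf_regular C g"
  shows "cmod (f s - g s) \<le> 2 * C * s\<^sup>2"
proof -
  have *: "cmod (h s - 1) \<le> C * s\<^sup>2" if h: "cf_regular C h" for h
  proof -
    have "cmod (h 0 - 1) \<le> C * \<bar>0\<bar>" using h unfolding cf_regular_def by blast
    then have "h 0 = 1" by simp
    moreover have "cmod (h s - h 0) \<le> C * \<bar>s - 0\<bar> * (\<bar>s\<bar> + \<bar>0\<bar>)" using h unfolding cf_regular_def by blast
    ultimately show ?thesis by (simp add: power2_eq_square mult.assoc)
  qed
  have "cmod (f s - g s) \<le> cmod (f s - 1) + cmod (g s - 1)"
    using norm_triangle_ineq4[of "f s - 1" "g s - 1"] by simp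
  then show ?thesis using *[OF assms(1)] *[OF assms(2)] by linarith
qed

context quicksort
begin

lemma cf_regular_\<psi>: "\<exists>C\<ge>0. \<forall>n. cf_regular C (\<psi> n) \<and> 2 * (1 + (\<integral>y. y\<^sup>2 \<partial>Y n)) \<le> C"
proof -
  obtain B where B: "\<And>n. (\<integral>y. \<bar>y\<bar>\<^sup>2 \<partial>Y n) \<le> B" using moment_uniform by blast
  have sq: "(\<integral>y. y\<^sup>2 \<partial>Y n) \<le> B" for n using B[of n] by simp
  have "0 \<le> (\<integral>y. y\<^sup>2 \<partial>Y 0)" by (rule Bochner_Integration.integral_nonneg) simp
  then have "0 \<le> B" using sq[of 0] by linarith
  moreover have "2 * (1 + (\<integral>y. y\<^sup>2 \<partial>Y n)) \<le> 2 * (1 + B)" for n using sq[of n] by simp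
  moreover have "cf_regular (2 * (1 + B)) (\<psi> n)" for n
    unfolding \<psi>_def using sq[of n]
    by (intro cf_regular_char real_distribution_Y mean_Y integral_Y(1)) (auto intro!: continuous_intros)
  ultimately show ?thesis by (intro exI[of _ "2 * (1 + B)"]) auto
qed

text \<open>Sublists shorter than \<open>N\<close> fall outside the asymptotic bound assumed for
  indices from \<open>N\<close> on; they become rare as \<open>n\<close> grows.\<close>

lemma expectation_small:
  assumes n: "K < n"
  shows "integrable (input_space K) (\<lambda>\<omega>. \<Sum>i=0..K. of_bool (I n \<omega> i < N) :: real)"
    "(\<integral>\<omega>. (\<Sum>i=0..K. of_bool (I n \<omega> i < N) :: real) \<partial>input_space K) \<le> real (K + 1) * real K * real N / real n"
proof -
  show "integrable (input_space K) (\<lambda>\<omega>. \<Sum>i=0..K. of_bool (I n \<omega> i < N) :: real)"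
    using sum_weight(1)[OF n, of "\<lambda>j. of_bool (j < N)"] by simp
  have "(\<integral>\<omega>. (\<Sum>i=0..K. of_bool (I n \<omega> i < N) :: real) \<partial>input_space K) = (\<Sum>j<n. sublist_weight K n j * of_bool (j < N))"
    by (rule sum_weight(2)[OF n])
  also have "\<dots> \<le> (\<Sum>j<n. real (K + 1) * real K / real n * of_bool (j < N))"
    by (intro sum_mono mult_right_mono sublist_weight_upper K_pos n) auto
  also have "\<dots> = real (K + 1) * real K / real n * (\<Sum>j<n. of_bool (j < N))" by (rule sum_distrib_left[symmetric])
  also have "\<dots> \<le> real (K + 1) * real K / real n * real N"
  proof (rule mult_left_mono)
    have "(\<Sum>j<n. of_bool (j < N) :: real) = real (card ({..<n} \<inter> {..<N}))"
      by (simp add: of_bool_def sum.If_cases lessThan_def)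
    also have "\<dots> \<le> real (card {..<N})" by (intro of_nat_mono card_mono) auto
    finally show "(\<Sum>j<n. of_bool (j < N) :: real) \<le> real N" by simp
  qed simp
  finally show "(\<integral>\<omega>. (\<Sum>i=0..K. of_bool (I n \<omega> i < N) :: real) \<partial>input_space K) \<le> real (K + 1) * real K * real N / real n"
    by simp
qed

definition dev :: "nat \<Rightarrow> real" where
  "dev n = (\<integral>\<omega>. (\<Sum>i=0..K. \<bar>real (I n \<omega> i) / real n - D \<omega> i\<bar>) \<partial>input_space K)"

lemma dev_tendsto: "dev \<longlonglongrightarrow> 0"
proof (rule tendsto_sandwich[OF _ _ tendsto_const])
  show "\<forall>\<^sub>F n in sequentially. 0 \<le> dev n" unfolding dev_def by (simp add: sum_nonneg)
  show "\<forall>\<^sub>F n in sequentially. dev n \<le> 2 * (real (K + 1))\<^sup>2 / sqrt (real n)"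
    using eventually_gt_at_top[of K] by eventually_elim (unfold dev_def, rule sublist_size_deviation(2))
  show "(\<lambda>n. 2 * (real (K + 1))\<^sup>2 / sqrt (real n)) \<longlonglongrightarrow> 0" by real_asymp
qed

definition toll_dev :: "nat \<Rightarrow> real" where
  "toll_dev n = (\<integral>\<omega>. \<bar>toll n \<omega> - b \<omega>\<bar> \<partial>input_space K)"

lemma toll_dev_tendsto: "toll_dev \<longlonglongrightarrow> 0"
  unfolding toll_dev_def[abs_def] by (rule toll_tendsto)

text \<open>One estimate with two uses. For the Cauchy property the primed data belong to a second
  index \<open>m\<close>, with \<open>J\<close> marking its small sublists; for the fixed point they
  are the limits \<open>D\<close>, \<open>b\<close> and the limit characteristic function, with
  \<open>J = 0\<close>. Driving both sides by the same \<open>\<omega>\<close> couples the sizes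
  through the spacings.\<close>

lemma recursion_compare:
  fixes \<psi>' :: "(nat \<Rightarrow> real) \<times> (nat \<Rightarrow> real) \<Rightarrow> nat \<Rightarrow> real \<Rightarrow> complex"
  assumes n: "K < n" and C: "0 \<le> C" "\<And>i. cf_regular C (\<psi> i)" and d: "0 \<le> d"
    and \<beta>: "0 \<le> \<beta>" "AE \<omega> in input_space K. \<bar>toll n \<omega>\<bar> \<le> \<beta>" "AE \<omega> in input_space K. \<bar>b' \<omega>\<bar> \<le> \<beta>"
    and [measurable]: "b' \<in> borel_measurable (input_space K)"
      "\<And>i. (\<lambda>\<omega>. A' \<omega> i) \<in> borel_measurable (input_space K)"
      "\<And>i. (\<lambda>\<omega>. J \<omega> i) \<in> borel_measurable (input_space K)"
      "\<And>i. (\<lambda>\<omega>. \<psi>' \<omega> i (t * A' \<omega> i)) \<in> borel_measurable (input_space K)"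
    and mean: "(\<integral>\<omega>. b' \<omega> \<partial>input_space K) = 0"
    and A': "AE \<omega> in input_space K. (\<forall>i\<in>{0..K}. 0 \<le> A' \<omega> i \<and> A' \<omega> i \<le> 1) \<and> (\<Sum>i=0..K. A' \<omega> i) \<le> 1"
    and \<psi>': "\<And>\<omega> i. cf_regular C (\<psi>' \<omega> i)"
    and J: "integrable (input_space K) (\<lambda>\<omega>. \<Sum>i=0..K. J \<omega> i)" "\<And>\<omega> i. 0 \<le> J \<omega> i"
    and dA': "integrable (input_space K) (\<lambda>\<omega>. \<Sum>i=0..K. \<bar>A' \<omega> i - D \<omega> i\<bar>)"
    and close: "\<And>\<omega> i s. cmod (\<psi> (I n \<omega> i) s - \<psi>' \<omega> i s) \<le> (d + 2 * C * (of_bool (I n \<omega> i < N) + J \<omega> i)) * s\<^sup>2"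
  shows "cmod (\<psi> n t - (\<integral>\<omega>. iexp (t * b' \<omega>) * (\<Prod>i=0..K. \<psi>' \<omega> i (t * A' \<omega> i)) \<partial>input_space K))
    \<le> t\<^sup>2 * ((1 - \<kappa>0) * d + 2 * C * (real (K + 1) * real K * real N / real n + dev n) + (C + 2 * \<beta>) * toll_dev n
        + (2 * C * (\<integral>\<omega>. (\<Sum>i=0..K. J \<omega> i) \<partial>input_space K)
           + 2 * C * (\<integral>\<omega>. (\<Sum>i=0..K. \<bar>A' \<omega> i - D \<omega> i\<bar>) \<partial>input_space K)
           + (C + 2 * \<beta>) * (\<integral>\<omega>. \<bar>b' \<omega> - b \<omega>\<bar> \<partial>input_space K)))"
proof -
  let ?M = "input_space K"
  define A where "A \<omega> i = real (I n \<omega> i) / real n" for \<omega> i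
  \<comment> \<open>Where a sublist is small on either side, the a priori distance
    \<open>2 * C\<close> replaces \<open>d\<close>.\<close>
  define \<delta> where "\<delta> \<omega> i = d + 2 * C * (of_bool (I n \<omega> i < N) + J \<omega> i)" for \<omega> i
  have [measurable]: "(\<lambda>\<omega>. A \<omega> i) \<in> borel_measurable ?M" for i unfolding A_def by measurable
  have [measurable]: "(\<lambda>\<omega>. \<delta> \<omega> i) \<in> borel_measurable ?M" for i
    unfolding \<delta>_def
    by (intro borel_measurable_add borel_measurable_times borel_measurable_const assms(10)
        measurable_compose[OF measurable_sublist_count, of "\<lambda>j. of_bool (j < N)"]) simp
  have A01: "0 \<le> A \<omega> i" "A \<omega> i \<le> 1" for \<omega> i unfolding A_def using I_div_bounds[OF n] by auto
  have ib': "integrable ?M b'" by (rule input_space.integrable_const_bound[where B=\<beta>]) (use \<beta> in auto)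
  have sq: "(A \<omega> i)\<^sup>2 \<le> 1" for \<omega> i using A01[of \<omega> i] by (simp add: power_le_one)
  \<comment> \<open>Integrable majorant: the factor \<open>A\<^sup>2\<close> is kept on
    \<open>d\<close>, where it yields the contraction, and bounded by 1 on the exceptional
    terms.\<close>
  define H where "H \<omega> = d * (\<Sum>i=0..K. (A \<omega> i)\<^sup>2) + 2 * C * ((\<Sum>i=0..K. of_bool (I n \<omega> i < N)) + (\<Sum>i=0..K. J \<omega> i))" for \<omega>
  have iA: "integrable ?M (\<lambda>\<omega>. \<Sum>i=0..K. (A \<omega> i)\<^sup>2)" "(\<integral>\<omega>. (\<Sum>i=0..K. (A \<omega> i)\<^sup>2) \<partial>?M) \<le> 1 - \<kappa>0"
    unfolding A_def by (fact sum_squares[OF n])+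
  note sm = expectation_small[OF n, of N]
  have iH: "integrable ?M H" unfolding H_def
    by (intro Bochner_Integration.integrable_add integrable_mult_right iA(1) sm(1) J(1))
  have EH: "(\<integral>\<omega>. H \<omega> \<partial>?M) = d * (\<integral>\<omega>. (\<Sum>i=0..K. (A \<omega> i)\<^sup>2) \<partial>?M)
     + 2 * C * ((\<integral>\<omega>. (\<Sum>i=0..K. of_bool (I n \<omega> i < N)) \<partial>?M) + (\<integral>\<omega>. (\<Sum>i=0..K. J \<omega> i) \<partial>?M))"
    unfolding H_def using iA(1) sm(1) J(1)
    by (simp only: Bochner_Integration.integral_add integrable_mult_right Bochner_Integration.integrable_add integral_mult_right_zero)
  have S1: "0 \<le> (\<Sum>i=0..K. \<delta> \<omega> i * (A \<omega> i)\<^sup>2)" "(\<Sum>i=0..K. \<delta> \<omega> i * (A \<omega> i)\<^sup>2) \<le> H \<omega>" for \<omega>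
  proof -
    show "0 \<le> (\<Sum>i=0..K. \<delta> \<omega> i * (A \<omega> i)\<^sup>2)"
      unfolding \<delta>_def using d C J by (intro sum_nonneg mult_nonneg_nonneg add_nonneg_nonneg) auto
    have "(\<Sum>i=0..K. \<delta> \<omega> i * (A \<omega> i)\<^sup>2) \<le> (\<Sum>i=0..K. d * (A \<omega> i)\<^sup>2 + 2 * C * (of_bool (I n \<omega> i < N) + J \<omega> i))"
    proof (rule sum_mono)
      fix i
      have "0 \<le> 2 * C * (of_bool (I n \<omega> i < N) + J \<omega> i)" using C J by (intro mult_nonneg_nonneg add_nonneg_nonneg) auto
      then have "2 * C * (of_bool (I n \<omega> i < N) + J \<omega> i) * (A \<omega> i)\<^sup>2 \<le> 2 * C * (of_bool (I n \<omega> i < N) + J \<omega> i) * 1"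
        using sq by (intro mult_left_mono) auto
      then show "\<delta> \<omega> i * (A \<omega> i)\<^sup>2 \<le> d * (A \<omega> i)\<^sup>2 + 2 * C * (of_bool (I n \<omega> i < N) + J \<omega> i)"
        unfolding \<delta>_def by (simp only: distrib_right mult_1_right)
    qed
    also have "\<dots> = H \<omega>" unfolding H_def by (simp only: sum.distrib sum_distrib_left distrib_left)
    finally show "(\<Sum>i=0..K. \<delta> \<omega> i * (A \<omega> i)\<^sup>2) \<le> H \<omega>" .
  qed
  have i1: "integrable ?M (\<lambda>\<omega>. \<Sum>i=0..K. \<delta> \<omega> i * (A \<omega> i)\<^sup>2)"
  proof (rule Bochner_Integration.integrable_bound[OF iH])
    show "AE \<omega> in ?M. norm (\<Sum>i=0..K. \<delta> \<omega> i * (A \<omega> i)\<^sup>2) \<le> norm (H \<omega>)"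
    proof (rule AE_I2)
      fix \<omega> show "norm (\<Sum>i=0..K. \<delta> \<omega> i * (A \<omega> i)\<^sup>2) \<le> norm (H \<omega>)" using S1[of \<omega>] by simp
    qed
  qed measurable
  have E1: "(\<integral>\<omega>. (\<Sum>i=0..K. \<delta> \<omega> i * (A \<omega> i)\<^sup>2) \<partial>?M) \<le> (1 - \<kappa>0) * d
     + 2 * C * (real (K + 1) * real K * real N / real n) + 2 * C * (\<integral>\<omega>. (\<Sum>i=0..K. J \<omega> i) \<partial>?M)"
  proof -
    have "(\<integral>\<omega>. (\<Sum>i=0..K. \<delta> \<omega> i * (A \<omega> i)\<^sup>2) \<partial>?M) \<le> (\<integral>\<omega>. H \<omega> \<partial>?M)" by (rule integral_mono[OF i1 iH S1(2)])
    also have "\<dots> \<le> d * (1 - \<kappa>0) + 2 * C * (real (K + 1) * real K * real N / real n + (\<integral>\<omega>. (\<Sum>i=0..K. J \<omega> i) \<partial>?M))"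
      unfolding EH using iA(2) sm(2) d C by (intro add_mono mult_left_mono order_refl) auto
    finally show ?thesis by (simp only: distrib_left mult.commute[of d] add.assoc)
  qed
  note dv = sublist_size_deviation[OF n, folded A_def]
  have i2: "integrable ?M (\<lambda>\<omega>. \<Sum>i=0..K. \<bar>A \<omega> i - A' \<omega> i\<bar>)" and
    E2: "(\<integral>\<omega>. (\<Sum>i=0..K. \<bar>A \<omega> i - A' \<omega> i\<bar>) \<partial>?M) \<le> dev n + (\<integral>\<omega>. (\<Sum>i=0..K. \<bar>A' \<omega> i - D \<omega> i\<bar>) \<partial>?M)"
  proof -
    have i: "integrable ?M (\<lambda>\<omega>. (\<Sum>i=0..K. \<bar>A \<omega> i - D \<omega> i\<bar>) + (\<Sum>i=0..K. \<bar>A' \<omega> i - D \<omega> i\<bar>))"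
      using dv(1) dA' by (rule Bochner_Integration.integrable_add)
    have le: "(\<Sum>i=0..K. \<bar>A \<omega> i - A' \<omega> i\<bar>) \<le> (\<Sum>i=0..K. \<bar>A \<omega> i - D \<omega> i\<bar>) + (\<Sum>i=0..K. \<bar>A' \<omega> i - D \<omega> i\<bar>)" for \<omega>
      unfolding sum.distrib[symmetric] by (rule sum_mono) linarith
    show i2: "integrable ?M (\<lambda>\<omega>. \<Sum>i=0..K. \<bar>A \<omega> i - A' \<omega> i\<bar>)"
    proof (rule Bochner_Integration.integrable_bound[OF i])
      show "AE \<omega> in ?M. norm (\<Sum>i=0..K. \<bar>A \<omega> i - A' \<omega> i\<bar>) \<le> norm ((\<Sum>i=0..K. \<bar>A \<omega> i - D \<omega> i\<bar>) + (\<Sum>i=0..K. \<bar>A' \<omega> i - D \<omega> i\<bar>))"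
      proof (rule AE_I2)
        fix \<omega>
        have "0 \<le> (\<Sum>i=0..K. \<bar>A \<omega> i - A' \<omega> i\<bar>)" by (intro sum_nonneg) auto
        then show "norm (\<Sum>i=0..K. \<bar>A \<omega> i - A' \<omega> i\<bar>) \<le> norm ((\<Sum>i=0..K. \<bar>A \<omega> i - D \<omega> i\<bar>) + (\<Sum>i=0..K. \<bar>A' \<omega> i - D \<omega> i\<bar>))"
          using le[of \<omega>] unfolding real_norm_def by linarith
      qed
    qed measurable
    have "(\<integral>\<omega>. (\<Sum>i=0..K. \<bar>A \<omega> i - A' \<omega> i\<bar>) \<partial>?M) \<le> (\<integral>\<omega>. (\<Sum>i=0..K. \<bar>A \<omega> i - D \<omega> i\<bar>) + (\<Sum>i=0..K. \<bar>A' \<omega> i - D \<omega> i\<bar>) \<partial>?M)"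
      by (rule integral_mono[OF i2 i le])
    also have "\<dots> = dev n + (\<integral>\<omega>. (\<Sum>i=0..K. \<bar>A' \<omega> i - D \<omega> i\<bar>) \<partial>?M)"
      unfolding dev_def A_def[symmetric] by (rule Bochner_Integration.integral_add[OF dv(1) dA'])
    finally show "(\<integral>\<omega>. (\<Sum>i=0..K. \<bar>A \<omega> i - A' \<omega> i\<bar>) \<partial>?M) \<le> dev n + (\<integral>\<omega>. (\<Sum>i=0..K. \<bar>A' \<omega> i - D \<omega> i\<bar>) \<partial>?M)" .
  qed
  have E3: "(\<integral>\<omega>. \<bar>toll n \<omega> - b' \<omega>\<bar> \<partial>?M) \<le> toll_dev n + (\<integral>\<omega>. \<bar>b' \<omega> - b \<omega>\<bar> \<partial>?M)"
  proof -
    have "(\<integral>\<omega>. \<bar>toll n \<omega> - b' \<omega>\<bar> \<partial>?M) \<le> (\<integral>\<omega>. \<bar>toll n \<omega> - b \<omega>\<bar> + \<bar>b' \<omega> - b \<omega>\<bar> \<partial>?M)"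
      using integrable_toll[OF n] integrable_b ib' by (intro integral_mono) auto
    also have "\<dots> = toll_dev n + (\<integral>\<omega>. \<bar>b' \<omega> - b \<omega>\<bar> \<partial>?M)"
      unfolding toll_dev_def using integrable_toll[OF n] integrable_b ib' by (intro Bochner_Integration.integral_add) auto
    finally show ?thesis .
  qed
  have "cmod ((\<integral>\<omega>. iexp (t * toll n \<omega>) * (\<Prod>i\<in>{0..K}. \<psi> (I n \<omega> i) (t * A \<omega> i)) \<partial>?M)
      - (\<integral>\<omega>. iexp (t * b' \<omega>) * (\<Prod>i\<in>{0..K}. \<psi>' \<omega> i (t * A' \<omega> i)) \<partial>?M))
    \<le> t\<^sup>2 * ((\<integral>\<omega>. (\<Sum>i=0..K. \<delta> \<omega> i * (A \<omega> i)\<^sup>2) \<partial>?M)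
          + 2 * C * (\<integral>\<omega>. (\<Sum>i=0..K. \<bar>A \<omega> i - A' \<omega> i\<bar>) \<partial>?M)
          + (C + 2 * \<beta>) * (\<integral>\<omega>. \<bar>toll n \<omega> - b' \<omega>\<bar> \<partial>?M))"
  proof (rule input_space.cf_recursion_diff[OF _ C(1) measurable_toll _ _ _ _ _ _ _ _ i1 i2])
    show "(\<lambda>\<omega>. \<psi> (I n \<omega> i) (t * A \<omega> i)) \<in> borel_measurable ?M" for i
      unfolding A_def by (rule measurable_compose[OF measurable_sublist_count]) simp
    show "AE \<omega> in ?M. \<bar>toll n \<omega>\<bar> \<le> \<beta> \<and> \<bar>b' \<omega>\<bar> \<le> \<beta>" using \<beta>(2,3) by eventually_elim simp
    show "(\<integral>\<omega>. toll n \<omega> \<partial>?M) = (\<integral>\<omega>. b' \<omega> \<partial>?M)" using expectation_toll[OF n] mean by simp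
    show "AE \<omega> in ?M. (\<forall>i\<in>{0..K}. 0 \<le> A \<omega> i \<and> A \<omega> i \<le> 1 \<and> 0 \<le> A' \<omega> i \<and> A' \<omega> i \<le> 1) \<and> (\<Sum>i\<in>{0..K}. A' \<omega> i) \<le> 1"
      using A' by eventually_elim (use A01 in blast)
    show "AE \<omega> in ?M. \<forall>i\<in>{0..K}. cf_regular C (\<psi> (I n \<omega> i)) \<and> cf_regular C (\<psi>' \<omega> i)" using C \<psi>' by simp
    show "AE \<omega> in ?M. \<forall>i\<in>{0..K}. \<forall>s. cmod (\<psi> (I n \<omega> i) s - \<psi>' \<omega> i s) \<le> \<delta> \<omega> i * s\<^sup>2"
      unfolding \<delta>_def using close by simp
  qed (auto, measurable)
  also have "(\<integral>\<omega>. iexp (t * toll n \<omega>) * (\<Prod>i\<in>{0..K}. \<psi> (I n \<omega> i) (t * A \<omega> i)) \<partial>?M) = \<psi> n t"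
    unfolding A_def by (rule \<psi>_recursion[OF n, symmetric])
  also have "t\<^sup>2 * ((\<integral>\<omega>. (\<Sum>i=0..K. \<delta> \<omega> i * (A \<omega> i)\<^sup>2) \<partial>?M)
          + 2 * C * (\<integral>\<omega>. (\<Sum>i=0..K. \<bar>A \<omega> i - A' \<omega> i\<bar>) \<partial>?M)
          + (C + 2 * \<beta>) * (\<integral>\<omega>. \<bar>toll n \<omega> - b' \<omega>\<bar> \<partial>?M))
     \<le> t\<^sup>2 * ((1 - \<kappa>0) * d
     + 2 * C * (real (K + 1) * real K * real N / real n) + 2 * C * (\<integral>\<omega>. (\<Sum>i=0..K. J \<omega> i) \<partial>?M)
     + 2 * C * (dev n + (\<integral>\<omega>. (\<Sum>i=0..K. \<bar>A' \<omega> i - D \<omega> i\<bar>) \<partial>?M))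
     + (C + 2 * \<beta>) * (toll_dev n + (\<integral>\<omega>. \<bar>b' \<omega> - b \<omega>\<bar> \<partial>?M)))"
    using C(1) \<beta>(1) by (intro mult_left_mono add_mono E1 E2 E3) auto
  finally show ?thesis by (simp only: distrib_left add_ac)
qed


text \<open>The errors in \<open>recursion_compare\<close> that stem from the index
  \<open>n\<close>; for fixed \<open>N\<close> they vanish as \<open>n\<close> grows.\<close>

definition gap :: "real \<Rightarrow> real \<Rightarrow> nat \<Rightarrow> nat \<Rightarrow> real" where
  "gap C \<beta> N n = 2 * C * (real (K + 1) * real K * real N / real n + dev n) + (C + 2 * \<beta>) * toll_dev n"

lemma gap_tendsto: "gap C \<beta> N \<longlonglongrightarrow> 0"
proof -
  have "(\<lambda>n. real (K + 1) * real K * real N / real n) \<longlonglongrightarrow> 0"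
    by (rule real_tendsto_divide_at_top[OF tendsto_const filterlim_real_sequentially])
  then have "(\<lambda>n. 2 * C * (real (K + 1) * real K * real N / real n + dev n) + (C + 2 * \<beta>) * toll_dev n)
     \<longlonglongrightarrow> 2 * C * (0 + 0) + (C + 2 * \<beta>) * 0"
    by (intro tendsto_intros dev_tendsto toll_dev_tendsto)
  then show ?thesis by (simp add: gap_def[abs_def])
qed

lemma AE_I_fractions:
  assumes n: "K < n"
  shows "AE \<omega> in input_space K. (\<forall>i\<in>{0..K}. 0 \<le> real (I n \<omega> i) / real n \<and> real (I n \<omega> i) / real n \<le> 1) \<and>
     (\<Sum>i=0..K. real (I n \<omega> i) / real n) \<le> 1"
  using AE_\<U>[OF n order_refl zero_le_one] by eventually_elim (use I_div_bounds[OF n] in blast)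

lemma AE_D_fractions:
  "AE \<omega> in input_space K. (\<forall>i\<in>{0..K}. 0 \<le> D \<omega> i \<and> D \<omega> i \<le> 1) \<and> (\<Sum>i=0..K. D \<omega> i) \<le> 1"
  using AE_good
proof eventually_elim
  case (elim \<omega>)
  then show ?case using spacing_pos[OF elim] spacing_le_1[OF elim] sum_spacing[OF elim]
    by (auto simp: less_imp_le)
qed

text \<open>If \<open>d\<close> bounds the distances from \<open>N\<close> on, it applies to all
  sublists of size at least \<open>N\<close> on both sides, so the recursion gives
  \<open>(1 - \<kappa>0) * d\<close> plus the two gaps, which are small for large indices.\<close>

lemma \<psi>_cauchy:
  assumes "0 < \<eta>"
  shows "\<exists>N. \<forall>n\<ge>N. \<forall>m\<ge>N. \<forall>t. cmod (\<psi> n t - \<psi> m t) \<le> \<eta> * t\<^sup>2"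
proof -
  obtain C where C: "0 \<le> C" "\<And>n. cf_regular C (\<psi> n)" using cf_regular_\<psi> by blast
  obtain \<beta>' where \<beta>': "\<And>n. n > K \<Longrightarrow> AE \<omega> in input_space K. \<bar>toll n \<omega>\<bar> \<le> \<beta>'" using toll_bounded by blast
  define \<beta> where "\<beta> = max 0 \<beta>'"
  have \<beta>0: "0 \<le> \<beta>" by (simp add: \<beta>_def)
  have \<beta>: "AE \<omega> in input_space K. \<bar>toll n \<omega>\<bar> \<le> \<beta>" if "n > K" for n
    using \<beta>'[OF that] by eventually_elim (simp add: \<beta>_def)
  define Q where "Q d \<longleftrightarrow> (\<exists>N. \<forall>n\<ge>N. \<forall>m\<ge>N. \<forall>t. cmod (\<psi> n t - \<psi> m t) \<le> d * t\<^sup>2)" for d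
  have "Q \<eta>"
  proof (rule contraction_arbitrarily_small[where P=Q and \<kappa>=\<kappa>0 and ?d0.0="2 * C"])
    show "Q (2 * C)" unfolding Q_def using cf_regular_quadratic C by blast
    show "0 \<le> 2 * C" using C by simp
    show "0 < \<kappa>0" "\<kappa>0 \<le> 1" by (fact \<kappa>0)+
    show "0 < \<eta>" by fact
    show "Q e" if "Q d" "d \<le> e" for d e
    proof -
      have "d * t\<^sup>2 \<le> e * t\<^sup>2" for t :: real using that by (intro mult_right_mono) auto
      then show ?thesis using that(1) unfolding Q_def by (meson order_trans)
    qed
    fix d \<epsilon> :: real assume d: "0 \<le> d" "Q d" "0 < \<epsilon>"
    then obtain N where N: "\<And>n m t. n \<ge> N \<Longrightarrow> m \<ge> N \<Longrightarrow> cmod (\<psi> n t - \<psi> m t) \<le> d * t\<^sup>2" by (auto simp: Q_def)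
    have "eventually (\<lambda>n. gap C \<beta> N n < \<epsilon> / 2) sequentially"
      by (rule order_tendstoD(2)[OF gap_tendsto]) (use d in simp)
    then obtain N' where N': "\<And>n. n \<ge> N' \<Longrightarrow> gap C \<beta> N n < \<epsilon> / 2" by (auto simp: eventually_sequentially)
    have "cmod (\<psi> n t - \<psi> m t) \<le> ((1 - \<kappa>0) * d + \<epsilon>) * t\<^sup>2" if nm: "n \<ge> max N' (Suc K)" "m \<ge> max N' (Suc K)" for n m t
    proof -
      have n: "K < n" and m: "K < m" using nm by auto
      note sm = expectation_small[OF m, of N]
      have "cmod (\<psi> n t - (\<integral>\<omega>. iexp (t * toll m \<omega>) * (\<Prod>i=0..K. \<psi> (I m \<omega> i) (t * (real (I m \<omega> i) / real m))) \<partial>input_space K))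
        \<le> t\<^sup>2 * ((1 - \<kappa>0) * d + 2 * C * (real (K + 1) * real K * real N / real n + dev n) + (C + 2 * \<beta>) * toll_dev n
        + (2 * C * (\<integral>\<omega>. (\<Sum>i=0..K. of_bool (I m \<omega> i < N)) \<partial>input_space K)
           + 2 * C * (\<integral>\<omega>. (\<Sum>i=0..K. \<bar>real (I m \<omega> i) / real m - D \<omega> i\<bar>) \<partial>input_space K)
           + (C + 2 * \<beta>) * (\<integral>\<omega>. \<bar>toll m \<omega> - b \<omega>\<bar> \<partial>input_space K)))"
      proof (rule recursion_compare[OF n C d(1) \<beta>0 \<beta>[OF n] \<beta>[OF m] measurable_toll _ _ _ expectation_toll[OF m]
            AE_I_fractions[OF m] C(2) sm(1) _ sublist_size_deviation(1)[OF m]])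
        show "(\<lambda>\<omega>. real (I m \<omega> i) / real m) \<in> borel_measurable (input_space K)" for i by measurable
        show "(\<lambda>\<omega>. of_bool (I m \<omega> i < N)) \<in> borel_measurable (input_space K)" for i
          by (rule measurable_compose[OF measurable_sublist_count]) simp
        show "(\<lambda>\<omega>. \<psi> (I m \<omega> i) (t * (real (I m \<omega> i) / real m))) \<in> borel_measurable (input_space K)" for i
          by (rule measurable_compose[OF measurable_sublist_count]) simp
        fix \<omega> i s
        show "cmod (\<psi> (I n \<omega> i) s - \<psi> (I m \<omega> i) s)
           \<le> (d + 2 * C * (of_bool (I n \<omega> i < N) + of_bool (I m \<omega> i < N))) * s\<^sup>2"
        proof (cases "I n \<omega> i < N \<or> I m \<omega> i < N")
          case True
          have "cmod (\<psi> (I n \<omega> i) s - \<psi> (I m \<omega> i) s) \<le> 2 * C * s\<^sup>2" by (rule cf_regular_quadratic[OF C(2) C(2)])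
          also have "\<dots> \<le> (d + 2 * C * (of_bool (I n \<omega> i < N) + of_bool (I m \<omega> i < N))) * s\<^sup>2"
          proof (rule mult_right_mono)
            have "2 * C * 1 \<le> 2 * C * (of_bool (I n \<omega> i < N) + of_bool (I m \<omega> i < N))"
              using True C(1) by (intro mult_left_mono) auto
            then show "2 * C \<le> d + 2 * C * (of_bool (I n \<omega> i < N) + of_bool (I m \<omega> i < N))" using d(1) by linarith
          qed simp
          finally show ?thesis .
        next
          case False
          then show ?thesis using N[of "I n \<omega> i" "I m \<omega> i" s] by simp
        qed
      qed simp
      also have "(\<integral>\<omega>. iexp (t * toll m \<omega>) * (\<Prod>i=0..K. \<psi> (I m \<omega> i) (t * (real (I m \<omega> i) / real m))) \<partial>input_space K) = \<psi> m t"
        by (rule \<psi>_recursion[OF m, symmetric])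
      also have "t\<^sup>2 * ((1 - \<kappa>0) * d + 2 * C * (real (K + 1) * real K * real N / real n + dev n) + (C + 2 * \<beta>) * toll_dev n
        + (2 * C * (\<integral>\<omega>. (\<Sum>i=0..K. of_bool (I m \<omega> i < N)) \<partial>input_space K)
           + 2 * C * (\<integral>\<omega>. (\<Sum>i=0..K. \<bar>real (I m \<omega> i) / real m - D \<omega> i\<bar>) \<partial>input_space K)
           + (C + 2 * \<beta>) * (\<integral>\<omega>. \<bar>toll m \<omega> - b \<omega>\<bar> \<partial>input_space K)))
        \<le> t\<^sup>2 * ((1 - \<kappa>0) * d + 2 * C * (real (K + 1) * real K * real N / real n + dev n) + (C + 2 * \<beta>) * toll_dev n
        + (2 * C * (real (K + 1) * real K * real N / real m) + 2 * C * dev m + (C + 2 * \<beta>) * toll_dev m))"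
        unfolding dev_def[symmetric] toll_dev_def[symmetric]
        using C(1) sm(2) by (intro mult_left_mono add_mono order_refl) auto
      also have "\<dots> = t\<^sup>2 * ((1 - \<kappa>0) * d + gap C \<beta> N n + gap C \<beta> N m)"
        by (simp only: gap_def distrib_left add.assoc)
      also have "\<dots> \<le> t\<^sup>2 * ((1 - \<kappa>0) * d + \<epsilon>)"
        using N'[of n] N'[of m] nm by (intro mult_left_mono) auto
      finally show ?thesis by (simp only: mult.commute)
    qed
    then show "Q ((1 - \<kappa>0) * d + \<epsilon>)" unfolding Q_def by blast
  qed
  then show ?thesis by (simp add: Q_def)
qed

lemma tight_Y: "tight Y"
  unfolding tight_def
proof (intro conjI allI impI real_distribution_Y)
  fix \<epsilon> :: real assume \<epsilon>: "0 < \<epsilon>"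
  obtain B where B: "\<And>n. (\<integral>y. \<bar>y\<bar> ^ 1 \<partial>Y n) \<le> B" using moment_uniform by blast
  define a where "a = (\<bar>B\<bar> + 1) / \<epsilon>"
  have a: "0 < a" using \<epsilon> by (simp add: a_def)
  have "1 - \<epsilon> < measure (Y n) {- a<..a}" for n
  proof -
    interpret Yn: real_distribution "Y n" by (rule real_distribution_Y)
    have "measure (Y n) {y \<in> space (Y n). \<bar>y\<bar> \<ge> a} \<le> (\<integral>y. \<bar>y\<bar> \<partial>Y n) / a"
      by (rule integral_Markov_inequality_measure[where A="{}"]) (auto intro!: integral_Y(1) continuous_intros a)
    also have "\<dots> \<le> B / a" using B[of n] a by (intro divide_right_mono) auto
    also have "\<dots> < \<epsilon>" using a \<epsilon> by (simp add: a_def field_simps abs_if split: if_splits)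
    finally have "measure (Y n) {y. \<bar>y\<bar> \<ge> a} < \<epsilon>" by simp
    moreover have "measure (Y n) (UNIV - {- a<..a}) \<le> measure (Y n) {y. \<bar>y\<bar> \<ge> a}"
      by (rule Yn.finite_measure_mono) auto
    moreover have "measure (Y n) (UNIV - {- a<..a}) = 1 - measure (Y n) {- a<..a}"
      using Yn.prob_compl[of "{- a<..a}"] by simp
    ultimately show ?thesis by linarith
  qed
  then show "\<exists>a b. a < b \<and> (\<forall>n. 1 - \<epsilon> < measure (Y n) {a<..b})" using a by (intro exI[of _ "- a"] exI[of _ a]) auto
qed

text \<open>Tightness gives a limit along a subsequence. Letting one index of the Cauchy estimate
  run along it transfers the estimate, with its factor \<open>t\<^sup>2\<close>, to the limit and so
  to the whole sequence.\<close>

theorem weak_limit: "\<exists>M. real_distribution M \<and> weak_conv_m Y M \<and>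
  (\<forall>\<eta>>0. \<exists>N. \<forall>n\<ge>N. \<forall>t. cmod (\<psi> n t - char M t) \<le> \<eta> * t\<^sup>2)"
proof -
  obtain s M where s: "strict_mono (s :: nat \<Rightarrow> nat)" and M: "real_distribution M" and w: "weak_conv_m (Y \<circ> id \<circ> s) M"
    using tight_imp_convergent_subsubsequence[OF tight_Y, of id] by (auto simp: strict_mono_def)
  have sub: "(\<lambda>n. \<psi> (s n) t) \<longlonglongrightarrow> char M t" for t
    using levy_continuity1[OF _ M w, of t] by (simp add: \<psi>_def real_distribution_Y)
  have unif: "\<exists>N. \<forall>n\<ge>N. \<forall>t. cmod (\<psi> n t - char M t) \<le> \<eta> * t\<^sup>2" if \<eta>: "\<eta> > 0" for \<eta>
  proof -
    obtain N where N: "\<And>n m t. n \<ge> N \<Longrightarrow> m \<ge> N \<Longrightarrow> cmod (\<psi> n t - \<psi> m t) \<le> \<eta> * t\<^sup>2" using \<psi>_cauchy[OF \<eta>] by blast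
    have "cmod (\<psi> n t - char M t) \<le> \<eta> * t\<^sup>2" if n: "n \<ge> N" for n t
    proof (rule tendsto_upperbound)
      show "(\<lambda>k. cmod (\<psi> n t - \<psi> (s k) t)) \<longlonglongrightarrow> cmod (\<psi> n t - char M t)" by (intro tendsto_intros sub)
      show "\<forall>\<^sub>F k in sequentially. cmod (\<psi> n t - \<psi> (s k) t) \<le> \<eta> * t\<^sup>2"
        using eventually_ge_at_top[of N] by eventually_elim (use N n seq_suble[OF s] order_trans in blast)
    qed simp
    then show ?thesis by blast
  qed
  have "(\<lambda>n. char (Y n) t) \<longlonglongrightarrow> char M t" for t
  proof (rule LIMSEQ_I)
    fix e :: real assume e: "0 < e"
    have "t\<^sup>2 + 1 > 0" by (simp add: add_nonneg_pos)
    then have "e / (t\<^sup>2 + 1) > 0" using e by simp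
    then obtain N where N: "\<And>n u. n \<ge> N \<Longrightarrow> cmod (\<psi> n u - char M u) \<le> e / (t\<^sup>2 + 1) * u\<^sup>2" using unif by blast
    have "e / (t\<^sup>2 + 1) * t\<^sup>2 < e" using e \<open>t\<^sup>2 + 1 > 0\<close> by (simp add: divide_less_eq)
    then show "\<exists>N. \<forall>n\<ge>N. cmod (char (Y n) t - char M t) < e" using N[of _ t] by (fastforce simp: \<psi>_def)
  qed
  then have "weak_conv_m Y M" by (rule levy_continuity[OF real_distribution_Y M])
  with M unif show ?thesis by blast
qed

text \<open>The square of a power or an exponential is again of that kind with doubled exponent, so
  the uniform bounds provide the second moments required for uniform integrability.\<close>

lemma weak_limit_moments:
  assumes M: "real_distribution M" and w: "weak_conv_m Y M"
  shows "integrable M (\<lambda>z. z ^ p)" "(\<lambda>n. \<integral>y. y ^ p \<partial>Y n) \<longlonglongrightarrow> (\<integral>z. z ^ p \<partial>M)"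
    "integrable M (\<lambda>z. exp (s * z))" "(\<lambda>n. \<integral>y. exp (s * y) \<partial>Y n) \<longlonglongrightarrow> (\<integral>z. exp (s * z) \<partial>M)"
proof -
  obtain B where B: "\<And>n. (\<integral>y. \<bar>y\<bar> ^ (2 * p) \<partial>Y n) \<le> B" using moment_uniform by blast
  have "(y ^ p)\<^sup>2 = \<bar>y\<bar> ^ (2 * p)" for y :: real by (simp add: power_mult[symmetric] power_even_abs mult.commute)
  then have B': "(\<integral>y. (y ^ p)\<^sup>2 \<partial>Y n) \<le> B" for n using B[of n] by simp
  show "integrable M (\<lambda>z. z ^ p)" "(\<lambda>n. \<integral>y. y ^ p \<partial>Y n) \<longlonglongrightarrow> (\<integral>z. z ^ p \<partial>M)"
    by (rule weak_conv_imp_integral_conv[OF real_distribution_Y M w _ integral_Y(1) B']; auto intro!: continuous_intros)+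
  obtain B where "\<And>n. mgf n (2 * s) \<le> B" using mgf_uniform by blast
  then have B: "(\<integral>y. (exp (s * y))\<^sup>2 \<partial>Y n) \<le> B" for n by (simp add: mgf_def exp_double[symmetric] mult.assoc)
  show "integrable M (\<lambda>z. exp (s * z))" "(\<lambda>n. \<integral>y. exp (s * y) \<partial>Y n) \<longlonglongrightarrow> (\<integral>z. exp (s * z) \<partial>M)"
    by (rule weak_conv_imp_integral_conv[OF real_distribution_Y M w _ integral_Y(1) B]; auto intro!: continuous_intros)+
qed

end

section \<open>The limit law\<close>

lemma eq_if_dist_arbitrarily_small:
  fixes x y :: "'a :: real_normed_vector"
  assumes u: "0 \<le> u" and le: "\<And>\<eta>. 0 < \<eta> \<Longrightarrow> norm (x - y) \<le> \<eta> * u"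
  shows "x = y"
proof (rule ccontr)
  assume "x \<noteq> y"
  then have n: "0 < norm (x - y)" by simp
  have "norm (x - y) \<le> norm (x - y) / (u + 1) * u" using n u by (intro le) auto
  also have "\<dots> < norm (x - y)" using n u by (simp add: divide_less_eq)
  finally show False by simp
qed

context quicksort
begin

lemma limit_toll: "b (v, a) = (\<Sum>i=0..K. alpha_const K * spacing K v i * ln (spacing K v i)) + opt_cost K (spacing K v)"
  by (simp add: b_def entD_def \<alpha>_def sum_distrib_left mult.assoc)

lemma integral_input_space_fst:
  fixes f :: "(nat \<Rightarrow> real) \<Rightarrow> 'b :: {banach, second_countable_topology}"
  assumes "f \<in> borel_measurable (pivot_space K)"
  shows "(\<integral>\<omega>. f (fst \<omega>) \<partial>input_space K) = (\<integral>v. f v \<partial>pivot_space K)"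
proof -
  have "distr (input_space K) (pivot_space K) fst = pivot_space K"
    unfolding input_space_eq by (rule seq_space.distr_pair_fst)
  then have "(\<integral>v. f v \<partial>pivot_space K) = (\<integral>v. f v \<partial>distr (input_space K) (pivot_space K) fst)" by simp
  also have "\<dots> = (\<integral>\<omega>. f (fst \<omega>) \<partial>input_space K)"
    by (rule integral_distr[OF _ assms]) (simp add: input_space_eq)
  finally show ?thesis by simp
qed

text \<open>The right-hand side is written over \<open>input_space\<close>, although it depends on
  the pivots only, to match the form of \<open>\<psi>_recursion\<close>.\<close>

lemma limit_map_char:
  assumes Z: "real_distribution Z"
  shows "real_distribution (limit_map K Z)"
    and "char (limit_map K Z) t = (\<integral>\<omega>. iexp (t * b \<omega>) * (\<Prod>i=0..K. char Z (t * D \<omega> i)) \<partial>input_space K)"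
proof -
  let ?V = "pivot_space K" and ?Z = "PiM {0..K} (\<lambda>_. Z)"
  interpret Z: real_distribution Z by (rule Z)
  interpret ZZ: prob_space ?Z by (intro prob_space_PiM Z.prob_space_axioms)
  interpret VZ: pair_sigma_finite ?V ?Z ..
  interpret PZ: prob_space "?V \<Otimes>\<^sub>M ?Z" by (intro prob_space_pair prob_space_pivot_space ZZ.prob_space_axioms)
  interpret X: product_sigma_finite "\<lambda>i::nat. Z"
    by (intro product_sigma_finite.intro prob_space_imp_sigma_finite Z.prob_space_axioms)
  define c where "c v = (\<Sum>i=0..K. alpha_const K * spacing K v i * ln (spacing K v i)) + opt_cost K (spacing K v)" for v
  define G where "G p = (\<Sum>i=0..K. spacing K (fst p) i * snd p i) + c (fst p)" for p :: "(nat \<Rightarrow> real) \<times> (nat \<Rightarrow> real)"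
  have c [measurable]: "c \<in> borel_measurable ?V" unfolding c_def by measurable
  have comp: "(\<lambda>p. snd p i) \<in> borel_measurable (?V \<Otimes>\<^sub>M ?Z)" if "i \<in> {0..K}" for i
  proof -
    have "(\<lambda>z. z i) \<in> measurable ?Z Z" using that by (rule measurable_component_singleton)
    then have "(\<lambda>z. z i) \<in> borel_measurable ?Z" by (simp cong: measurable_cong_sets)
    then show ?thesis by (rule measurable_compose[OF measurable_snd])
  qed
  have G [measurable]: "G \<in> borel_measurable (?V \<Otimes>\<^sub>M ?Z)"
    unfolding G_def
    by (intro borel_measurable_add borel_measurable_sum borel_measurable_times comp measurable_compose[OF measurable_fst] measurable_spacing c)
  have eq: "limit_map K Z = distr (?V \<Otimes>\<^sub>M ?Z) borel G"
    unfolding limit_map_def by (intro distr_cong refl) (auto simp: G_def c_def sum.distrib)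
  show "real_distribution (limit_map K Z)" unfolding eq by (rule PZ.real_distribution_distr[OF G])
  have int: "integrable (?V \<Otimes>\<^sub>M ?Z) (\<lambda>p. iexp (t * G p))"
    by (rule PZ.integrable_const_bound[where B=1]) auto
  have "char (limit_map K Z) t = (\<integral>p. iexp (t * G p) \<partial>(?V \<Otimes>\<^sub>M ?Z))"
    unfolding char_def eq by (rule integral_distr[OF G]) simp
  also have "\<dots> = (\<integral>v. (\<integral>z. iexp (t * G (v, z)) \<partial>?Z) \<partial>?V)" by (rule VZ.integral_fst'[OF int, symmetric])
  also have "\<dots> = (\<integral>v. iexp (t * c v) * (\<Prod>i=0..K. char Z (t * spacing K v i)) \<partial>?V)"
  proof (intro Bochner_Integration.integral_cong refl)
    fix v
    have e: "iexp (t * G (v, z)) = iexp (t * c v) * (\<Prod>i=0..K. iexp (t * spacing K v i * z i))" for z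
    proof -
      have "(\<Prod>i=0..K. iexp (t * spacing K v i * z i)) = exp (\<Sum>i=0..K. \<i> * complex_of_real (t * spacing K v i * z i))"
        by (rule exp_sum[symmetric]) simp
      also have "(\<Sum>i=0..K. \<i> * complex_of_real (t * spacing K v i * z i)) = \<i> * complex_of_real (t * (\<Sum>i=0..K. spacing K v i * z i))"
        by (simp add: sum_distrib_left mult.assoc)
      finally show ?thesis by (simp add: G_def exp_add[symmetric] distrib_left add.commute)
    qed
    have "(\<integral>z. iexp (t * G (v, z)) \<partial>?Z) = iexp (t * c v) * (\<integral>z. (\<Prod>i=0..K. iexp (t * spacing K v i * z i)) \<partial>?Z)"
      unfolding e by (rule integral_mult_right_zero)
    also have "(\<integral>z. (\<Prod>i=0..K. iexp (t * spacing K v i * z i)) \<partial>?Z) = (\<Prod>i=0..K. char Z (t * spacing K v i))"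
      unfolding char_def
      by (rule X.product_integral_prod[of "{0..K}" "\<lambda>i y. iexp (t * spacing K v i * y)"])
         (auto intro!: Z.integrable_const_bound[where B=1])
    finally show "(\<integral>z. iexp (t * G (v, z)) \<partial>?Z) = iexp (t * c v) * (\<Prod>i=0..K. char Z (t * spacing K v i))" .
  qed
  also have "\<dots> = (\<integral>\<omega>. iexp (t * c (fst \<omega>)) * (\<Prod>i=0..K. char Z (t * D \<omega> i)) \<partial>input_space K)"
  proof (rule integral_input_space_fst[symmetric])
    have "(\<lambda>v. char Z (t * spacing K v i)) \<in> borel_measurable ?V" for i
      by (rule measurable_compose[OF _ Z.char_measurable]) measurable
    then show "(\<lambda>v. iexp (t * c v) * (\<Prod>i=0..K. char Z (t * spacing K v i))) \<in> borel_measurable ?V"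
      by (intro borel_measurable_times borel_measurable_prod) (auto, measurable)
  qed
  also have "\<dots> = (\<integral>\<omega>. iexp (t * b \<omega>) * (\<Prod>i=0..K. char Z (t * D \<omega> i)) \<partial>input_space K)"
    by (intro Bochner_Integration.integral_cong refl) (metis c_def limit_toll prod.collapse)
  finally show "char (limit_map K Z) t = (\<integral>\<omega>. iexp (t * b \<omega>) * (\<Prod>i=0..K. char Z (t * D \<omega> i)) \<partial>input_space K)" .
qed

text \<open>For large \<open>n\<close>, \<open>\<psi> n\<close> lies within
  \<open>\<eta> / 2\<close> of \<open>char M\<close> and also of the right-hand side of the limit
  equation with \<open>M\<close> inserted. For the latter, the gap is chosen below the amount
  \<open>\<kappa>0 * \<eta> / 2\<close> freed by the contraction.\<close>

lemma limit_fixed_point: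
  assumes M: "real_distribution M" and reg: "cf_regular C (char M)"
    and C: "0 \<le> C" "\<And>n. cf_regular C (\<psi> n)"
    and unif: "\<And>\<eta>. \<eta> > 0 \<Longrightarrow> \<exists>N. \<forall>n\<ge>N. \<forall>t. cmod (\<psi> n t - char M t) \<le> \<eta> * t\<^sup>2"
  shows "M = limit_map K M"
proof (rule Levy_uniqueness[OF M limit_map_char(1)[OF M]], rule ext)
  fix t
  let ?T = "\<integral>\<omega>. iexp (t * b \<omega>) * (\<Prod>i=0..K. char M (t * D \<omega> i)) \<partial>input_space K"
  obtain \<beta>' where \<beta>': "\<And>n. n > K \<Longrightarrow> AE \<omega> in input_space K. \<bar>toll n \<omega>\<bar> \<le> \<beta>'" "AE \<omega> in input_space K. \<bar>b \<omega>\<bar> \<le> \<beta>'"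
    using toll_bounded by blast
  define \<beta> where "\<beta> = max 0 \<beta>'"
  have \<beta>0: "0 \<le> \<beta>" by (simp add: \<beta>_def)
  have \<beta>: "AE \<omega> in input_space K. \<bar>toll n \<omega>\<bar> \<le> \<beta>" if "n > K" for n
    using \<beta>'(1)[OF that] by eventually_elim (simp add: \<beta>_def)
  have \<beta>b: "AE \<omega> in input_space K. \<bar>b \<omega>\<bar> \<le> \<beta>" using \<beta>'(2) by eventually_elim (simp add: \<beta>_def)
  have "char M t = ?T"
  proof (rule eq_if_dist_arbitrarily_small[where u="t\<^sup>2"])
    fix \<eta> :: real assume \<eta>: "0 < \<eta>"
    obtain N where N: "\<And>n s. n \<ge> N \<Longrightarrow> cmod (\<psi> n s - char M s) \<le> \<eta> / 2 * s\<^sup>2" using unif[of "\<eta> / 2"] \<eta> by auto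
    obtain N' where N': "\<And>n. n \<ge> N' \<Longrightarrow> gap C \<beta> N n < \<eta> / 2 * \<kappa>0"
      using order_tendstoD(2)[OF gap_tendsto, of "\<eta> / 2 * \<kappa>0" C \<beta> N] \<eta> \<kappa>0 by (auto simp: eventually_sequentially)
    define n where "n = max N (max N' (Suc K))"
    have n: "K < n" "n \<ge> N" "n \<ge> N'" by (auto simp: n_def)
    have "cmod (\<psi> n t - ?T)
        \<le> t\<^sup>2 * ((1 - \<kappa>0) * (\<eta> / 2) + 2 * C * (real (K + 1) * real K * real N / real n + dev n) + (C + 2 * \<beta>) * toll_dev n
        + (2 * C * (\<integral>\<omega>. (\<Sum>i=0..K. 0) \<partial>input_space K)
           + 2 * C * (\<integral>\<omega>. (\<Sum>i=0..K. \<bar>D \<omega> i - D \<omega> i\<bar>) \<partial>input_space K)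
           + (C + 2 * \<beta>) * (\<integral>\<omega>. \<bar>b \<omega> - b \<omega>\<bar> \<partial>input_space K)))"
    proof (rule recursion_compare[OF n(1) C _ \<beta>0 \<beta>[OF n(1)] \<beta>b measurable_b measurable_D _ _ expectation_b AE_D_fractions reg])
      show "(\<lambda>\<omega>. char M (t * D \<omega> i)) \<in> borel_measurable (input_space K)" for i
        by (rule measurable_compose[OF _ real_distribution.char_measurable[OF M]]) measurable
      fix \<omega> i s
      show "cmod (\<psi> (I n \<omega> i) s - char M s) \<le> (\<eta> / 2 + 2 * C * (of_bool (I n \<omega> i < N) + 0)) * s\<^sup>2"
      proof (cases "I n \<omega> i < N")
        case True
        have "cmod (\<psi> (I n \<omega> i) s - char M s) \<le> 2 * C * s\<^sup>2" by (rule cf_regular_quadratic[OF C(2) reg])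
        also have "\<dots> \<le> (\<eta> / 2 + 2 * C * (of_bool (I n \<omega> i < N) + 0)) * s\<^sup>2"
          using True \<eta> by (intro mult_right_mono) auto
        finally show ?thesis .
      qed (use N[of "I n \<omega> i" s] in simp)
    qed (use \<eta> in auto)
    also have "\<dots> = t\<^sup>2 * ((1 - \<kappa>0) * (\<eta> / 2) + gap C \<beta> N n)" by (simp add: gap_def)
    also have "\<dots> \<le> t\<^sup>2 * (\<eta> / 2)"
    proof (rule mult_left_mono)
      have "(1 - \<kappa>0) * (\<eta> / 2) = \<eta> / 2 - \<eta> / 2 * \<kappa>0" by (simp add: field_simps)
      then show "(1 - \<kappa>0) * (\<eta> / 2) + gap C \<beta> N n \<le> \<eta> / 2" using N'[OF n(3)] by linarith
    qed simp
    finally have "cmod (\<psi> n t - ?T) \<le> \<eta> / 2 * t\<^sup>2" by (simp only: mult.commute)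
    moreover have "cmod (\<psi> n t - char M t) \<le> \<eta> / 2 * t\<^sup>2" by (rule N[OF n(2)])
    moreover have "cmod (char M t - ?T) \<le> cmod (\<psi> n t - char M t) + cmod (\<psi> n t - ?T)"
      using norm_triangle_ineq4[of "\<psi> n t - ?T" "\<psi> n t - char M t"] by (simp add: add.commute)
    ultimately show "cmod (char M t - ?T) \<le> \<eta> * t\<^sup>2" by simp
  qed simp
  then show "char M t = char (limit_map K M) t" using limit_map_char(2)[OF M] by simp
qed

text \<open>Limit of \<open>sum_squares\<close>: on the unit interval squares differ by at most
  \<open>2 * \<bar>x - y\<bar>\<close>, so the error is \<open>2 * dev n\<close> and the same gap
  \<open>\<kappa>0\<close> is inherited.\<close>

lemma expectation_square_spacings:
  "integrable (input_space K) (\<lambda>\<omega>. \<Sum>i=0..K. (D \<omega> i)\<^sup>2)" "(\<integral>\<omega>. (\<Sum>i=0..K. (D \<omega> i)\<^sup>2) \<partial>input_space K) \<le> 1 - \<kappa>0"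
proof -
  let ?M = "input_space K"
  show iD: "integrable ?M (\<lambda>\<omega>. \<Sum>i=0..K. (D \<omega> i)\<^sup>2)"
  proof (rule input_space.integrable_const_bound[where B="\<Sum>i=0..K. 1"])
    show "AE \<omega> in ?M. norm (\<Sum>i=0..K. (D \<omega> i)\<^sup>2) \<le> (\<Sum>i=0..K. 1)"
      using AE_D_fractions
    proof eventually_elim
      case (elim \<omega>)
      have "norm (\<Sum>i=0..K. (D \<omega> i)\<^sup>2) = (\<Sum>i=0..K. (D \<omega> i)\<^sup>2)" by (simp add: sum_nonneg)
      also have "\<dots> \<le> (\<Sum>i=0..K. 1)" using elim by (intro sum_mono) (auto intro!: power_le_one)
      finally show ?case .
    qed
  qed measurable
  have "(\<integral>\<omega>. (\<Sum>i=0..K. (D \<omega> i)\<^sup>2) \<partial>?M) \<le> 1 - \<kappa>0 + 2 * dev n" if n: "K < n" for n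
  proof -
    note sq = sum_squares[OF n] and dv = sublist_size_deviation(1)[OF n]
    have "(\<integral>\<omega>. (\<Sum>i=0..K. (D \<omega> i)\<^sup>2) \<partial>?M)
      \<le> (\<integral>\<omega>. (\<Sum>i=0..K. (real (I n \<omega> i) / real n)\<^sup>2) + 2 * (\<Sum>i=0..K. \<bar>real (I n \<omega> i) / real n - D \<omega> i\<bar>) \<partial>?M)"
    proof (rule integral_mono_AE[OF iD])
      show "AE \<omega> in ?M. (\<Sum>i=0..K. (D \<omega> i)\<^sup>2) \<le>
         (\<Sum>i=0..K. (real (I n \<omega> i) / real n)\<^sup>2) + 2 * (\<Sum>i=0..K. \<bar>real (I n \<omega> i) / real n - D \<omega> i\<bar>)"
        using AE_D_fractions
      proof eventually_elim
        case (elim \<omega>)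
        have "(\<Sum>i=0..K. (D \<omega> i)\<^sup>2) \<le> (\<Sum>i=0..K. (real (I n \<omega> i) / real n)\<^sup>2 + 2 * \<bar>real (I n \<omega> i) / real n - D \<omega> i\<bar>)"
        proof (rule sum_mono)
          fix i assume i: "i \<in> {0..K}"
          define x where "x = real (I n \<omega> i) / real n"
          define y where "y = D \<omega> i"
          have x: "0 \<le> x" "x \<le> 1" unfolding x_def using I_div_bounds[OF n] by auto
          have y: "0 \<le> y" "y \<le> 1" unfolding y_def using elim i by auto
          have "y\<^sup>2 - x\<^sup>2 = (y + x) * (y - x)" by (simp add: power2_eq_square algebra_simps)
          also have "\<dots> \<le> (y + x) * \<bar>x - y\<bar>" using x y by (intro mult_left_mono) auto
          also have "\<dots> \<le> 2 * \<bar>x - y\<bar>" using x y by (intro mult_right_mono) auto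
          finally show "(D \<omega> i)\<^sup>2 \<le> (real (I n \<omega> i) / real n)\<^sup>2 + 2 * \<bar>real (I n \<omega> i) / real n - D \<omega> i\<bar>"
            by (simp add: x_def y_def)
        qed
        then show ?case by (simp only: sum.distrib sum_distrib_left)
      qed
    qed (intro Bochner_Integration.integrable_add integrable_mult_right sq(1) dv)
    also have "\<dots> = (\<integral>\<omega>. (\<Sum>i=0..K. (real (I n \<omega> i) / real n)\<^sup>2) \<partial>?M) + 2 * dev n"
      unfolding dev_def using sq(1) dv
      by (simp only: Bochner_Integration.integral_add integrable_mult_right integral_mult_right_zero)
    also have "\<dots> \<le> 1 - \<kappa>0 + 2 * dev n" using sq(2) by (rule add_right_mono)
    finally show ?thesis .
  qed
  then have "\<forall>\<^sub>F n in sequentially. (\<integral>\<omega>. (\<Sum>i=0..K. (D \<omega> i)\<^sup>2) \<partial>?M) \<le> 1 - \<kappa>0 + 2 * dev n"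
    using eventually_gt_at_top[of K] by (rule eventually_mono[rotated])
  moreover have "(\<lambda>n. 1 - \<kappa>0 + 2 * dev n) \<longlonglongrightarrow> 1 - \<kappa>0 + 2 * 0" by (intro tendsto_intros dev_tendsto)
  ultimately show "(\<integral>\<omega>. (\<Sum>i=0..K. (D \<omega> i)\<^sup>2) \<partial>?M) \<le> 1 - \<kappa>0"
    using tendsto_lowerbound[of "\<lambda>n. 1 - \<kappa>0 + 2 * dev n" "1 - \<kappa>0 + 2 * 0" sequentially] by simp
qed

text \<open>Both solutions satisfy the same equation with identical \<open>D\<close> and
  \<open>b\<close>, so only the contracted term survives in the comparison.\<close>

lemma limit_law_unique:
  assumes Z: "limit_law K Z" "limit_law K Z'"
  shows "Z = Z'"
proof -
  let ?M = "input_space K"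
  have rd: "real_distribution Z" "real_distribution Z'" using Z by (auto simp: limit_law_def)
  define C where "C = max (2 * (1 + (\<integral>z. z\<^sup>2 \<partial>Z))) (2 * (1 + (\<integral>z. z\<^sup>2 \<partial>Z')))"
  have reg: "cf_regular C (char Z)" "cf_regular C (char Z')"
    using Z by (auto simp: limit_law_def C_def intro!: cf_regular_char)
  have "0 \<le> (\<integral>z. z\<^sup>2 \<partial>Z)" by (rule Bochner_Integration.integral_nonneg) simp
  then have C: "0 \<le> C" by (simp add: C_def max_def)
  obtain \<beta> where \<beta>: "AE \<omega> in ?M. \<bar>b \<omega>\<bar> \<le> \<beta>" using toll_bounded by blast
  have fix_eq: "char W t = (\<integral>\<omega>. iexp (t * b \<omega>) * (\<Prod>i=0..K. char W (t * D \<omega> i)) \<partial>?M)" if "limit_law K W" for W t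
    using limit_map_char(2)[of W t] that unfolding limit_law_def by metis
  define Q where "Q d \<longleftrightarrow> (\<forall>t. cmod (char Z t - char Z' t) \<le> d * t\<^sup>2)" for d
  have "Q \<eta>" if "0 < \<eta>" for \<eta>
  proof (rule contraction_arbitrarily_small[where P=Q and \<kappa>=\<kappa>0 and ?d0.0="2 * C"])
    show "Q (2 * C)" unfolding Q_def using cf_regular_quadratic[OF reg] by blast
    show "0 \<le> 2 * C" "0 < \<kappa>0" "\<kappa>0 \<le> 1" "0 < \<eta>" using C \<kappa>0 that by auto
    show "Q e" if "Q d" "d \<le> e" for d e
    proof -
      have "d * t\<^sup>2 \<le> e * t\<^sup>2" for t :: real using that by (intro mult_right_mono) auto
      then show ?thesis using that(1) unfolding Q_def by (meson order_trans)
    qed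
    fix d \<epsilon> :: real assume d: "0 \<le> d" "Q d" "0 < \<epsilon>"
    have meas: "(\<lambda>\<omega>. char W (t * D \<omega> i)) \<in> borel_measurable ?M" if "real_distribution W" for W i t
      by (rule measurable_compose[OF _ real_distribution.char_measurable[OF that]]) measurable
    have int: "integrable ?M (\<lambda>\<omega>. \<Sum>i\<in>{0..K}. d * (D \<omega> i)\<^sup>2)"
      unfolding sum_distrib_left[symmetric] by (rule integrable_mult_right[OF expectation_square_spacings(1)])
    have "cmod (char Z t - char Z' t) \<le> t\<^sup>2 * ((1 - \<kappa>0) * d + \<epsilon>)" for t
    proof -
    have "cmod (char Z t - char Z' t) \<le> t\<^sup>2 * ((\<integral>\<omega>. (\<Sum>i\<in>{0..K}. d * (D \<omega> i)\<^sup>2) \<partial>?M)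
          + 2 * C * (\<integral>\<omega>. (\<Sum>i\<in>{0..K}. \<bar>D \<omega> i - D \<omega> i\<bar>) \<partial>?M)
          + (C + 2 * \<beta>) * (\<integral>\<omega>. \<bar>b \<omega> - b \<omega>\<bar> \<partial>?M))"
      unfolding fix_eq[OF Z(1), of t] fix_eq[OF Z(2), of t]
    proof (rule input_space.cf_recursion_diff[where I="{0..K}" and C=C and \<beta>=\<beta> and b=b and b'=b
          and A="\<lambda>\<omega> i. D \<omega> i" and A'="\<lambda>\<omega> i. D \<omega> i" and \<psi>="\<lambda>_ _. char Z" and \<psi>'="\<lambda>_ _. char Z'" and \<delta>="\<lambda>_ _. d"])
      show "AE \<omega> in ?M. (\<forall>i\<in>{0..K}. 0 \<le> D \<omega> i \<and> D \<omega> i \<le> 1 \<and> 0 \<le> D \<omega> i \<and> D \<omega> i \<le> 1) \<and> (\<Sum>i\<in>{0..K}. D \<omega> i) \<le> 1"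
        using AE_D_fractions by eventually_elim blast
      show "AE \<omega> in ?M. \<bar>b \<omega>\<bar> \<le> \<beta> \<and> \<bar>b \<omega>\<bar> \<le> \<beta>" using \<beta> by simp
    qed (use C reg d(2) int meas rd in \<open>auto simp: Q_def\<close>)
    also have "t\<^sup>2 * ((\<integral>\<omega>. (\<Sum>i\<in>{0..K}. d * (D \<omega> i)\<^sup>2) \<partial>?M)
          + 2 * C * (\<integral>\<omega>. (\<Sum>i\<in>{0..K}. \<bar>D \<omega> i - D \<omega> i\<bar>) \<partial>?M)
          + (C + 2 * \<beta>) * (\<integral>\<omega>. \<bar>b \<omega> - b \<omega>\<bar> \<partial>?M)) = t\<^sup>2 * (d * (\<integral>\<omega>. (\<Sum>i=0..K. (D \<omega> i)\<^sup>2) \<partial>?M))"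
      by (simp add: sum_distrib_left[symmetric])
    also have "t\<^sup>2 * (d * (\<integral>\<omega>. (\<Sum>i=0..K. (D \<omega> i)\<^sup>2) \<partial>?M)) \<le> t\<^sup>2 * (d * (1 - \<kappa>0))"
      by (intro mult_left_mono expectation_square_spacings(2) d) auto
    also have "t\<^sup>2 * (d * (1 - \<kappa>0)) \<le> t\<^sup>2 * ((1 - \<kappa>0) * d + \<epsilon>)"
      using d(3) by (intro mult_left_mono) (auto simp: mult.commute)
      finally show ?thesis .
    qed
    then show "Q ((1 - \<kappa>0) * d + \<epsilon>)" unfolding Q_def by (metis mult.commute)
  qed
  then have "char Z t = char Z' t" for t
    by (intro eq_if_dist_arbitrarily_small[where u="t\<^sup>2"]) (auto simp: Q_def)
  then show ?thesis by (intro Levy_uniqueness rd ext)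
qed

text \<open>Convergence of the first moments centers the limit, and convergence of the second
  moments carries the constant \<open>C\<close> over to it; these make its characteristic function
  regular, as the fixed-point argument requires.\<close>

theorem limit_theorem:
  "\<exists>Z. limit_law K Z \<and> (\<forall>Z'. limit_law K Z' \<longrightarrow> Z' = Z) \<and>
     weak_conv_m Y Z \<and>
     (\<forall>n. integrable (Y n) (\<lambda>y. exp (lam * y))) \<and> integrable Z (\<lambda>z. exp (lam * z)) \<and>
     (\<lambda>n. \<integral>y. exp (lam * y) \<partial>Y n) \<longlonglongrightarrow> (\<integral>z. exp (lam * z) \<partial>Z) \<and>
     (\<forall>p::nat. (\<forall>n. integrable (Y n) (\<lambda>y. y ^ p)) \<and> integrable Z (\<lambda>z. z ^ p) \<and>
        (\<lambda>n. \<integral>y. y ^ p \<partial>Y n) \<longlonglongrightarrow> (\<integral>z. z ^ p \<partial>Z))"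
proof -
  obtain M where M: "real_distribution M" and w: "weak_conv_m Y M"
    and unif: "\<And>\<eta>. 0 < \<eta> \<Longrightarrow> \<exists>N. \<forall>n\<ge>N. \<forall>t. cmod (\<psi> n t - char M t) \<le> \<eta> * t\<^sup>2"
    using weak_limit by blast
  note mom = weak_limit_moments[OF M w]
  have "(\<lambda>n. 0) \<longlonglongrightarrow> (\<integral>z. z \<partial>M)" using mom(2)[of 1] by (simp add: mean_Y)
  then have mean: "(\<integral>z. z \<partial>M) = 0" using LIMSEQ_unique[OF tendsto_const] by metis
  obtain C where C: "0 \<le> C" "\<And>n. cf_regular C (\<psi> n)" "\<And>n. 2 * (1 + (\<integral>y. y\<^sup>2 \<partial>Y n)) \<le> C" using cf_regular_\<psi> by blast
  have "(\<lambda>n. 2 * (1 + (\<integral>y. y\<^sup>2 \<partial>Y n))) \<longlonglongrightarrow> 2 * (1 + (\<integral>z. z\<^sup>2 \<partial>M))" by (intro tendsto_intros mom(2))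
  then have "2 * (1 + (\<integral>z. z\<^sup>2 \<partial>M)) \<le> C" by (rule LIMSEQ_le_const2) (use C(3) in blast)
  then have reg: "cf_regular C (char M)" by (rule cf_regular_char[OF M mom(1) mean])
  have "limit_law K M"
    unfolding limit_law_def using M mom(1)[of 2] mean limit_fixed_point[OF M reg C(1,2) unif] by blast
  moreover have "integrable (Y n) (\<lambda>y. exp (lam * y))" "integrable (Y n) (\<lambda>y. y ^ p)" for n p
    by (auto intro!: integral_Y(1) continuous_intros)
  ultimately show ?thesis using limit_law_unique w mom by blast
qed

end

theorem theorem4:
  fixes K :: nat and lam :: real
    and ord :: "nat tree rel" and piv :: cmp_tree and alg :: "nat \<Rightarrow> cmp_tree"
  assumes "K \<ge> 1"
    and "linear_order_on (search_trees K) ord"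
    and "sorting_algorithm K piv"
    and "\<And>x. inj_on x {1..K} \<Longrightarrow> cmp_count piv x \<le> K\<^sup>2"
    and "\<And>n. n \<le> K \<Longrightarrow> sorting_algorithm n (alg n)"
    and "\<And>n x. n \<le> K \<Longrightarrow> inj_on x {1..n} \<Longrightarrow> cmp_count (alg n) x \<le> K\<^sup>2"
  defines "Y \<equiv> normalized_law K ord piv alg"
  shows "\<exists>Z. limit_law K Z \<and> (\<forall>Z'. limit_law K Z' \<longrightarrow> Z' = Z) \<and>
     weak_conv_m Y Z \<and>
     (\<forall>n. integrable (Y n) (\<lambda>y. exp (lam * y))) \<and> integrable Z (\<lambda>z. exp (lam * z)) \<and>
     (\<lambda>n. \<integral>y. exp (lam * y) \<partial>Y n) \<longlonglongrightarrow> (\<integral>z. exp (lam * z) \<partial>Z) \<and>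
     (\<forall>p::nat. (\<forall>n. integrable (Y n) (\<lambda>y. y ^ p)) \<and> integrable Z (\<lambda>z. z ^ p) \<and>
        (\<lambda>n. \<integral>y. y ^ p \<partial>Y n) \<longlonglongrightarrow> (\<integral>z. z ^ p \<partial>Z))"
proof -
  interpret quicksort K ord piv alg by unfold_locales (fact assms(1-6))+
  show ?thesis unfolding Y_def by (rule limit_theorem)
qed

end
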